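(* Let $\Gamma$ be an admissible Fuchsian group. Let $z_1,\ldots,z_n\in\mathbb D$ and $w_1,\ldots,w_n\in\mathbb C$. There exists a function $f\in H^\infty_\Gamma$ with $\|f\|_\infty\le 1$ such that $f(z_j)=w_j$ for $j=1,\dots,n$ if and only if $$A_\sigma:=\big[(1-w_i\overline{w_j})K^\sigma(z_i,z_j)\big]_{i,j=1}^n\ge 0$$ (positive semidefinite) for all $\sigma\in\hat\Gamma$.
   Context: $\mathbb D$ is the open unit disk, $\mathbb T$ the unit circle with normalized Lebesgue measure $m$, $L^p=L^p(\mathbb T,m)$ and $H^p\subseteq L^p$ the Hardy spaces ($1\le p\le\infty$), whose elements are also regarded as analytic functions on $\mathbb D$. An automorphism is a M\"obius map of $\mathbb D$ onto $\mathbb D$ (it extends to $\mathbb T$); a Fuchsian group is a discrete group $\Gamma$ of automorphisms. $\Gamma$ acts on $L^p$ and $H^p$ by $f\mapsto f\circ\gamma$. The character group $\hat\Gamma$ is the set of homomorphisms $\Gamma\to\mathbb T$. For $X\in\{L^p,H^p\}$, $X_\Gamma=\{f\in X: f\circ\gamma=f\ \forall\gamma\in\Gamma\}$ and, for $\sigma\in\hat\Gamma$, $X_\sigma=\{f\in X: f\circ\gamma=\sigma(\gamma)f\ \forall\gamma\in\Gamma\}$; these are written $L^p_\Gamma,H^p_\Gamma,L^p_\sigma,H^p_\sigma$. $\Gamma$ is of convergence type if $\sum_{\zeta\in\Gamma(0)}(1-|\zeta|)<\infty$, where $\Gamma(0)$ is the orbit of $0$. Let $\Psi:L^p\to L^p_\Gamma$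 be the conditional expectation onto the functions measurable with respect to the $\sigma$-algebra of $\Gamma$-invariant sets (measurable $E$ with $m(E\triangle\gamma^{-1}(E))=0$ for all $\gamma\in\Gamma$). Let $k_z(\zeta)=(1-\bar z\zeta)^{-1}$ be the Szeg\"o kernel, $v_\gamma=-i\,\Psi(k_{\gamma(0)}-\overline{k_{\gamma(0)}})\in L^\infty_\Gamma$ for $\gamma\in\Gamma$. The defect space is $N=\operatorname{span}\{v_\gamma:\gamma\in\Gamma\}$. $\Gamma$ is called admissible if it is Fuchsian of convergence type and $N$ is finite dimensional. $K^\sigma$ denotes the reproducing kernel of $H^2_\sigma$, viewed as a closed subspace of the reproducing kernel Hilbert space $H^2$ on $\mathbb D$: $K^\sigma(z,w)=k_w^\sigma(z)$ where $k_w^\sigma\in H^2_\sigma$ satisfies $\langle f,k_w^\sigma\rangle=f(w)$ for all $f\in H^2_\sigma$. *)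

theory Defs
  imports
    "HOL-Analysis.Analysis"
    "HOL-Probability.Probability"
    "HOL-Algebra.Bij"
    "HOL-Library.Function_Algebras"
begin

section \<open>Fuchsian groups and their characters\<close>

text \<open>
  Automorphisms are functions on the closed disc, which contains both the disc and the circle;
  outside they take the value \<open>undefined\<close>, so that equal automorphisms are equal functions and
  composition is the multiplication of \<open>BijGroup (cball 0 1)\<close>. Being onto the disc forces the
  pole \<open>- d / c\<close> (where division returns \<open>0\<close>) to lie outside the closed disc.
\<close>

definition disc_automorphisms :: "(complex \<Rightarrow> complex) set" where
  "disc_automorphisms =
     {\<lambda>z\<in>cball 0 1. (a * z + b) / (c * z + d) | a b c d.
        a * d - b * c \<noteq> 0 \<and> (\<lambda>z. (a * z + b) / (c * z + d)) ` ball 0 1 = ball 0 1}"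

text \<open>
  Discreteness refers to uniform convergence on the closed disc, which on automorphisms of the disc
  is the usual topology of the automorphism group.
\<close>

definition fuchsian :: "(complex \<Rightarrow> complex) set \<Rightarrow> bool" where
  "fuchsian \<Gamma> \<longleftrightarrow>
     \<Gamma> \<subseteq> disc_automorphisms \<and> subgroup \<Gamma> (BijGroup (cball 0 1)) \<and>
     (\<forall>\<gamma>\<in>\<Gamma>. \<exists>\<epsilon>>0. \<forall>\<delta>\<in>\<Gamma>. (\<forall>z\<in>cball 0 1. dist (\<delta> z) (\<gamma> z) < \<epsilon>) \<longrightarrow> \<delta> = \<gamma>)"

definition circle_group :: "complex monoid" where
  "circle_group = \<lparr>carrier = sphere 0 1, mult = (*), one = 1\<rparr>"

definition characters :: "(complex \<Rightarrow> complex) set \<Rightarrow> ((complex \<Rightarrow> complex) \<Rightarrow> complex) set" where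
  "characters \<Gamma> = hom ((BijGroup (cball 0 1))\<lparr>carrier := \<Gamma>\<rparr>) circle_group"

definition convergence_type :: "(complex \<Rightarrow> complex) set \<Rightarrow> bool" where
  "convergence_type \<Gamma> \<longleftrightarrow> (\<lambda>\<zeta>. 1 - norm \<zeta>) summable_on ((\<lambda>\<gamma>. \<gamma> 0) ` \<Gamma>)"


section \<open>Lebesgue and Hardy spaces on the circle\<close>

text \<open>
  The elements of the spaces below are functions rather than classes modulo equality almost
  everywhere; all identities between them are therefore stated almost everywhere.
\<close>

definition circle_measure :: "complex measure" where
  "circle_measure =
     distr (uniform_measure lborel {0..<2 * pi}) (restrict_space borel (sphere 0 1)) cis"

definition Linf_norm :: "(complex \<Rightarrow> complex) \<Rightarrow> ereal" where
  "Linf_norm f = esssup circle_measure (\<lambda>\<zeta>. ereal (norm (f \<zeta>)))"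

definition Lp :: "ennreal \<Rightarrow> (complex \<Rightarrow> complex) set" where
  "Lp p = {f \<in> borel_measurable circle_measure.
     if p = \<infinity> then Linf_norm f < \<infinity>
     else integrable circle_measure (\<lambda>\<zeta>. norm (f \<zeta>) powr enn2real p)}"

text \<open>\<open>\<integral>f(\<zeta>)\<zeta>\<^sup>n dm\<close> is the Fourier coefficient of \<open>f\<close> of index \<open>-n\<close>.\<close>

definition Hp :: "ennreal \<Rightarrow> (complex \<Rightarrow> complex) set" where
  "Hp p = {f \<in> Lp p. \<forall>n\<ge>1. (\<integral>\<zeta>. f \<zeta> * \<zeta> ^ n \<partial>circle_measure) = 0}"

text \<open>
  The analytic function on the disc whose boundary function is \<open>f \<in> Hp p\<close>, given by its Poisson
  integral.
\<close>

definition disc_extension :: "(complex \<Rightarrow> complex) \<Rightarrow> complex \<Rightarrow> complex" where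
  "disc_extension f z =
     (\<integral>\<zeta>. f \<zeta> * of_real ((1 - (norm z)\<^sup>2) / (norm (\<zeta> - z))\<^sup>2) \<partial>circle_measure)"

definition Hp_inv :: "ennreal \<Rightarrow> (complex \<Rightarrow> complex) set \<Rightarrow> (complex \<Rightarrow> complex) set" where
  "Hp_inv p \<Gamma> = {f \<in> Hp p. \<forall>\<gamma>\<in>\<Gamma>. AE \<zeta> in circle_measure. f (\<gamma> \<zeta>) = f \<zeta>}"

definition Hp_char ::
  "ennreal \<Rightarrow> (complex \<Rightarrow> complex) set \<Rightarrow> ((complex \<Rightarrow> complex) \<Rightarrow> complex) \<Rightarrow>
     (complex \<Rightarrow> complex) set" where
  "Hp_char p \<Gamma> \<sigma> = {f \<in> Hp p. \<forall>\<gamma>\<in>\<Gamma>. AE \<zeta> in circle_measure. f (\<gamma> \<zeta>) = \<sigma> \<gamma> * f \<zeta>}"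


section \<open>The defect space and admissibility\<close>

definition invariant_algebra :: "(complex \<Rightarrow> complex) set \<Rightarrow> complex measure" where
  "invariant_algebra \<Gamma> = sigma (space circle_measure)
     {E \<in> sets circle_measure. \<forall>\<gamma>\<in>\<Gamma>.
        emeasure circle_measure (sym_diff E (\<gamma> -` E \<inter> space circle_measure)) = 0}"

definition invariant_cond_exp ::
  "(complex \<Rightarrow> complex) set \<Rightarrow> (complex \<Rightarrow> complex) \<Rightarrow> complex \<Rightarrow> complex" where
  "invariant_cond_exp \<Gamma> f \<zeta> =
     Complex (real_cond_exp circle_measure (invariant_algebra \<Gamma>) (\<lambda>\<xi>. Re (f \<xi>)) \<zeta>)
             (real_cond_exp circle_measure (invariant_algebra \<Gamma>) (\<lambda>\<xi>. Im (f \<xi>)) \<zeta>)"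

definition szego_kernel :: "complex \<Rightarrow> complex \<Rightarrow> complex" where
  "szego_kernel z \<zeta> = 1 / (1 - cnj z * \<zeta>)"

definition defect_function ::
  "(complex \<Rightarrow> complex) set \<Rightarrow> (complex \<Rightarrow> complex) \<Rightarrow> complex \<Rightarrow> complex" where
  "defect_function \<Gamma> \<gamma> = (\<lambda>\<zeta>. - \<i> * invariant_cond_exp \<Gamma>
     (\<lambda>\<xi>. szego_kernel (\<gamma> 0) \<xi> - cnj (szego_kernel (\<gamma> 0) \<xi>)) \<zeta>)"

definition complex_span :: "(complex \<Rightarrow> complex) set \<Rightarrow> (complex \<Rightarrow> complex) set" where
  "complex_span = module.span (\<lambda>c f \<zeta>. c * f \<zeta>)"

definition defect_space :: "(complex \<Rightarrow> complex) set \<Rightarrow> (complex \<Rightarrow> complex) set" where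
  "defect_space \<Gamma> = complex_span (defect_function \<Gamma> ` \<Gamma>)"

text \<open>The dimension is that of the space of classes modulo equality almost everywhere.\<close>

definition finite_dim_ae :: "(complex \<Rightarrow> complex) set \<Rightarrow> bool" where
  "finite_dim_ae N \<longleftrightarrow>
     (\<exists>B\<subseteq>N. finite B \<and> (\<forall>f\<in>N. \<exists>g\<in>complex_span B. AE \<zeta> in circle_measure. f \<zeta> = g \<zeta>))"

definition admissible :: "(complex \<Rightarrow> complex) set \<Rightarrow> bool" where
  "admissible \<Gamma> \<longleftrightarrow> fuchsian \<Gamma> \<and> convergence_type \<Gamma> \<and> finite_dim_ae (defect_space \<Gamma>)"


section \<open>Reproducing kernels and positivity\<close>

text \<open>
  The kernel function at \<open>w\<close> is unique up to equality almost everywhere, which does not affect the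
  values of its extension to the disc.
\<close>

definition kernel_function ::
  "(complex \<Rightarrow> complex) set \<Rightarrow> ((complex \<Rightarrow> complex) \<Rightarrow> complex) \<Rightarrow> complex \<Rightarrow>
     complex \<Rightarrow> complex" where
  "kernel_function \<Gamma> \<sigma> w =
     (SOME k. k \<in> Hp_char 2 \<Gamma> \<sigma> \<and>
        (\<forall>f\<in>Hp_char 2 \<Gamma> \<sigma>. (\<integral>\<zeta>. f \<zeta> * cnj (k \<zeta>) \<partial>circle_measure) = disc_extension f w))"

definition reproducing_kernel ::
  "(complex \<Rightarrow> complex) set \<Rightarrow> ((complex \<Rightarrow> complex) \<Rightarrow> complex) \<Rightarrow> complex \<Rightarrow>
     complex \<Rightarrow> complex" where
  "reproducing_kernel \<Gamma> \<sigma> z w = disc_extension (kernel_function \<Gamma> \<sigma> w) z"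

definition pos_semidef :: "complex ^ 'n ^ 'n \<Rightarrow> bool" where
  "pos_semidef A \<longleftrightarrow>
     (\<forall>x :: complex ^ 'n. (\<Sum>i\<in>UNIV. \<Sum>j\<in>UNIV. cnj (x $ i) * A $ i $ j * x $ j) \<in> \<real>\<^sub>\<ge>\<^sub>0)"

end

theory Submission
  imports Defs "HOL-Complex_Analysis.Complex_Analysis"
begin

text \<open>
  If \<open>f\<close> interpolates and is bounded by \<open>1\<close>, multiplication by \<open>f\<close> is a contraction of every
  \<open>H\<^sup>2\<^sub>\<sigma>\<close>, and its adjoint multiplies the kernel at \<open>z\<^sub>j\<close> by the conjugate of \<open>w\<^sub>j\<close>. Positivity of
  the Pick matrix is the statement that this prescription on the span of the kernels is a contraction
  (\<open>pos_semidef_pick_iff\<close>), so that the condition is necessary.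

  Conversely, let the prescription be contractive for all \<open>\<sigma>\<close>. An invariant weight \<open>r \<ge> \<epsilon> > 0\<close> on the circle
  is the square of the modulus of an outer function \<open>h = exp g\<close>, where \<open>Re g = log r / 2\<close>. The
  conjugate function of an invariant function changes under \<open>\<gamma>\<close> by an additive constant, its period, so
  \<open>h\<close> is automorphic with respect to some character \<open>\<sigma>\<close>. Applied to \<open>h\<close>, the adjoint of
  the contraction gives \<open>y\<close> in \<open>H\<^sup>2\<^sub>\<sigma>\<close> with \<open>y(z\<^sub>j) = w\<^sub>j h(z\<^sub>j)\<close> and norm at most that of \<open>h\<close>. Then
  \<open>q = y/h\<close> is invariant, interpolates, and satisfies \<open>\<integral>|q|\<^sup>2 r \<le> \<integral>r\<close>. Up to small errors this solves the
  problem in the mean, for every weight (\<open>weighted_interpolation\<close>).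

  The function \<open>q\<close> is not bounded. It is multiplied by an outer function with modulus \<open>min 1 (n/|q|)\<close>, but this
  outer function again has a character. Here the defect space enters: the functions \<open>v\<^sub>\<gamma>\<close> represent the periods, so
  if they span a finite dimensional space, the periods of a function that is small in \<open>L\<^sup>2\<close> are those of a
  function that is small uniformly (\<open>period_correction\<close>). Subtracting it makes the multiplier invariant at
  the cost of a factor close to \<open>1\<close> (\<open>bounding_multipliers\<close>).

  Finally, solutions in the mean for all weights yield a bounded solution by convex duality. If \<open>1\<close> had
  positive distance in \<open>L\<^sup>2\<close> from the convex set of invariant majorants of the functions \<open>|f|\<^sup>2\<close> with \<open>f\<close>
  approximately interpolating, then the functional separating them would be a weight for which there is no solution in the
  mean (\<open>approximate_interpolation\<close>). A limit of approximate solutions is the function sought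
  (\<open>pick_matrix_sufficient\<close>).

  Everything takes place on the circle, in \<open>L\<^sup>2\<close>: outer functions are exponentials of boundary functions, and
  values in the disc are Poisson integrals.
\<close>

section \<open>Square integrable functions\<close>

definition square_integrable :: "'a measure \<Rightarrow> ('a \<Rightarrow> 'b::euclidean_space) \<Rightarrow> bool" where
  "square_integrable M f \<longleftrightarrow> f \<in> borel_measurable M \<and> integrable M (\<lambda>x. (norm (f x))\<^sup>2)"

definition l2norm :: "'a measure \<Rightarrow> ('a \<Rightarrow> 'b::euclidean_space) \<Rightarrow> real" where
  "l2norm M f = sqrt (\<integral>x. (norm (f x))\<^sup>2 \<partial>M)"

definition l2inner :: "'a measure \<Rightarrow> ('a \<Rightarrow> 'b::euclidean_space) \<Rightarrow> ('a \<Rightarrow> 'b) \<Rightarrow> real" where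
  "l2inner M f g = (\<integral>x. f x \<bullet> g x \<partial>M)"

lemma square_integrable_measurable[measurable_dest]:
  "square_integrable M f \<Longrightarrow> f \<in> borel_measurable M"
  by (simp add: square_integrable_def)

lemma square_integrable_integrable:
  "square_integrable M f \<Longrightarrow> integrable M (\<lambda>x. (norm (f x))\<^sup>2)"
  by (simp add: square_integrable_def)

lemma l2norm_nonneg[simp]: "l2norm M f \<ge> 0"
  by (simp add: l2norm_def)

lemma l2norm_square: "(l2norm M f)\<^sup>2 = (\<integral>x. (norm (f x))\<^sup>2 \<partial>M)"
  by (simp add: l2norm_def)

lemma l2norm_cong_AE:
  assumes "square_integrable M f" "square_integrable M g" "AE x in M. norm (f x) = norm (g x)"
  shows "l2norm M f = l2norm M g"
  unfolding l2norm_def using assms(3)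
  by (intro arg_cong[where f=sqrt] integral_cong_AE) (use assms(1,2) in \<open>auto simp: square_integrable_def\<close>)

lemma square_integrableI:
  assumes "f \<in> borel_measurable M" "integrable M g" "AE x in M. (norm (f x))\<^sup>2 \<le> g x"
  shows "square_integrable M f"
  unfolding square_integrable_def
proof
  show "integrable M (\<lambda>x. (norm (f x))\<^sup>2)"
    by (rule Bochner_Integration.integrable_bound[OF assms(2)]) (use assms in \<open>auto elim!: eventually_mono\<close>)
qed fact

lemma square_integrable_zero[simp, intro]: "square_integrable M (\<lambda>x. 0)"
  by (simp add: square_integrable_def)

lemma norm_add_square_le: "(norm (a + b))\<^sup>2 \<le> 2 * (norm a)\<^sup>2 + 2 * (norm (b::'b::real_inner))\<^sup>2"
proof -
  have "0 \<le> (norm (a - b))\<^sup>2" by simp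
  then show ?thesis by (simp add: power2_norm_eq_inner algebra_simps inner_commute)
qed

lemma abs_inner_le_squares: "\<bar>a \<bullet> b\<bar> \<le> (norm a)\<^sup>2 + (norm (b::'b::real_inner))\<^sup>2"
proof -
  have "\<bar>a \<bullet> b\<bar> \<le> norm a * norm b" by (rule Cauchy_Schwarz_ineq2)
  also have "\<dots> \<le> (norm a)\<^sup>2 + (norm b)\<^sup>2"
    using sum_squares_bound[of "norm a" "norm b"] mult_nonneg_nonneg[OF norm_ge_zero norm_ge_zero, of a b] by linarith
  finally show ?thesis .
qed

lemma square_integrable_add[intro]:
  assumes "square_integrable M f" "square_integrable M g"
  shows "square_integrable M (\<lambda>x. f x + g x)"
  by (rule square_integrableI[where g="\<lambda>x. 2 * (norm (f x))\<^sup>2 + 2 * (norm (g x))\<^sup>2"])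
     (use assms norm_add_square_le in \<open>auto simp: square_integrable_def\<close>)

lemma square_integrable_scaleR[intro]:
  "square_integrable M f \<Longrightarrow> square_integrable M (\<lambda>x. c *\<^sub>R f x)"
  by (auto simp: square_integrable_def power_mult_distrib)

lemma square_integrable_minus[intro]:
  "square_integrable M f \<Longrightarrow> square_integrable M (\<lambda>x. - f x)"
  by (auto simp: square_integrable_def)

lemma square_integrable_diff[intro]:
  "square_integrable M f \<Longrightarrow> square_integrable M g \<Longrightarrow> square_integrable M (\<lambda>x. f x - g x)"
  using square_integrable_add[of M f "\<lambda>x. - g x"] by auto

lemma square_integrable_sum:
  "(\<And>i. i \<in> I \<Longrightarrow> square_integrable M (f i)) \<Longrightarrow> square_integrable M (\<lambda>x. \<Sum>i\<in>I. f i x)"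
  by (induction I rule: infinite_finite_induct) auto

lemma square_integrable_inner:
  assumes "square_integrable M f" "square_integrable M g"
  shows "integrable M (\<lambda>x. f x \<bullet> g x)"
  by (rule Bochner_Integration.integrable_bound[where f="\<lambda>x. (norm (f x))\<^sup>2 + (norm (g x))\<^sup>2"])
     (use assms abs_inner_le_squares in \<open>auto simp: square_integrable_def\<close>)

lemma l2norm_scaleR: "l2norm M (\<lambda>x. c *\<^sub>R f x) = \<bar>c\<bar> * l2norm M f"
  by (simp add: l2norm_def power_mult_distrib real_sqrt_mult)

lemma l2inner_commute: "l2inner M f g = l2inner M g f"
  by (simp add: l2inner_def inner_commute)

lemma l2inner_add_left:
  assumes "square_integrable M f" "square_integrable M g" "square_integrable M h"
  shows "l2inner M (\<lambda>x. f x + g x) h = l2inner M f h + l2inner M g h"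
  using assms by (simp add: l2inner_def inner_add_left square_integrable_inner)

lemma l2inner_scaleR_left: "l2inner M (\<lambda>x. c *\<^sub>R f x) h = c * l2inner M f h"
  by (simp add: l2inner_def)

lemma l2inner_self: "l2inner M f f = (l2norm M f)\<^sup>2"
  by (simp add: l2norm_square l2inner_def power2_norm_eq_inner)

lemma l2norm_add_square:
  assumes "square_integrable M f" "square_integrable M g"
  shows "(l2norm M (\<lambda>x. f x + g x))\<^sup>2 = (l2norm M f)\<^sup>2 + 2 * l2inner M f g + (l2norm M g)\<^sup>2"
proof -
  have "(norm (f x + g x))\<^sup>2 = (norm (f x))\<^sup>2 + 2 * (f x \<bullet> g x) + (norm (g x))\<^sup>2" for x
    by (simp add: power2_norm_eq_inner algebra_simps inner_commute)
  then show ?thesis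
    using assms by (simp add: l2norm_square l2inner_def square_integrable_inner square_integrable_integrable)
qed

lemma l2norm_minus: "l2norm M (\<lambda>x. - f x) = l2norm M f"
  by (simp add: l2norm_def)

lemma l2norm_diff_square:
  assumes "square_integrable M f" "square_integrable M g"
  shows "(l2norm M (\<lambda>x. f x - g x))\<^sup>2 = (l2norm M f)\<^sup>2 - 2 * l2inner M f g + (l2norm M g)\<^sup>2"
  using l2norm_add_square[of M f "\<lambda>x. - g x"] assms by (auto simp: l2norm_minus l2inner_def)

lemma quadratic_nonneg_imp_discriminant:
  fixes a b c :: real
  assumes "\<And>t. 0 \<le> a + 2 * t * b + t\<^sup>2 * c" "a \<ge> 0" "c \<ge> 0"
  shows "b\<^sup>2 \<le> a * c"
proof (cases "c = 0")
  case True
  have "b = 0"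
  proof (rule ccontr)
    assume b: "b \<noteq> 0"
    have "2 * (-(a+1)/(2*b)) * b = -(a+1)" using b by simp
    then show False using assms(1)[of "-(a+1)/(2*b)"] True by simp
  qed
  then show ?thesis using True by simp
next
  case False
  have "2 * (-b/c) * b + (-b/c)\<^sup>2 * c = - (b\<^sup>2 / c)"
    using False by (simp add: power2_eq_square)
  then have "b\<^sup>2 / c \<le> a" using assms(1)[of "-b/c"] by simp
  then show ?thesis using False assms(3) by (simp add: pos_divide_le_eq)
qed

lemma l2inner_Cauchy_Schwarz:
  assumes "square_integrable M f" "square_integrable M g"
  shows "\<bar>l2inner M f g\<bar> \<le> l2norm M f * l2norm M g"
proof -
  have "0 \<le> (l2norm M f)\<^sup>2 + 2 * t * l2inner M f g + t\<^sup>2 * (l2norm M g)\<^sup>2" for t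
  proof -
    have "0 \<le> (l2norm M (\<lambda>x. f x + t *\<^sub>R g x))\<^sup>2" by simp
    also have "\<dots> = (l2norm M f)\<^sup>2 + 2 * t * l2inner M f g + t\<^sup>2 * (l2norm M g)\<^sup>2"
      using l2norm_add_square[OF assms(1) square_integrable_scaleR[OF assms(2)], of t]
      by (simp add: l2norm_scaleR l2inner_def power_mult_distrib)
    finally show ?thesis .
  qed
  then have "(l2inner M f g)\<^sup>2 \<le> (l2norm M f)\<^sup>2 * (l2norm M g)\<^sup>2"
    by (rule quadratic_nonneg_imp_discriminant) auto
  then have "\<bar>l2inner M f g\<bar>\<^sup>2 \<le> (l2norm M f * l2norm M g)\<^sup>2"
    by (simp only: power_mult_distrib power2_abs)
  then show ?thesis
    by (rule power2_le_imp_le) (intro mult_nonneg_nonneg l2norm_nonneg)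
qed

lemma l2norm_triangle:
  assumes "square_integrable M f" "square_integrable M g"
  shows "l2norm M (\<lambda>x. f x + g x) \<le> l2norm M f + l2norm M g"
proof (rule power2_le_imp_le)
  have "(l2norm M f + l2norm M g)\<^sup>2 = (l2norm M f)\<^sup>2 + 2 * (l2norm M f * l2norm M g) + (l2norm M g)\<^sup>2"
    by (simp add: power2_sum)
  then show "(l2norm M (\<lambda>x. f x + g x))\<^sup>2 \<le> (l2norm M f + l2norm M g)\<^sup>2"
    using l2inner_Cauchy_Schwarz[OF assms] l2norm_add_square[OF assms] by linarith
qed (intro add_nonneg_nonneg l2norm_nonneg)

lemma l2norm_triangle_diff:
  assumes "square_integrable M f" "square_integrable M g" "square_integrable M h"
  shows "l2norm M (\<lambda>x. f x - h x) \<le> l2norm M (\<lambda>x. f x - g x) + l2norm M (\<lambda>x. g x - h x)"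
  using l2norm_triangle[of M "\<lambda>x. f x - g x" "\<lambda>x. g x - h x"] assms by auto

lemma l2norm_diff_commute: "l2norm M (\<lambda>x. f x - g x) = l2norm M (\<lambda>x. g x - f x)"
  by (simp add: l2norm_def norm_minus_commute)

lemma l2norm_le_add_diff:
  assumes "square_integrable M f" "square_integrable M g"
  shows "l2norm M f \<le> l2norm M g + l2norm M (\<lambda>x. f x - g x)"
  using l2norm_triangle[of M g "\<lambda>x. f x - g x"] assms by auto

lemma l2norm_mono:
  assumes "f \<in> borel_measurable M" "square_integrable M g" "AE x in M. norm (f x) \<le> norm (g x)"
  shows "square_integrable M f" "l2norm M f \<le> l2norm M g"
proof -
  show f: "square_integrable M f"
    by (rule square_integrableI[OF assms(1) square_integrable_integrable[OF assms(2)]])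
       (use assms(3) in \<open>auto elim!: eventually_mono simp: power_mono\<close>)
  show "l2norm M f \<le> l2norm M g"
    unfolding l2norm_def
    by (intro real_sqrt_le_mono integral_mono_AE square_integrable_integrable f assms(2))
       (use assms(3) in \<open>auto elim!: eventually_mono simp: power_mono\<close>)
qed

lemma l2norm_eq_0_AE:
  assumes "square_integrable M f" "l2norm M f = 0"
  shows "AE x in M. f x = 0"
proof -
  have "(\<integral>x. (norm (f x))\<^sup>2 \<partial>M) = 0" using assms(2) l2norm_square[of M f] by simp
  then show ?thesis
    using integral_nonneg_eq_0_iff_AE[OF square_integrable_integrable[OF assms(1)]] by simp
qed

lemma l2_tendsto_AE_subseq:
  assumes "\<And>n. square_integrable M (g n)" "square_integrable M f"
    "(\<lambda>n. l2norm M (\<lambda>x. g n x - f x)) \<longlonglongrightarrow> 0"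
  obtains r :: "nat \<Rightarrow> nat" where "strict_mono r" "AE x in M. (\<lambda>n. g (r n) x) \<longlonglongrightarrow> f x"
proof -
  have *: "square_integrable M (\<lambda>x. g n x - f x)" for n using assms by auto
  have "(\<lambda>n. (l2norm M (\<lambda>x. g n x - f x))\<^sup>2) \<longlonglongrightarrow> 0\<^sup>2" by (intro tendsto_power assms)
  then have "(\<lambda>n. \<integral>x. norm ((norm (g n x - f x))\<^sup>2) \<partial>M) \<longlonglongrightarrow> 0" by (simp add: l2norm_square)
  from tendsto_L1_AE_subseq[OF square_integrable_integrable[OF *] this]
  obtain r where r: "strict_mono r" "AE x in M. (\<lambda>n. (norm (g (r n) x - f x))\<^sup>2) \<longlonglongrightarrow> 0" by auto
  have "(\<lambda>n. g (r n) x) \<longlonglongrightarrow> f x" if "(\<lambda>n. (norm (g (r n) x - f x))\<^sup>2) \<longlonglongrightarrow> 0" for x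
  proof -
    have "(\<lambda>n. sqrt ((norm (g (r n) x - f x))\<^sup>2)) \<longlonglongrightarrow> sqrt 0" by (intro tendsto_real_sqrt that)
    then have "(\<lambda>n. norm (g (r n) x - f x)) \<longlonglongrightarrow> 0" by simp
    then show ?thesis using LIM_zero_iff tendsto_norm_zero_iff by blast
  qed
  with r(2) have "AE x in M. (\<lambda>n. g (r n) x) \<longlonglongrightarrow> f x" by (auto elim: eventually_mono)
  with r(1) show ?thesis by (rule that)
qed

lemma le_one_plus_square: "(t::real) \<le> 1 + t\<^sup>2"
proof -
  have "2 * t \<le> t\<^sup>2 + 1" using sum_squares_bound[of t 1] by simp
  moreover have "0 \<le> t\<^sup>2" by simp
  ultimately show ?thesis by linarith
qed

lemma (in prob_space) l2_imp_integrable: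
  assumes "square_integrable M f" shows "integrable M f"
  by (rule Bochner_Integration.integrable_bound[where f="\<lambda>x. 1 + (norm (f x))\<^sup>2"])
     (use assms le_one_plus_square in \<open>auto simp: square_integrable_def\<close>)

lemma (in prob_space) bounded_square_integrable:
  assumes "f \<in> borel_measurable M" "AE x in M. norm (f x) \<le> B"
  shows "square_integrable M f" "B \<ge> 0 \<Longrightarrow> l2norm M f \<le> B"
proof -
  have *: "AE x in M. (norm (f x))\<^sup>2 \<le> B\<^sup>2"
    using assms(2) by eventually_elim (simp add: power_mono)
  show s: "square_integrable M f"
    by (rule square_integrableI[OF assms(1) _ *]) simp
  have "(l2norm M f)\<^sup>2 \<le> (\<integral>x. B\<^sup>2 \<partial>M)"
    unfolding l2norm_square by (intro integral_mono_AE * square_integrable_integrable s) simp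
  then show "B \<ge> 0 \<Longrightarrow> l2norm M f \<le> B" using power2_le_imp_le[of "l2norm M f" B] by (simp add: prob_space)
qed

lemma (in prob_space) integral_norm_le_l2norm:
  assumes "square_integrable M f"
  shows "(\<integral>x. norm (f x) \<partial>M) \<le> l2norm M f"
proof -
  have 1: "square_integrable M (\<lambda>x. norm (f x))" using assms by (auto simp: square_integrable_def)
  have 2: "square_integrable M (\<lambda>x. 1::real)" by (rule bounded_square_integrable(1)) auto
  have "(l2norm M (\<lambda>x. 1::real)) = 1" by (simp add: l2norm_def prob_space)
  moreover have "l2norm M (\<lambda>x. norm (f x)) = l2norm M f" by (simp add: l2norm_def)
  ultimately show ?thesis using l2inner_Cauchy_Schwarz[OF 1 2] by (simp add: l2inner_def)
qed

text \<open>A Cauchy sequence has a subsequence whose increments have summable norms. It converges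
  almost everywhere, and by Fatou's lemma the whole sequence converges to its limit in the mean.\<close>

lemma (in prob_space) l2_complete:
  fixes g :: "nat \<Rightarrow> 'a \<Rightarrow> 'b::euclidean_space"
  assumes g: "\<And>n. square_integrable M (g n)"
    and Cauchy: "\<And>e. e > 0 \<Longrightarrow> \<exists>N. \<forall>m\<ge>N. \<forall>n\<ge>N. l2norm M (\<lambda>x. g m x - g n x) < e"
  obtains f where "square_integrable M f" "(\<lambda>n. l2norm M (\<lambda>x. g n x - f x)) \<longlonglongrightarrow> 0"
proof -
  note [measurable] = square_integrable_measurable[OF g]
  have "\<forall>k. \<exists>N. \<forall>m\<ge>N. \<forall>n\<ge>N. l2norm M (\<lambda>x. g m x - g n x) < (1/2)^k"
    by (intro allI Cauchy) simp
  from choice[OF this]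
  obtain N where N: "\<And>k m n. m \<ge> N k \<Longrightarrow> n \<ge> N k \<Longrightarrow> l2norm M (\<lambda>x. g m x - g n x) < (1/2)^k"
    by auto
  \<comment> \<open>The sum serves as a bound for all of \<open>N 0, \<dots>, N k\<close>, since \<open>N\<close> need not be monotone.\<close>
  define r where "r k = (\<Sum>i\<le>k. N i) + k" for k
  have rN: "r k \<ge> N j" if "j \<le> k" for j k
  proof -
    have "N j \<le> (\<Sum>i\<le>k. N i)" using that by (intro member_le_sum) auto
    then show ?thesis by (simp add: r_def)
  qed
  define d where "d k x = norm (g (r (Suc k)) x - g (r k) x)" for k x
  have [measurable]: "d k \<in> borel_measurable M" for k unfolding d_def by measurable
  have d: "(\<integral>\<^sup>+x. d k x \<partial>M) \<le> ennreal ((1/2)^k)" for k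
  proof -
    have i: "square_integrable M (\<lambda>x. g (r (Suc k)) x - g (r k) x)" using g by auto
    have "(\<integral>\<^sup>+x. d k x \<partial>M) = ennreal (\<integral>x. d k x \<partial>M)"
      unfolding d_def by (rule nn_integral_eq_integral) (use l2_imp_integrable[OF i] in auto)
    also have "(\<integral>x. d k x \<partial>M) \<le> l2norm M (\<lambda>x. g (r (Suc k)) x - g (r k) x)"
      unfolding d_def by (rule integral_norm_le_l2norm[OF i])
    also have "\<dots> \<le> (1/2)^k" using N[of k "r (Suc k)" "r k"] rN[of k "Suc k"] rN[of k k] by simp
    finally show ?thesis by (simp add: ennreal_leI)
  qed
  have "(\<integral>\<^sup>+x. (\<Sum>k. ennreal (d k x)) \<partial>M) = (\<Sum>k. \<integral>\<^sup>+x. d k x \<partial>M)"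
    by (rule nn_integral_suminf) measurable
  also have "\<dots> \<le> (\<Sum>k. ennreal ((1/2)^k))" by (intro suminf_le d) auto
  also have "\<dots> = ennreal (\<Sum>k. (1/2)^k)" by (rule suminf_ennreal2) auto
  also have "\<dots> < \<infinity>" by simp
  finally have fin: "(\<integral>\<^sup>+x. (\<Sum>k. ennreal (d k x)) \<partial>M) \<noteq> \<infinity>" by simp
  have "AE x in M. (\<Sum>k. ennreal (d k x)) \<noteq> \<infinity>"
    by (rule nn_integral_PInf_AE[OF _ fin]) measurable
  then have conv: "AE x in M. convergent (\<lambda>k. g (r k) x)"
  proof eventually_elim
    case (elim x)
    have "summable (\<lambda>k. d k x)" using elim by (intro summable_suminf_not_top) (auto simp: d_def)
    then have "summable (\<lambda>k. g (r (Suc k)) x - g (r k) x)" unfolding d_def by (rule summable_norm_cancel)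
    then have "convergent (\<lambda>n. \<Sum>k<n. g (r (Suc k)) x - g (r k) x)" by (simp add: summable_iff_convergent)
    then have "convergent (\<lambda>n. g (r n) x - g (r 0) x)"
      using sum_lessThan_telescope[of "\<lambda>k. g (r k) x"] by simp
    then have "convergent (\<lambda>n. (g (r n) x - g (r 0) x) + g (r 0) x)"
      by (rule convergent_add) (rule convergent_const)
    then show ?case by simp
  qed
  define f where "f x = lim (\<lambda>k. g (r k) x)" for x
  have [measurable]: "f \<in> borel_measurable M" unfolding f_def by measurable
  from conv have conv: "AE x in M. (\<lambda>k. g (r k) x) \<longlonglongrightarrow> f x"
    by eventually_elim (simp add: f_def convergent_LIMSEQ_iff)
  have est: "(\<integral>\<^sup>+x. ennreal ((norm (g n x - f x))\<^sup>2) \<partial>M) \<le> ennreal (((1/2)^j)\<^sup>2)" if "n \<ge> N j" for n j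
  proof -
    have "(\<integral>\<^sup>+x. ennreal ((norm (g n x - f x))\<^sup>2) \<partial>M)
        = (\<integral>\<^sup>+x. liminf (\<lambda>k. ennreal ((norm (g n x - g (r k) x))\<^sup>2)) \<partial>M)"
    proof (rule nn_integral_cong_AE, use conv in eventually_elim)
      case (elim x)
      have "(\<lambda>k. ennreal ((norm (g n x - g (r k) x))\<^sup>2)) \<longlonglongrightarrow> ennreal ((norm (g n x - f x))\<^sup>2)"
        by (intro tendsto_intros elim)
      from lim_imp_Liminf[OF _ this] show ?case by simp
    qed
    also have "\<dots> \<le> liminf (\<lambda>k. (\<integral>\<^sup>+x. ennreal ((norm (g n x - g (r k) x))\<^sup>2) \<partial>M))"
      by (rule nn_integral_liminf) measurable
    also have "\<dots> \<le> ennreal (((1/2)^j)\<^sup>2)"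
    proof (rule Liminf_le)
      show "\<forall>\<^sub>F k in sequentially. (\<integral>\<^sup>+x. ennreal ((norm (g n x - g (r k) x))\<^sup>2) \<partial>M) \<le> ennreal (((1/2)^j)\<^sup>2)"
        using eventually_ge_at_top[of j]
      proof eventually_elim
        case (elim k)
        have i: "square_integrable M (\<lambda>x. g n x - g (r k) x)" using g by auto
        have "(\<integral>\<^sup>+x. ennreal ((norm (g n x - g (r k) x))\<^sup>2) \<partial>M) = ennreal ((l2norm M (\<lambda>x. g n x - g (r k) x))\<^sup>2)"
          unfolding l2norm_square by (rule nn_integral_eq_integral) (use square_integrable_integrable[OF i] in auto)
        also have "\<dots> \<le> ennreal (((1/2)^j)\<^sup>2)"
          using N[OF that rN[OF elim]] by (intro ennreal_leI power_mono) auto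
        finally show ?case .
      qed
    qed simp
    finally show ?thesis .
  qed
  have sd: "square_integrable M (\<lambda>x. g n x - f x)" if "n \<ge> N j" for n j
    unfolding square_integrable_def
  proof
    show "integrable M (\<lambda>x. (norm (g n x - f x))\<^sup>2)"
      using le_less_trans[OF est[OF that], of \<infinity>] by (intro integrableI_nonneg) auto
  qed measurable
  have f: "square_integrable M f"
    using square_integrable_diff[OF g sd[OF order_refl, of 0], of "N 0"] by simp
  have "(\<lambda>n. l2norm M (\<lambda>x. g n x - f x)) \<longlonglongrightarrow> 0"
  proof (rule LIMSEQ_I)
    fix e :: real assume "e > 0"
    then obtain j where j: "(1/2)^j < e" using real_arch_pow_inv[of e "1/2"] by auto
    have "norm (l2norm M (\<lambda>x. g n x - f x) - 0) < e" if "n \<ge> N j" for n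
    proof -
      have "ennreal ((l2norm M (\<lambda>x. g n x - f x))\<^sup>2) = (\<integral>\<^sup>+x. ennreal ((norm (g n x - f x))\<^sup>2) \<partial>M)"
        unfolding l2norm_square
        by (rule nn_integral_eq_integral[symmetric]) (use square_integrable_integrable[OF sd[OF that]] in auto)
      also have "\<dots> \<le> ennreal (((1/2)^j)\<^sup>2)" by (rule est[OF that])
      finally have "(l2norm M (\<lambda>x. g n x - f x))\<^sup>2 \<le> ((1/2)^j)\<^sup>2"
        by (subst (asm) ennreal_le_iff) auto
      then have "l2norm M (\<lambda>x. g n x - f x) \<le> (1/2)^j"
        by (rule power2_le_imp_le) simp
      then show ?thesis using j by simp
    qed
    then show "\<exists>no. \<forall>n\<ge>no. norm (l2norm M (\<lambda>x. g n x - f x) - 0) < e" by blast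
  qed
  with f show ?thesis by (rule that)
qed

lemma l2norm_tendsto:
  assumes "\<And>n. square_integrable M (g n)" "square_integrable M f"
    "(\<lambda>n. l2norm M (\<lambda>x. g n x - f x)) \<longlonglongrightarrow> 0"
  shows "(\<lambda>n. l2norm M (g n)) \<longlonglongrightarrow> l2norm M f"
proof (rule LIM_zero_cancel, rule Lim_null_comparison)
  show "\<forall>\<^sub>F n in sequentially. norm (l2norm M (g n) - l2norm M f) \<le> l2norm M (\<lambda>x. g n x - f x)"
    using l2norm_le_add_diff[OF assms(1,2)] l2norm_le_add_diff[OF assms(2,1)]
    by (intro always_eventually allI) (simp add: abs_le_iff l2norm_diff_commute[of M f] algebra_simps)
  show "(\<lambda>n. l2norm M (\<lambda>x. g n x - f x)) \<longlonglongrightarrow> 0" by fact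
qed

lemma l2inner_tendsto:
  assumes "\<And>n. square_integrable M (g n)" "square_integrable M f" "square_integrable M h"
    "(\<lambda>n. l2norm M (\<lambda>x. g n x - f x)) \<longlonglongrightarrow> 0"
  shows "(\<lambda>n. l2inner M (g n) h) \<longlonglongrightarrow> l2inner M f h"
proof (rule LIM_zero_cancel, rule Lim_null_comparison)
  have "\<bar>l2inner M (g n) h - l2inner M f h\<bar> \<le> l2norm M (\<lambda>x. g n x - f x) * l2norm M h" for n
  proof -
    have d: "square_integrable M (\<lambda>x. g n x - f x)" using assms by auto
    show ?thesis
      using l2inner_Cauchy_Schwarz[OF d assms(3)] l2inner_add_left[OF d assms(2,3)] by simp
  qed
  then show "\<forall>\<^sub>F n in sequentially. norm (l2inner M (g n) h - l2inner M f h) \<le> l2norm M (\<lambda>x. g n x - f x) * l2norm M h"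
    by simp
  show "(\<lambda>n. l2norm M (\<lambda>x. g n x - f x) * l2norm M h) \<longlonglongrightarrow> 0"
    using tendsto_mult_left_zero[OF assms(4)] by simp
qed

text \<open>Elements of almost minimal norm in a decreasing sequence of convex sets form a Cauchy sequence,
  by the parallelogram law. For a constant sequence of sets this is the existence of an element of least norm
  in the closure; for a decreasing one it takes the place of the weak compactness of balls.\<close>

lemma (in prob_space) l2_nested_convex:
  fixes S :: "nat \<Rightarrow> ('a \<Rightarrow> 'b::euclidean_space) set"
  assumes S: "\<And>n g. g \<in> S n \<Longrightarrow> square_integrable M g"
    and ne: "\<And>n. S n \<noteq> {}"
    and dec: "\<And>n. S (Suc n) \<subseteq> S n"
    and mid: "\<And>n f g. f \<in> S n \<Longrightarrow> g \<in> S n \<Longrightarrow> (\<lambda>x. (1/2) *\<^sub>R (f x + g x)) \<in> S n"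
    and bound: "\<And>n. \<exists>g\<in>S n. l2norm M g \<le> B"
  obtains f g where "\<And>n. g n \<in> S n" "square_integrable M f"
    "(\<lambda>n. l2norm M (\<lambda>x. g n x - f x)) \<longlonglongrightarrow> 0"
    "\<And>h. (\<And>n. h \<in> S n) \<Longrightarrow> l2norm M f \<le> l2norm M h"
proof -
  define D where "D n = (INF g\<in>S n. (l2norm M g)\<^sup>2)" for n
  have bdd: "bdd_below ((\<lambda>g. (l2norm M g)\<^sup>2) ` S n)" for n
    by (rule bdd_belowI[of _ 0]) auto
  have D_le: "D n \<le> (l2norm M g)\<^sup>2" if "g \<in> S n" for n g
    unfolding D_def by (rule cINF_lower[OF bdd that])
  have incD: "D n \<le> D (Suc n)" for n
    unfolding D_def by (rule cINF_superset_mono[OF ne bdd dec]) auto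
  have DB: "D n \<le> B\<^sup>2" for n
  proof -
    obtain g where "g \<in> S n" "l2norm M g \<le> B" using bound by blast
    then show ?thesis using D_le[of g n] power_mono[of "l2norm M g" B 2] by auto
  qed
  have incD': "incseq D" by (rule incseq_SucI) (rule incD)
  then obtain L where L: "D \<longlonglongrightarrow> L" "\<And>n. D n \<le> L"
    by (rule incseq_convergent[of D "B\<^sup>2"]) (use DB in auto)
  have "\<exists>g\<in>S n. (l2norm M g)\<^sup>2 < D n + 1 / Suc n" for n
  proof -
    have "D n < D n + 1 / Suc n" by simp
    then show ?thesis unfolding D_def using cINF_less_iff[OF ne bdd] by blast
  qed
  then obtain g where g: "\<And>n. g n \<in> S n" "\<And>n. (l2norm M (g n))\<^sup>2 < D n + 1 / Suc n"
    unfolding Bex_def using choice[of "\<lambda>n g. g \<in> S n \<and> (l2norm M g)\<^sup>2 < D n + 1 / Suc n"] by auto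
  have mono: "S n \<subseteq> S m" if "m \<le> n" for m n using that dec lift_Suc_antimono_le[of S] by blast
  have key: "(l2norm M (\<lambda>x. g m x - g n x))\<^sup>2 \<le> 4 * (L - D N) + 4 / Suc N"
    if mn: "m \<ge> N" "n \<ge> N" for m n N
  proof -
    have s: "square_integrable M (g m)" "square_integrable M (g n)" using g S by blast+
    have "g m \<in> S N" "g n \<in> S N" using g(1) mono mn by blast+
    from D_le[OF mid[OF this]]
    have "D N \<le> (1/4) * (l2norm M (\<lambda>x. g m x + g n x))\<^sup>2"
      unfolding l2norm_scaleR by (simp add: power_mult_distrib power2_eq_square)
    then have D4: "4 * D N \<le> (l2norm M (\<lambda>x. g m x + g n x))\<^sup>2" by simp
    define c where "c = 1 / real (Suc N)"
    have *: "(l2norm M (g k))\<^sup>2 \<le> L + c" if "k \<ge> N" for k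
      using g(2)[of k] L(2)[of k] frac_le[of 1 1 "Suc N" "Suc k"] that by (simp add: c_def)
    have aux: "d \<le> 4 * (L - D N) + 4 * c"
      if "4 * D N \<le> s" "a \<le> L + c" "b \<le> L + c" "s = a + 2 * i + b" "d = a - 2 * i + b" for a b s d i :: real
      using that by argo
    have "(l2norm M (\<lambda>x. g m x - g n x))\<^sup>2 \<le> 4 * (L - D N) + 4 * c"
      by (rule aux[OF D4 *[OF mn(1)] *[OF mn(2)] l2norm_add_square[OF s] l2norm_diff_square[OF s]])
    then show ?thesis by (simp add: c_def)
  qed
  have lim: "(\<lambda>N. 4 * (L - D N) + 4 / Suc N) \<longlonglongrightarrow> 4 * (L - L) + 0"
    by (intro tendsto_intros L LIMSEQ_Suc[OF lim_const_over_n])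
  have "\<exists>N. \<forall>m\<ge>N. \<forall>n\<ge>N. l2norm M (\<lambda>x. g m x - g n x) < e" if e: "e > 0" for e
  proof -
    have "\<forall>\<^sub>F N in sequentially. 4 * (L - D N) + 4 / Suc N < e\<^sup>2"
      using order_tendstoD(2)[OF lim, of "e\<^sup>2"] e by simp
    then obtain N where N: "4 * (L - D N) + 4 / Suc N < e\<^sup>2" by (auto simp: eventually_sequentially)
    have "l2norm M (\<lambda>x. g m x - g n x) < e" if "m \<ge> N" "n \<ge> N" for m n
      using key[OF that] N e power2_less_imp_less[of "l2norm M (\<lambda>x. g m x - g n x)" e] by auto
    then show ?thesis by blast
  qed
  from l2_complete[OF S[OF g(1)] this]
  obtain f where f: "square_integrable M f" "(\<lambda>n. l2norm M (\<lambda>x. g n x - f x)) \<longlonglongrightarrow> 0" by blast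
  have "l2norm M f \<le> l2norm M h" if h: "\<And>n. h \<in> S n" for h
  proof -
    have 1: "(\<lambda>n. (l2norm M (g n))\<^sup>2) \<longlonglongrightarrow> (l2norm M f)\<^sup>2"
      by (intro tendsto_power l2norm_tendsto f S[OF g(1)])
    have 2: "(\<lambda>n. (l2norm M h)\<^sup>2 + 1 / Suc n) \<longlonglongrightarrow> (l2norm M h)\<^sup>2 + 0"
      by (intro tendsto_intros LIMSEQ_Suc[OF lim_const_over_n])
    have "(l2norm M f)\<^sup>2 \<le> (l2norm M h)\<^sup>2 + 0"
    proof (rule LIMSEQ_le[OF 1 2])
      show "\<exists>N. \<forall>n\<ge>N. (l2norm M (g n))\<^sup>2 \<le> (l2norm M h)\<^sup>2 + 1 / Suc n"
        using g(2) D_le[OF h] by (meson add_right_mono less_imp_le order_trans)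
    qed
    then have "(l2norm M f)\<^sup>2 \<le> (l2norm M h)\<^sup>2" by simp
    then show ?thesis by (rule power2_le_imp_le) simp
  qed
  then show ?thesis by (rule that[OF g(1) f])
qed

section \<open>Measures on the circle and their moments\<close>

lemma space_circle_measure[simp]: "space circle_measure = sphere 0 1"
  by (simp add: circle_measure_def space_restrict_space)

lemma sets_circle_measure[measurable_cong]:
  "sets circle_measure = sets (restrict_space borel (sphere 0 1))"
  by (simp add: circle_measure_def)

lemma cis_measurable_circle[measurable]:
  "cis \<in> measurable borel (restrict_space borel (sphere 0 1))"
proof (rule measurable_restrict_space2)
  show "cis \<in> borel_measurable borel"
    by (intro borel_measurable_continuous_onI continuous_intros)
qed simp

global_interpretation circle: prob_space circle_measure
proof -
  have *: "prob_space (uniform_measure lborel {0..<2 * pi})"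
    by (rule prob_space_uniform_measure) auto
  have "cis \<in> measurable (uniform_measure lborel {0..<2 * pi}) (restrict_space borel (sphere 0 1))"
    using cis_measurable_circle by (simp cong: measurable_cong_sets)
  from prob_space.prob_space_distr[OF * this]
  show "prob_space circle_measure" unfolding circle_measure_def .
qed

lemma borel_imp_circle_measurable[measurable (raw)]:
  "f \<in> borel_measurable borel \<Longrightarrow> f \<in> borel_measurable circle_measure"
  by (simp add: measurable_restrict_space1 cong: measurable_cong_sets[OF sets_circle_measure refl])

lemma AE_circleI: "(\<And>\<zeta>. norm \<zeta> = 1 \<Longrightarrow> P \<zeta>) \<Longrightarrow> AE \<zeta> in circle_measure. P \<zeta>"
  by (rule AE_I2) simp

lemma circle_integral_power:
  assumes "n \<ge> 1"
  shows "(\<integral>\<zeta>. \<zeta> ^ n \<partial>circle_measure) = 0"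
proof -
  have n: "complex_of_real (real n) * \<i> \<noteq> 0" using assms by simp
  have cm: "(\<lambda>t. cis t ^ n) \<in> borel_measurable borel"
    by (intro borel_measurable_continuous_onI continuous_intros)
  define F where "F t = cis (real n * t) / (of_nat n * \<i>)" for t :: real
  have F: "(F has_vector_derivative cis t ^ n) (at t within {0..2*pi})" for t
  proof -
    have "((\<lambda>z. exp (\<i> * (of_nat n * z)) / (of_nat n * \<i>)) has_field_derivative exp (\<i> * (of_nat n * of_real t))) (at (of_real t))"
      by (rule derivative_eq_intros refl | use n in \<open>simp add: field_simps\<close>)+
    from has_vector_derivative_real_field[OF this]
    show ?thesis by (simp add: F_def[abs_def] cis_conv_exp exp_of_nat_mult[symmetric] mult_ac)
  qed
  have hb: "has_bochner_integral lborel (\<lambda>t. indicator {0..2*pi} t *\<^sub>R cis t ^ n) (F (2*pi) - F 0)"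
    by (rule has_bochner_integral_FTC_Icc[OF _ F]) (auto intro!: continuous_intros)
  have "F (2*pi) = F 0"
  proof -
    have "cis (real n * (2 * pi)) = cis (2 * pi) ^ n" by (rule Complex.DeMoivre[symmetric])
    then show ?thesis by (simp add: F_def)
  qed
  then have z: "(\<integral>t. indicator {0..2*pi} t *\<^sub>R cis t ^ n \<partial>lborel) = 0"
    using hb by (simp add: has_bochner_integral_integral_eq)
  have "(\<integral>\<zeta>. \<zeta> ^ n \<partial>circle_measure) = (\<integral>t. cis t ^ n \<partial>uniform_measure lborel {0..<2 * pi})"
    unfolding circle_measure_def
  proof (rule integral_distr)
    show "cis \<in> measurable (uniform_measure lborel {0..<2 * pi}) (restrict_space borel (sphere 0 1))"
      using cis_measurable_circle by (simp cong: measurable_cong_sets)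
  qed (intro measurable_restrict_space1, measurable)
  also have "uniform_measure lborel {0..<2 * pi} = density lborel (\<lambda>t. ennreal (indicator {0..<2*pi} t / (2*pi)))"
    unfolding uniform_measure_def
    by (intro density_cong) (auto simp: indicator_def divide_ennreal ennreal_1[symmetric] simp del: ennreal_1)
  also have "(\<integral>t. cis t ^ n \<partial>density lborel (\<lambda>t. ennreal (indicator {0..<2*pi} t / (2*pi))))
      = (\<integral>t. (indicator {0..<2*pi} t / (2*pi)) *\<^sub>R cis t ^ n \<partial>lborel)"
    by (rule integral_density) (use cm in auto)
  also have "\<dots> = (\<integral>t. (1/(2*pi)) *\<^sub>R (indicator {0..2*pi} t *\<^sub>R cis t ^ n) \<partial>lborel)"
  proof (rule integral_cong_AE)
    show "AE t in lborel. (indicator {0..<2*pi} t / (2*pi)) *\<^sub>R cis t ^ n = (1/(2*pi)) *\<^sub>R (indicator {0..2*pi} t *\<^sub>R cis t ^ n)"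
      using AE_lborel_singleton[of "2*pi"] by eventually_elim (auto simp: indicator_def)
  qed (use cm in auto)
  also have "\<dots> = 0" unfolding integral_scaleR_right z by simp
  finally show ?thesis .
qed

lemma unit_mult_cnj: "norm \<zeta> = 1 \<Longrightarrow> \<zeta> * cnj \<zeta> = 1"
  by (simp add: complex_norm_square[symmetric])

lemma cnj_power_mult_power_unit:
  assumes "norm \<zeta> = 1"
  shows "\<zeta> ^ i * cnj \<zeta> ^ j = (if j \<le> i then \<zeta> ^ (i - j) else cnj \<zeta> ^ (j - i))"
proof -
  have u: "\<zeta> * cnj \<zeta> = 1" by (rule unit_mult_cnj[OF assms])
  show ?thesis
  proof (cases "j \<le> i")
    case True
    then have "\<zeta> ^ i = \<zeta> ^ (i - j) * \<zeta> ^ j" by (simp add: power_add[symmetric])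
    then have "\<zeta> ^ i * cnj \<zeta> ^ j = \<zeta> ^ (i - j) * (\<zeta> * cnj \<zeta>) ^ j" by (simp add: power_mult_distrib)
    then show ?thesis using True u by simp
  next
    case False
    then have "cnj \<zeta> ^ j = cnj \<zeta> ^ (j - i) * cnj \<zeta> ^ i" by (simp add: power_add[symmetric])
    then have "\<zeta> ^ i * cnj \<zeta> ^ j = cnj \<zeta> ^ (j - i) * (\<zeta> * cnj \<zeta>) ^ i" by (simp add: power_mult_distrib)
    then show ?thesis using False u by simp
  qed
qed

text \<open>On the circle the conjugate of \<open>\<zeta>\<close> is its inverse, so that polynomials in the real and imaginary part
  are trigonometric polynomials.\<close>

lemma real_polynomial_function_on_circle:
  assumes "real_polynomial_function p"
  shows "\<exists>q N. \<forall>\<zeta>. norm \<zeta> = 1 \<longrightarrow> complex_of_real (p \<zeta>) = poly q \<zeta> * cnj \<zeta> ^ N"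
  using assms
proof induction
  case (linear f)
  define \<alpha> where "\<alpha> = (of_real (f 1) - \<i> * of_real (f \<i>)) / 2"
  define \<beta> where "\<beta> = (of_real (f 1) + \<i> * of_real (f \<i>)) / 2"
  have "complex_of_real (f \<zeta>) = poly [:\<beta>, 0, \<alpha>:] \<zeta> * cnj \<zeta> ^ 1" if "norm \<zeta> = 1" for \<zeta>
  proof -
    have u: "\<zeta> * cnj \<zeta> = 1" by (rule unit_mult_cnj[OF that])
    have "f \<zeta> = f (Re \<zeta> *\<^sub>R 1 + Im \<zeta> *\<^sub>R \<i>)" by (rule arg_cong[where f=f]) (simp add: complex_eq_iff)
    also have "\<dots> = Re \<zeta> * f 1 + Im \<zeta> * f \<i>"
      using linear.hyps by (simp add: linear_simps linear_cmul bounded_linear.linear)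
    finally have "complex_of_real (f \<zeta>) = \<beta> * cnj \<zeta> + \<alpha> * \<zeta>"
      by (simp add: \<alpha>_def \<beta>_def complex_eq_iff field_simps)
    also have "\<dots> = \<beta> * cnj \<zeta> + \<alpha> * \<zeta> * (\<zeta> * cnj \<zeta>)" using u by simp
    finally show ?thesis by (simp add: algebra_simps)
  qed
  then show ?case by blast
next
  case (const c)
  have "\<forall>\<zeta>. norm \<zeta> = 1 \<longrightarrow> complex_of_real c = poly [:of_real c:] \<zeta> * cnj \<zeta> ^ 0" by simp
  then show ?case by blast
next
  case (add f g)
  then obtain q1 N1 q2 N2 where
    q1: "\<And>\<zeta>. norm \<zeta> = 1 \<Longrightarrow> complex_of_real (f \<zeta>) = poly q1 \<zeta> * cnj \<zeta> ^ N1" and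
    q2: "\<And>\<zeta>. norm \<zeta> = 1 \<Longrightarrow> complex_of_real (g \<zeta>) = poly q2 \<zeta> * cnj \<zeta> ^ N2" by blast
  have "complex_of_real (f \<zeta> + g \<zeta>) = poly (q1 * monom 1 N2 + q2 * monom 1 N1) \<zeta> * cnj \<zeta> ^ (N1 + N2)"
    if "norm \<zeta> = 1" for \<zeta>
  proof -
    have "\<zeta> * cnj \<zeta> = 1" by (rule unit_mult_cnj[OF that])
    then have u: "\<zeta> ^ n * cnj \<zeta> ^ n = 1" for n by (simp add: power_mult_distrib[symmetric])
    have "poly (q1 * monom 1 N2 + q2 * monom 1 N1) \<zeta> * cnj \<zeta> ^ (N1 + N2)
      = poly q1 \<zeta> * cnj \<zeta> ^ N1 * (\<zeta> ^ N2 * cnj \<zeta> ^ N2) + poly q2 \<zeta> * cnj \<zeta> ^ N2 * (\<zeta> ^ N1 * cnj \<zeta> ^ N1)"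
      by (simp add: poly_monom power_add algebra_simps)
    then show ?thesis by (simp add: u q1 q2 that)
  qed
  then show ?case by blast
next
  case (mult f g)
  then obtain q1 N1 q2 N2 where
    q1: "\<And>\<zeta>. norm \<zeta> = 1 \<Longrightarrow> complex_of_real (f \<zeta>) = poly q1 \<zeta> * cnj \<zeta> ^ N1" and
    q2: "\<And>\<zeta>. norm \<zeta> = 1 \<Longrightarrow> complex_of_real (g \<zeta>) = poly q2 \<zeta> * cnj \<zeta> ^ N2" by blast
  have "complex_of_real (f \<zeta> * g \<zeta>) = poly (q1 * q2) \<zeta> * cnj \<zeta> ^ (N1 + N2)"
    if "norm \<zeta> = 1" for \<zeta>
    by (simp add: q1 q2 that power_add)
  then show ?case by blast
qed

lemma finite_circle_measure_integrable:
  fixes f :: "complex \<Rightarrow> 'b::{banach, second_countable_topology}"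
  assumes "finite_measure A" "sets A = sets circle_measure" "f \<in> borel_measurable borel"
    "\<And>\<zeta>. norm \<zeta> = 1 \<Longrightarrow> norm (f \<zeta>) \<le> B"
  shows "integrable A f"
proof -
  interpret finite_measure A by fact
  have sp: "space A = sphere 0 1" using sets_eq_imp_space_eq[OF assms(2)] by simp
  show ?thesis
  proof (rule integrable_const_bound[where B=B])
    show "AE x in A. norm (f x) \<le> B" by (rule AE_I2) (simp add: sp assms(4))
    show "f \<in> borel_measurable A" using borel_imp_circle_measurable[OF assms(3)] 
      by (simp cong: measurable_cong_sets[OF assms(2) refl])
  qed
qed

lemma borel_measurable_cnj[measurable (raw)]:
  "f \<in> borel_measurable M \<Longrightarrow> (\<lambda>x. cnj (f x)) \<in> borel_measurable M"
  by (rule measurable_compose[of f M borel cnj borel])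
     (auto intro!: borel_measurable_continuous_onI continuous_intros)

text \<open>By the Stone--Weierstrass theorem the moments determine the integrals of continuous functions,
  hence the measures of closed sets.\<close>

lemma circle_measures_eqI:
  assumes A: "finite_measure A" "sets A = sets circle_measure"
    and B: "finite_measure B" "sets B = sets circle_measure"
    and moments: "\<And>n. (\<integral>\<zeta>. \<zeta> ^ n \<partial>A) = (\<integral>\<zeta>. \<zeta> ^ n \<partial>B)"
  shows "A = B"
proof -
  interpret A: finite_measure A by fact
  interpret B: finite_measure B by fact
  have sA: "space A = sphere 0 1" using sets_eq_imp_space_eq[OF A(2)] by simp
  have sB: "space B = sphere 0 1" using sets_eq_imp_space_eq[OF B(2)] by simp
  note intA = finite_circle_measure_integrable[OF A]
  note intB = finite_circle_measure_integrable[OF B]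
  have mono_eq: "(\<integral>\<zeta>. \<zeta> ^ i * cnj \<zeta> ^ j \<partial>A) = (\<integral>\<zeta>. \<zeta> ^ i * cnj \<zeta> ^ j \<partial>B)" for i j
  proof -
    have cnj_eq: "(\<integral>\<zeta>. cnj \<zeta> ^ n \<partial>A) = (\<integral>\<zeta>. cnj \<zeta> ^ n \<partial>B)" for n
      using moments[of n] by (simp flip: complex_cnj_power)
    have "(\<integral>\<zeta>. \<zeta> ^ i * cnj \<zeta> ^ j \<partial>C) = (\<integral>\<zeta>. (if j \<le> i then \<zeta> ^ (i - j) else cnj \<zeta> ^ (j - i)) \<partial>C)"
      if "space C = sphere 0 1" for C
      by (intro Bochner_Integration.integral_cong refl cnj_power_mult_power_unit) (simp add: that)
    then show ?thesis using moments cnj_eq sA sB by (cases "j \<le> i") auto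
  qed
  have poly_eq: "(\<integral>\<zeta>. poly q \<zeta> * cnj \<zeta> ^ N \<partial>A) = (\<integral>\<zeta>. poly q \<zeta> * cnj \<zeta> ^ N \<partial>B)" for q N
  proof -
    have *: "(\<integral>\<zeta>. poly q \<zeta> * cnj \<zeta> ^ N \<partial>C) = (\<Sum>i\<le>degree q. coeff q i * (\<integral>\<zeta>. \<zeta> ^ i * cnj \<zeta> ^ N \<partial>C))"
      if C: "finite_measure C" "sets C = sets circle_measure" for C
    proof -
      have i: "integrable C (\<lambda>\<zeta>. coeff q i * (\<zeta> ^ i * cnj \<zeta> ^ N))" for i
        by (intro integrable_mult_right finite_circle_measure_integrable[OF C, where B=1])
           (auto simp: norm_mult norm_power)
      have "(\<integral>\<zeta>. poly q \<zeta> * cnj \<zeta> ^ N \<partial>C) = (\<integral>\<zeta>. (\<Sum>i\<le>degree q. coeff q i * (\<zeta> ^ i * cnj \<zeta> ^ N)) \<partial>C)"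
        by (simp only: poly_altdef sum_distrib_right mult.assoc)
      also have "\<dots> = (\<Sum>i\<le>degree q. \<integral>\<zeta>. coeff q i * (\<zeta> ^ i * cnj \<zeta> ^ N) \<partial>C)"
        using i by (rule Bochner_Integration.integral_sum)
      finally show ?thesis by simp
    qed
    show ?thesis using *[OF A] *[OF B] mono_eq by simp
  qed
  have rpoly_eq: "(\<integral>\<zeta>. p \<zeta> \<partial>A) = (\<integral>\<zeta>. p \<zeta> \<partial>B)" if p: "real_polynomial_function p" for p :: "complex \<Rightarrow> real"
  proof -
    obtain q N where q: "\<And>\<zeta>. norm \<zeta> = 1 \<Longrightarrow> complex_of_real (p \<zeta>) = poly q \<zeta> * cnj \<zeta> ^ N"
      using real_polynomial_function_on_circle[OF p] by blast
    have "(\<integral>\<zeta>. complex_of_real (p \<zeta>) \<partial>C) = (\<integral>\<zeta>. poly q \<zeta> * cnj \<zeta> ^ N \<partial>C)"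
      if "space C = sphere 0 1" for C
      by (intro Bochner_Integration.integral_cong refl q) (simp add: that)
    then have "(\<integral>\<zeta>. complex_of_real (p \<zeta>) \<partial>A) = (\<integral>\<zeta>. complex_of_real (p \<zeta>) \<partial>B)"
      using poly_eq sA sB by simp
    then show ?thesis by simp
  qed
  have cont_eq: "(\<integral>\<zeta>. f \<zeta> \<partial>A) = (\<integral>\<zeta>. f \<zeta> \<partial>B)" if f: "continuous_on UNIV f" for f :: "complex \<Rightarrow> real"
  proof -
    have fm: "f \<in> borel_measurable borel" by (rule borel_measurable_continuous_onI[OF f])
    have cf: "continuous_on (sphere 0 1) f" using f by (rule continuous_on_subset) simp
    obtain K where "\<forall>x\<in>f ` sphere 0 1. norm x \<le> K"
      using compact_imp_bounded[OF compact_continuous_image[OF cf compact_sphere]]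
      unfolding bounded_iff by blast
    then have K: "\<And>\<zeta>. norm \<zeta> = 1 \<Longrightarrow> norm (f \<zeta>) \<le> K" by simp
    define T where "T = measure A (space A) + measure B (space B)"
    have "\<bar>(\<integral>\<zeta>. f \<zeta> \<partial>A) - (\<integral>\<zeta>. f \<zeta> \<partial>B)\<bar> \<le> e * T" if e: "e > 0" for e
    proof -
      obtain p where p: "real_polynomial_function p" "\<And>x. x \<in> sphere 0 1 \<Longrightarrow> \<bar>f x - p x\<bar> < e"
        using Stone_Weierstrass_real_polynomial_function[OF compact_sphere cf e] by blast
      have pm: "p \<in> borel_measurable borel"
        using p(1) by (intro borel_measurable_continuous_onI continuous_on_polymonial_function)
          (simp add: real_polynomial_function_eq)
      have bp: "norm (p \<zeta>) \<le> K + e" if "norm \<zeta> = 1" for \<zeta>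
        using p(2)[of \<zeta>] K[OF that] that by (simp add: abs_le_iff abs_less_iff)
      have *: "\<bar>(\<integral>\<zeta>. f \<zeta> \<partial>C) - (\<integral>\<zeta>. p \<zeta> \<partial>C)\<bar> \<le> e * measure C (space C)"
        if C: "finite_measure C" "sets C = sets circle_measure" for C
      proof -
        interpret C: finite_measure C by fact
        have sC: "space C = sphere 0 1" using sets_eq_imp_space_eq[OF C(2)] by simp
        have 1: "integrable C f" by (rule finite_circle_measure_integrable[OF C fm K])
        have 2: "integrable C p" by (rule finite_circle_measure_integrable[OF C pm bp])
        have "\<bar>(\<integral>\<zeta>. f \<zeta> \<partial>C) - (\<integral>\<zeta>. p \<zeta> \<partial>C)\<bar> = \<bar>\<integral>\<zeta>. f \<zeta> - p \<zeta> \<partial>C\<bar>" using 1 2 by simp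
        also have "\<dots> \<le> (\<integral>\<zeta>. \<bar>f \<zeta> - p \<zeta>\<bar> \<partial>C)" by (rule integral_abs_bound)
        also have "\<dots> \<le> (\<integral>\<zeta>. e \<partial>C)"
          using 1 2 p(2) sC by (intro integral_mono) (auto intro: less_imp_le)
        finally show ?thesis by (simp add: mult.commute)
      qed
      show ?thesis using *[OF A] *[OF B] rpoly_eq[OF p(1)] by (simp add: T_def distrib_left abs_le_iff)
    qed
    then have *: "\<bar>(\<integral>\<zeta>. f \<zeta> \<partial>A) - (\<integral>\<zeta>. f \<zeta> \<partial>B)\<bar> \<le> e * (T + 1)" if "e > 0" for e
      using that by (smt (verit) mult_left_mono)
    have T: "T + 1 > 0" by (simp add: T_def add_nonneg_pos)
    have "\<bar>(\<integral>\<zeta>. f \<zeta> \<partial>A) - (\<integral>\<zeta>. f \<zeta> \<partial>B)\<bar> \<le> 0 + e" if "e > 0" for e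
      using *[of "e / (T + 1)"] T that by simp
    then have "\<bar>(\<integral>\<zeta>. f \<zeta> \<partial>A) - (\<integral>\<zeta>. f \<zeta> \<partial>B)\<bar> \<le> 0" by (rule field_le_epsilon)
    then show ?thesis by simp
  qed
  have closed_eq: "measure A (C \<inter> sphere 0 1) = measure B (C \<inter> sphere 0 1)" if C: "closed C" "C \<noteq> {}" for C
  proof -
    define f where "f k z = max 0 (1 - real k * infdist z C)" for k z
    have fc: "continuous_on UNIV (f k)" for k unfolding f_def by (intro continuous_intros)
    have f01: "norm (f k z) \<le> 1" for k z using infdist_nonneg[of z C] by (auto simp: f_def)
    have lim: "(\<lambda>k. f k z) \<longlonglongrightarrow> indicator C z" for z
    proof (cases "z \<in> C")
      case True then show ?thesis by (simp add: f_def)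
    next
      case False
      then have d: "infdist z C > 0" using in_closed_iff_infdist_zero[OF C, of z] infdist_nonneg[of z C] by linarith
      obtain k0 where k0: "1 < real k0 * infdist z C" using reals_Archimedean3[OF d] by blast
      have "\<forall>\<^sub>F k in sequentially. f k z = indicator C z"
        using eventually_ge_at_top[of k0]
      proof eventually_elim
        case (elim k)
        then have "real k0 * infdist z C \<le> real k * infdist z C" using d by (intro mult_right_mono) auto
        then show ?case using k0 False by (simp add: f_def)
      qed
      then show ?thesis by (rule tendsto_eventually)
    qed
    have *: "(\<lambda>k. \<integral>z. f k z \<partial>D) \<longlonglongrightarrow> measure D (C \<inter> sphere 0 1)"
      if D: "finite_measure D" "sets D = sets circle_measure" for D
    proof -
      interpret D: finite_measure D by fact
      have sD: "space D = sphere 0 1" using sets_eq_imp_space_eq[OF D(2)] by simp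
      have CD: "C \<inter> sphere 0 1 \<in> sets D"
        unfolding D(2) sets_circle_measure sets_restrict_space using C(1) by (auto simp: image_iff)
      have ind: "indicator (C \<inter> sphere 0 1) \<in> borel_measurable D" using CD by simp
      have "(\<lambda>k. \<integral>z. f k z \<partial>D) \<longlonglongrightarrow> (\<integral>z. indicator (C \<inter> sphere 0 1) z \<partial>D)"
      proof (rule integral_dominated_convergence[where w="\<lambda>_. 1"])
        show "f k \<in> borel_measurable D" for k
          using finite_circle_measure_integrable[OF D borel_measurable_continuous_onI[OF fc] f01] by blast
        show "AE x in D. (\<lambda>k. f k x) \<longlonglongrightarrow> indicator (C \<inter> sphere 0 1) x"
          by (rule AE_I2) (use lim in \<open>simp add: sD indicator_inter_arith\<close>)
      qed (use f01 ind in auto)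
      then show ?thesis using CD by simp
    qed
    show ?thesis using LIMSEQ_unique[OF *[OF A]] *[OF B] cont_eq[OF fc] by simp
  qed
  have ida: "(\<lambda>x. x) \<in> measurable D borel" if "sets D = sets circle_measure" for D
    using borel_imp_circle_measurable[of "\<lambda>x. x"] by (simp cong: measurable_cong_sets[OF that refl])
  have "distr A borel (\<lambda>x. x) = distr B borel (\<lambda>x. x)"
  proof (rule measure_eqI_generator_eq[where E="Collect closed" and \<Omega>=UNIV and A="\<lambda>_. UNIV"])
    show "Int_stable (Collect closed :: complex set set)" by (auto simp: Int_stable_def)
    show "emeasure (distr A borel (\<lambda>x. x)) X = emeasure (distr B borel (\<lambda>x. x)) X" if "X \<in> Collect closed" for X
    proof (cases "X = {}")
      case False
      then have "emeasure A (X \<inter> sphere 0 1) = emeasure B (X \<inter> sphere 0 1)"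
        using closed_eq[of X] that by (simp add: A.emeasure_eq_measure B.emeasure_eq_measure)
      then show ?thesis using that
        by (simp add: emeasure_distr[OF ida[OF A(2)]] emeasure_distr[OF ida[OF B(2)]] sA sB vimage_def)
    qed simp
    show "sets (distr A borel (\<lambda>x. x)) = sigma_sets UNIV (Collect closed)"
      by (simp add: borel_eq_closed)
    show "sets (distr B borel (\<lambda>x. x)) = sigma_sets UNIV (Collect closed)"
      by (simp add: borel_eq_closed)
    show "emeasure (distr A borel (\<lambda>x. x)) UNIV \<noteq> \<infinity>" for i :: nat
      by (simp add: emeasure_distr[OF ida[OF A(2)]])
  qed auto
  then have eq: "emeasure (distr A borel (\<lambda>x. x)) X = emeasure (distr B borel (\<lambda>x. x)) X" for X by simp
  show ?thesis
  proof (rule measure_eqI)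
    show "sets A = sets B" using A B by simp
    fix X assume "X \<in> sets A"
    then obtain Y where Y: "Y \<in> sets borel" "X = sphere 0 1 \<inter> Y"
      unfolding A(2) sets_circle_measure sets_restrict_space by auto
    then show "emeasure A X = emeasure B X"
      using eq[of Y] by (simp add: emeasure_distr[OF ida[OF A(2)]] emeasure_distr[OF ida[OF B(2)]] sA sB vimage_def Int_commute)
  qed
qed

text \<open>The positive and the negative part of \<open>f\<close> are the densities of two measures with the same moments.\<close>

lemma AE_zero_of_moments_real:
  fixes f :: "complex \<Rightarrow> real"
  assumes f: "integrable circle_measure f"
    and moments: "\<And>n. (\<integral>\<zeta>. of_real (f \<zeta>) * \<zeta> ^ n \<partial>circle_measure) = 0"
  shows "AE \<zeta> in circle_measure. f \<zeta> = 0"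
proof -
  note [measurable] = borel_measurable_integrable[OF f]
  define A where "A = density circle_measure (\<lambda>\<zeta>. ennreal (max (f \<zeta>) 0))"
  define B where "B = density circle_measure (\<lambda>\<zeta>. ennreal (max (- f \<zeta>) 0))"
  have fin: "finite_measure (density circle_measure (\<lambda>\<zeta>. ennreal (g \<zeta>)))"
    if g: "integrable circle_measure g" "\<And>\<zeta>. g \<zeta> \<ge> 0" for g
  proof
    have "(\<integral>\<^sup>+\<zeta>. ennreal (g \<zeta>) \<partial>circle_measure) = ennreal (\<integral>\<zeta>. g \<zeta> \<partial>circle_measure)"
      using g by (intro nn_integral_eq_integral) auto
    moreover have "emeasure (density circle_measure (\<lambda>\<zeta>. ennreal (g \<zeta>))) (sphere 0 1)
        = (\<integral>\<^sup>+\<zeta>. ennreal (g \<zeta>) \<partial>circle_measure)"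
    proof -
      have "emeasure (density circle_measure (\<lambda>\<zeta>. ennreal (g \<zeta>))) (space circle_measure)
          = (\<integral>\<^sup>+\<zeta>. ennreal (g \<zeta>) * indicator (space circle_measure) \<zeta> \<partial>circle_measure)"
        using g(1) by (intro emeasure_density sets.top) auto
      also have "\<dots> = (\<integral>\<^sup>+\<zeta>. ennreal (g \<zeta>) \<partial>circle_measure)"
        by (intro nn_integral_cong) simp
      finally show ?thesis by simp
    qed
    ultimately show "emeasure (density circle_measure (\<lambda>\<zeta>. ennreal (g \<zeta>)))
        (space (density circle_measure (\<lambda>\<zeta>. ennreal (g \<zeta>)))) \<noteq> \<infinity>"
      by simp
  qed
  have ip: "integrable circle_measure (\<lambda>\<zeta>. max (f \<zeta>) 0)" "integrable circle_measure (\<lambda>\<zeta>. max (- f \<zeta>) 0)"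
    using f by auto
  have pw: "integrable circle_measure (\<lambda>\<zeta>. g \<zeta> *\<^sub>R \<zeta> ^ n)" if g: "integrable circle_measure g" for g and n
    by (rule Bochner_Integration.integrable_bound[OF g])
       (use borel_measurable_integrable[OF g] in \<open>auto intro!: AE_circleI simp: norm_power\<close>)
  have "A = B"
  proof (rule circle_measures_eqI)
    show "finite_measure A" "finite_measure B" unfolding A_def B_def by (intro fin ip; simp)+
    show "(\<integral>\<zeta>. \<zeta> ^ n \<partial>A) = (\<integral>\<zeta>. \<zeta> ^ n \<partial>B)" for n
    proof -
      have m: "(\<lambda>\<zeta>::complex. \<zeta> ^ n) \<in> borel_measurable circle_measure" by measurable
      have "(\<integral>\<zeta>. \<zeta> ^ n \<partial>A) - (\<integral>\<zeta>. \<zeta> ^ n \<partial>B)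
         = (\<integral>\<zeta>. max (f \<zeta>) 0 *\<^sub>R \<zeta> ^ n \<partial>circle_measure) - (\<integral>\<zeta>. max (- f \<zeta>) 0 *\<^sub>R \<zeta> ^ n \<partial>circle_measure)"
        unfolding A_def B_def using integral_density[OF m, of "\<lambda>\<zeta>. max (f \<zeta>) 0"]
          integral_density[OF m, of "\<lambda>\<zeta>. max (- f \<zeta>) 0"] by (auto simp del: ennreal_max_0 ennreal_max_0')
      also have "\<dots> = (\<integral>\<zeta>. max (f \<zeta>) 0 *\<^sub>R \<zeta> ^ n - max (- f \<zeta>) 0 *\<^sub>R \<zeta> ^ n \<partial>circle_measure)"
        by (rule Bochner_Integration.integral_diff[symmetric]) (intro pw ip)+
      also have "\<dots> = (\<integral>\<zeta>. of_real (f \<zeta>) * \<zeta> ^ n \<partial>circle_measure)"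
        by (intro Bochner_Integration.integral_cong) (auto simp: max_def scaleR_conv_of_real)
      finally show ?thesis using moments by simp
    qed
  qed (simp_all add: A_def B_def)
  have "AE \<zeta> in circle_measure. ennreal (max (f \<zeta>) 0) = ennreal (max (- f \<zeta>) 0)"
  proof (rule circle.density_unique_finite_measure)
    fix X assume X: "X \<in> sets circle_measure"
    show "(\<integral>\<^sup>+\<zeta>. ennreal (max (f \<zeta>) 0) * indicator X \<zeta> \<partial>circle_measure)
        = (\<integral>\<^sup>+\<zeta>. ennreal (max (- f \<zeta>) 0) * indicator X \<zeta> \<partial>circle_measure)"
      using arg_cong[OF \<open>A = B\<close>, of "\<lambda>C. emeasure C X"] X
      unfolding A_def B_def by (simp add: emeasure_density)
  qed auto
  then show ?thesis by eventually_elim (auto simp: max_def split: if_splits)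
qed

lemma integrable_mult_bounded:
  fixes f g :: "'a \<Rightarrow> complex"
  assumes "integrable M f" "g \<in> borel_measurable M" "AE x in M. norm (g x) \<le> B"
  shows "integrable M (\<lambda>x. f x * g x)"
proof (rule Bochner_Integration.integrable_bound)
  show "integrable M (\<lambda>x. B * norm (f x))" using assms(1) by simp
  show "AE x in M. norm (f x * g x) \<le> norm (B * norm (f x))"
    using assms(3)
  proof eventually_elim
    case (elim x)
    then have "norm (f x) * norm (g x) \<le> norm (f x) * B" by (intro mult_left_mono) auto
    then show ?case by (simp add: norm_mult mult.commute abs_le_iff)
  qed
qed (use assms in auto)

text \<open>The moments of the real and the imaginary part are combinations of those of \<open>f\<close> of opposite index.\<close>

lemma AE_zero_of_moments:
  assumes f: "integrable circle_measure f"
    and moments: "\<And>n. (\<integral>\<zeta>. f \<zeta> * \<zeta> ^ n \<partial>circle_measure) = 0" "\<And>n. (\<integral>\<zeta>. f \<zeta> * cnj \<zeta> ^ n \<partial>circle_measure) = 0"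
  shows "AE \<zeta> in circle_measure. f \<zeta> = 0"
proof -
  note [measurable] = borel_measurable_integrable[OF f]
  have i1: "integrable circle_measure (\<lambda>\<zeta>. f \<zeta> * \<zeta> ^ n)" for n
    by (rule integrable_mult_bounded[OF f, where B=1]) (auto intro!: AE_circleI simp: norm_power)
  have "integrable circle_measure (\<lambda>\<zeta>. f \<zeta> * cnj \<zeta> ^ n)" for n
    by (rule integrable_mult_bounded[OF f, where B=1]) (auto intro!: AE_circleI simp: norm_power)
  then have i2: "integrable circle_measure (\<lambda>\<zeta>. cnj (f \<zeta> * cnj \<zeta> ^ n))" for n
    by (simp only: integrable_cnj)
  have m2: "(\<integral>\<zeta>. cnj (f \<zeta> * cnj \<zeta> ^ n) \<partial>circle_measure) = 0" for n
    using moments(2)[of n] by (simp del: complex_cnj_mult complex_cnj_power add: integral_cnj)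
  have re: "AE \<zeta> in circle_measure. Re (f \<zeta>) = 0"
  proof (rule AE_zero_of_moments_real)
    show "(\<integral>\<zeta>. of_real (Re (f \<zeta>)) * \<zeta> ^ n \<partial>circle_measure) = 0" for n
    proof -
      have "(\<integral>\<zeta>. of_real (Re (f \<zeta>)) * \<zeta> ^ n \<partial>circle_measure)
          = (\<integral>\<zeta>. (1/2) * (f \<zeta> * \<zeta> ^ n + cnj (f \<zeta> * cnj \<zeta> ^ n)) \<partial>circle_measure)"
        by (intro Bochner_Integration.integral_cong) (auto simp: complex_eq_iff field_simps)
      then show ?thesis using moments(1)[of n] m2[of n] i1[of n] i2[of n] by (simp del: complex_cnj_mult)
    qed
  qed (use f in auto)
  have im: "AE \<zeta> in circle_measure. Im (f \<zeta>) = 0"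
  proof (rule AE_zero_of_moments_real)
    show "(\<integral>\<zeta>. of_real (Im (f \<zeta>)) * \<zeta> ^ n \<partial>circle_measure) = 0" for n
    proof -
      have "(\<integral>\<zeta>. of_real (Im (f \<zeta>)) * \<zeta> ^ n \<partial>circle_measure)
          = (\<integral>\<zeta>. (-\<i>/2) * (f \<zeta> * \<zeta> ^ n - cnj (f \<zeta> * cnj \<zeta> ^ n)) \<partial>circle_measure)"
        by (intro Bochner_Integration.integral_cong) (auto simp: complex_eq_iff field_simps)
      then show ?thesis using moments(1)[of n] m2[of n] i1[of n] i2[of n] by (simp del: complex_cnj_mult)
    qed
  qed (use f in auto)
  from re im show ?thesis by eventually_elim (simp add: complex_eq_iff)
qed

section \<open>Hardy spaces on the circle\<close>

subsection \<open>Integrals of products\<close>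

lemma l2_mult_integrable:
  fixes f g :: "'a \<Rightarrow> complex"
  assumes "square_integrable M f" "square_integrable M g"
  shows "integrable M (\<lambda>x. f x * g x)"
proof (rule Bochner_Integration.integrable_bound)
  have "square_integrable M (\<lambda>x. norm (f x))" "square_integrable M (\<lambda>x. norm (g x))"
    using assms by (auto simp: square_integrable_def)
  from square_integrable_inner[OF this] show "integrable M (\<lambda>x. norm (f x) * norm (g x))" by simp
qed (use assms in \<open>auto simp: norm_mult\<close>)

lemma norm_integral_mult_le:
  fixes f g :: "'a \<Rightarrow> complex"
  assumes "square_integrable M f" "square_integrable M g"
  shows "norm (\<integral>x. f x * g x \<partial>M) \<le> l2norm M f * l2norm M g"
proof -
  have s: "square_integrable M (\<lambda>x. norm (f x))" "square_integrable M (\<lambda>x. norm (g x))"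
    using assms by (auto simp: square_integrable_def)
  have "norm (\<integral>x. f x * g x \<partial>M) \<le> (\<integral>x. norm (f x * g x) \<partial>M)" by (rule integral_norm_bound)
  also have "\<dots> = l2inner M (\<lambda>x. norm (f x)) (\<lambda>x. norm (g x))" by (simp add: l2inner_def norm_mult)
  also have "\<dots> \<le> l2norm M (\<lambda>x. norm (f x)) * l2norm M (\<lambda>x. norm (g x))"
    using l2inner_Cauchy_Schwarz[OF s] by linarith
  finally show ?thesis by (simp add: l2norm_def)
qed

lemma tendsto_integral_mult:
  fixes f :: "'a \<Rightarrow> complex"
  assumes "\<And>n. square_integrable M (g n)" "square_integrable M f" "square_integrable M h"
    "(\<lambda>n. l2norm M (\<lambda>x. g n x - f x)) \<longlonglongrightarrow> 0"
  shows "(\<lambda>n. \<integral>x. g n x * h x \<partial>M) \<longlonglongrightarrow> (\<integral>x. f x * h x \<partial>M)"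
proof (rule LIM_zero_cancel, rule Lim_null_comparison)
  have "norm ((\<integral>x. g n x * h x \<partial>M) - (\<integral>x. f x * h x \<partial>M)) \<le> l2norm M (\<lambda>x. g n x - f x) * l2norm M h" for n
  proof -
    have d: "square_integrable M (\<lambda>x. g n x - f x)" using assms by auto
    have "(\<integral>x. g n x * h x \<partial>M) - (\<integral>x. f x * h x \<partial>M) = (\<integral>x. (g n x - f x) * h x \<partial>M)"
      using assms by (simp add: left_diff_distrib l2_mult_integrable)
    then show ?thesis using norm_integral_mult_le[OF d assms(3)] by simp
  qed
  then show "\<forall>\<^sub>F n in sequentially. norm ((\<integral>x. g n x * h x \<partial>M) - (\<integral>x. f x * h x \<partial>M))
      \<le> l2norm M (\<lambda>x. g n x - f x) * l2norm M h" by simp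
  show "(\<lambda>n. l2norm M (\<lambda>x. g n x - f x) * l2norm M h) \<longlonglongrightarrow> 0"
    using tendsto_mult_left_zero[OF assms(4)] by simp
qed

lemma square_integrable_mult_bounded:
  fixes f g :: "'a \<Rightarrow> complex"
  assumes "square_integrable M f" "g \<in> borel_measurable M" "AE x in M. norm (g x) \<le> B"
  shows "square_integrable M (\<lambda>x. f x * g x)"
proof (rule square_integrableI)
  show "integrable M (\<lambda>x. B\<^sup>2 * (norm (f x))\<^sup>2)" using assms(1) by (simp add: square_integrable_def)
  show "AE x in M. (norm (f x * g x))\<^sup>2 \<le> B\<^sup>2 * (norm (f x))\<^sup>2"
    using assms(3)
  proof eventually_elim
    case (elim x)
    then have "(norm (g x))\<^sup>2 \<le> B\<^sup>2" by (simp add: power_mono)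
    then have "(norm (f x))\<^sup>2 * (norm (g x))\<^sup>2 \<le> (norm (f x))\<^sup>2 * B\<^sup>2" by (intro mult_left_mono) auto
    then show ?case by (simp add: norm_mult power_mult_distrib mult.commute)
  qed
qed (use assms in auto)

lemma square_integrable_cmult:
  fixes f :: "'a \<Rightarrow> complex"
  shows "square_integrable M f \<Longrightarrow> square_integrable M (\<lambda>x. c * f x)"
  by (auto simp: square_integrable_def norm_mult power_mult_distrib)

lemma square_integrable_cnj:
  fixes f :: "'a \<Rightarrow> complex"
  shows "square_integrable M f \<Longrightarrow> square_integrable M (\<lambda>x. cnj (f x))"
  by (auto simp: square_integrable_def)

subsection \<open>The spaces \<open>H\<^sup>1\<close>, \<open>H\<^sup>2\<close> and \<open>H\<^sup>\<infinity>\<close>\<close>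

lemma Lp_1_iff: "f \<in> Lp 1 \<longleftrightarrow> integrable circle_measure f"
  by (auto simp: Lp_def intro: integrable_norm_cancel)

lemma Lp_2_iff: "f \<in> Lp 2 \<longleftrightarrow> square_integrable circle_measure f"
  by (auto simp: Lp_def square_integrable_def)

lemma Linf_norm_le_iff:
  assumes "f \<in> borel_measurable circle_measure"
  shows "Linf_norm f \<le> ereal B \<longleftrightarrow> (AE \<zeta> in circle_measure. norm (f \<zeta>) \<le> B)"
proof
  assume "Linf_norm f \<le> ereal B"
  moreover have "AE \<zeta> in circle_measure. ereal (norm (f \<zeta>)) \<le> Linf_norm f"
    unfolding Linf_norm_def by (rule esssup_AE)
  ultimately show "AE \<zeta> in circle_measure. norm (f \<zeta>) \<le> B"
    by (auto elim!: eventually_mono dest: order_trans)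
next
  assume "AE \<zeta> in circle_measure. norm (f \<zeta>) \<le> B"
  then show "Linf_norm f \<le> ereal B"
    unfolding Linf_norm_def using assms by (intro esssup_I) auto
qed

lemma Lp_infinity_iff:
  "f \<in> Lp \<infinity> \<longleftrightarrow> f \<in> borel_measurable circle_measure \<and> (\<exists>B. AE \<zeta> in circle_measure. norm (f \<zeta>) \<le> B)"
proof -
  have A: "Linf_norm f < \<infinity> \<longleftrightarrow> (\<exists>B. Linf_norm f \<le> ereal B)"
    by (cases "Linf_norm f") auto
  have "f \<in> Lp \<infinity> \<longleftrightarrow> f \<in> borel_measurable circle_measure \<and> (\<exists>B. Linf_norm f \<le> ereal B)"
    unfolding A[symmetric] by (simp add: Lp_def)
  then show ?thesis using Linf_norm_le_iff[of f] by blast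
qed

lemma Hp_1_iff: "f \<in> Hp 1 \<longleftrightarrow> integrable circle_measure f \<and> (\<forall>n\<ge>1. (\<integral>\<zeta>. f \<zeta> * \<zeta> ^ n \<partial>circle_measure) = 0)"
  by (auto simp: Hp_def Lp_1_iff)

lemma Hp_2_iff: "f \<in> Hp 2 \<longleftrightarrow> square_integrable circle_measure f \<and> (\<forall>n\<ge>1. (\<integral>\<zeta>. f \<zeta> * \<zeta> ^ n \<partial>circle_measure) = 0)"
  by (auto simp: Hp_def Lp_2_iff)

lemma Hp_infinity_iff: "f \<in> Hp \<infinity> \<longleftrightarrow> f \<in> borel_measurable circle_measure \<and>
    (\<exists>B. AE \<zeta> in circle_measure. norm (f \<zeta>) \<le> B) \<and> (\<forall>n\<ge>1. (\<integral>\<zeta>. f \<zeta> * \<zeta> ^ n \<partial>circle_measure) = 0)"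
  unfolding Hp_def mem_Collect_eq Lp_infinity_iff by blast

lemma Hp_infinity_imp_2: "f \<in> Hp \<infinity> \<Longrightarrow> f \<in> Hp 2"
  unfolding Hp_infinity_iff Hp_2_iff using circle.bounded_square_integrable(1) by blast

lemma Hp_2_imp_1: "f \<in> Hp 2 \<Longrightarrow> f \<in> Hp 1"
  using circle.l2_imp_integrable by (auto simp: Hp_1_iff Hp_2_iff)

lemma Hp_2_square_integrable: "f \<in> Hp 2 \<Longrightarrow> square_integrable circle_measure f"
  by (simp add: Hp_2_iff)

lemma circle_power_bounded: "AE \<zeta> in circle_measure. norm (\<zeta> ^ n) \<le> 1" "AE \<zeta> in circle_measure. norm (cnj \<zeta> ^ n) \<le> 1"
  by (rule AE_circleI, simp add: norm_power)+

lemma square_integrable_power: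
  "square_integrable circle_measure (\<lambda>\<zeta>. \<zeta> ^ n)" "square_integrable circle_measure (\<lambda>\<zeta>. cnj \<zeta> ^ n)"
  by (rule circle.bounded_square_integrable(1)[OF _ circle_power_bounded(1)], simp)
     (rule circle.bounded_square_integrable(1)[OF _ circle_power_bounded(2)], simp)

lemma circle_integral_power_cnj_power:
  "(\<integral>\<zeta>. \<zeta> ^ i * cnj \<zeta> ^ j \<partial>circle_measure) = (if i = j then 1 else 0)"
proof -
  have "(\<integral>\<zeta>. \<zeta> ^ i * cnj \<zeta> ^ j \<partial>circle_measure)
      = (\<integral>\<zeta>. (if j \<le> i then \<zeta> ^ (i - j) else cnj \<zeta> ^ (j - i)) \<partial>circle_measure)"
    by (intro Bochner_Integration.integral_cong refl cnj_power_mult_power_unit) simp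
  also have "\<dots> = (if i = j then 1 else 0)"
  proof -
    have "(\<integral>\<zeta>. cnj \<zeta> ^ n \<partial>circle_measure) = 0" if "n \<ge> 1" for n
      using circle_integral_power[OF that] by (simp flip: complex_cnj_power)
    then have "(\<integral>\<zeta>. cnj \<zeta> ^ (j - i) \<partial>circle_measure) = 0" if "\<not> j \<le> i" using that by simp
    then show ?thesis using circle_integral_power[of "i - j"] circle.prob_space
      by (cases "j \<le> i"; cases "i = j") auto
  qed
  finally show ?thesis .
qed

lemma sums_integral_power_series:
  fixes f a e :: "_ \<Rightarrow> complex"
  assumes f: "integrable circle_measure f" and a: "summable (\<lambda>n. norm (a n))"
    and e: "e \<in> borel_measurable circle_measure" "\<And>\<zeta>. norm \<zeta> = 1 \<Longrightarrow> norm (e \<zeta>) \<le> 1"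
  shows "(\<lambda>n. a n * (\<integral>\<zeta>. f \<zeta> * e \<zeta> ^ n \<partial>circle_measure)) sums (\<integral>\<zeta>. f \<zeta> * (\<Sum>n. a n * e \<zeta> ^ n) \<partial>circle_measure)"
proof -
  have en: "norm (e \<zeta> ^ n) \<le> 1" if "norm \<zeta> = 1" for \<zeta> n
    using power_le_one[OF norm_ge_zero e(2)[OF that]] by (simp add: norm_power)
  have bd: "norm (a n * (f \<zeta> * e \<zeta> ^ n)) \<le> norm (a n) * norm (f \<zeta>)" if "norm \<zeta> = 1" for \<zeta> n
  proof -
    have "norm (f \<zeta>) * norm (e \<zeta> ^ n) \<le> norm (f \<zeta>) * 1" using en[OF that] by (intro mult_left_mono) auto
    then show ?thesis by (simp add: norm_mult mult_left_mono)
  qed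
  have i: "integrable circle_measure (\<lambda>\<zeta>. a n * (f \<zeta> * e \<zeta> ^ n))" for n
    by (intro integrable_mult_right integrable_mult_bounded[OF f, where B=1]) (use e en in \<open>auto intro!: AE_circleI\<close>)
  have "(\<lambda>n. \<integral>\<zeta>. a n * (f \<zeta> * e \<zeta> ^ n) \<partial>circle_measure) sums (\<integral>\<zeta>. (\<Sum>n. a n * (f \<zeta> * e \<zeta> ^ n)) \<partial>circle_measure)"
  proof (rule sums_integral[OF i])
    show "AE \<zeta> in circle_measure. summable (\<lambda>n. norm (a n * (f \<zeta> * e \<zeta> ^ n)))"
    proof (rule AE_circleI)
      fix \<zeta> :: complex assume z: "norm \<zeta> = 1"
      show "summable (\<lambda>n. norm (a n * (f \<zeta> * e \<zeta> ^ n)))"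
        by (rule summable_comparison_test'[OF summable_mult2[OF a, of "norm (f \<zeta>)"]]) (use bd[OF z] in simp)
    qed
    show "summable (\<lambda>n. \<integral>\<zeta>. norm (a n * (f \<zeta> * e \<zeta> ^ n)) \<partial>circle_measure)"
    proof (rule summable_comparison_test'[OF summable_mult2[OF a, of "\<integral>\<zeta>. norm (f \<zeta>) \<partial>circle_measure"]])
      fix n
      have "(\<integral>\<zeta>. norm (a n * (f \<zeta> * e \<zeta> ^ n)) \<partial>circle_measure) \<le> (\<integral>\<zeta>. norm (a n) * norm (f \<zeta>) \<partial>circle_measure)"
        by (intro integral_mono integrable_norm i integrable_mult_right f bd) simp
      then show "norm (\<integral>\<zeta>. norm (a n * (f \<zeta> * e \<zeta> ^ n)) \<partial>circle_measure) \<le> norm (a n) * (\<integral>\<zeta>. norm (f \<zeta>) \<partial>circle_measure)"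
        by simp
    qed
  qed
  also have "(\<integral>\<zeta>. (\<Sum>n. a n * (f \<zeta> * e \<zeta> ^ n)) \<partial>circle_measure) = (\<integral>\<zeta>. f \<zeta> * (\<Sum>n. a n * e \<zeta> ^ n) \<partial>circle_measure)"
  proof (intro Bochner_Integration.integral_cong refl)
    fix \<zeta> assume "\<zeta> \<in> space circle_measure"
    then have z: "norm \<zeta> = 1" by simp
    have "summable (\<lambda>n. a n * e \<zeta> ^ n)"
      by (rule summable_comparison_test'[OF a])
         (use en[OF z] in \<open>auto simp: norm_mult intro: mult_left_le\<close>)
    from suminf_mult[OF this, of "f \<zeta>"]
    show "(\<Sum>n. a n * (f \<zeta> * e \<zeta> ^ n)) = f \<zeta> * (\<Sum>n. a n * e \<zeta> ^ n)" by (simp add: mult_ac)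
  qed
  finally show ?thesis by simp
qed

subsection \<open>Poisson and Szego kernels\<close>

definition poisson_kernel :: "complex \<Rightarrow> complex \<Rightarrow> real" where
  "poisson_kernel z \<zeta> = (1 - (norm z)\<^sup>2) / (norm (\<zeta> - z))\<^sup>2"

lemma disc_extension_poisson: "disc_extension f z = (\<integral>\<zeta>. f \<zeta> * of_real (poisson_kernel z \<zeta>) \<partial>circle_measure)"
  by (simp add: disc_extension_def poisson_kernel_def)

lemma poisson_kernel_measurable[measurable]: "poisson_kernel z \<in> borel_measurable borel"
  unfolding poisson_kernel_def[abs_def] by measurable

lemma szego_kernel_measurable[measurable]: "szego_kernel z \<in> borel_measurable borel"
  unfolding szego_kernel_def[abs_def] by measurable

lemma norm_diff_circle_disc: "norm \<zeta> = 1 \<Longrightarrow> norm z < 1 \<Longrightarrow> norm (\<zeta> - z) \<ge> 1 - norm z"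
  using norm_triangle_ineq2[of \<zeta> z] by simp

lemma poisson_kernel_pos:
  assumes "norm \<zeta> = 1" "norm z < 1" shows "poisson_kernel z \<zeta> > 0"
proof -
  have "norm (\<zeta> - z) > 0" using norm_diff_circle_disc[OF assms] assms by linarith
  moreover have "(norm z)\<^sup>2 < 1" using assms by (simp add: power_less_one_iff abs_square_less_1)
  ultimately show ?thesis by (simp add: poisson_kernel_def)
qed

lemma poisson_kernel_le:
  assumes "norm \<zeta> = 1" "norm z < 1"
  shows "poisson_kernel z \<zeta> \<le> 1 / (1 - norm z)\<^sup>2"
proof -
  have "(1 - norm z)\<^sup>2 \<le> (norm (\<zeta> - z))\<^sup>2"
    using norm_diff_circle_disc[OF assms] assms by (intro power_mono) auto
  moreover have "(1 - norm z)\<^sup>2 > 0" using assms by simp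
  ultimately show ?thesis unfolding poisson_kernel_def by (intro frac_le) auto
qed

lemma szego_kernel_bounded:
  assumes "norm \<zeta> = 1" "norm z < 1"
  shows "norm (szego_kernel z \<zeta>) \<le> 1 / (1 - norm z)"
proof -
  have "norm (1 - cnj z * \<zeta>) \<ge> 1 - norm z"
    using norm_triangle_ineq2[of 1 "cnj z * \<zeta>"] assms by (simp add: norm_mult)
  then show ?thesis using assms unfolding szego_kernel_def
    by (simp add: norm_divide) (intro frac_le, auto)
qed

lemma szego_kernel_square_integrable:
  assumes "norm z < 1" shows "square_integrable circle_measure (szego_kernel z)"
  by (rule circle.bounded_square_integrable(1)[where B="1 / (1 - norm z)"])
     (use szego_kernel_bounded assms in \<open>auto intro!: AE_circleI\<close>)

lemma szego_kernel_sums: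
  assumes "norm \<zeta> = 1" "norm z < 1"
  shows "szego_kernel z \<zeta> = (\<Sum>n. cnj z ^ n * \<zeta> ^ n)" "cnj (szego_kernel z \<zeta>) = (\<Sum>n. z ^ n * cnj \<zeta> ^ n)"
proof -
  have "norm (cnj z * \<zeta>) < 1" "norm (z * cnj \<zeta>) < 1" using assms by (simp_all add: norm_mult)
  from this[THEN suminf_geometric]
  show "szego_kernel z \<zeta> = (\<Sum>n. cnj z ^ n * \<zeta> ^ n)" "cnj (szego_kernel z \<zeta>) = (\<Sum>n. z ^ n * cnj \<zeta> ^ n)"
    by (simp_all add: szego_kernel_def power_mult_distrib)
qed

lemma poisson_kernel_eq_szego:
  assumes "norm \<zeta> = 1" "norm z < 1"
  shows "complex_of_real (poisson_kernel z \<zeta>) = cnj (szego_kernel z \<zeta>) + szego_kernel z \<zeta> - 1"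
proof -
  have u: "\<zeta> * cnj \<zeta> = 1" by (rule unit_mult_cnj[OF assms(1)])
  have d1: "1 - cnj z * \<zeta> \<noteq> 0" and d2: "1 - z * cnj \<zeta> \<noteq> 0"
  proof -
    have "norm (cnj z * \<zeta>) < 1" "norm (z * cnj \<zeta>) < 1" using assms by (simp_all add: norm_mult)
    then show "1 - cnj z * \<zeta> \<noteq> 0" "1 - z * cnj \<zeta> \<noteq> 0" by auto
  qed
  have "complex_of_real ((norm (\<zeta> - z))\<^sup>2) = (\<zeta> - z) * cnj (\<zeta> - z)" by (rule complex_norm_square)
  also have "\<dots> = (\<zeta> - z) * cnj (\<zeta> - z) * (\<zeta> * cnj \<zeta>)" using u by simp
  also have "\<dots> = (\<zeta> * cnj \<zeta> - z * cnj \<zeta>) * (\<zeta> * cnj \<zeta> - cnj z * \<zeta>)" by (simp add: algebra_simps)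
  also have "\<dots> = (1 - z * cnj \<zeta>) * (1 - cnj z * \<zeta>)" using u by simp
  finally have n: "complex_of_real ((norm (\<zeta> - z))\<^sup>2) = (1 - z * cnj \<zeta>) * (1 - cnj z * \<zeta>)" .
  have n2: "complex_of_real ((norm z)\<^sup>2) = z * cnj z" by (rule complex_norm_square)
  have "complex_of_real (poisson_kernel z \<zeta>) = (1 - z * cnj z) / ((1 - z * cnj \<zeta>) * (1 - cnj z * \<zeta>))"
    unfolding poisson_kernel_def of_real_divide n of_real_diff n2 by simp
  also have "1 - z * cnj z = 1 - z * cnj z * (\<zeta> * cnj \<zeta>)" using u by simp
  also have "\<dots> = (1 - cnj z * \<zeta>) + (1 - z * cnj \<zeta>) - (1 - z * cnj \<zeta>) * (1 - cnj z * \<zeta>)"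
    by (simp add: algebra_simps)
  also have "\<dots> / ((1 - z * cnj \<zeta>) * (1 - cnj z * \<zeta>)) = 1 / (1 - z * cnj \<zeta>) + 1 / (1 - cnj z * \<zeta>) - 1"
  proof -
    have "(A + B - B * A) / (B * A) = 1 / B + 1 / A - 1" if "A \<noteq> 0" "B \<noteq> 0" for A B :: complex
      using that by (simp add: add_divide_distrib diff_divide_distrib)
    from this[OF d1 d2] show ?thesis .
  qed
  finally show ?thesis by (simp add: szego_kernel_def)
qed

lemma summable_norm_powers: "norm (z::complex) < 1 \<Longrightarrow> summable (\<lambda>n. norm (z ^ n))"
  by (simp add: norm_power summable_geometric)

lemma integrable_mult_szego:
  assumes "integrable circle_measure f" "norm z < 1"
  shows "integrable circle_measure (\<lambda>\<zeta>. f \<zeta> * szego_kernel z \<zeta>)"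
    "integrable circle_measure (\<lambda>\<zeta>. f \<zeta> * cnj (szego_kernel z \<zeta>))"
  by (rule integrable_mult_bounded[OF assms(1), where B="1 / (1 - norm z)"];
      use szego_kernel_bounded assms(2) in \<open>auto intro!: AE_circleI\<close>)+

text \<open>The Poisson kernel is the sum of the conjugate Szego kernel and of positive powers of \<open>\<zeta>\<close>, whose
  integrals against \<open>f\<close> vanish.\<close>

lemma disc_extension_szego:
  assumes f: "f \<in> Hp 1" and z: "norm z < 1"
  shows "disc_extension f z = (\<integral>\<zeta>. f \<zeta> * cnj (szego_kernel z \<zeta>) \<partial>circle_measure)"
proof -
  have fi: "integrable circle_measure f" using f by (simp add: Hp_1_iff)
  have cz: "norm (cnj z) < 1" using z by simp
  have "(\<lambda>n. cnj z ^ n * (\<integral>\<zeta>. f \<zeta> * \<zeta> ^ n \<partial>circle_measure)) sums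
      (\<integral>\<zeta>. f \<zeta> * (\<Sum>n. cnj z ^ n * \<zeta> ^ n) \<partial>circle_measure)"
    by (rule sums_integral_power_series[OF fi summable_norm_powers[OF cz]]) auto
  moreover have "(\<lambda>n. cnj z ^ n * (\<integral>\<zeta>. f \<zeta> * \<zeta> ^ n \<partial>circle_measure)) sums (\<integral>\<zeta>. f \<zeta> \<partial>circle_measure)"
  proof -
    have "(\<lambda>n. cnj z ^ n * (\<integral>\<zeta>. f \<zeta> * \<zeta> ^ n \<partial>circle_measure)) = (\<lambda>n. if n = 0 then (\<integral>\<zeta>. f \<zeta> \<partial>circle_measure) else 0)"
      using f by (auto simp: Hp_1_iff)
    then show ?thesis using sums_single[of 0 "\<lambda>_. \<integral>\<zeta>. f \<zeta> \<partial>circle_measure"] by simp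
  qed
  ultimately have "(\<integral>\<zeta>. f \<zeta> * (\<Sum>n. cnj z ^ n * \<zeta> ^ n) \<partial>circle_measure) = (\<integral>\<zeta>. f \<zeta> \<partial>circle_measure)"
    by (rule sums_unique2)
  then have k: "(\<integral>\<zeta>. f \<zeta> * szego_kernel z \<zeta> \<partial>circle_measure) = (\<integral>\<zeta>. f \<zeta> \<partial>circle_measure)"
    by (subst Bochner_Integration.integral_cong[OF refl, of _ _ "\<lambda>\<zeta>. f \<zeta> * (\<Sum>n. cnj z ^ n * \<zeta> ^ n)"])
       (use szego_kernel_sums(1) z in auto)
  have "disc_extension f z = (\<integral>\<zeta>. f \<zeta> * cnj (szego_kernel z \<zeta>) + f \<zeta> * szego_kernel z \<zeta> - f \<zeta> \<partial>circle_measure)"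
    unfolding disc_extension_poisson
    by (intro Bochner_Integration.integral_cong refl)
       (simp add: poisson_kernel_eq_szego z algebra_simps)
  also have "\<dots> = (\<integral>\<zeta>. f \<zeta> * cnj (szego_kernel z \<zeta>) \<partial>circle_measure)"
    using integrable_mult_szego[OF fi z] fi k by simp
  finally show ?thesis .
qed

subsection \<open>Fourier coefficients\<close>

definition fourier :: "(complex \<Rightarrow> complex) \<Rightarrow> nat \<Rightarrow> complex" where
  "fourier f n = (\<integral>\<zeta>. f \<zeta> * cnj \<zeta> ^ n \<partial>circle_measure)"

lemma disc_extension_sums:
  assumes f: "f \<in> Hp 1" and z: "norm z < 1"
  shows "(\<lambda>n. fourier f n * z ^ n) sums disc_extension f z"
proof -
  have "(\<lambda>n. z ^ n * (\<integral>\<zeta>. f \<zeta> * cnj \<zeta> ^ n \<partial>circle_measure)) sums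
      (\<integral>\<zeta>. f \<zeta> * (\<Sum>n. z ^ n * cnj \<zeta> ^ n) \<partial>circle_measure)"
    by (rule sums_integral_power_series[OF _ summable_norm_powers[OF z]]) (use f in \<open>auto simp: Hp_1_iff\<close>)
  also have "(\<integral>\<zeta>. f \<zeta> * (\<Sum>n. z ^ n * cnj \<zeta> ^ n) \<partial>circle_measure) = disc_extension f z"
    unfolding disc_extension_szego[OF f z]
    by (intro Bochner_Integration.integral_cong refl) (use szego_kernel_sums(2) z in auto)
  finally show ?thesis by (simp add: fourier_def mult.commute)
qed

text \<open>Such series converge uniformly on the circle and may be integrated term by term. They comprise the functions
  analytic beyond the circle.\<close>

lemma power_series_Hp_infinity:
  assumes a: "summable (\<lambda>n. norm (a n))"
  shows "(\<lambda>\<zeta>. \<Sum>n. a n * \<zeta> ^ n) \<in> Hp \<infinity>"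
    "norm z < 1 \<Longrightarrow> disc_extension (\<lambda>\<zeta>. \<Sum>n. a n * \<zeta> ^ n) z = (\<Sum>n. a n * z ^ n)"
    "fourier (\<lambda>\<zeta>. \<Sum>n. a n * \<zeta> ^ n) k = a k"
proof -
  define F where "F \<zeta> = (\<Sum>n. a n * \<zeta> ^ n)" for \<zeta>
  have F[measurable]: "F \<in> borel_measurable circle_measure" unfolding F_def[abs_def] by measurable
  have sm: "summable (\<lambda>n. norm (a n * \<zeta> ^ n))" if "norm \<zeta> = 1" for \<zeta>
    using a that by (simp add: norm_mult norm_power)
  have bd: "norm (F \<zeta>) \<le> (\<Sum>n. norm (a n))" if "norm \<zeta> = 1" for \<zeta>
    using summable_norm[OF sm[OF that]] that by (simp add: F_def norm_mult norm_power)
  have s: "(\<lambda>n. a n * (\<integral>\<zeta>. f \<zeta> * \<zeta> ^ n \<partial>circle_measure)) sums (\<integral>\<zeta>. F \<zeta> * f \<zeta> \<partial>circle_measure)"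
    if "integrable circle_measure f" for f
    using sums_integral_power_series[OF that a, of "\<lambda>\<zeta>. \<zeta>"] by (simp add: F_def mult.commute)
  have "(\<integral>\<zeta>. F \<zeta> * \<zeta> ^ n \<partial>circle_measure) = 0" if "n \<ge> 1" for n
  proof -
    have "(\<integral>\<zeta>. \<zeta> ^ n * \<zeta> ^ k \<partial>circle_measure) = 0" for k
      using circle_integral_power[of "n + k"] that by (simp add: power_add)
    then have "(\<lambda>_. 0) sums (\<integral>\<zeta>. F \<zeta> * \<zeta> ^ n \<partial>circle_measure)"
      using s[OF circle.l2_imp_integrable[OF square_integrable_power(1)], of n] by simp
    from sums_unique2[OF this sums_zero] show ?thesis .
  qed
  moreover have "AE \<zeta> in circle_measure. norm (F \<zeta>) \<le> (\<Sum>n. norm (a n))"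
    by (rule AE_circleI) (rule bd)
  ultimately have "F \<in> Hp \<infinity>" unfolding Hp_infinity_iff using F by blast
  then show "(\<lambda>\<zeta>. \<Sum>n. a n * \<zeta> ^ n) \<in> Hp \<infinity>" by (simp add: F_def[abs_def])
  have fk: "fourier F k = a k" for k
  proof -
    have "(\<lambda>n. a n * (\<integral>\<zeta>. cnj \<zeta> ^ k * \<zeta> ^ n \<partial>circle_measure)) = (\<lambda>n. if n = k then a n else 0)"
      by (auto simp: circle_integral_power_cnj_power mult.commute[of "cnj _ ^ _"])
    then have "(\<lambda>n. a n * (\<integral>\<zeta>. cnj \<zeta> ^ k * \<zeta> ^ n \<partial>circle_measure)) sums a k"
      using sums_single[of k a] by simp
    from sums_unique2[OF this s[OF circle.l2_imp_integrable[OF square_integrable_power(2)]]]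
    show ?thesis by (simp add: fourier_def)
  qed
  then show "fourier (\<lambda>\<zeta>. \<Sum>n. a n * \<zeta> ^ n) k = a k" by (simp add: F_def[abs_def])
  show "disc_extension (\<lambda>\<zeta>. \<Sum>n. a n * \<zeta> ^ n) z = (\<Sum>n. a n * z ^ n)" if z: "norm z < 1"
    using disc_extension_sums[OF Hp_2_imp_1[OF Hp_infinity_imp_2[OF \<open>F \<in> Hp \<infinity>\<close>]] z] 
    unfolding fk by (simp add: F_def[abs_def] sums_iff)
qed

lemma Hp_infinity_cong:
  assumes "f \<in> Hp \<infinity>" "\<And>\<zeta>. norm \<zeta> = 1 \<Longrightarrow> f \<zeta> = g \<zeta>"
  shows "g \<in> Hp \<infinity>"
proof -
  have "g \<in> borel_measurable circle_measure \<longleftrightarrow> f \<in> borel_measurable circle_measure"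
    by (rule measurable_cong) (simp add: assms(2))
  moreover have "(\<integral>\<zeta>. g \<zeta> * \<zeta> ^ n \<partial>circle_measure) = (\<integral>\<zeta>. f \<zeta> * \<zeta> ^ n \<partial>circle_measure)" for n
    by (intro Bochner_Integration.integral_cong refl) (simp add: assms(2))
  moreover have "(AE \<zeta> in circle_measure. norm (g \<zeta>) \<le> B) \<longleftrightarrow> (AE \<zeta> in circle_measure. norm (f \<zeta>) \<le> B)" for B
    by (rule AE_cong) (simp add: assms(2))
  ultimately show ?thesis using assms(1) unfolding Hp_infinity_iff by presburger
qed

lemma disc_extension_cong: "(\<And>\<zeta>. norm \<zeta> = 1 \<Longrightarrow> f \<zeta> = g \<zeta>) \<Longrightarrow> disc_extension f z = disc_extension g z"
  unfolding disc_extension_poisson by (intro Bochner_Integration.integral_cong) auto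

lemma holomorphic_Hp_infinity:
  assumes F: "F holomorphic_on ball 0 R" and R: "R > 1"
  shows "F \<in> Hp \<infinity>" "norm z < 1 \<Longrightarrow> disc_extension F z = F z"
proof -
  define a where "a n = (deriv ^^ n) F 0 / fact n" for n
  have s: "(\<lambda>n. a n * w ^ n) sums F w" if "norm w < R" for w
    using holomorphic_power_series[OF F, of w] that by (simp add: a_def)
  have "summable (\<lambda>n. norm (a n * 1 ^ n))"
  proof (rule powser_insidea)
    show "summable (\<lambda>n. a n * of_real ((1 + R) / 2) ^ n)"
    proof (rule sums_summable, rule s)
      show "norm (complex_of_real ((1 + R) / 2)) < R" using R by (simp only: norm_of_real) simp
    qed
    show "norm (1::complex) < norm (complex_of_real ((1 + R) / 2))" using R by (simp only: norm_of_real) simp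
  qed
  then have a: "summable (\<lambda>n. norm (a n))" by simp
  have eq: "(\<Sum>n. a n * w ^ n) = F w" if "norm w < R" for w using s[OF that] by (simp add: sums_iff)
  show "F \<in> Hp \<infinity>" by (rule Hp_infinity_cong[OF power_series_Hp_infinity(1)[OF a]]) (use eq R in simp)
  show "disc_extension F z = F z" if "norm z < 1"
    using power_series_Hp_infinity(2)[OF a that] eq[of z] R that
      disc_extension_cong[of F "\<lambda>\<zeta>. \<Sum>n. a n * \<zeta> ^ n" z] by (simp add: eq)
qed

subsection \<open>The Riesz--Fischer theorem for \<open>H\<^sup>2\<close>\<close>

lemma square_integrable_trig: "square_integrable circle_measure (\<lambda>\<zeta>. \<Sum>n\<in>I. a n * \<zeta> ^ n)"
  by (intro square_integrable_sum square_integrable_cmult square_integrable_power)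

lemma l2norm_trig:
  assumes "finite I"
  shows "(l2norm circle_measure (\<lambda>\<zeta>. \<Sum>n\<in>I. a n * \<zeta> ^ n))\<^sup>2 = (\<Sum>n\<in>I. (norm (a n))\<^sup>2)"
proof -
  have i: "integrable circle_measure (\<lambda>\<zeta>. a m * cnj (a n) * (\<zeta> ^ m * cnj \<zeta> ^ n))" for m n
    by (intro integrable_mult_right l2_mult_integrable square_integrable_power)
  have "complex_of_real ((l2norm circle_measure (\<lambda>\<zeta>. \<Sum>n\<in>I. a n * \<zeta> ^ n))\<^sup>2)
      = (\<integral>\<zeta>. complex_of_real ((norm (\<Sum>n\<in>I. a n * \<zeta> ^ n))\<^sup>2) \<partial>circle_measure)"
    unfolding l2norm_square by (simp del: of_real_power)
  also have "\<dots> = (\<integral>\<zeta>. (\<Sum>m\<in>I. \<Sum>n\<in>I. a m * cnj (a n) * (\<zeta> ^ m * cnj \<zeta> ^ n)) \<partial>circle_measure)"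
    by (simp del: of_real_power add: complex_norm_square sum_product mult_ac)
  also have "\<dots> = (\<Sum>m\<in>I. \<Sum>n\<in>I. a m * cnj (a n) * (if m = n then 1 else 0))"
    using i by (simp add: Bochner_Integration.integral_sum circle_integral_power_cnj_power)
  also have "\<dots> = (\<Sum>m\<in>I. complex_of_real ((norm (a m))\<^sup>2))"
    using assms by (simp del: of_real_power add: complex_norm_square if_distrib[of "(*) _"] sum.delta cong: if_cong)
  finally show ?thesis by (simp only: of_real_sum[symmetric] of_real_eq_iff)
qed

lemma fourier_trig:
  assumes "finite I"
  shows "fourier (\<lambda>\<zeta>. \<Sum>n\<in>I. a n * \<zeta> ^ n) k = (if k \<in> I then a k else 0)"
proof -
  have "fourier (\<lambda>\<zeta>. \<Sum>n\<in>I. a n * \<zeta> ^ n) k = (\<integral>\<zeta>. (\<Sum>n\<in>I. a n * (\<zeta> ^ n * cnj \<zeta> ^ k)) \<partial>circle_measure)"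
    by (simp add: fourier_def sum_distrib_right mult.assoc)
  also have "\<dots> = (\<Sum>n\<in>I. a n * (if n = k then 1 else 0))"
    by (subst Bochner_Integration.integral_sum)
       (auto intro!: integrable_mult_right l2_mult_integrable square_integrable_power simp: circle_integral_power_cnj_power)
  also have "\<dots> = (if k \<in> I then a k else 0)" using assms by (simp add: if_distrib[of "(*) _"] cong: if_cong)
  finally show ?thesis .
qed

lemma bessel_inequality:
  assumes f: "square_integrable circle_measure f"
  shows "summable (\<lambda>n. (norm (fourier f n))\<^sup>2)" "(\<Sum>n. (norm (fourier f n))\<^sup>2) \<le> (l2norm circle_measure f)\<^sup>2"
proof -
  have b: "(\<Sum>n<N. (norm (fourier f n))\<^sup>2) \<le> (l2norm circle_measure f)\<^sup>2" for N
  proof -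
    define p where "p \<zeta> = (\<Sum>n<N. fourier f n * \<zeta> ^ n)" for \<zeta>
    have p: "square_integrable circle_measure p" unfolding p_def[abs_def] by (rule square_integrable_trig)
    have pn: "(l2norm circle_measure p)\<^sup>2 = (\<Sum>n<N. (norm (fourier f n))\<^sup>2)"
      unfolding p_def[abs_def] by (rule l2norm_trig) simp
    have "l2inner circle_measure f p = Re (\<integral>\<zeta>. f \<zeta> * cnj (p \<zeta>) \<partial>circle_measure)"
    proof -
      have "l2inner circle_measure f p = (\<integral>\<zeta>. Re (f \<zeta> * cnj (p \<zeta>)) \<partial>circle_measure)"
        by (simp add: l2inner_def inner_complex_def)
      also have "\<dots> = Re (\<integral>\<zeta>. f \<zeta> * cnj (p \<zeta>) \<partial>circle_measure)"
        by (rule integral_Re[OF l2_mult_integrable[OF f square_integrable_cnj[OF p]]])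
      finally show ?thesis .
    qed
    also have "(\<integral>\<zeta>. f \<zeta> * cnj (p \<zeta>) \<partial>circle_measure) = (\<Sum>n<N. \<integral>\<zeta>. cnj (fourier f n) * (f \<zeta> * cnj \<zeta> ^ n) \<partial>circle_measure)"
    proof -
      have "f \<zeta> * cnj (p \<zeta>) = (\<Sum>n<N. cnj (fourier f n) * (f \<zeta> * cnj \<zeta> ^ n))" for \<zeta>
        by (simp add: p_def sum_distrib_left mult_ac)
      then show ?thesis
        by (simp only:) (intro Bochner_Integration.integral_sum integrable_mult_right l2_mult_integrable f square_integrable_power)
    qed
    also have "\<dots> = (\<Sum>n<N. cnj (fourier f n) * fourier f n)" by (simp add: fourier_def)
    also have "\<dots> = complex_of_real (\<Sum>n<N. (norm (fourier f n))\<^sup>2)"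
      by (simp only: of_real_sum complex_norm_square mult.commute)
    finally have "l2inner circle_measure f p = (\<Sum>n<N. (norm (fourier f n))\<^sup>2)" by simp
    then have "0 \<le> (l2norm circle_measure f)\<^sup>2 - (\<Sum>n<N. (norm (fourier f n))\<^sup>2)"
      using l2norm_diff_square[OF f p] pn zero_le_power2[of "l2norm circle_measure (\<lambda>x. f x - p x)"] by linarith
    then show ?thesis by simp
  qed
  show "summable (\<lambda>n. (norm (fourier f n))\<^sup>2)"
    by (rule bounded_imp_summable[of _ "(l2norm circle_measure f)\<^sup>2"])
       (use b[of "Suc n" for n] in \<open>auto simp: lessThan_Suc_atMost\<close>)
  then show "(\<Sum>n. (norm (fourier f n))\<^sup>2) \<le> (l2norm circle_measure f)\<^sup>2"
    by (rule suminf_le_const) (rule b)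
qed

lemma Hp_2_l2_limit:
  assumes "\<And>n. square_integrable circle_measure (g n)" "square_integrable circle_measure f"
    "(\<lambda>n. l2norm circle_measure (\<lambda>x. g n x - f x)) \<longlonglongrightarrow> 0"
    and "\<And>n. g n \<in> Hp 2"
  shows "f \<in> Hp 2"
proof -
  have "(\<integral>\<zeta>. f \<zeta> * \<zeta> ^ k \<partial>circle_measure) = 0" if "k \<ge> 1" for k
    using tendsto_integral_mult[OF assms(1,2) square_integrable_power(1) assms(3), of k] assms(4) that
    by (simp add: Hp_2_iff LIMSEQ_const_iff)
  then show ?thesis using assms(2) by (simp add: Hp_2_iff)
qed

lemma trig_Hp_2: "(\<lambda>\<zeta>. \<Sum>n\<in>I. a n * \<zeta> ^ n) \<in> Hp 2"
proof -
  have "(\<integral>\<zeta>. (\<Sum>n\<in>I. a n * \<zeta> ^ n) * \<zeta> ^ k \<partial>circle_measure) = 0" if "k \<ge> 1" for k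
  proof -
    have "(\<integral>\<zeta>. (\<Sum>n\<in>I. a n * \<zeta> ^ n) * \<zeta> ^ k \<partial>circle_measure) = (\<integral>\<zeta>. (\<Sum>n\<in>I. a n * \<zeta> ^ (n + k)) \<partial>circle_measure)"
      by (simp add: sum_distrib_right power_add mult.assoc)
    also have "\<dots> = (\<Sum>n\<in>I. a n * (\<integral>\<zeta>. \<zeta> ^ (n + k) \<partial>circle_measure))"
      by (subst Bochner_Integration.integral_sum)
         (auto intro!: circle.l2_imp_integrable square_integrable_cmult square_integrable_power)
    also have "\<dots> = 0" using that by (simp add: circle_integral_power)
    finally show ?thesis .
  qed
  then show ?thesis by (simp add: Hp_2_iff square_integrable_trig)
qed

lemma riesz_fischer:
  assumes a: "summable (\<lambda>n. (norm (a n))\<^sup>2)"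
  obtains f where "f \<in> Hp 2" "\<And>n. fourier f n = a n"
    "(\<lambda>N. l2norm circle_measure (\<lambda>\<zeta>. (\<Sum>n<N. a n * \<zeta> ^ n) - f \<zeta>)) \<longlonglongrightarrow> 0"
    "(l2norm circle_measure f)\<^sup>2 = (\<Sum>n. (norm (a n))\<^sup>2)"
proof -
  define p where "p N \<zeta> = (\<Sum>n<N. a n * \<zeta> ^ n)" for N \<zeta>
  have p: "square_integrable circle_measure (p N)" for N unfolding p_def[abs_def] by (rule square_integrable_trig)
  have dp: "(l2norm circle_measure (\<lambda>\<zeta>. p m \<zeta> - p n \<zeta>))\<^sup>2 = (\<Sum>i=n..<m. (norm (a i))\<^sup>2)" if "n \<le> m" for m n
  proof -
    have "p m \<zeta> - p n \<zeta> = (\<Sum>i=n..<m. a i * \<zeta> ^ i)" for \<zeta>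
      using sum_diff_nat_ivl[of 0 n m "\<lambda>i. a i * \<zeta> ^ i"] that by (simp add: p_def atLeast0LessThan)
    then show ?thesis using l2norm_trig[of "{n..<m}" a] by simp
  qed
  have Cau: "\<exists>N. \<forall>m\<ge>N. \<forall>n\<ge>N. l2norm circle_measure (\<lambda>x. p m x - p n x) < e" if e: "e > 0" for e
  proof -
    obtain N where N: "\<And>m n. m \<ge> N \<Longrightarrow> norm (\<Sum>i=m..<n. (norm (a i))\<^sup>2) < e\<^sup>2"
      using summable_Cauchy[of "\<lambda>n. (norm (a n))\<^sup>2"] a e by (meson zero_less_power)
    have *: "l2norm circle_measure (\<lambda>x. p m x - p n x) < e" if "m \<ge> n" "n \<ge> N" for m n
    proof (rule power2_less_imp_less)
      show "(l2norm circle_measure (\<lambda>x. p m x - p n x))\<^sup>2 < e\<^sup>2" 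
        unfolding dp[OF that(1)] using N[OF that(2), of m] by simp
    qed (use e in simp)
    have "l2norm circle_measure (\<lambda>x. p m x - p n x) < e" if "m \<ge> N" "n \<ge> N" for m n
      using *[of n m] *[of m n] that l2norm_diff_commute[of circle_measure "p m" "p n"] by (cases "n \<le> m") auto
    then show ?thesis by blast
  qed
  obtain f where f: "square_integrable circle_measure f" "(\<lambda>N. l2norm circle_measure (\<lambda>\<zeta>. p N \<zeta> - f \<zeta>)) \<longlonglongrightarrow> 0"
    by (rule circle.l2_complete[OF p Cau])
  have fH: "f \<in> Hp 2" by (rule Hp_2_l2_limit[OF p f]) (simp add: p_def[abs_def] trig_Hp_2)
  have fa: "fourier f n = a n" for n
  proof -
    have 1: "(\<lambda>N. fourier (p N) n) \<longlonglongrightarrow> fourier f n"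
      unfolding fourier_def by (rule tendsto_integral_mult[OF p f(1) square_integrable_power(2) f(2)])
    have "\<forall>\<^sub>F N in sequentially. fourier (p N) n = a n"
      using eventually_gt_at_top[of n] by eventually_elim (simp add: p_def[abs_def] fourier_trig)
    then have "(\<lambda>N. fourier (p N) n) \<longlonglongrightarrow> a n" by (rule tendsto_eventually)
    with 1 show ?thesis by (rule LIMSEQ_unique)
  qed
  have "(\<lambda>N. (l2norm circle_measure (p N))\<^sup>2) \<longlonglongrightarrow> (l2norm circle_measure f)\<^sup>2"
    by (intro tendsto_power l2norm_tendsto p f)
  moreover have "(\<lambda>N. (l2norm circle_measure (p N))\<^sup>2) \<longlonglongrightarrow> (\<Sum>n. (norm (a n))\<^sup>2)"
    unfolding p_def[abs_def] by (simp add: l2norm_trig summable_LIMSEQ[OF a])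
  ultimately have "(l2norm circle_measure f)\<^sup>2 = (\<Sum>n. (norm (a n))\<^sup>2)" by (rule LIMSEQ_unique)
  with fH fa f(2)[unfolded p_def[abs_def]] show ?thesis by (intro that)
qed

lemma Hp_2_eq_AE:
  assumes f: "f \<in> Hp 2" and g: "g \<in> Hp 2" and eq: "\<And>n. fourier f n = fourier g n"
  shows "AE \<zeta> in circle_measure. f \<zeta> = g \<zeta>"
proof -
  have s: "square_integrable circle_measure f" "square_integrable circle_measure g"
    using f g by (auto intro: Hp_2_square_integrable)
  have m: "(\<integral>\<zeta>. f \<zeta> * \<zeta> ^ n \<partial>circle_measure) = (\<integral>\<zeta>. g \<zeta> * \<zeta> ^ n \<partial>circle_measure)" for n
  proof (cases "n = 0")
    case True then show ?thesis using eq[of 0] by (simp add: fourier_def)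
  next
    case False then show ?thesis using f g by (simp add: Hp_2_iff)
  qed
  have "AE \<zeta> in circle_measure. f \<zeta> - g \<zeta> = 0"
  proof (rule AE_zero_of_moments)
    show "integrable circle_measure (\<lambda>\<zeta>. f \<zeta> - g \<zeta>)"
      using s by (intro Bochner_Integration.integrable_diff circle.l2_imp_integrable)
    show "(\<integral>\<zeta>. (f \<zeta> - g \<zeta>) * \<zeta> ^ n \<partial>circle_measure) = 0" for n
      using m[of n] s square_integrable_power by (simp add: left_diff_distrib l2_mult_integrable)
    show "(\<integral>\<zeta>. (f \<zeta> - g \<zeta>) * cnj \<zeta> ^ n \<partial>circle_measure) = 0" for n
      using eq[of n] s square_integrable_power by (simp add: left_diff_distrib l2_mult_integrable fourier_def)
  qed
  then show ?thesis by eventually_elim simp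
qed

lemma l2norm_diff_cong_AE:
  assumes "square_integrable M f" "square_integrable M g" "square_integrable M h" "AE x in M. f x = g x"
  shows "l2norm M (\<lambda>x. h x - f x) = l2norm M (\<lambda>x. h x - g x)"
  by (rule l2norm_cong_AE) (use assms in \<open>auto elim: eventually_mono\<close>)

lemma Hp_2_partial_sums:
  assumes f: "f \<in> Hp 2"
  shows "(\<lambda>N. l2norm circle_measure (\<lambda>\<zeta>. (\<Sum>n<N. fourier f n * \<zeta> ^ n) - f \<zeta>)) \<longlonglongrightarrow> 0"
    "(l2norm circle_measure f)\<^sup>2 = (\<Sum>n. (norm (fourier f n))\<^sup>2)"
proof -
  have s: "square_integrable circle_measure f" by (rule Hp_2_square_integrable[OF f])
  obtain g where g: "g \<in> Hp 2" "\<And>n. fourier g n = fourier f n"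
    "(\<lambda>N. l2norm circle_measure (\<lambda>\<zeta>. (\<Sum>n<N. fourier f n * \<zeta> ^ n) - g \<zeta>)) \<longlonglongrightarrow> 0"
    "(l2norm circle_measure g)\<^sup>2 = (\<Sum>n. (norm (fourier f n))\<^sup>2)"
    using riesz_fischer[OF bessel_inequality(1)[OF s]] by blast
  have ae: "AE \<zeta> in circle_measure. f \<zeta> = g \<zeta>" by (rule Hp_2_eq_AE[OF f g(1)]) (simp add: g(2))
  have sg: "square_integrable circle_measure g" by (rule Hp_2_square_integrable[OF g(1)])
  show "(\<lambda>N. l2norm circle_measure (\<lambda>\<zeta>. (\<Sum>n<N. fourier f n * \<zeta> ^ n) - f \<zeta>)) \<longlonglongrightarrow> 0"
    unfolding l2norm_diff_cong_AE[OF s sg square_integrable_trig ae] by (rule g(3))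
  have "l2norm circle_measure f = l2norm circle_measure g"
    by (rule l2norm_cong_AE[OF s sg]) (use ae in \<open>auto elim: eventually_mono\<close>)
  then show "(l2norm circle_measure f)\<^sup>2 = (\<Sum>n. (norm (fourier f n))\<^sup>2)" using g(4) by simp
qed

subsection \<open>Products\<close>

lemma integral_power_cnj_szego:
  assumes z: "norm z < 1"
  shows "(\<integral>\<zeta>. \<zeta> ^ n * cnj (szego_kernel z \<zeta>) \<partial>circle_measure) = z ^ n"
proof -
  have H: "(\<lambda>\<zeta>. \<zeta> ^ n) \<in> Hp 2" using trig_Hp_2[of "\<lambda>_. 1" "{n}"] by simp
  have "(\<lambda>k. fourier (\<lambda>\<zeta>. \<zeta> ^ n) k * z ^ k) sums disc_extension (\<lambda>\<zeta>. \<zeta> ^ n) z"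
    by (rule disc_extension_sums[OF Hp_2_imp_1[OF H] z])
  moreover have "(\<lambda>k. fourier (\<lambda>\<zeta>. \<zeta> ^ n) k * z ^ k) = (\<lambda>k. if k = n then z ^ k else 0)"
    by (auto simp: fourier_def circle_integral_power_cnj_power)
  ultimately have "(\<lambda>k. if k = n then z ^ k else 0) sums disc_extension (\<lambda>\<zeta>. \<zeta> ^ n) z" by simp
  from sums_unique2[OF this sums_single[of n "\<lambda>k. z ^ k"]]
  show ?thesis using disc_extension_szego[OF Hp_2_imp_1[OF H] z] by simp
qed

text \<open>An identity between two functionals of \<open>f\<close> that are continuous in the mean needs to be checked only for powers of
  \<open>\<zeta>\<close>. Used once for each factor, this reduces the multiplicativity of the extension to monomials.\<close>

lemma Hp_2_integral_factor:
  assumes f: "f \<in> Hp 2" and g: "square_integrable circle_measure g"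
    and k: "k \<in> borel_measurable circle_measure" "\<And>\<zeta>. norm \<zeta> = 1 \<Longrightarrow> norm (k \<zeta>) \<le> B"
    and l: "square_integrable circle_measure l"
    and mono: "\<And>i. (\<integral>\<zeta>. \<zeta> ^ i * (g \<zeta> * k \<zeta>) \<partial>circle_measure) = (\<integral>\<zeta>. \<zeta> ^ i * l \<zeta> \<partial>circle_measure) * c"
  shows "(\<integral>\<zeta>. f \<zeta> * (g \<zeta> * k \<zeta>) \<partial>circle_measure) = (\<integral>\<zeta>. f \<zeta> * l \<zeta> \<partial>circle_measure) * c"
proof -
  define p where "p N \<zeta> = (\<Sum>n<N. fourier f n * \<zeta> ^ n)" for N \<zeta>
  have p: "square_integrable circle_measure (p N)" for N unfolding p_def[abs_def] by (rule square_integrable_trig)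
  have lim: "(\<lambda>N. l2norm circle_measure (\<lambda>\<zeta>. p N \<zeta> - f \<zeta>)) \<longlonglongrightarrow> 0"
    unfolding p_def by (rule Hp_2_partial_sums[OF f])
  note s = Hp_2_square_integrable[OF f]
  have gk: "square_integrable circle_measure (\<lambda>\<zeta>. g \<zeta> * k \<zeta>)"
    by (rule square_integrable_mult_bounded[OF g k(1) AE_circleI[OF k(2)]])
  have int: "(\<integral>\<zeta>. p N \<zeta> * h \<zeta> \<partial>circle_measure) = (\<Sum>n<N. fourier f n * (\<integral>\<zeta>. \<zeta> ^ n * h \<zeta> \<partial>circle_measure))"
    if h: "square_integrable circle_measure h" for h N
  proof -
    have "(\<integral>\<zeta>. p N \<zeta> * h \<zeta> \<partial>circle_measure) = (\<integral>\<zeta>. (\<Sum>n<N. fourier f n * (\<zeta> ^ n * h \<zeta>)) \<partial>circle_measure)"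
      by (simp add: p_def sum_distrib_right mult.assoc)
    also have "\<dots> = (\<Sum>n<N. fourier f n * (\<integral>\<zeta>. \<zeta> ^ n * h \<zeta> \<partial>circle_measure))"
      by (subst Bochner_Integration.integral_sum)
         (auto intro!: integrable_mult_right l2_mult_integrable square_integrable_power h)
    finally show ?thesis .
  qed
  have "(\<integral>\<zeta>. p N \<zeta> * (g \<zeta> * k \<zeta>) \<partial>circle_measure) = (\<integral>\<zeta>. p N \<zeta> * l \<zeta> \<partial>circle_measure) * c" for N
    by (simp add: int[OF gk] int[OF l] mono sum_distrib_right mult.assoc)
  moreover have "(\<lambda>N. \<integral>\<zeta>. p N \<zeta> * (g \<zeta> * k \<zeta>) \<partial>circle_measure) \<longlonglongrightarrow> (\<integral>\<zeta>. f \<zeta> * (g \<zeta> * k \<zeta>) \<partial>circle_measure)"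
    by (rule tendsto_integral_mult[OF p s gk lim])
  moreover have "(\<lambda>N. (\<integral>\<zeta>. p N \<zeta> * l \<zeta> \<partial>circle_measure) * c) \<longlonglongrightarrow> (\<integral>\<zeta>. f \<zeta> * l \<zeta> \<partial>circle_measure) * c"
    by (intro tendsto_mult_right tendsto_integral_mult[OF p s l lim])
  ultimately show ?thesis using LIMSEQ_unique by auto
qed

lemma Hp_2_mult:
  assumes f: "f \<in> Hp 2" and g: "g \<in> Hp 2"
  shows "(\<lambda>\<zeta>. f \<zeta> * g \<zeta>) \<in> Hp 1"
    "norm z < 1 \<Longrightarrow> disc_extension (\<lambda>\<zeta>. f \<zeta> * g \<zeta>) z = disc_extension f z * disc_extension g z"
proof -
  note sf = Hp_2_square_integrable[OF f] and sg = Hp_2_square_integrable[OF g]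
  have fg: "integrable circle_measure (\<lambda>\<zeta>. f \<zeta> * g \<zeta>)" by (rule l2_mult_integrable[OF sf sg])
  have "(\<integral>\<zeta>. (f \<zeta> * g \<zeta>) * \<zeta> ^ n \<partial>circle_measure) = 0" if n: "n \<ge> 1" for n
  proof -
    have "(\<integral>\<zeta>. f \<zeta> * (g \<zeta> * \<zeta> ^ n) \<partial>circle_measure) = (\<integral>\<zeta>. f \<zeta> * 0 \<partial>circle_measure) * 0"
    proof (rule Hp_2_integral_factor[OF f sg, where B=1])
      fix i
      have "(\<integral>\<zeta>. g \<zeta> * \<zeta> ^ (i + n) \<partial>circle_measure) = 0" using g n by (simp add: Hp_2_iff)
      then show "(\<integral>\<zeta>. \<zeta> ^ i * (g \<zeta> * \<zeta> ^ n) \<partial>circle_measure) = (\<integral>\<zeta>. \<zeta> ^ i * 0 \<partial>circle_measure) * 0"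
        by (simp add: power_add mult_ac)
    qed (auto simp: norm_power)
    then show ?thesis by (simp add: mult.assoc)
  qed
  with fg show H: "(\<lambda>\<zeta>. f \<zeta> * g \<zeta>) \<in> Hp 1" by (simp add: Hp_1_iff)
  assume z: "norm z < 1"
  let ?k = "\<lambda>\<zeta>. cnj (szego_kernel z \<zeta>)"
  have k: "?k \<in> borel_measurable circle_measure" by measurable
  have kb: "norm (?k \<zeta>) \<le> 1 / (1 - norm z)" if "norm \<zeta> = 1" for \<zeta>
    using szego_kernel_bounded[OF that z] by simp
  have sk: "square_integrable circle_measure ?k" by (intro square_integrable_cnj szego_kernel_square_integrable z)
  have "(\<integral>\<zeta>. f \<zeta> * (g \<zeta> * ?k \<zeta>) \<partial>circle_measure) = (\<integral>\<zeta>. f \<zeta> * ?k \<zeta> \<partial>circle_measure) * (\<integral>\<zeta>. g \<zeta> * ?k \<zeta> \<partial>circle_measure)"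
  proof (rule Hp_2_integral_factor[OF f sg k kb sk])
    fix i
    have "(\<integral>\<zeta>. g \<zeta> * (\<zeta> ^ i * ?k \<zeta>) \<partial>circle_measure) = (\<integral>\<zeta>. g \<zeta> * ?k \<zeta> \<partial>circle_measure) * (\<integral>\<zeta>. \<zeta> ^ i * ?k \<zeta> \<partial>circle_measure)"
    proof (rule Hp_2_integral_factor[OF g square_integrable_power(1) k kb sk])
      fix j
      show "(\<integral>\<zeta>. \<zeta> ^ j * (\<zeta> ^ i * ?k \<zeta>) \<partial>circle_measure) = (\<integral>\<zeta>. \<zeta> ^ j * ?k \<zeta> \<partial>circle_measure) * (\<integral>\<zeta>. \<zeta> ^ i * ?k \<zeta> \<partial>circle_measure)"
        using integral_power_cnj_szego[OF z, of "j + i"] by (simp add: integral_power_cnj_szego[OF z] power_add mult.assoc)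
    qed
    then show "(\<integral>\<zeta>. \<zeta> ^ i * (g \<zeta> * ?k \<zeta>) \<partial>circle_measure) = (\<integral>\<zeta>. \<zeta> ^ i * ?k \<zeta> \<partial>circle_measure) * (\<integral>\<zeta>. g \<zeta> * ?k \<zeta> \<partial>circle_measure)"
      by (simp add: mult_ac)
  qed
  then show "disc_extension (\<lambda>\<zeta>. f \<zeta> * g \<zeta>) z = disc_extension f z * disc_extension g z"
    using disc_extension_szego[OF H z] disc_extension_szego[OF Hp_2_imp_1[OF f] z]
      disc_extension_szego[OF Hp_2_imp_1[OF g] z] by (simp add: mult.assoc)
qed

lemma Hp_2_mult_infinity:
  assumes f: "f \<in> Hp \<infinity>" and g: "g \<in> Hp 2"
  shows "(\<lambda>\<zeta>. f \<zeta> * g \<zeta>) \<in> Hp 2"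
proof -
  from f obtain B where B: "f \<in> borel_measurable circle_measure" "AE \<zeta> in circle_measure. norm (f \<zeta>) \<le> B"
    unfolding Hp_infinity_iff by blast
  have "square_integrable circle_measure (\<lambda>\<zeta>. g \<zeta> * f \<zeta>)"
    by (rule square_integrable_mult_bounded[OF Hp_2_square_integrable[OF g] B])
  with Hp_2_mult(1)[OF Hp_infinity_imp_2[OF f] g] show ?thesis by (simp add: Hp_1_iff Hp_2_iff mult.commute)
qed

section \<open>Exponentials of analytic completions\<close>

lemma integral_dominated_mult:
  fixes f :: "'a \<Rightarrow> complex" and w :: "'a \<Rightarrow> real"
  assumes "\<And>k. F k \<in> borel_measurable M" "f \<in> borel_measurable M" "\<phi> \<in> borel_measurable M"
    and "AE x in M. (\<lambda>k. F k x) \<longlonglongrightarrow> f x" "integrable M w"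
    and "\<And>k. AE x in M. norm (F k x) \<le> w x" "AE x in M. norm (\<phi> x) \<le> B"
  shows "(\<lambda>k. \<integral>x. F k x * \<phi> x \<partial>M) \<longlonglongrightarrow> (\<integral>x. f x * \<phi> x \<partial>M)"
proof (rule integral_dominated_convergence[where w="\<lambda>x. w x * B"])
  show "AE x in M. (\<lambda>k. F k x * \<phi> x) \<longlonglongrightarrow> f x * \<phi> x"
    using assms(4) by eventually_elim (intro tendsto_intros)
  show "AE x in M. norm (F k x * \<phi> x) \<le> w x * B" for k
    using assms(6)[of k] assms(7)
  proof eventually_elim
    case (elim x)
    then have "norm (F k x) * norm (\<phi> x) \<le> w x * B"
      by (intro mult_mono) (auto intro: order_trans[OF norm_ge_zero])
    then show ?case by (simp add: norm_mult)
  qed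
qed (use assms in auto)

lemma square_integrable_of_real[simp]:
  "square_integrable M (\<lambda>x. complex_of_real (u x)) \<longleftrightarrow> square_integrable M u"
proof -
  have "(\<lambda>x. complex_of_real (u x)) \<in> borel_measurable M \<longleftrightarrow> u \<in> borel_measurable M"
  proof
    assume "(\<lambda>x. complex_of_real (u x)) \<in> borel_measurable M"
    from measurable_compose[OF this borel_measurable_Re] show "u \<in> borel_measurable M" by simp
  qed measurable
  then show ?thesis by (simp add: square_integrable_def)
qed

lemma l2norm_of_real[simp]: "l2norm M (\<lambda>x. complex_of_real (u x)) = l2norm M u"
  by (simp add: l2norm_def)

lemma fourier_diff:
  assumes "square_integrable circle_measure f" "square_integrable circle_measure g"
  shows "fourier (\<lambda>\<zeta>. f \<zeta> - g \<zeta>) n = fourier f n - fourier g n"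
  using assms square_integrable_power by (simp add: fourier_def left_diff_distrib l2_mult_integrable)

lemma Hp_2_diff:
  assumes "f \<in> Hp 2" "g \<in> Hp 2" shows "(\<lambda>\<zeta>. f \<zeta> - g \<zeta>) \<in> Hp 2"
  using assms square_integrable_power by (auto simp: Hp_2_iff left_diff_distrib l2_mult_integrable)

lemma Hp_2_cmult: "f \<in> Hp 2 \<Longrightarrow> (\<lambda>\<zeta>. c * f \<zeta>) \<in> Hp 2"
  by (auto simp: Hp_2_iff square_integrable_cmult mult.assoc)

lemma disc_extension_cmult: "disc_extension (\<lambda>\<zeta>. c * f \<zeta>) z = c * disc_extension f z"
  by (simp add: disc_extension_poisson mult.assoc)

lemma disc_extension_diff:
  assumes "f \<in> Hp 2" "g \<in> Hp 2" "norm z < 1"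
  shows "disc_extension (\<lambda>\<zeta>. f \<zeta> - g \<zeta>) z = disc_extension f z - disc_extension g z"
  using assms Hp_2_diff[OF assms(1,2)]
    integrable_mult_szego(2)[OF circle.l2_imp_integrable[OF Hp_2_square_integrable[OF assms(1)]] assms(3)]
    integrable_mult_szego(2)[OF circle.l2_imp_integrable[OF Hp_2_square_integrable[OF assms(2)]] assms(3)]
  by (simp add: disc_extension_szego Hp_2_imp_1 left_diff_distrib)

lemma norm_disc_extension_le:
  assumes f: "f \<in> Hp 2" and z: "norm z < 1"
  shows "norm (disc_extension f z) \<le> l2norm circle_measure f * (1 / (1 - norm z))"
proof -
  have k: "square_integrable circle_measure (\<lambda>\<zeta>. cnj (szego_kernel z \<zeta>))"
    by (intro square_integrable_cnj szego_kernel_square_integrable z)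
  have "norm (disc_extension f z) \<le> l2norm circle_measure f * l2norm circle_measure (\<lambda>\<zeta>. cnj (szego_kernel z \<zeta>))"
    unfolding disc_extension_szego[OF Hp_2_imp_1[OF f] z]
    by (rule norm_integral_mult_le[OF Hp_2_square_integrable[OF f] k])
  also have "l2norm circle_measure (\<lambda>\<zeta>. cnj (szego_kernel z \<zeta>)) \<le> 1 / (1 - norm z)"
    by (rule circle.bounded_square_integrable(2))
       (use k szego_kernel_bounded z in \<open>auto intro!: AE_circleI\<close>)
  finally show ?thesis by (simp add: mult_left_mono)
qed

lemma disc_extension_tendsto:
  assumes "\<And>n. g n \<in> Hp 2" "f \<in> Hp 2" "norm z < 1"
    "(\<lambda>n. l2norm circle_measure (\<lambda>x. g n x - f x)) \<longlonglongrightarrow> 0"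
  shows "(\<lambda>n. disc_extension (g n) z) \<longlonglongrightarrow> disc_extension f z"
  unfolding disc_extension_szego[OF Hp_2_imp_1[OF assms(1)] assms(3)] disc_extension_szego[OF Hp_2_imp_1[OF assms(2)] assms(3)]
  by (intro tendsto_integral_mult assms square_integrable_cnj szego_kernel_square_integrable Hp_2_square_integrable)

lemma poisson_integral_one:
  assumes z: "norm z < 1"
  shows "integrable circle_measure (poisson_kernel z)" "(\<integral>\<zeta>. poisson_kernel z \<zeta> \<partial>circle_measure) = 1"
proof -
  show i: "integrable circle_measure (poisson_kernel z)"
  proof (rule circle.integrable_const_bound)
    show "AE \<zeta> in circle_measure. norm (poisson_kernel z \<zeta>) \<le> 1 / (1 - norm z)\<^sup>2"
      by (rule AE_circleI) (use poisson_kernel_pos poisson_kernel_le z in \<open>auto simp: abs_of_pos\<close>)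
  qed measurable
  have "disc_extension (\<lambda>\<zeta>. 1) z = 1"
    by (rule holomorphic_Hp_infinity(2)[of _ 2]) (use z in auto)
  then have "complex_of_real (\<integral>\<zeta>. poisson_kernel z \<zeta> \<partial>circle_measure) = 1" by (simp add: disc_extension_poisson)
  then show "(\<integral>\<zeta>. poisson_kernel z \<zeta> \<partial>circle_measure) = 1" by (simp only: of_real_eq_1_iff)
qed

lemma Re_disc_extension_le:
  assumes g: "g \<in> Hp 2" and C: "AE \<zeta> in circle_measure. Re (g \<zeta>) \<le> C" and z: "norm z < 1"
  shows "Re (disc_extension g z) \<le> C"
proof -
  have gi: "integrable circle_measure g" by (intro circle.l2_imp_integrable Hp_2_square_integrable g)
  have i: "integrable circle_measure (\<lambda>\<zeta>. g \<zeta> * of_real (poisson_kernel z \<zeta>))"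
    by (rule integrable_mult_bounded[OF gi, where B="1 / (1 - norm z)\<^sup>2"])
       (use poisson_kernel_pos poisson_kernel_le z in \<open>auto intro!: AE_circleI simp: abs_of_pos\<close>)
  have pp: "AE \<zeta> in circle_measure. poisson_kernel z \<zeta> > 0"
    by (rule AE_circleI) (rule poisson_kernel_pos[OF _ z])
  have "Re (disc_extension g z) = (\<integral>\<zeta>. Re (g \<zeta> * of_real (poisson_kernel z \<zeta>)) \<partial>circle_measure)"
    unfolding disc_extension_poisson by (rule integral_Re[OF i, symmetric])
  also have "\<dots> \<le> (\<integral>\<zeta>. C * poisson_kernel z \<zeta> \<partial>circle_measure)"
  proof (rule integral_mono_AE)
    show "AE \<zeta> in circle_measure. Re (g \<zeta> * of_real (poisson_kernel z \<zeta>)) \<le> C * poisson_kernel z \<zeta>"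
      using C pp
      by eventually_elim (simp add: mult_right_mono)
    show "integrable circle_measure (\<lambda>\<zeta>. Re (g \<zeta> * of_real (poisson_kernel z \<zeta>)))"
      by (rule integrable_Re[OF i])
  qed (use poisson_integral_one[OF z] in auto)
  also have "\<dots> = C" using poisson_integral_one[OF z] by simp
  finally show ?thesis .
qed

lemma holomorphic_disc_extension:
  assumes g: "g \<in> Hp 1"
  shows "disc_extension g holomorphic_on ball 0 1"
proof (rule power_series_holomorphic)
  show "(\<lambda>n. fourier g n * (w - 0) ^ n) sums disc_extension g w" if "w \<in> ball 0 1" for w
    using disc_extension_sums[OF g, of w] that by simp
qed

text \<open>The dilation \<open>g(s\<zeta>)\<close> has the coefficients of \<open>g\<close> multiplied by \<open>s\<^sup>n\<close>. Hence it is given by an absolutely convergent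
  series if \<open>s < 1\<close>, and Parseval's identity turns the distance from \<open>g\<close> into a sum with a fixed majorant.\<close>

lemma dilation_tendsto:
  assumes g: "g \<in> Hp 2" and s: "s \<longlonglongrightarrow> 1" "\<And>k. 0 < s k" "\<And>k. s k < 1"
  shows "\<And>k. (\<lambda>\<zeta>. disc_extension g (of_real (s k) * \<zeta>)) \<in> Hp 2"
    "(\<lambda>k. l2norm circle_measure (\<lambda>\<zeta>. disc_extension g (of_real (s k) * \<zeta>) - g \<zeta>)) \<longlonglongrightarrow> 0"
proof -
  define h where "h k \<zeta> = disc_extension g (of_real (s k) * \<zeta>)" for k \<zeta>
  define a where "a n = fourier g n" for n
  have hs: "(\<lambda>n. (a n * of_real (s k) ^ n) * w ^ n) sums h k w" if "norm w < 1 / s k" for k w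
  proof -
    have "norm (of_real (s k) * w) < 1" using that s(2)[of k] by (simp add: norm_mult field_simps)
    from disc_extension_sums[OF Hp_2_imp_1[OF g] this] show ?thesis
      by (simp add: a_def h_def power_mult_distrib mult_ac)
  qed
  have sk: "1 < 1 / s k" for k using s(2,3)[of k] by simp
  have sm: "summable (\<lambda>n. norm (a n * of_real (s k) ^ n))" for k
  proof -
    define x where "x = (1 + 1 / s k) / 2"
    have x: "1 < x" "x < 1 / s k" using sk[of k] by (simp_all add: x_def field_simps)
    have nx: "norm (complex_of_real x) = x" using x by simp
    have "summable (\<lambda>n. norm ((a n * of_real (s k) ^ n) * 1 ^ n))"
      by (rule powser_insidea[OF sums_summable[OF hs[of "of_real x" k]]]) (use x nx in auto)
    then show ?thesis by simp
  qed
  have heq: "h k \<zeta> = (\<Sum>n. (a n * of_real (s k) ^ n) * \<zeta> ^ n)" if "norm \<zeta> = 1" for k \<zeta>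
    using hs[of \<zeta> k] sk[of k] that by (simp add: sums_iff)
  have hI: "h k \<in> Hp \<infinity>" for k
    by (rule Hp_infinity_cong[OF power_series_Hp_infinity(1)[OF sm]]) (simp add: heq)
  then show h2: "(\<lambda>\<zeta>. disc_extension g (of_real (s k) * \<zeta>)) \<in> Hp 2" for k
    using Hp_infinity_imp_2[OF hI[of k]] by (simp add: h_def[abs_def])
  have h2': "h k \<in> Hp 2" for k using h2 by (simp add: h_def[abs_def])
  have fh: "fourier (h k) n = a n * of_real (s k) ^ n" for k n
  proof -
    have "fourier (h k) n = fourier (\<lambda>\<zeta>. \<Sum>n. (a n * of_real (s k) ^ n) * \<zeta> ^ n) n"
      unfolding fourier_def by (intro Bochner_Integration.integral_cong refl) (simp add: heq)
    then show ?thesis using power_series_Hp_infinity(3)[OF sm] by simp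
  qed
  have nrm: "(l2norm circle_measure (\<lambda>\<zeta>. h k \<zeta> - g \<zeta>))\<^sup>2 = (\<Sum>n. (norm (a n))\<^sup>2 * (1 - s k ^ n)\<^sup>2)" for k
  proof -
    have "(norm (fourier (\<lambda>\<zeta>. h k \<zeta> - g \<zeta>) n))\<^sup>2 = (norm (a n))\<^sup>2 * (1 - s k ^ n)\<^sup>2" for n
    proof -
      have "fourier (\<lambda>\<zeta>. h k \<zeta> - g \<zeta>) n = - (a n * of_real (1 - s k ^ n))"
        using fourier_diff[OF Hp_2_square_integrable[OF h2'] Hp_2_square_integrable[OF g]]
        by (simp add: fh a_def algebra_simps)
      then show ?thesis by (simp only: norm_minus_cancel norm_mult norm_of_real power_mult_distrib power2_abs)
    qed
    then show ?thesis using Hp_2_partial_sums(2)[OF Hp_2_diff[OF h2' g]] by simp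
  qed
  have bound: "norm ((norm (a n))\<^sup>2 * (1 - s k ^ n)\<^sup>2) \<le> (norm (a n))\<^sup>2" for n k
  proof -
    have "0 \<le> s k ^ n" "s k ^ n \<le> 1" using s(2,3)[of k] by (simp_all add: power_le_one less_imp_le)
    then have "\<bar>1 - s k ^ n\<bar> \<le> 1" by simp
    then have "(1 - s k ^ n)\<^sup>2 \<le> 1" by (simp add: abs_square_le_1)
    then show ?thesis by (simp add: mult_left_le)
  qed
  have "(\<lambda>k. \<Sum>n. (norm (a n))\<^sup>2 * (1 - s k ^ n)\<^sup>2) \<longlonglongrightarrow> (\<Sum>n. 0)"
  proof (rule tannerys_theorem[THEN conjunct2, THEN conjunct2])
    show "(\<lambda>k. (norm (a n))\<^sup>2 * (1 - s k ^ n)\<^sup>2) \<longlonglongrightarrow> 0" for n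
    proof -
      have "(\<lambda>k. (norm (a n))\<^sup>2 * (1 - s k ^ n)\<^sup>2) \<longlonglongrightarrow> (norm (a n))\<^sup>2 * (1 - 1 ^ n)\<^sup>2"
        by (intro tendsto_intros s)
      then show ?thesis by simp
    qed
    show "summable (\<lambda>n. (norm (a n))\<^sup>2)"
      unfolding a_def by (rule bessel_inequality(1)[OF Hp_2_square_integrable[OF g]])
    show "\<forall>\<^sub>F (n, k) in sequentially \<times>\<^sub>F sequentially. norm ((norm (a n))\<^sup>2 * (1 - s k ^ n)\<^sup>2) \<le> (norm (a n))\<^sup>2"
      using bound by (intro always_eventually) auto
  qed simp
  then have "(\<lambda>k. (l2norm circle_measure (\<lambda>\<zeta>. h k \<zeta> - g \<zeta>))\<^sup>2) \<longlonglongrightarrow> 0" by (simp add: nrm)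
  from tendsto_real_sqrt[OF this]
  show "(\<lambda>k. l2norm circle_measure (\<lambda>\<zeta>. disc_extension g (of_real (s k) * \<zeta>) - g \<zeta>)) \<longlonglongrightarrow> 0"
    by (simp add: h_def[abs_def])
qed

text \<open>For the dilations of \<open>g\<close> the claim is elementary. Their real parts stay below \<open>C\<close>, as Poisson integrals, so
  that their exponentials are uniformly bounded and the limit can be taken under the integral.\<close>

lemma exp_Hp_infinity:
  assumes g: "g \<in> Hp 2" and C: "AE \<zeta> in circle_measure. Re (g \<zeta>) \<le> C"
  shows "(\<lambda>\<zeta>. exp (g \<zeta>)) \<in> Hp \<infinity>"
    "norm z < 1 \<Longrightarrow> disc_extension (\<lambda>\<zeta>. exp (g \<zeta>)) z = exp (disc_extension g z)"
proof -
  define s :: "nat \<Rightarrow> real" where "s k = 1 - 1 / (real k + 2)" for k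
  have s01: "0 < s k" "s k < 1" for k by (auto simp: s_def field_simps)
  have slim: "s \<longlonglongrightarrow> 1"
  proof -
    have "(\<lambda>k. 1 / (real k + 2)) \<longlonglongrightarrow> 0"
      using LIMSEQ_ignore_initial_segment[OF lim_const_over_n[of 1], of 2] by (simp add: add.commute)
    from tendsto_diff[OF tendsto_const[of 1] this] show ?thesis by (simp add: s_def[abs_def])
  qed
  define h where "h k \<zeta> = disc_extension g (of_real (s k) * \<zeta>)" for k \<zeta>
  have h: "h k \<in> Hp 2" "(\<lambda>k. l2norm circle_measure (\<lambda>\<zeta>. h k \<zeta> - g \<zeta>)) \<longlonglongrightarrow> 0" for k
    using dilation_tendsto[OF g slim s01] by (simp_all add: h_def[abs_def])
  have hs: "square_integrable circle_measure (h k)" for k by (rule Hp_2_square_integrable[OF h(1)])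
  note gs = Hp_2_square_integrable[OF g]
  obtain r where r: "strict_mono r" "AE \<zeta> in circle_measure. (\<lambda>k. h (r k) \<zeta>) \<longlonglongrightarrow> g \<zeta>"
    using l2_tendsto_AE_subseq[OF hs gs h(2)] by blast
  have hol: "disc_extension g holomorphic_on ball 0 1"
    by (rule holomorphic_disc_extension[OF Hp_2_imp_1[OF g]])
  have ss: "of_real (s k) * w \<in> ball 0 1" if "norm w < 1 / s k" for k and w :: complex
    using that s01(1)[of k] by (simp add: norm_mult field_simps)
  have s1: "norm (of_real (s k) * w) < 1" if "norm w \<le> 1" for k and w :: complex
  proof -
    have "s k * norm w \<le> s k * 1" using that s01(1)[of k] by (intro mult_left_mono) auto
    moreover have "norm (of_real (s k) * w) = s k * norm w" using s01(1)[of k] by (simp add: norm_mult)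
    ultimately show ?thesis using s01(2)[of k] by linarith
  qed
  have eh: "(\<lambda>w. exp (h k w)) holomorphic_on ball 0 (1 / s k)" for k
    unfolding h_def
    by (intro holomorphic_on_exp' holomorphic_on_compose_gen[OF _ hol, unfolded o_def] holomorphic_intros) (use ss in auto)
  have R: "1 < 1 / s k" for k using s01[of k] by simp
  note E = holomorphic_Hp_infinity[OF eh R]
  have bd: "norm (exp (h k \<zeta>)) \<le> exp C" if "norm \<zeta> = 1" for k \<zeta>
    unfolding h_def norm_exp_eq_Re using Re_disc_extension_le[OF g C s1] that by simp
  have lim: "(\<lambda>k. \<integral>\<zeta>. exp (h (r k) \<zeta>) * \<phi> \<zeta> \<partial>circle_measure) \<longlonglongrightarrow> (\<integral>\<zeta>. exp (g \<zeta>) * \<phi> \<zeta> \<partial>circle_measure)"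
    if \<phi>: "\<phi> \<in> borel_measurable circle_measure" "\<And>\<zeta>. norm \<zeta> = 1 \<Longrightarrow> norm (\<phi> \<zeta>) \<le> B" for \<phi> B
  proof (rule integral_dominated_mult[where w="\<lambda>_. exp C" and B=B])
    show "(\<lambda>\<zeta>. exp (h (r k) \<zeta>)) \<in> borel_measurable circle_measure" for k
      using E(1) unfolding Hp_infinity_iff by blast
    show "(\<lambda>\<zeta>. exp (g \<zeta>)) \<in> borel_measurable circle_measure" using gs by measurable
    show "AE \<zeta> in circle_measure. (\<lambda>k. exp (h (r k) \<zeta>)) \<longlonglongrightarrow> exp (g \<zeta>)"
      using r(2) by eventually_elim (rule tendsto_exp)
    show "AE \<zeta> in circle_measure. norm (exp (h (r k) \<zeta>)) \<le> exp C" for k by (rule AE_circleI) (rule bd)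
    show "AE \<zeta> in circle_measure. norm (\<phi> \<zeta>) \<le> B" by (rule AE_circleI) (rule \<phi>(2))
  qed (use \<phi> in auto)
  have "(\<integral>\<zeta>. exp (g \<zeta>) * \<zeta> ^ n \<partial>circle_measure) = 0" if n: "n \<ge> 1" for n
  proof -
    have "(\<lambda>k. \<integral>\<zeta>. exp (h (r k) \<zeta>) * \<zeta> ^ n \<partial>circle_measure) \<longlonglongrightarrow> (\<integral>\<zeta>. exp (g \<zeta>) * \<zeta> ^ n \<partial>circle_measure)"
      by (rule lim[where B=1]) (auto simp: norm_power)
    moreover have "(\<integral>\<zeta>. exp (h (r k) \<zeta>) * \<zeta> ^ n \<partial>circle_measure) = 0" for k
      using E(1)[of "r k"] n unfolding Hp_infinity_iff by blast
    ultimately show ?thesis by (simp add: LIMSEQ_const_iff)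
  qed
  moreover have "AE \<zeta> in circle_measure. norm (exp (g \<zeta>)) \<le> exp C"
    using C by eventually_elim simp
  moreover have "(\<lambda>\<zeta>. exp (g \<zeta>)) \<in> borel_measurable circle_measure" using gs by measurable
  ultimately show "(\<lambda>\<zeta>. exp (g \<zeta>)) \<in> Hp \<infinity>" unfolding Hp_infinity_iff by blast
  assume z: "norm z < 1"
  have "(\<lambda>k. disc_extension (\<lambda>\<zeta>. exp (h (r k) \<zeta>)) z) \<longlonglongrightarrow> disc_extension (\<lambda>\<zeta>. exp (g \<zeta>)) z"
    unfolding disc_extension_poisson
    by (rule lim[where B="1 / (1 - norm z)\<^sup>2"])
       (use poisson_kernel_pos poisson_kernel_le z in \<open>auto simp: abs_of_pos\<close>)
  moreover have "(\<lambda>k. exp (h (r k) z)) \<longlonglongrightarrow> exp (disc_extension g z)"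
  proof -
    have "isCont (disc_extension g) z"
      using holomorphic_on_imp_continuous_on[OF hol] z by (simp add: continuous_on_eq_continuous_at)
    moreover have "(\<lambda>k. of_real (s (r k)) * z) \<longlonglongrightarrow> of_real 1 * z"
      by (intro tendsto_intros LIMSEQ_subseq_LIMSEQ[OF slim r(1), unfolded o_def])
    ultimately have "(\<lambda>k. disc_extension g (of_real (s (r k)) * z)) \<longlonglongrightarrow> disc_extension g z"
      by (intro isCont_tendsto_compose[of z "disc_extension g"]) simp_all
    then show ?thesis unfolding h_def by (rule tendsto_exp)
  qed
  ultimately show "disc_extension (\<lambda>\<zeta>. exp (g \<zeta>)) z = exp (disc_extension g z)"
    using E(2)[OF z] LIMSEQ_unique by simp
qed

text \<open>The function \<open>u + i u'\<close> with \<open>u'\<close> the conjugate function of \<open>u\<close>: its coefficients are obtained from those of \<open>u\<close>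
  by doubling the positive frequencies. They determine it only almost everywhere, whence the choice operator.\<close>

definition analytic_completion :: "(complex \<Rightarrow> real) \<Rightarrow> complex \<Rightarrow> complex" where
  "analytic_completion u = (SOME g. g \<in> Hp 2 \<and>
     (\<forall>n. fourier g n = (if n = 0 then 1 else 2) * fourier (\<lambda>\<zeta>. of_real (u \<zeta>)) n))"

lemma analytic_completion:
  assumes u: "square_integrable circle_measure u"
  shows "analytic_completion u \<in> Hp 2"
    "fourier (analytic_completion u) n = (if n = 0 then 1 else 2) * fourier (\<lambda>\<zeta>. of_real (u \<zeta>)) n"
proof -
  define c where "c n = fourier (\<lambda>\<zeta>. of_real (u \<zeta>)) n" for n
  have "summable (\<lambda>n. (norm (c n))\<^sup>2)" unfolding c_def by (rule bessel_inequality(1)) (simp add: u)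
  from summable_mult[OF this, of 4]
  have "summable (\<lambda>n. (norm ((if n = 0 then 1 else 2) * c n))\<^sup>2)"
    by (rule summable_comparison_test') (auto simp: norm_mult power_mult_distrib)
  from riesz_fischer[OF this] have "\<exists>g. g \<in> Hp 2 \<and> (\<forall>n. fourier g n = (if n = 0 then 1 else 2) * c n)"
    by blast
  from someI_ex[OF this]
  show "analytic_completion u \<in> Hp 2"
    "fourier (analytic_completion u) n = (if n = 0 then 1 else 2) * fourier (\<lambda>\<zeta>. of_real (u \<zeta>)) n"
    by (simp_all add: analytic_completion_def c_def)
qed

lemma l2norm_le_of_fourier:
  assumes g: "g \<in> Hp 2" and u: "square_integrable circle_measure u"
    and le: "\<And>n. norm (fourier g n) \<le> 2 * norm (fourier u n)"
  shows "l2norm circle_measure g \<le> 2 * l2norm circle_measure u"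
proof -
  have s: "summable (\<lambda>n. (norm (fourier u n))\<^sup>2)" by (rule bessel_inequality(1)[OF u])
  have "(l2norm circle_measure g)\<^sup>2 = (\<Sum>n. (norm (fourier g n))\<^sup>2)" by (rule Hp_2_partial_sums(2)[OF g])
  also have "\<dots> \<le> (\<Sum>n. 4 * (norm (fourier u n))\<^sup>2)"
  proof (rule suminf_le)
    show "(norm (fourier g n))\<^sup>2 \<le> 4 * (norm (fourier u n))\<^sup>2" for n
      using power_mono[OF le[of n], of 2] by (simp add: power_mult_distrib)
  qed (use bessel_inequality(1)[OF Hp_2_square_integrable[OF g]] summable_mult[OF s] in auto)
  also have "\<dots> = 4 * (\<Sum>n. (norm (fourier u n))\<^sup>2)" by (rule suminf_mult[OF s])
  also have "\<dots> \<le> 4 * (l2norm circle_measure u)\<^sup>2" using bessel_inequality(2)[OF u] by simp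
  also have "\<dots> = (2 * l2norm circle_measure u)\<^sup>2" by (simp add: power_mult_distrib)
  finally show ?thesis by (rule power2_le_imp_le) simp
qed

lemma l2norm_analytic_completion:
  assumes u: "square_integrable circle_measure u"
  shows "l2norm circle_measure (analytic_completion u) \<le> 2 * l2norm circle_measure u"
  using l2norm_le_of_fourier[OF analytic_completion(1)[OF u], of "\<lambda>\<zeta>. of_real (u \<zeta>)"] u analytic_completion(2)[OF u]
  by (simp add: norm_mult)

lemma l2norm_analytic_completion_diff:
  assumes u: "square_integrable circle_measure u" and v: "square_integrable circle_measure v"
  shows "l2norm circle_measure (\<lambda>\<zeta>. analytic_completion u \<zeta> - analytic_completion v \<zeta>)
      \<le> 2 * l2norm circle_measure (\<lambda>\<zeta>. u \<zeta> - v \<zeta>)"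
proof -
  note a = analytic_completion[OF u] analytic_completion[OF v]
  have d: "square_integrable circle_measure (\<lambda>\<zeta>. complex_of_real (u \<zeta> - v \<zeta>))"
    using u v by (subst square_integrable_of_real) auto
  have "fourier (\<lambda>\<zeta>. analytic_completion u \<zeta> - analytic_completion v \<zeta>) n
      = (if n = 0 then 1 else 2) * fourier (\<lambda>\<zeta>. of_real (u \<zeta> - v \<zeta>)) n" for n
  proof -
    have 1: "fourier (\<lambda>\<zeta>. analytic_completion u \<zeta> - analytic_completion v \<zeta>) n
        = fourier (analytic_completion u) n - fourier (analytic_completion v) n"
      by (intro fourier_diff Hp_2_square_integrable a)
    have 2: "fourier (\<lambda>\<zeta>. of_real (u \<zeta> - v \<zeta>)) n
        = fourier (\<lambda>\<zeta>. of_real (u \<zeta>)) n - fourier (\<lambda>\<zeta>. of_real (v \<zeta>)) n"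
      unfolding of_real_diff by (intro fourier_diff) (simp_all add: u v)
    show ?thesis by (simp only: 1 2 a(2,4) right_diff_distrib)
  qed
  then have "l2norm circle_measure (\<lambda>\<zeta>. analytic_completion u \<zeta> - analytic_completion v \<zeta>)
      \<le> 2 * l2norm circle_measure (\<lambda>\<zeta>. complex_of_real (u \<zeta> - v \<zeta>))"
    by (intro l2norm_le_of_fourier Hp_2_diff a(1,3) d) (simp add: norm_mult)
  then show ?thesis by (simp only: l2norm_of_real)
qed

lemma Re_analytic_completion:
  assumes u: "square_integrable circle_measure u"
  shows "AE \<zeta> in circle_measure. Re (analytic_completion u \<zeta>) = u \<zeta>"
proof -
  define g where "g = analytic_completion u"
  note g = analytic_completion[OF u, folded g_def]
  note gs = Hp_2_square_integrable[OF g(1)]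
  have us: "square_integrable circle_measure (\<lambda>\<zeta>. complex_of_real (u \<zeta>))" using u by simp
  have [measurable]: "g \<in> borel_measurable circle_measure" using gs by measurable
  have iu: "integrable circle_measure u" by (rule circle.l2_imp_integrable[OF u])
  have ig: "integrable circle_measure g" by (rule circle.l2_imp_integrable[OF gs])
  have "AE \<zeta> in circle_measure. Re (g \<zeta>) - u \<zeta> = 0"
  proof (rule AE_zero_of_moments_real)
    show "integrable circle_measure (\<lambda>\<zeta>. Re (g \<zeta>) - u \<zeta>)" using iu ig by auto
    fix n
    have i: "integrable circle_measure (\<lambda>\<zeta>. g \<zeta> * \<zeta> ^ n)" "integrable circle_measure (\<lambda>\<zeta>. g \<zeta> * cnj \<zeta> ^ n)"
      "integrable circle_measure (\<lambda>\<zeta>. of_real (u \<zeta>) * cnj \<zeta> ^ n)"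
      by (intro l2_mult_integrable gs us square_integrable_power)+
    have i': "integrable circle_measure (\<lambda>\<zeta>. cnj (g \<zeta> * cnj \<zeta> ^ n))"
      "integrable circle_measure (\<lambda>\<zeta>. cnj (of_real (u \<zeta>) * cnj \<zeta> ^ n))"
      using i(2,3) by (simp_all only: complex_integrable_cnj)
    have "(\<integral>\<zeta>. of_real (Re (g \<zeta>) - u \<zeta>) * \<zeta> ^ n \<partial>circle_measure)
        = (\<integral>\<zeta>. (1/2) * (g \<zeta> * \<zeta> ^ n + cnj (g \<zeta> * cnj \<zeta> ^ n)) - cnj (of_real (u \<zeta>) * cnj \<zeta> ^ n) \<partial>circle_measure)"
      by (intro Bochner_Integration.integral_cong refl) (simp add: complex_eq_iff field_simps)
    also have "\<dots> = (1/2) * ((\<integral>\<zeta>. g \<zeta> * \<zeta> ^ n \<partial>circle_measure) + cnj (fourier g n)) - cnj (fourier (\<lambda>\<zeta>. of_real (u \<zeta>)) n)"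
      using i i' by (simp del: complex_cnj_mult complex_cnj_power add: fourier_def)
    also have "\<dots> = 0"
    proof (cases "n = 0")
      case True
      have "(\<integral>\<zeta>. g \<zeta> \<partial>circle_measure) = complex_of_real (\<integral>\<zeta>. u \<zeta> \<partial>circle_measure)"
        using g(2)[of 0] by (simp add: fourier_def)
      then show ?thesis using True by (simp add: fourier_def)
    next
      case False
      then show ?thesis using g by (simp add: Hp_2_iff)
    qed
    finally show "(\<integral>\<zeta>. of_real (Re (g \<zeta>) - u \<zeta>) * \<zeta> ^ n \<partial>circle_measure) = 0" .
  qed
  then show ?thesis unfolding g_def by eventually_elim simp
qed

lemma disc_extension_analytic_completion:
  assumes u: "square_integrable circle_measure u" and z: "norm z < 1"
  shows "disc_extension (analytic_completion u) z
    = 2 * (\<integral>\<zeta>. of_real (u \<zeta>) * cnj (szego_kernel z \<zeta>) \<partial>circle_measure) - of_real (\<integral>\<zeta>. u \<zeta> \<partial>circle_measure)"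
proof -
  define c where "c n = fourier (\<lambda>\<zeta>. of_real (u \<zeta>)) n" for n
  have ui: "integrable circle_measure (\<lambda>\<zeta>. complex_of_real (u \<zeta>))"
    using circle.l2_imp_integrable[OF u] by simp
  have "(\<lambda>n. z ^ n * (\<integral>\<zeta>. of_real (u \<zeta>) * cnj \<zeta> ^ n \<partial>circle_measure)) sums
      (\<integral>\<zeta>. of_real (u \<zeta>) * (\<Sum>n. z ^ n * cnj \<zeta> ^ n) \<partial>circle_measure)"
    by (rule sums_integral_power_series[OF ui summable_norm_powers[OF z]]) auto
  also have "(\<integral>\<zeta>. of_real (u \<zeta>) * (\<Sum>n. z ^ n * cnj \<zeta> ^ n) \<partial>circle_measure)
      = (\<integral>\<zeta>. of_real (u \<zeta>) * cnj (szego_kernel z \<zeta>) \<partial>circle_measure)"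
    by (intro Bochner_Integration.integral_cong refl) (use szego_kernel_sums(2) z in auto)
  finally have "(\<lambda>n. c n * z ^ n) sums (\<integral>\<zeta>. of_real (u \<zeta>) * cnj (szego_kernel z \<zeta>) \<partial>circle_measure)"
    by (simp add: c_def fourier_def mult.commute)
  from sums_diff[OF sums_mult[OF this, of 2] sums_single[of 0 c]]
  have "(\<lambda>n. 2 * (c n * z ^ n) - (if n = 0 then c n else 0)) sums
      (2 * (\<integral>\<zeta>. of_real (u \<zeta>) * cnj (szego_kernel z \<zeta>) \<partial>circle_measure) - c 0)" .
  moreover have eq: "(\<lambda>n. 2 * (c n * z ^ n) - (if n = 0 then c n else 0)) = (\<lambda>n. fourier (analytic_completion u) n * z ^ n)"
    by (auto simp: analytic_completion(2)[OF u] c_def)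
  ultimately have "(\<lambda>n. fourier (analytic_completion u) n * z ^ n) sums
      (2 * (\<integral>\<zeta>. of_real (u \<zeta>) * cnj (szego_kernel z \<zeta>) \<partial>circle_measure) - c 0)"
    by (simp only:)
  from sums_unique2[OF disc_extension_sums[OF Hp_2_imp_1[OF analytic_completion(1)[OF u]] z] this]
  show ?thesis by (simp add: c_def fourier_def)
qed

text \<open>The truncations \<open>min u k\<close> are bounded above, so their exponentials lie in \<open>H\<^sup>\<infinity>\<close>, and all of them are
  dominated by \<open>exp u\<close>.\<close>

lemma exp_analytic_completion_Hp_2:
  assumes u: "square_integrable circle_measure u" and eu: "square_integrable circle_measure (\<lambda>\<zeta>. exp (u \<zeta>))"
  shows "(\<lambda>\<zeta>. exp (analytic_completion u \<zeta>)) \<in> Hp 2"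
proof -
  define g where "g = analytic_completion u"
  define v where "v k \<zeta> = min (u \<zeta>) (real k)" for k \<zeta>
  have [measurable]: "u \<in> borel_measurable circle_measure" using u by measurable
  have vm[measurable]: "v k \<in> borel_measurable circle_measure" for k unfolding v_def by measurable
  have vu: "\<bar>v k \<zeta>\<bar> \<le> \<bar>u \<zeta>\<bar>" "\<bar>v k \<zeta> - u \<zeta>\<bar> \<le> \<bar>u \<zeta>\<bar>" for k \<zeta> by (auto simp: v_def)
  have v: "square_integrable circle_measure (v k)" for k
    by (rule l2norm_mono(1)[OF vm u]) (use vu in auto)
  have vlim: "(\<lambda>k. v k \<zeta>) \<longlonglongrightarrow> u \<zeta>" for \<zeta>
  proof -
    obtain k0 where k0: "u \<zeta> \<le> real k0" using real_arch_simple by blast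
    have "\<forall>\<^sub>F k in sequentially. v k \<zeta> = u \<zeta>"
      by (rule eventually_mono[OF eventually_ge_at_top[of k0]]) (use k0 in \<open>simp add: v_def\<close>)
    then show ?thesis by (rule tendsto_eventually)
  qed
  have "(\<lambda>k. \<integral>\<zeta>. (norm (v k \<zeta> - u \<zeta>))\<^sup>2 \<partial>circle_measure) \<longlonglongrightarrow> (\<integral>\<zeta>. 0 \<partial>circle_measure)"
  proof (rule integral_dominated_convergence[where w="\<lambda>\<zeta>. (norm (u \<zeta>))\<^sup>2"])
    show "AE \<zeta> in circle_measure. (\<lambda>k. (norm (v k \<zeta> - u \<zeta>))\<^sup>2) \<longlonglongrightarrow> 0"
    proof (rule AE_I2)
      fix \<zeta>
      have "(\<lambda>k. (norm (v k \<zeta> - u \<zeta>))\<^sup>2) \<longlonglongrightarrow> (norm (u \<zeta> - u \<zeta>))\<^sup>2" by (intro tendsto_intros vlim)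
      then show "(\<lambda>k. (norm (v k \<zeta> - u \<zeta>))\<^sup>2) \<longlonglongrightarrow> 0" by simp
    qed
    show "AE \<zeta> in circle_measure. norm ((norm (v k \<zeta> - u \<zeta>))\<^sup>2) \<le> (norm (u \<zeta>))\<^sup>2" for k
      using vu(2) by (intro AE_I2) (simp add: abs_le_square_iff[symmetric])
  qed (use u in \<open>auto simp: square_integrable_def\<close>)
  then have "(\<lambda>k. (l2norm circle_measure (\<lambda>\<zeta>. v k \<zeta> - u \<zeta>))\<^sup>2) \<longlonglongrightarrow> 0" by (simp add: l2norm_square)
  from tendsto_real_sqrt[OF this] have lim: "(\<lambda>k. 2 * l2norm circle_measure (\<lambda>\<zeta>. v k \<zeta> - u \<zeta>)) \<longlonglongrightarrow> 0"
    by (auto intro: tendsto_mult_right_zero)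
  have glim: "(\<lambda>k. l2norm circle_measure (\<lambda>\<zeta>. analytic_completion (v k) \<zeta> - g \<zeta>)) \<longlonglongrightarrow> 0"
    unfolding g_def
    by (rule Lim_null_comparison[OF _ lim]) (simp add: l2norm_analytic_completion_diff[OF v u])
  have gH: "g \<in> Hp 2" unfolding g_def by (rule analytic_completion(1)[OF u])
  note gs = Hp_2_square_integrable[OF gH] and vs = Hp_2_square_integrable[OF analytic_completion(1)[OF v]]
  obtain r where r: "strict_mono r" "AE \<zeta> in circle_measure. (\<lambda>k. analytic_completion (v (r k)) \<zeta>) \<longlonglongrightarrow> g \<zeta>"
    using l2_tendsto_AE_subseq[OF vs gs glim] by blast
  have gm[measurable]: "g \<in> borel_measurable circle_measure" using gs by measurable
  have egs: "square_integrable circle_measure (\<lambda>\<zeta>. exp (g \<zeta>))"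
  proof (rule l2norm_mono(1)[OF _ eu])
    show "AE \<zeta> in circle_measure. norm (exp (g \<zeta>)) \<le> norm (exp (u \<zeta>))"
      using Re_analytic_completion[OF u] unfolding g_def by eventually_elim simp
  qed measurable
  have E: "(\<lambda>\<zeta>. exp (analytic_completion (v k) \<zeta>)) \<in> Hp \<infinity>" for k
  proof (rule exp_Hp_infinity(1)[OF analytic_completion(1)[OF v]])
    show "AE \<zeta> in circle_measure. Re (analytic_completion (v k) \<zeta>) \<le> real k"
      using Re_analytic_completion[OF v[of k]] by eventually_elim (simp add: v_def)
  qed
  have "(\<integral>\<zeta>. exp (g \<zeta>) * \<zeta> ^ n \<partial>circle_measure) = 0" if n: "n \<ge> 1" for n
  proof -
    have "(\<lambda>k. \<integral>\<zeta>. exp (analytic_completion (v (r k)) \<zeta>) * \<zeta> ^ n \<partial>circle_measure) \<longlonglongrightarrow> (\<integral>\<zeta>. exp (g \<zeta>) * \<zeta> ^ n \<partial>circle_measure)"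
    proof (rule integral_dominated_mult[where w="\<lambda>\<zeta>. exp (u \<zeta>)" and B=1])
      show "(\<lambda>\<zeta>. exp (analytic_completion (v (r k)) \<zeta>)) \<in> borel_measurable circle_measure" for k
        using E unfolding Hp_infinity_iff by blast
      show "AE \<zeta> in circle_measure. (\<lambda>k. exp (analytic_completion (v (r k)) \<zeta>)) \<longlonglongrightarrow> exp (g \<zeta>)"
        using r(2) by eventually_elim (rule tendsto_exp)
      show "integrable circle_measure (\<lambda>\<zeta>. exp (u \<zeta>))" by (rule circle.l2_imp_integrable[OF eu])
      show "AE \<zeta> in circle_measure. norm (exp (analytic_completion (v (r k)) \<zeta>)) \<le> exp (u \<zeta>)" for k
        using Re_analytic_completion[OF v[of "r k"]] by eventually_elim (simp add: v_def)
    qed (use circle_power_bounded in auto)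
    moreover have "(\<integral>\<zeta>. exp (analytic_completion (v (r k)) \<zeta>) * \<zeta> ^ n \<partial>circle_measure) = 0" for k
      using E n unfolding Hp_infinity_iff by blast
    ultimately show ?thesis by (simp add: LIMSEQ_const_iff)
  qed
  then show ?thesis using egs by (simp add: Hp_2_iff g_def)
qed

section \<open>The action of automorphisms\<close>

text \<open>Where the denominator does not vanish, \<open>|az + b| < |cz + d|\<close> holds in the open disc. By continuity the weak
  inequality extends to the closed disc, so that a zero of the denominator there would be one of the
  numerator as well, against the determinant.\<close>

lemma moebius_denominator_nonzero:
  fixes a b c d :: complex
  assumes det: "a * d - b * c \<noteq> 0" and im: "(\<lambda>z. (a * z + b) / (c * z + d)) ` ball 0 1 \<subseteq> ball 0 1"
    and z0: "norm z0 \<le> 1"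
  shows "norm (a * z0 + b) \<le> norm (c * z0 + d)" "c * z0 + d \<noteq> 0"
proof -
  define p where "p = - d / c"
  have p: "c * z + d \<noteq> 0" if "z \<noteq> p \<or> c = 0" for z
  proof
    assume 0: "c * z + d = 0"
    then show False using that det by (cases "c = 0") (auto simp: p_def field_simps eq_neg_iff_add_eq_0)
  qed
  have le: "norm (a * z + b) \<le> norm (c * z + d)" if "norm z < 1" "c * z + d \<noteq> 0" for z
  proof -
    have "(a * z + b) / (c * z + d) \<in> ball 0 1" using subsetD[OF im imageI[of z "ball 0 1"]] that(1) by simp
    then show ?thesis using that(2) by (simp add: norm_divide field_simps)
  qed
  \<comment> \<open>\<open>z0\<close> is approached along a segment from a different point of the open disc, so as to avoid \<open>z0\<close> itself,
    which might be the pole.\<close>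
  define w where "w = (if z0 = 0 then 1/2 else (0::complex))"
  have w: "norm w < 1" "w \<noteq> z0" by (auto simp: w_def)
  define t where "t n = 1 / (real n + 2)" for n :: nat
  have t: "0 < t n" "t n < 1" for n by (auto simp: t_def field_simps)
  have tlim: "t \<longlonglongrightarrow> 0"
    using LIMSEQ_ignore_initial_segment[OF lim_const_over_n[of 1], of 2] by (simp add: t_def[abs_def] add.commute)
  define y where "y n = z0 + of_real (t n) * (w - z0)" for n
  have ylim: "y \<longlonglongrightarrow> z0"
  proof -
    have "y \<longlonglongrightarrow> z0 + of_real 0 * (w - z0)" unfolding y_def[abs_def] by (intro tendsto_intros tlim)
    then show ?thesis by simp
  qed
  have yb: "norm (y n) < 1" for n
  proof -
    have "y n = (1 - t n) *\<^sub>R z0 + t n *\<^sub>R w" by (simp add: y_def scaleR_conv_of_real algebra_simps)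
    then have "norm (y n) \<le> (1 - t n) * norm z0 + t n * norm w"
      using norm_triangle_ineq[of "(1 - t n) *\<^sub>R z0" "t n *\<^sub>R w"] t[of n] by simp
    also have "\<dots> < (1 - t n) * 1 + t n * 1"
      using t[of n] w(1) z0 by (intro add_le_less_mono mult_left_mono mult_strict_left_mono) auto
    finally show ?thesis by simp
  qed
  have ev: "\<forall>\<^sub>F n in sequentially. norm (a * y n + b) \<le> norm (c * y n + d)"
  proof (cases "z0 = p \<and> c \<noteq> 0")
    case True
    have "norm (a * y n + b) \<le> norm (c * y n + d)" for n
      using True t[of n] w(2) by (intro le yb p) (simp add: y_def)
    then show ?thesis by simp
  next
    case False
    have "(\<lambda>n. c * y n + d) \<longlonglongrightarrow> c * z0 + d" by (intro tendsto_intros ylim)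
    moreover have "c * z0 + d \<noteq> 0" using p False by blast
    ultimately have "\<forall>\<^sub>F n in sequentially. c * y n + d \<noteq> 0" by (rule tendsto_imp_eventually_ne)
    then show ?thesis by eventually_elim (rule le[OF yb])
  qed
  show n: "norm (a * z0 + b) \<le> norm (c * z0 + d)"
    by (rule tendsto_le[OF _ _ _ ev]) (auto intro!: tendsto_intros ylim)
  show "c * z0 + d \<noteq> 0"
  proof
    assume 0: "c * z0 + d = 0"
    with n have "a * z0 + b = 0" by simp
    then have "a * (c * z0 + d) - c * (a * z0 + b) = 0" using 0 by simp
    then show False using det by (simp add: algebra_simps)
  qed
qed

lemma disc_automorphism_extends:
  assumes "\<gamma> \<in> disc_automorphisms"
  obtains F R where "R > 1" "F holomorphic_on ball 0 R" "\<And>z. norm z \<le> 1 \<Longrightarrow> \<gamma> z = F z"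
    "\<And>z. norm z < 1 \<Longrightarrow> norm (F z) < 1" "\<And>z. norm z = 1 \<Longrightarrow> norm (F z) = 1"
proof -
  obtain a b c d where \<gamma>: "\<gamma> = (\<lambda>z\<in>cball 0 1. (a * z + b) / (c * z + d))"
    and det: "a * d - b * c \<noteq> 0" and im: "(\<lambda>z. (a * z + b) / (c * z + d)) ` ball 0 1 = ball 0 1"
    using assms unfolding disc_automorphisms_def by blast
  define F where "F z = (a * z + b) / (c * z + d)" for z
  note nz = moebius_denominator_nonzero(2)[OF det equalityD1[OF im]]
    and le = moebius_denominator_nonzero(1)[OF det equalityD1[OF im]]
  have disc: "norm (F z) < 1" if "norm z < 1" for z
    using equalityD1[OF im] that by (force simp: F_def)
  have circ: "norm (F z) = 1" if z: "norm z = 1" for z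
  proof (rule ccontr)
    assume "norm (F z) \<noteq> 1"
    moreover have "norm (F z) \<le> 1" using le[of z] nz[of z] z by (simp add: F_def norm_divide)
    ultimately have "F z \<in> ball 0 1" by simp
    then have "F z \<in> (\<lambda>z. (a * z + b) / (c * z + d)) ` ball 0 1" unfolding im .
    then obtain y where y: "norm y < 1" "F y = F z" unfolding F_def by force
    have "(a * y + b) * (c * z + d) = (a * z + b) * (c * y + d)"
      using y nz[of y] nz[of z] z by (simp add: F_def frac_eq_eq)
    then have "(a * d - b * c) * (y - z) = 0" by (simp add: algebra_simps)
    then show False using det y z by auto
  qed
  \<comment> \<open>Without a pole any radius above \<open>1\<close> will do.\<close>
  define R where "R = (if c = 0 then 2 else norm (d / c))"
  have R: "R > 1"
  proof (cases "c = 0")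
    case False
    have "norm (- d / c) > 1"
    proof (rule ccontr)
      assume "\<not> norm (- d / c) > 1"
      then have "c * (- d / c) + d \<noteq> 0" by (intro nz) simp
      then show False using False by simp
    qed
    then show ?thesis using False by (simp add: R_def norm_divide)
  qed (simp add: R_def)
  have "F holomorphic_on ball 0 R"
    unfolding F_def
  proof (intro holomorphic_intros)
    fix z :: complex assume z: "z \<in> ball 0 R"
    show "c * z + d \<noteq> 0"
    proof
      assume 0: "c * z + d = 0"
      show False
      proof (cases "c = 0")
        case True then show False using 0 det by simp
      next
        case False
        then have "z = - (d / c)" using 0 by (simp add: field_simps eq_neg_iff_add_eq_0)
        then show False using z False by (simp add: R_def)
      qed
    qed
  qed
  with R show ?thesis by (rule that) (auto simp: \<gamma> F_def[symmetric] disc circ)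
qed

lemma automorphism_norm:
  assumes "\<gamma> \<in> disc_automorphisms"
  shows "norm z < 1 \<Longrightarrow> norm (\<gamma> z) < 1" "norm z = 1 \<Longrightarrow> norm (\<gamma> z) = 1"
  using disc_automorphism_extends[OF assms] by (metis less_imp_le, metis order_refl)

lemma automorphism_measurable[measurable (raw)]:
  assumes "\<gamma> \<in> disc_automorphisms"
  shows "\<gamma> \<in> measurable circle_measure circle_measure"
proof -
  obtain F R where F: "R > 1" "F holomorphic_on ball 0 R" "\<And>z. norm z \<le> 1 \<Longrightarrow> \<gamma> z = F z"
    using disc_automorphism_extends[OF assms] by metis
  have "continuous_on (sphere 0 1) F"
    by (rule continuous_on_subset[OF holomorphic_on_imp_continuous_on[OF F(2)]]) (use F(1) in auto)
  then have "continuous_on (sphere 0 1) \<gamma>"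
    by (rule continuous_on_cong[THEN iffD1, OF refl, rotated]) (use F(3) in simp)
  then have "\<gamma> \<in> borel_measurable (restrict_space borel (sphere 0 1))"
    by (rule borel_measurable_continuous_on_restrict)
  then have "\<gamma> \<in> measurable (restrict_space borel (sphere 0 1)) (restrict_space borel (sphere 0 1))"
    by (intro measurable_restrict_space2) (use automorphism_norm(2)[OF assms] in \<open>auto simp: space_restrict_space\<close>)
  then show ?thesis by (simp cong: measurable_cong_sets[OF sets_circle_measure sets_circle_measure])
qed

lemma automorphism_power_Hp_infinity:
  assumes "\<gamma> \<in> disc_automorphisms"
  shows "(\<lambda>\<zeta>. \<gamma> \<zeta> ^ n) \<in> Hp \<infinity>" "norm z < 1 \<Longrightarrow> disc_extension (\<lambda>\<zeta>. \<gamma> \<zeta> ^ n) z = \<gamma> z ^ n"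
proof -
  obtain F R where F: "R > 1" "F holomorphic_on ball 0 R" "\<And>z. norm z \<le> 1 \<Longrightarrow> \<gamma> z = F z"
    using disc_automorphism_extends[OF assms] by metis
  have "(\<lambda>z. F z ^ n) holomorphic_on ball 0 R" by (intro holomorphic_intros F)
  note H = holomorphic_Hp_infinity[OF this F(1)]
  show "(\<lambda>\<zeta>. \<gamma> \<zeta> ^ n) \<in> Hp \<infinity>" by (rule Hp_infinity_cong[OF H(1)]) (simp add: F(3))
  show "disc_extension (\<lambda>\<zeta>. \<gamma> \<zeta> ^ n) z = \<gamma> z ^ n" if "norm z < 1"
    using H(2)[OF that] disc_extension_cong[of "\<lambda>\<zeta>. \<gamma> \<zeta> ^ n" "\<lambda>\<zeta>. F \<zeta> ^ n" z] F(3) that by simp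
qed

lemma finite_measure_poisson:
  assumes z: "norm z < 1"
  shows "finite_measure (density circle_measure (\<lambda>\<zeta>. ennreal (poisson_kernel z \<zeta>)))"
proof
  have "emeasure (density circle_measure (\<lambda>\<zeta>. ennreal (poisson_kernel z \<zeta>))) (space circle_measure)
      = (\<integral>\<^sup>+\<zeta>. ennreal (poisson_kernel z \<zeta>) * indicator (space circle_measure) \<zeta> \<partial>circle_measure)"
    by (intro emeasure_density sets.top) measurable
  also have "\<dots> = (\<integral>\<^sup>+\<zeta>. ennreal (poisson_kernel z \<zeta>) \<partial>circle_measure)"
    by (intro nn_integral_cong) simp
  also have "\<dots> = ennreal (\<integral>\<zeta>. poisson_kernel z \<zeta> \<partial>circle_measure)"
    using poisson_kernel_pos z
    by (intro nn_integral_eq_integral poisson_integral_one(1)[OF z] AE_circleI) (auto intro: less_imp_le)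
  finally show "emeasure (density circle_measure (\<lambda>\<zeta>. ennreal (poisson_kernel z \<zeta>)))
      (space (density circle_measure (\<lambda>\<zeta>. ennreal (poisson_kernel z \<zeta>)))) \<noteq> \<infinity>"
    by simp
qed

lemma integral_poisson_density:
  fixes f :: "complex \<Rightarrow> complex"
  assumes z: "norm z < 1" and f: "f \<in> borel_measurable circle_measure"
  shows "(\<integral>\<zeta>. f \<zeta> \<partial>density circle_measure (\<lambda>\<zeta>. ennreal (poisson_kernel z \<zeta>))) = disc_extension f z"
proof -
  have "(\<integral>\<zeta>. f \<zeta> \<partial>density circle_measure (\<lambda>\<zeta>. ennreal (poisson_kernel z \<zeta>)))
      = (\<integral>\<zeta>. poisson_kernel z \<zeta> *\<^sub>R f \<zeta> \<partial>circle_measure)"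
    by (rule integral_density[OF f])
       (use poisson_kernel_pos z in \<open>auto intro!: AE_circleI less_imp_le\<close>)
  then show ?thesis by (simp add: disc_extension_poisson scaleR_conv_of_real mult.commute)
qed

text \<open>Harmonic measures are carried to harmonic measures: both sides have the moments \<open>\<gamma>(z)\<^sup>n\<close>.\<close>

lemma automorphism_pushforward:
  assumes \<gamma>: "\<gamma> \<in> disc_automorphisms" and z: "norm z < 1"
  shows "distr (density circle_measure (\<lambda>\<zeta>. ennreal (poisson_kernel z \<zeta>))) circle_measure \<gamma>
    = density circle_measure (\<lambda>\<zeta>. ennreal (poisson_kernel (\<gamma> z) \<zeta>))"
    (is "distr ?P _ _ = ?Q")
proof (rule circle_measures_eqI)
  note m = automorphism_measurable[OF \<gamma>]
  have mP: "\<gamma> \<in> measurable ?P circle_measure" using m by simp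
  note gz = automorphism_norm(1)[OF \<gamma> z]
  interpret P: finite_measure ?P by (rule finite_measure_poisson[OF z])
  show "finite_measure (distr ?P circle_measure \<gamma>)" by (rule P.finite_measure_distr[OF mP])
  show "finite_measure ?Q" by (rule finite_measure_poisson[OF gz])
  show "(\<integral>\<zeta>. \<zeta> ^ n \<partial>distr ?P circle_measure \<gamma>) = (\<integral>\<zeta>. \<zeta> ^ n \<partial>?Q)" for n
  proof -
    have pm: "(\<lambda>\<zeta>::complex. \<zeta> ^ n) \<in> borel_measurable circle_measure" by measurable
    have "(\<integral>\<zeta>. \<zeta> ^ n \<partial>distr ?P circle_measure \<gamma>) = (\<integral>\<zeta>. \<gamma> \<zeta> ^ n \<partial>?P)"
      by (rule integral_distr[OF mP]) measurable
    also have "\<dots> = disc_extension (\<lambda>\<zeta>. \<gamma> \<zeta> ^ n) z"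
      by (rule integral_poisson_density[OF z]) (use measurable_compose[OF m pm] in simp)
    also have "\<dots> = \<gamma> z ^ n" by (rule automorphism_power_Hp_infinity(2)[OF \<gamma> z])
    also have "\<dots> = disc_extension (\<lambda>\<zeta>. \<zeta> ^ n) (\<gamma> z)"
      using holomorphic_Hp_infinity(2)[of "\<lambda>\<zeta>. \<zeta> ^ n" 2 "\<gamma> z"] gz by (simp add: holomorphic_intros)
    also have "\<dots> = (\<integral>\<zeta>. \<zeta> ^ n \<partial>?Q)" by (rule integral_poisson_density[OF gz pm, symmetric])
    finally show ?thesis .
  qed
qed simp_all

lemma poisson_kernel_0: "norm \<zeta> = 1 \<Longrightarrow> poisson_kernel 0 \<zeta> = 1"
  by (simp add: poisson_kernel_def)

lemma automorphism_distr:
  assumes \<gamma>: "\<gamma> \<in> disc_automorphisms"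
  shows "distr circle_measure circle_measure \<gamma> = density circle_measure (\<lambda>\<zeta>. ennreal (poisson_kernel (\<gamma> 0) \<zeta>))"
proof -
  have "density circle_measure (\<lambda>\<zeta>. ennreal (poisson_kernel 0 \<zeta>)) = density circle_measure (\<lambda>_. 1)"
    by (rule density_cong) (auto intro!: AE_circleI simp: poisson_kernel_0)
  then have "density circle_measure (\<lambda>\<zeta>. ennreal (poisson_kernel 0 \<zeta>)) = circle_measure"
    by (simp add: density_1)
  then show ?thesis using automorphism_pushforward[OF \<gamma>, of 0] by simp
qed

lemma AE_automorphism:
  assumes \<gamma>: "\<gamma> \<in> disc_automorphisms" and P: "AE \<zeta> in circle_measure. P \<zeta>"
  shows "AE \<zeta> in circle_measure. P (\<gamma> \<zeta>)"
proof -
  have "AE \<zeta> in distr circle_measure circle_measure \<gamma>. P \<zeta>"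
    unfolding automorphism_distr[OF \<gamma>] using P by (subst AE_density) (auto elim: eventually_mono)
  then show ?thesis by (rule AE_distrD[OF automorphism_measurable[OF \<gamma>]])
qed

lemma integrable_automorphism:
  fixes f :: "complex \<Rightarrow> 'b::{banach, second_countable_topology}"
  assumes \<gamma>: "\<gamma> \<in> disc_automorphisms" and f: "integrable circle_measure f"
  shows "integrable circle_measure (\<lambda>\<zeta>. f (\<gamma> \<zeta>))"
    "(\<integral>\<zeta>. f (\<gamma> \<zeta>) \<partial>circle_measure) = (\<integral>\<zeta>. poisson_kernel (\<gamma> 0) \<zeta> *\<^sub>R f \<zeta> \<partial>circle_measure)"
proof -
  note m = automorphism_measurable[OF \<gamma>]
  note [measurable] = borel_measurable_integrable[OF f]
  have g0: "norm (\<gamma> 0) < 1" by (rule automorphism_norm(1)[OF \<gamma>]) simp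
  have pp: "AE \<zeta> in circle_measure. 0 \<le> poisson_kernel (\<gamma> 0) \<zeta>"
    using poisson_kernel_pos[OF _ g0] by (auto intro!: AE_circleI less_imp_le)
  have "integrable circle_measure (\<lambda>\<zeta>. poisson_kernel (\<gamma> 0) \<zeta> *\<^sub>R f \<zeta>)"
  proof (rule Bochner_Integration.integrable_bound)
    show "integrable circle_measure (\<lambda>\<zeta>. (1 / (1 - norm (\<gamma> 0))\<^sup>2) *\<^sub>R f \<zeta>)" using f by auto
    show "AE \<zeta> in circle_measure. norm (poisson_kernel (\<gamma> 0) \<zeta> *\<^sub>R f \<zeta>) \<le> norm ((1 / (1 - norm (\<gamma> 0))\<^sup>2) *\<^sub>R f \<zeta>)"
    proof (rule AE_circleI)
      fix \<zeta> :: complex assume "norm \<zeta> = 1"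
      then have "\<bar>poisson_kernel (\<gamma> 0) \<zeta>\<bar> \<le> \<bar>1 / (1 - norm (\<gamma> 0))\<^sup>2\<bar>"
        using poisson_kernel_le[OF _ g0] poisson_kernel_pos[OF _ g0] by force
      then show "norm (poisson_kernel (\<gamma> 0) \<zeta> *\<^sub>R f \<zeta>) \<le> norm ((1 / (1 - norm (\<gamma> 0))\<^sup>2) *\<^sub>R f \<zeta>)"
        unfolding norm_scaleR by (rule mult_right_mono) simp
    qed
  qed measurable
  then have "integrable (distr circle_measure circle_measure \<gamma>) f"
    unfolding automorphism_distr[OF \<gamma>] by (subst integrable_density) (use pp in auto)
  then show "integrable circle_measure (\<lambda>\<zeta>. f (\<gamma> \<zeta>))" by (subst (asm) integrable_distr_eq[OF m]) auto
  have "(\<integral>\<zeta>. f (\<gamma> \<zeta>) \<partial>circle_measure) = (\<integral>\<zeta>. f \<zeta> \<partial>distr circle_measure circle_measure \<gamma>)"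
    by (rule integral_distr[OF m, symmetric]) measurable
  also have "\<dots> = (\<integral>\<zeta>. poisson_kernel (\<gamma> 0) \<zeta> *\<^sub>R f \<zeta> \<partial>circle_measure)"
    unfolding automorphism_distr[OF \<gamma>] by (rule integral_density) (use pp in auto)
  finally show "(\<integral>\<zeta>. f (\<gamma> \<zeta>) \<partial>circle_measure) = (\<integral>\<zeta>. poisson_kernel (\<gamma> 0) \<zeta> *\<^sub>R f \<zeta> \<partial>circle_measure)" .
qed

lemma square_integrable_automorphism:
  fixes f :: "complex \<Rightarrow> 'b::euclidean_space"
  assumes \<gamma>: "\<gamma> \<in> disc_automorphisms" and f: "square_integrable circle_measure f"
  shows "square_integrable circle_measure (\<lambda>\<zeta>. f (\<gamma> \<zeta>))"
    "l2norm circle_measure (\<lambda>\<zeta>. f (\<gamma> \<zeta>)) \<le> (1 / (1 - norm (\<gamma> 0))) * l2norm circle_measure f"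
proof -
  note i = integrable_automorphism[OF \<gamma> square_integrable_integrable[OF f]]
  have [measurable]: "f \<in> borel_measurable circle_measure" using f by measurable
  have g0: "norm (\<gamma> 0) < 1" by (rule automorphism_norm(1)[OF \<gamma>]) simp
  show s: "square_integrable circle_measure (\<lambda>\<zeta>. f (\<gamma> \<zeta>))"
    unfolding square_integrable_def using i(1) measurable_compose[OF automorphism_measurable[OF \<gamma>], of f borel] by simp
  have "(l2norm circle_measure (\<lambda>\<zeta>. f (\<gamma> \<zeta>)))\<^sup>2 = (\<integral>\<zeta>. poisson_kernel (\<gamma> 0) \<zeta> *\<^sub>R (norm (f \<zeta>))\<^sup>2 \<partial>circle_measure)"
    unfolding l2norm_square by (rule i(2))
  also have "\<dots> \<le> (\<integral>\<zeta>. (1 / (1 - norm (\<gamma> 0))\<^sup>2) * (norm (f \<zeta>))\<^sup>2 \<partial>circle_measure)"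
  proof (rule integral_mono_AE')
    show "integrable circle_measure (\<lambda>\<zeta>. (1 / (1 - norm (\<gamma> 0))\<^sup>2) * (norm (f \<zeta>))\<^sup>2)"
      using square_integrable_integrable[OF f] by simp
    show "AE \<zeta> in circle_measure. poisson_kernel (\<gamma> 0) \<zeta> *\<^sub>R (norm (f \<zeta>))\<^sup>2 \<le> (1 / (1 - norm (\<gamma> 0))\<^sup>2) * (norm (f \<zeta>))\<^sup>2"
    proof (rule AE_circleI)
      fix \<zeta> :: complex assume "norm \<zeta> = 1"
      from mult_right_mono[OF poisson_kernel_le[OF this g0], of "(norm (f \<zeta>))\<^sup>2"]
      show "poisson_kernel (\<gamma> 0) \<zeta> *\<^sub>R (norm (f \<zeta>))\<^sup>2 \<le> (1 / (1 - norm (\<gamma> 0))\<^sup>2) * (norm (f \<zeta>))\<^sup>2"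
        by simp
    qed
    show "AE \<zeta> in circle_measure. 0 \<le> (1 / (1 - norm (\<gamma> 0))\<^sup>2) * (norm (f \<zeta>))\<^sup>2"
      by (rule AE_circleI) simp
  qed
  also have "\<dots> = ((1 / (1 - norm (\<gamma> 0))) * l2norm circle_measure f)\<^sup>2"
    by (simp add: power_mult_distrib l2norm_square power_divide)
  finally show "l2norm circle_measure (\<lambda>\<zeta>. f (\<gamma> \<zeta>)) \<le> (1 / (1 - norm (\<gamma> 0))) * l2norm circle_measure f"
    by (rule power2_le_imp_le) (use g0 in simp)
qed

lemma disc_extension_automorphism:
  assumes \<gamma>: "\<gamma> \<in> disc_automorphisms" and f: "f \<in> borel_measurable circle_measure" and z: "norm z < 1"
  shows "disc_extension (\<lambda>\<zeta>. f (\<gamma> \<zeta>)) z = disc_extension f (\<gamma> z)"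
proof -
  let ?P = "density circle_measure (\<lambda>\<zeta>. ennreal (poisson_kernel z \<zeta>))"
  note m = automorphism_measurable[OF \<gamma>]
  have mP: "\<gamma> \<in> measurable ?P circle_measure" using m by simp
  have "disc_extension (\<lambda>\<zeta>. f (\<gamma> \<zeta>)) z = (\<integral>\<zeta>. f (\<gamma> \<zeta>) \<partial>?P)"
    by (rule integral_poisson_density[OF z measurable_compose[OF m f], symmetric])
  also have "\<dots> = (\<integral>\<zeta>. f \<zeta> \<partial>distr ?P circle_measure \<gamma>)" by (rule integral_distr[OF mP f, symmetric])
  also have "\<dots> = disc_extension f (\<gamma> z)"
    unfolding automorphism_pushforward[OF \<gamma> z]
    by (rule integral_poisson_density[OF automorphism_norm(1)[OF \<gamma> z] f])
  finally show ?thesis .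
qed

text \<open>Writing \<open>\<zeta>\<^sup>n\<close> as \<open>\<delta>(\<gamma>(\<zeta>))\<^sup>n\<close>, the moments of \<open>f \<circ> \<gamma>\<close> become the values at \<open>\<gamma>(0)\<close> of the extensions of \<open>f \<delta>\<^sup>n\<close>,
  and these contain the factor \<open>\<delta>(\<gamma>(0))\<^sup>n = 0\<close>.\<close>

lemma Hp_2_automorphism:
  assumes \<gamma>: "\<gamma> \<in> disc_automorphisms" and \<delta>: "\<delta> \<in> disc_automorphisms"
    and inv: "\<And>z. norm z \<le> 1 \<Longrightarrow> \<delta> (\<gamma> z) = z" and f: "f \<in> Hp 2"
  shows "(\<lambda>\<zeta>. f (\<gamma> \<zeta>)) \<in> Hp 2"
proof -
  note fs = Hp_2_square_integrable[OF f]
  have [measurable]: "f \<in> borel_measurable circle_measure" using fs by measurable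
  have g0: "norm (\<gamma> 0) < 1" by (rule automorphism_norm(1)[OF \<gamma>]) simp
  have "(\<integral>\<zeta>. f (\<gamma> \<zeta>) * \<zeta> ^ n \<partial>circle_measure) = 0" if n: "n \<ge> 1" for n
  proof -
    note D = Hp_infinity_imp_2[OF automorphism_power_Hp_infinity(1)[OF \<delta>, of n]]
    have "(\<integral>\<zeta>. f (\<gamma> \<zeta>) * \<zeta> ^ n \<partial>circle_measure) = disc_extension (\<lambda>\<zeta>. f (\<gamma> \<zeta>) * \<delta> (\<gamma> \<zeta>) ^ n) 0"
      unfolding disc_extension_poisson
      by (intro Bochner_Integration.integral_cong refl) (simp add: inv poisson_kernel_0)
    also have "\<dots> = disc_extension (\<lambda>\<zeta>. f \<zeta> * \<delta> \<zeta> ^ n) (\<gamma> 0)"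
      by (rule disc_extension_automorphism[OF \<gamma>, of "\<lambda>\<zeta>. f \<zeta> * \<delta> \<zeta> ^ n"])
         (use Hp_2_square_integrable[OF D] in \<open>auto simp: square_integrable_def\<close>)
    also have "\<dots> = disc_extension f (\<gamma> 0) * \<delta> (\<gamma> 0) ^ n"
      using Hp_2_mult(2)[OF f D g0] automorphism_power_Hp_infinity(2)[OF \<delta> g0] by simp
    also have "\<dots> = 0" using inv[of 0] n by (simp add: power_0_left)
    finally show ?thesis .
  qed
  then show ?thesis using square_integrable_automorphism(1)[OF \<gamma> fs] by (simp add: Hp_2_iff)
qed

subsection \<open>Groups of automorphisms\<close>

locale automorphism_group =
  fixes \<Gamma> :: "(complex \<Rightarrow> complex) set"
  assumes automorphisms: "\<Gamma> \<subseteq> disc_automorphisms" and subgroup: "subgroup \<Gamma> (BijGroup (cball 0 1))"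
begin

lemma automorphism: "\<gamma> \<in> \<Gamma> \<Longrightarrow> \<gamma> \<in> disc_automorphisms"
  using automorphisms by blast

lemma in_Bij: "\<gamma> \<in> \<Gamma> \<Longrightarrow> \<gamma> \<in> Bij (cball 0 1)"
  using subgroup.subset[OF subgroup] by (auto simp: BijGroup_def)

lemma group_mult:
  assumes "\<gamma> \<in> \<Gamma>" "\<delta> \<in> \<Gamma>"
  shows "\<gamma> \<otimes>\<^bsub>BijGroup (cball 0 1)\<^esub> \<delta> \<in> \<Gamma>" "norm z \<le> 1 \<Longrightarrow> (\<gamma> \<otimes>\<^bsub>BijGroup (cball 0 1)\<^esub> \<delta>) z = \<gamma> (\<delta> z)"
proof -
  show "\<gamma> \<otimes>\<^bsub>BijGroup (cball 0 1)\<^esub> \<delta> \<in> \<Gamma>" by (rule subgroup.m_closed[OF subgroup assms])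
  show "norm z \<le> 1 \<Longrightarrow> (\<gamma> \<otimes>\<^bsub>BijGroup (cball 0 1)\<^esub> \<delta>) z = \<gamma> (\<delta> z)"
    using in_Bij[OF assms(1)] in_Bij[OF assms(2)] by (simp add: BijGroup_def compose_def)
qed

lemma inverse_automorphism:
  assumes "\<gamma> \<in> \<Gamma>"
  obtains \<delta> where "\<delta> \<in> \<Gamma>" "\<And>z. norm z \<le> 1 \<Longrightarrow> \<delta> (\<gamma> z) = z"
proof -
  interpret G: group "BijGroup (cball (0::complex) 1)" by (rule group_BijGroup)
  have c: "\<gamma> \<in> carrier (BijGroup (cball 0 1))" using in_Bij[OF assms] by (simp add: BijGroup_def)
  define \<delta> where "\<delta> = inv\<^bsub>BijGroup (cball 0 1)\<^esub> \<gamma>"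
  have \<delta>: "\<delta> \<in> \<Gamma>" unfolding \<delta>_def by (rule subgroup.m_inv_closed[OF subgroup assms])
  have "\<delta> (\<gamma> z) = z" if "norm z \<le> 1" for z
  proof -
    have "\<delta> (\<gamma> z) = (\<delta> \<otimes>\<^bsub>BijGroup (cball 0 1)\<^esub> \<gamma>) z" using group_mult(2)[OF \<delta> assms that] by simp
    also have "\<dots> = \<one>\<^bsub>BijGroup (cball 0 1)\<^esub> z" unfolding \<delta>_def by (simp add: G.l_inv[OF c])
    also have "\<dots> = z" using that by (simp add: BijGroup_def)
    finally show ?thesis .
  qed
  with \<delta> show ?thesis by (rule that)
qed

lemma Hp_2_compose: "\<gamma> \<in> \<Gamma> \<Longrightarrow> f \<in> Hp 2 \<Longrightarrow> (\<lambda>\<zeta>. f (\<gamma> \<zeta>)) \<in> Hp 2"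
  using inverse_automorphism Hp_2_automorphism automorphism by metis

lemma norm_at_0: "\<gamma> \<in> \<Gamma> \<Longrightarrow> norm (\<gamma> 0) < 1"
  using automorphism_norm(1)[OF automorphism, of \<gamma> 0] by simp

end

section \<open>Character-automorphic functions and their kernels\<close>

text \<open>Composition with an automorphism is a bounded operator on \<open>L\<^sup>2\<close>.\<close>

lemma equivariance_l2_limit:
  fixes f :: "complex \<Rightarrow> complex"
  assumes \<gamma>: "\<gamma> \<in> disc_automorphisms"
    and g: "\<And>n. square_integrable circle_measure (g n)" and f: "square_integrable circle_measure f"
    and lim: "(\<lambda>n. l2norm circle_measure (\<lambda>\<zeta>. g n \<zeta> - f \<zeta>)) \<longlonglongrightarrow> 0"
    and eq: "\<And>n. AE \<zeta> in circle_measure. g n (\<gamma> \<zeta>) = c * g n \<zeta>"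
  shows "AE \<zeta> in circle_measure. f (\<gamma> \<zeta>) = c * f \<zeta>"
proof -
  define C where "C = 1 / (1 - norm (\<gamma> 0))"
  note comp = square_integrable_automorphism[OF \<gamma>]
  have cf: "square_integrable circle_measure (\<lambda>\<zeta>. c * f \<zeta>)" and cg: "square_integrable circle_measure (\<lambda>\<zeta>. c * g n \<zeta>)" for n
    using f g by (simp_all add: square_integrable_cmult)
  have d: "square_integrable circle_measure (\<lambda>\<zeta>. g n \<zeta> - f \<zeta>)" for n using f g by auto
  have le: "l2norm circle_measure (\<lambda>\<zeta>. f (\<gamma> \<zeta>) - c * f \<zeta>) \<le> (C + norm c) * l2norm circle_measure (\<lambda>\<zeta>. g n \<zeta> - f \<zeta>)" for n
  proof -
    have "l2norm circle_measure (\<lambda>\<zeta>. f (\<gamma> \<zeta>) - c * f \<zeta>)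
        \<le> l2norm circle_measure (\<lambda>\<zeta>. f (\<gamma> \<zeta>) - g n (\<gamma> \<zeta>)) + l2norm circle_measure (\<lambda>\<zeta>. g n (\<gamma> \<zeta>) - c * f \<zeta>)"
      by (rule l2norm_triangle_diff[OF comp(1)[OF f] comp(1)[OF g] cf])
    also have "l2norm circle_measure (\<lambda>\<zeta>. f (\<gamma> \<zeta>) - g n (\<gamma> \<zeta>)) \<le> C * l2norm circle_measure (\<lambda>\<zeta>. g n \<zeta> - f \<zeta>)"
      using comp(2)[OF d, of n] by (simp add: C_def l2norm_diff_commute[of _ "\<lambda>\<zeta>. f (\<gamma> \<zeta>)"])
    also have "l2norm circle_measure (\<lambda>\<zeta>. g n (\<gamma> \<zeta>) - c * f \<zeta>) = l2norm circle_measure (\<lambda>\<zeta>. c * (g n \<zeta> - f \<zeta>))"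
    proof (rule l2norm_cong_AE)
      show "AE \<zeta> in circle_measure. norm (g n (\<gamma> \<zeta>) - c * f \<zeta>) = norm (c * (g n \<zeta> - f \<zeta>))"
        using eq[of n] by eventually_elim (simp add: right_diff_distrib)
    qed (intro square_integrable_diff[OF comp(1)[OF g] cf] square_integrable_cmult[OF d])+
    also have "\<dots> = norm c * l2norm circle_measure (\<lambda>\<zeta>. g n \<zeta> - f \<zeta>)"
      by (simp add: l2norm_def norm_mult power_mult_distrib real_sqrt_mult)
    finally show ?thesis by (simp add: distrib_right)
  qed
  have "(\<lambda>n. (C + norm c) * l2norm circle_measure (\<lambda>\<zeta>. g n \<zeta> - f \<zeta>)) \<longlonglongrightarrow> 0"
    using tendsto_mult_right_zero[OF lim] by simp
  then have "l2norm circle_measure (\<lambda>\<zeta>. f (\<gamma> \<zeta>) - c * f \<zeta>) \<le> 0"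
    by (rule LIMSEQ_le_const) (use le in auto)
  then have "l2norm circle_measure (\<lambda>\<zeta>. f (\<gamma> \<zeta>) - c * f \<zeta>) = 0"
    using l2norm_nonneg[of circle_measure "\<lambda>\<zeta>. f (\<gamma> \<zeta>) - c * f \<zeta>"] by linarith
  from l2norm_eq_0_AE[OF square_integrable_diff[OF comp(1)[OF f] cf] this]
  show ?thesis by eventually_elim simp
qed

lemma Hp_2_add:
  assumes "f \<in> Hp 2" "g \<in> Hp 2" shows "(\<lambda>\<zeta>. f \<zeta> + g \<zeta>) \<in> Hp 2"
  using assms square_integrable_power by (auto simp: Hp_2_iff distrib_right l2_mult_integrable)

lemma Hp_char_iff: "f \<in> Hp_char p \<Gamma> \<sigma> \<longleftrightarrow> f \<in> Hp p \<and> (\<forall>\<gamma>\<in>\<Gamma>. AE \<zeta> in circle_measure. f (\<gamma> \<zeta>) = \<sigma> \<gamma> * f \<zeta>)"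
  by (simp add: Hp_char_def)

lemma Hp_inv_iff: "f \<in> Hp_inv p \<Gamma> \<longleftrightarrow> f \<in> Hp p \<and> (\<forall>\<gamma>\<in>\<Gamma>. AE \<zeta> in circle_measure. f (\<gamma> \<zeta>) = f \<zeta>)"
  by (simp add: Hp_inv_def)

lemma Hp_char_add:
  assumes "f \<in> Hp_char 2 \<Gamma> \<sigma>" "g \<in> Hp_char 2 \<Gamma> \<sigma>" shows "(\<lambda>\<zeta>. f \<zeta> + g \<zeta>) \<in> Hp_char 2 \<Gamma> \<sigma>"
  unfolding Hp_char_iff
proof (intro conjI ballI)
  show "(\<lambda>\<zeta>. f \<zeta> + g \<zeta>) \<in> Hp 2" using assms by (intro Hp_2_add) (auto simp: Hp_char_iff)
  fix \<gamma> assume "\<gamma> \<in> \<Gamma>"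
  then have "AE \<zeta> in circle_measure. f (\<gamma> \<zeta>) = \<sigma> \<gamma> * f \<zeta>" "AE \<zeta> in circle_measure. g (\<gamma> \<zeta>) = \<sigma> \<gamma> * g \<zeta>"
    using assms by (auto simp: Hp_char_iff)
  then show "AE \<zeta> in circle_measure. f (\<gamma> \<zeta>) + g (\<gamma> \<zeta>) = \<sigma> \<gamma> * (f \<zeta> + g \<zeta>)"
    by eventually_elim (simp add: distrib_left)
qed

lemma Hp_char_cmult:
  assumes "f \<in> Hp_char 2 \<Gamma> \<sigma>" shows "(\<lambda>\<zeta>. c * f \<zeta>) \<in> Hp_char 2 \<Gamma> \<sigma>"
  unfolding Hp_char_iff
proof (intro conjI ballI)
  show "(\<lambda>\<zeta>. c * f \<zeta>) \<in> Hp 2" using assms by (intro Hp_2_cmult) (auto simp: Hp_char_iff)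
  fix \<gamma> assume "\<gamma> \<in> \<Gamma>"
  then have "AE \<zeta> in circle_measure. f (\<gamma> \<zeta>) = \<sigma> \<gamma> * f \<zeta>" using assms by (auto simp: Hp_char_iff)
  then show "AE \<zeta> in circle_measure. c * f (\<gamma> \<zeta>) = \<sigma> \<gamma> * (c * f \<zeta>)"
    by eventually_elim simp
qed

lemma Hp_char_zero: "(\<lambda>\<zeta>. 0) \<in> Hp_char 2 \<Gamma> \<sigma>"
  by (simp add: Hp_char_iff Hp_2_iff)

lemma Hp_char_sum:
  assumes "\<And>i. i \<in> I \<Longrightarrow> f i \<in> Hp_char 2 \<Gamma> \<sigma>" shows "(\<lambda>\<zeta>. \<Sum>i\<in>I. f i \<zeta>) \<in> Hp_char 2 \<Gamma> \<sigma>"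
  using assms
proof (induction I rule: infinite_finite_induct)
  case (insert i I) then show ?case using Hp_char_add by simp
qed (simp_all add: Hp_char_zero)

lemma Hp_inv_mult_char:
  assumes f: "f \<in> Hp_inv \<infinity> \<Gamma>" and g: "g \<in> Hp_char 2 \<Gamma> \<sigma>"
  shows "(\<lambda>\<zeta>. f \<zeta> * g \<zeta>) \<in> Hp_char 2 \<Gamma> \<sigma>"
  unfolding Hp_char_iff
proof (intro conjI ballI)
  show "(\<lambda>\<zeta>. f \<zeta> * g \<zeta>) \<in> Hp 2" using f g unfolding Hp_char_iff Hp_inv_iff by (intro Hp_2_mult_infinity) blast+
  fix \<gamma> assume "\<gamma> \<in> \<Gamma>"
  then have "AE \<zeta> in circle_measure. f (\<gamma> \<zeta>) = f \<zeta>" "AE \<zeta> in circle_measure. g (\<gamma> \<zeta>) = \<sigma> \<gamma> * g \<zeta>"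
    using f g unfolding Hp_char_iff Hp_inv_iff by blast+
  then show "AE \<zeta> in circle_measure. f (\<gamma> \<zeta>) * g (\<gamma> \<zeta>) = \<sigma> \<gamma> * (f \<zeta> * g \<zeta>)"
    by eventually_elim simp
qed

lemma Hp_char_2: "f \<in> Hp_char 2 \<Gamma> \<sigma> \<Longrightarrow> f \<in> Hp 2"
  by (simp add: Hp_char_iff)

lemma Hp_char_square_integrable: "f \<in> Hp_char 2 \<Gamma> \<sigma> \<Longrightarrow> square_integrable circle_measure f"
  by (simp add: Hp_char_iff Hp_2_iff)

lemma l2inner_eq_Re:
  fixes f g :: "'a \<Rightarrow> complex"
  assumes "square_integrable M f" "square_integrable M g"
  shows "l2inner M f g = Re (\<integral>x. g x * cnj (f x) \<partial>M)"
proof -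
  have "l2inner M f g = (\<integral>x. Re (g x * cnj (f x)) \<partial>M)"
    by (simp add: l2inner_def inner_complex_def mult.commute)
  also have "\<dots> = Re (\<integral>x. g x * cnj (f x) \<partial>M)"
    by (rule integral_Re[OF l2_mult_integrable[OF assms(2) square_integrable_cnj[OF assms(1)]]])
  finally show ?thesis .
qed

lemma l2norm_square_complex:
  fixes f :: "'a \<Rightarrow> complex"
  shows "complex_of_real ((l2norm M f)\<^sup>2) = (\<integral>x. f x * cnj (f x) \<partial>M)"
proof -
  have "complex_of_real ((l2norm M f)\<^sup>2) = (\<integral>x. complex_of_real ((norm (f x))\<^sup>2) \<partial>M)"
    unfolding l2norm_square by (simp del: of_real_power)
  then show ?thesis by (simp only: complex_norm_square)
qed

context automorphism_group
begin

lemma Hp_char_l2_limit: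
  assumes "\<And>n. g n \<in> Hp_char 2 \<Gamma> \<sigma>" "square_integrable circle_measure f"
    "(\<lambda>n. l2norm circle_measure (\<lambda>\<zeta>. g n \<zeta> - f \<zeta>)) \<longlonglongrightarrow> 0"
  shows "f \<in> Hp_char 2 \<Gamma> \<sigma>"
  unfolding Hp_char_iff
proof (intro conjI ballI)
  show "f \<in> Hp 2"
    by (rule Hp_2_l2_limit[OF Hp_char_square_integrable[OF assms(1)] assms(2,3) Hp_char_2[OF assms(1)]])
  fix \<gamma> assume \<gamma>: "\<gamma> \<in> \<Gamma>"
  show "AE \<zeta> in circle_measure. f (\<gamma> \<zeta>) = \<sigma> \<gamma> * f \<zeta>"
    by (rule equivariance_l2_limit[OF automorphism[OF \<gamma>] Hp_char_square_integrable[OF assms(1)] assms(2,3)])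
       (use assms(1) \<gamma> in \<open>simp add: Hp_char_iff\<close>)
qed

text \<open>The kernel of the subspace is the orthogonal projection of the Szego kernel, obtained as the difference of
  the latter and an element of least norm in its coset.\<close>

lemma kernel_exists:
  assumes w: "norm w < 1"
  shows "\<exists>k. k \<in> Hp_char 2 \<Gamma> \<sigma> \<and>
    (\<forall>f\<in>Hp_char 2 \<Gamma> \<sigma>. (\<integral>\<zeta>. f \<zeta> * cnj (k \<zeta>) \<partial>circle_measure) = disc_extension f w)"
proof -
  note ks = szego_kernel_square_integrable[OF w]
  define S where "S = {\<lambda>\<zeta>. szego_kernel w \<zeta> - h \<zeta> | h. h \<in> Hp_char 2 \<Gamma> \<sigma>}"
  have S_I: "(\<lambda>\<zeta>. szego_kernel w \<zeta> - h \<zeta>) \<in> S" if "h \<in> Hp_char 2 \<Gamma> \<sigma>" for h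
    unfolding S_def mem_Collect_eq using that by (intro exI[of _ h] conjI refl)
  have S_sq: "square_integrable circle_measure g" if "g \<in> S" for g
    using that ks Hp_char_square_integrable by (auto simp: S_def)
  have S_mid: "(\<lambda>\<zeta>. (1/2) *\<^sub>R (f \<zeta> + g \<zeta>)) \<in> S" if fg: "f \<in> S" "g \<in> S" for f g
  proof -
    obtain a b where ab: "f = (\<lambda>\<zeta>. szego_kernel w \<zeta> - a \<zeta>)" "g = (\<lambda>\<zeta>. szego_kernel w \<zeta> - b \<zeta>)"
      "a \<in> Hp_char 2 \<Gamma> \<sigma>" "b \<in> Hp_char 2 \<Gamma> \<sigma>" using fg by (auto simp: S_def)
    have "(\<lambda>\<zeta>. (1/2) * (a \<zeta> + b \<zeta>)) \<in> Hp_char 2 \<Gamma> \<sigma>" by (intro Hp_char_cmult Hp_char_add ab)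
    moreover have "(1/2) *\<^sub>R (f \<zeta> + g \<zeta>) = szego_kernel w \<zeta> - (1/2) * (a \<zeta> + b \<zeta>)" for \<zeta>
      by (simp add: ab scaleR_conv_of_real field_simps)
    ultimately show ?thesis unfolding S_def by auto
  qed
  have S0: "szego_kernel w \<in> S" unfolding S_def using Hp_char_zero by force
  obtain p g where p: "\<And>n. g n \<in> S" "square_integrable circle_measure p"
    "(\<lambda>n::nat. l2norm circle_measure (\<lambda>\<zeta>. g n \<zeta> - p \<zeta>)) \<longlonglongrightarrow> 0"
    and min: "\<And>h. h \<in> S \<Longrightarrow> l2norm circle_measure p \<le> l2norm circle_measure h"
    by (rule circle.l2_nested_convex[of "\<lambda>_. S" "l2norm circle_measure (szego_kernel w)"])
       (use S_sq S_mid S0 in auto)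
  define k where "k \<zeta> = szego_kernel w \<zeta> - p \<zeta>" for \<zeta>
  have ksq: "square_integrable circle_measure k" unfolding k_def[abs_def] using ks p(2) by auto
  have "\<exists>h. g n = (\<lambda>\<zeta>. szego_kernel w \<zeta> - h \<zeta>) \<and> h \<in> Hp_char 2 \<Gamma> \<sigma>" for n
    using p(1)[of n] by (auto simp: S_def)
  then obtain h where h: "\<And>n. g n = (\<lambda>\<zeta>. szego_kernel w \<zeta> - h n \<zeta>)" "\<And>n. h n \<in> Hp_char 2 \<Gamma> \<sigma>" by metis
  have "(\<lambda>n. l2norm circle_measure (\<lambda>\<zeta>. h n \<zeta> - k \<zeta>)) \<longlonglongrightarrow> 0"
  proof -
    have "l2norm circle_measure (\<lambda>\<zeta>. h n \<zeta> - k \<zeta>) = l2norm circle_measure (\<lambda>\<zeta>. g n \<zeta> - p \<zeta>)" for n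
      using l2norm_minus[of circle_measure "\<lambda>\<zeta>. g n \<zeta> - p \<zeta>"] by (simp add: h k_def algebra_simps)
    then show ?thesis using p(3) by simp
  qed
  from Hp_char_l2_limit[OF h(2) ksq this] have kH: "k \<in> Hp_char 2 \<Gamma> \<sigma>" .
  have orth: "l2inner circle_measure p f = 0" if f: "f \<in> Hp_char 2 \<Gamma> \<sigma>" for f
  proof -
    note fs = Hp_char_square_integrable[OF f]
    have "0 \<le> 0 + 2 * t * (l2inner circle_measure p f) + t\<^sup>2 * (l2norm circle_measure f)\<^sup>2" for t
    proof -
      have "(\<lambda>\<zeta>. k \<zeta> + (- of_real t) * f \<zeta>) \<in> Hp_char 2 \<Gamma> \<sigma>" by (intro Hp_char_add kH Hp_char_cmult f)
      then have "(\<lambda>\<zeta>. szego_kernel w \<zeta> - (k \<zeta> + (- of_real t) * f \<zeta>)) \<in> S" by (rule S_I)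
      then have "(\<lambda>\<zeta>. p \<zeta> + t *\<^sub>R f \<zeta>) \<in> S" by (simp add: k_def scaleR_conv_of_real algebra_simps)
      from min[OF this] have "(l2norm circle_measure p)\<^sup>2 \<le> (l2norm circle_measure (\<lambda>\<zeta>. p \<zeta> + t *\<^sub>R f \<zeta>))\<^sup>2"
        by (rule power_mono) simp
      also have "\<dots> = (l2norm circle_measure p)\<^sup>2 + 2 * t * l2inner circle_measure p f + t\<^sup>2 * (l2norm circle_measure f)\<^sup>2"
        using l2norm_add_square[OF p(2) square_integrable_scaleR[OF fs], of t]
        by (simp add: l2norm_scaleR l2inner_def power_mult_distrib)
      finally show ?thesis by simp
    qed
    then have "(l2inner circle_measure p f)\<^sup>2 \<le> 0 * (l2norm circle_measure f)\<^sup>2"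
      by (rule quadratic_nonneg_imp_discriminant) auto
    then show ?thesis by simp
  qed
  have "(\<integral>\<zeta>. f \<zeta> * cnj (k \<zeta>) \<partial>circle_measure) = disc_extension f w" if f: "f \<in> Hp_char 2 \<Gamma> \<sigma>" for f
  proof -
    note fs = Hp_char_square_integrable[OF f]
    have "Re (\<integral>\<zeta>. f \<zeta> * cnj (p \<zeta>) \<partial>circle_measure) = 0"
      using orth[OF f] l2inner_eq_Re[OF p(2) fs] by simp
    moreover have "Im (\<integral>\<zeta>. f \<zeta> * cnj (p \<zeta>) \<partial>circle_measure) = 0"
      using orth[OF Hp_char_cmult[OF f, of \<i>]] l2inner_eq_Re[OF p(2) square_integrable_cmult[OF fs, of \<i>]]
      by (simp add: mult.assoc)
    ultimately have "(\<integral>\<zeta>. f \<zeta> * cnj (p \<zeta>) \<partial>circle_measure) = 0" by (simp add: complex_eq_iff)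
    moreover have "(\<integral>\<zeta>. f \<zeta> * cnj (k \<zeta>) \<partial>circle_measure)
        = (\<integral>\<zeta>. f \<zeta> * cnj (szego_kernel w \<zeta>) \<partial>circle_measure) - (\<integral>\<zeta>. f \<zeta> * cnj (p \<zeta>) \<partial>circle_measure)"
      using l2_mult_integrable[OF fs square_integrable_cnj[OF ks]] l2_mult_integrable[OF fs square_integrable_cnj[OF p(2)]]
      by (simp add: k_def right_diff_distrib)
    ultimately show ?thesis
      using disc_extension_szego[OF Hp_2_imp_1[OF Hp_char_2[OF f]] w] by simp
  qed
  with kH show ?thesis by blast
qed

lemma kernel_function:
  assumes "norm w < 1"
  shows "kernel_function \<Gamma> \<sigma> w \<in> Hp_char 2 \<Gamma> \<sigma>"
    "f \<in> Hp_char 2 \<Gamma> \<sigma> \<Longrightarrow> (\<integral>\<zeta>. f \<zeta> * cnj (kernel_function \<Gamma> \<sigma> w \<zeta>) \<partial>circle_measure) = disc_extension f w"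
  using someI_ex[OF kernel_exists[OF assms, of \<sigma>]] unfolding kernel_function_def by auto

lemma kernel_combination_inner:
  fixes z :: "complex ^ 'n"
  assumes z: "\<And>j. norm (z $ j) < 1" and f: "f \<in> Hp_char 2 \<Gamma> \<sigma>"
  shows "(\<integral>\<zeta>. f \<zeta> * cnj (\<Sum>j\<in>UNIV. x j * kernel_function \<Gamma> \<sigma> (z $ j) \<zeta>) \<partial>circle_measure)
    = (\<Sum>j\<in>UNIV. cnj (x j) * disc_extension f (z $ j))"
proof -
  have i: "integrable circle_measure (\<lambda>\<zeta>. cnj (x j) * (f \<zeta> * cnj (kernel_function \<Gamma> \<sigma> (z $ j) \<zeta>)))" for j
    by (intro integrable_mult_right l2_mult_integrable square_integrable_cnj Hp_char_square_integrable[OF f]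
        Hp_char_square_integrable[OF kernel_function(1)] z)
  have "f \<zeta> * cnj (\<Sum>j\<in>UNIV. x j * kernel_function \<Gamma> \<sigma> (z $ j) \<zeta>)
      = (\<Sum>j\<in>UNIV. cnj (x j) * (f \<zeta> * cnj (kernel_function \<Gamma> \<sigma> (z $ j) \<zeta>)))" for \<zeta>
    by (simp add: sum_distrib_left mult_ac)
  then have "(\<integral>\<zeta>. f \<zeta> * cnj (\<Sum>j\<in>UNIV. x j * kernel_function \<Gamma> \<sigma> (z $ j) \<zeta>) \<partial>circle_measure)
      = (\<Sum>j\<in>UNIV. \<integral>\<zeta>. cnj (x j) * (f \<zeta> * cnj (kernel_function \<Gamma> \<sigma> (z $ j) \<zeta>)) \<partial>circle_measure)"
    using i by (simp only: Bochner_Integration.integral_sum)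
  then show ?thesis using kernel_function(2)[OF z f] by simp
qed

lemma kernel_combination_Hp_char:
  fixes z :: "complex ^ 'n"
  assumes z: "\<And>j. norm (z $ j) < 1"
  shows "(\<lambda>\<zeta>. \<Sum>j\<in>UNIV. x j * kernel_function \<Gamma> \<sigma> (z $ j) \<zeta>) \<in> Hp_char 2 \<Gamma> \<sigma>"
  by (intro Hp_char_sum Hp_char_cmult kernel_function(1) z)

lemma disc_extension_kernel_combination:
  fixes z :: "complex ^ 'n"
  assumes z: "\<And>j. norm (z $ j) < 1" and a: "norm a < 1"
  shows "disc_extension (\<lambda>\<zeta>. \<Sum>j\<in>UNIV. x j * kernel_function \<Gamma> \<sigma> (z $ j) \<zeta>) a
    = (\<Sum>j\<in>UNIV. x j * reproducing_kernel \<Gamma> \<sigma> a (z $ j))"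
proof -
  note k = kernel_function(1)[OF z]
  have i: "integrable circle_measure (\<lambda>\<zeta>. x j * (kernel_function \<Gamma> \<sigma> (z $ j) \<zeta> * cnj (szego_kernel a \<zeta>)))" for j
    by (intro integrable_mult_right l2_mult_integrable square_integrable_cnj szego_kernel_square_integrable[OF a]
        Hp_char_square_integrable[OF k])
  have "disc_extension (\<lambda>\<zeta>. \<Sum>j\<in>UNIV. x j * kernel_function \<Gamma> \<sigma> (z $ j) \<zeta>) a
      = (\<integral>\<zeta>. (\<Sum>j\<in>UNIV. x j * (kernel_function \<Gamma> \<sigma> (z $ j) \<zeta> * cnj (szego_kernel a \<zeta>))) \<partial>circle_measure)"
    unfolding disc_extension_szego[OF Hp_2_imp_1[OF Hp_char_2[OF kernel_combination_Hp_char[OF z]]] a]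
    by (simp only: sum_distrib_right mult.assoc)
  also have "\<dots> = (\<Sum>j\<in>UNIV. x j * (\<integral>\<zeta>. kernel_function \<Gamma> \<sigma> (z $ j) \<zeta> * cnj (szego_kernel a \<zeta>) \<partial>circle_measure))"
    using i by (simp add: Bochner_Integration.integral_sum)
  finally show ?thesis
    by (simp add: reproducing_kernel_def disc_extension_szego[OF Hp_2_imp_1[OF Hp_char_2[OF k]] a])
qed

lemma l2norm_kernel_combination:
  fixes z :: "complex ^ 'n"
  assumes z: "\<And>j. norm (z $ j) < 1"
  shows "complex_of_real ((l2norm circle_measure (\<lambda>\<zeta>. \<Sum>j\<in>UNIV. x j * kernel_function \<Gamma> \<sigma> (z $ j) \<zeta>))\<^sup>2)
    = (\<Sum>i\<in>UNIV. \<Sum>j\<in>UNIV. cnj (x i) * (x j * reproducing_kernel \<Gamma> \<sigma> (z $ i) (z $ j)))"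
  unfolding l2norm_square_complex kernel_combination_inner[OF z kernel_combination_Hp_char[OF z]]
  by (simp add: disc_extension_kernel_combination[OF z z] sum_distrib_left)

text \<open>The quadratic form of the Pick matrix is a difference of two squared norms. The functions on the two sides
  are a combination of kernels and its image under the adjoint of multiplication by an interpolating
  function.\<close>

lemma pos_semidef_pick_iff:
  fixes z w :: "complex ^ 'n"
  assumes z: "\<And>j. norm (z $ j) < 1"
  shows "pos_semidef (\<chi> i j. (1 - w $ i * cnj (w $ j)) * reproducing_kernel \<Gamma> \<sigma> (z $ i) (z $ j)) \<longleftrightarrow>
    (\<forall>x. l2norm circle_measure (\<lambda>\<zeta>. \<Sum>j\<in>UNIV. (x j * cnj (w $ j)) * kernel_function \<Gamma> \<sigma> (z $ j) \<zeta>)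
       \<le> l2norm circle_measure (\<lambda>\<zeta>. \<Sum>j\<in>UNIV. x j * kernel_function \<Gamma> \<sigma> (z $ j) \<zeta>))"
    (is "_ \<longleftrightarrow> (\<forall>x. ?T x \<le> ?K x)")
proof -
  have eq: "(\<Sum>i\<in>UNIV. \<Sum>j\<in>UNIV. cnj (x i) * ((1 - w $ i * cnj (w $ j)) * reproducing_kernel \<Gamma> \<sigma> (z $ i) (z $ j)) * x j)
      = complex_of_real ((?K x)\<^sup>2 - (?T x)\<^sup>2)" for x
    unfolding of_real_diff l2norm_kernel_combination[OF z] sum_subtractf[symmetric]
    by (simp add: algebra_simps)
  have nn: "complex_of_real ((?K x)\<^sup>2 - (?T x)\<^sup>2) \<in> \<real>\<^sub>\<ge>\<^sub>0 \<longleftrightarrow> ?T x \<le> ?K x" for x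
    unfolding nonneg_Reals_of_real_iff by (simp add: power_mono_iff)
  have "pos_semidef (\<chi> i j. (1 - w $ i * cnj (w $ j)) * reproducing_kernel \<Gamma> \<sigma> (z $ i) (z $ j)) \<longleftrightarrow>
    (\<forall>x :: complex ^ 'n. ?T (\<lambda>i. x $ i) \<le> ?K (\<lambda>i. x $ i))"
    unfolding pos_semidef_def vec_lambda_beta eq nn ..
  also have "\<dots> \<longleftrightarrow> (\<forall>x. ?T x \<le> ?K x)"
  proof (intro iffI allI)
    fix x :: "'n \<Rightarrow> complex"
    assume "\<forall>x :: complex ^ 'n. ?T (\<lambda>i. x $ i) \<le> ?K (\<lambda>i. x $ i)"
    then have "?T (\<lambda>i. (\<chi> i. x i) $ i) \<le> ?K (\<lambda>i. (\<chi> i. x i) $ i)" by blast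
    then show "?T x \<le> ?K x" by simp
  qed blast
  finally show ?thesis .
qed

text \<open>The inner product of \<open>f T\<close> and \<open>K\<close> is the squared norm of \<open>T\<close>: this is the adjoint relation, tested on \<open>T\<close> itself.
  The Cauchy--Schwarz inequality does the rest.\<close>

lemma pick_matrix_necessary:
  fixes z w :: "complex ^ 'n"
  assumes z: "\<And>j. norm (z $ j) < 1" and f: "f \<in> Hp_inv \<infinity> \<Gamma>" and f1: "Linf_norm f \<le> 1"
    and int: "\<And>j. disc_extension f (z $ j) = w $ j"
  shows "pos_semidef (\<chi> i j. (1 - w $ i * cnj (w $ j)) * reproducing_kernel \<Gamma> \<sigma> (z $ i) (z $ j))"
  unfolding pos_semidef_pick_iff[OF z]
proof
  fix x :: "'n \<Rightarrow> complex"
  define K where "K \<zeta> = (\<Sum>j\<in>UNIV. x j * kernel_function \<Gamma> \<sigma> (z $ j) \<zeta>)" for \<zeta>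
  define T where "T \<zeta> = (\<Sum>j\<in>UNIV. (x j * cnj (w $ j)) * kernel_function \<Gamma> \<sigma> (z $ j) \<zeta>)" for \<zeta>
  have K: "K \<in> Hp_char 2 \<Gamma> \<sigma>" and T: "T \<in> Hp_char 2 \<Gamma> \<sigma>"
    unfolding K_def[abs_def] T_def[abs_def] by (rule kernel_combination_Hp_char[OF z])+
  have fH: "f \<in> Hp \<infinity>" using f unfolding Hp_inv_iff by blast
  have fT: "(\<lambda>\<zeta>. f \<zeta> * T \<zeta>) \<in> Hp_char 2 \<Gamma> \<sigma>" by (rule Hp_inv_mult_char[OF f T])
  have fb: "AE \<zeta> in circle_measure. norm (f \<zeta>) \<le> 1"
    using f1 Linf_norm_le_iff[of f 1] fH unfolding Hp_infinity_iff by (simp add: one_ereal_def)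
  note s = Hp_char_square_integrable[OF K] Hp_char_square_integrable[OF T] Hp_char_square_integrable[OF fT]
  have "(\<integral>\<zeta>. (f \<zeta> * T \<zeta>) * cnj (K \<zeta>) \<partial>circle_measure) = (\<Sum>j\<in>UNIV. cnj (x j) * disc_extension (\<lambda>\<zeta>. f \<zeta> * T \<zeta>) (z $ j))"
    unfolding K_def by (rule kernel_combination_inner[OF z fT])
  also have "\<dots> = (\<Sum>j\<in>UNIV. cnj (x j * cnj (w $ j)) * disc_extension T (z $ j))"
    using Hp_2_mult(2)[OF Hp_infinity_imp_2[OF fH] Hp_char_2[OF T] z] by (simp add: int mult_ac)
  also have "\<dots> = (\<integral>\<zeta>. T \<zeta> * cnj (T \<zeta>) \<partial>circle_measure)"
    using kernel_combination_inner[OF z T, of "\<lambda>j. x j * cnj (w $ j)"] unfolding T_def by simp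
  also have "\<dots> = complex_of_real ((l2norm circle_measure T)\<^sup>2)" by (rule l2norm_square_complex[symmetric])
  finally have "(l2norm circle_measure T)\<^sup>2 = norm (\<integral>\<zeta>. (f \<zeta> * T \<zeta>) * cnj (K \<zeta>) \<partial>circle_measure)"
    by (simp add: norm_power)
  also have "\<dots> \<le> l2norm circle_measure (\<lambda>\<zeta>. f \<zeta> * T \<zeta>) * l2norm circle_measure (\<lambda>\<zeta>. cnj (K \<zeta>))"
    by (rule norm_integral_mult_le[OF s(3) square_integrable_cnj[OF s(1)]])
  also have "l2norm circle_measure (\<lambda>\<zeta>. cnj (K \<zeta>)) = l2norm circle_measure K" by (simp add: l2norm_def)
  also have "l2norm circle_measure (\<lambda>\<zeta>. f \<zeta> * T \<zeta>) \<le> l2norm circle_measure T"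
  proof (rule l2norm_mono(2)[OF _ s(2)])
    show "AE \<zeta> in circle_measure. norm (f \<zeta> * T \<zeta>) \<le> norm (T \<zeta>)"
      using fb by eventually_elim (simp add: norm_mult mult_left_le_one_le)
  qed (use s(3) in auto)
  finally have *: "l2norm circle_measure T * l2norm circle_measure T \<le> l2norm circle_measure T * l2norm circle_measure K"
    by (simp add: power2_eq_square mult_right_mono)
  show "l2norm circle_measure T \<le> l2norm circle_measure K"
  proof (cases "l2norm circle_measure T = 0")
    case False
    then have "l2norm circle_measure T > 0" using l2norm_nonneg[of circle_measure T] by linarith
    then show ?thesis using * by simp
  qed simp
qed

end

section \<open>Periods of conjugate functions and the defect space\<close>

text \<open>The conjugate of such a function is its negative, which is again in \<open>H\<^sup>2\<close>; so only the constant
  coefficient survives.\<close>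

lemma Hp_2_imaginary_constant:
  assumes d: "d \<in> Hp 2" and re: "AE \<zeta> in circle_measure. Re (d \<zeta>) = 0"
  shows "AE \<zeta> in circle_measure. d \<zeta> = disc_extension d 0" "Re (disc_extension d 0) = 0"
proof -
  note ds = Hp_2_square_integrable[OF d]
  have [measurable]: "d \<in> borel_measurable circle_measure" using ds by measurable
  have d0: "disc_extension d 0 = fourier d 0"
    by (simp add: disc_extension_szego[OF Hp_2_imp_1[OF d]] fourier_def szego_kernel_def)
  have fn: "fourier d n = 0" if "n \<ge> 1" for n
  proof -
    have "(\<integral>\<zeta>. cnj (d \<zeta> * cnj \<zeta> ^ n) \<partial>circle_measure) = (\<integral>\<zeta>. - (d \<zeta> * \<zeta> ^ n) \<partial>circle_measure)"
    proof (rule integral_cong_AE)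
      show "AE \<zeta> in circle_measure. cnj (d \<zeta> * cnj \<zeta> ^ n) = - (d \<zeta> * \<zeta> ^ n)"
        using re by eventually_elim (simp add: complex_eq_iff)
    qed measurable
    also have "\<dots> = 0" using d that by (simp add: Hp_2_iff)
    finally show ?thesis by (simp del: complex_cnj_mult complex_cnj_power add: fourier_def)
  qed
  define c where "c = disc_extension d 0"
  have cH: "(\<lambda>_. c) \<in> Hp 2" using trig_Hp_2[of "\<lambda>_. c" "{0}"] by simp
  have fc: "fourier (\<lambda>_. c) n = (if n = 0 then c else 0)" for n
    using fourier_trig[of "{0}" "\<lambda>_. c" n] by simp
  show ae: "AE \<zeta> in circle_measure. d \<zeta> = disc_extension d 0"
    unfolding c_def[symmetric]
  proof (rule Hp_2_eq_AE[OF d cH])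
    have d0': "fourier d 0 = c" by (simp add: d0 c_def)
    show "fourier d n = fourier (\<lambda>_. c) n" for n by (cases "n = 0") (simp_all add: fc fn d0')
  qed
  from ae re have "AE \<zeta> in circle_measure. Re (disc_extension d 0) = 0" by eventually_elim simp
  then show "Re (disc_extension d 0) = 0" by (simp add: circle.AE_const)
qed

text \<open>Up to the sign, this is the value at \<open>\<gamma>(0)\<close> of the harmonic conjugate of \<open>u\<close> that vanishes at \<open>0\<close>, which for
  invariant \<open>u\<close> is the additive constant by which the conjugate function changes under \<open>\<gamma>\<close>.\<close>

definition period :: "(complex \<Rightarrow> real) \<Rightarrow> (complex \<Rightarrow> complex) \<Rightarrow> real" where
  "period u \<gamma> = (\<integral>\<zeta>. u \<zeta> * (2 * Im (szego_kernel (\<gamma> 0) \<zeta>)) \<partial>circle_measure)"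

lemma Im_disc_extension_analytic_completion:
  assumes u: "square_integrable circle_measure u" and z: "norm z < 1"
  shows "Im (disc_extension (analytic_completion u) z) = - (\<integral>\<zeta>. u \<zeta> * (2 * Im (szego_kernel z \<zeta>)) \<partial>circle_measure)"
proof -
  have us: "square_integrable circle_measure (\<lambda>\<zeta>. complex_of_real (u \<zeta>))" using u by simp
  have i: "integrable circle_measure (\<lambda>\<zeta>. of_real (u \<zeta>) * cnj (szego_kernel z \<zeta>))"
    by (intro l2_mult_integrable us square_integrable_cnj szego_kernel_square_integrable z)
  have "Im (disc_extension (analytic_completion u) z) = 2 * Im (\<integral>\<zeta>. of_real (u \<zeta>) * cnj (szego_kernel z \<zeta>) \<partial>circle_measure)"
    by (simp add: disc_extension_analytic_completion[OF u z])
  also have "Im (\<integral>\<zeta>. of_real (u \<zeta>) * cnj (szego_kernel z \<zeta>) \<partial>circle_measure)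
      = (\<integral>\<zeta>. Im (of_real (u \<zeta>) * cnj (szego_kernel z \<zeta>)) \<partial>circle_measure)"
    by (rule integral_Im[OF i, symmetric])
  also have "\<dots> = - (\<integral>\<zeta>. u \<zeta> * Im (szego_kernel z \<zeta>) \<partial>circle_measure)" by simp
  finally show ?thesis by (simp add: mult.left_commute[of _ 2])
qed

context automorphism_group
begin

definition invariant :: "(complex \<Rightarrow> 'b) \<Rightarrow> bool" where
  "invariant u \<longleftrightarrow> (\<forall>\<gamma>\<in>\<Gamma>. AE \<zeta> in circle_measure. u (\<gamma> \<zeta>) = u \<zeta>)"

lemma invariantD: "invariant u \<Longrightarrow> \<gamma> \<in> \<Gamma> \<Longrightarrow> AE \<zeta> in circle_measure. u (\<gamma> \<zeta>) = u \<zeta>"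
  by (simp add: invariant_def)

lemma invariant_compose: "invariant u \<Longrightarrow> invariant (\<lambda>\<zeta>. h (u \<zeta>))"
  unfolding invariant_def by (auto elim!: eventually_mono)

lemma invariant_compose2:
  assumes "invariant u" "invariant v" shows "invariant (\<lambda>\<zeta>. h (u \<zeta>) (v \<zeta>))"
  unfolding invariant_def
proof
  fix \<gamma> assume "\<gamma> \<in> \<Gamma>"
  from invariantD[OF assms(1) this] invariantD[OF assms(2) this]
  show "AE \<zeta> in circle_measure. h (u (\<gamma> \<zeta>)) (v (\<gamma> \<zeta>)) = h (u \<zeta>) (v \<zeta>)" by eventually_elim simp
qed

lemma completion_automorphic:
  assumes u: "square_integrable circle_measure u" "invariant u" and \<gamma>: "\<gamma> \<in> \<Gamma>"
  shows "AE \<zeta> in circle_measure. analytic_completion u (\<gamma> \<zeta>) = analytic_completion u \<zeta> - \<i> * of_real (period u \<gamma>)"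
proof -
  define g where "g = analytic_completion u"
  have g: "g \<in> Hp 2" unfolding g_def by (rule analytic_completion(1)[OF u(1)])
  define d where "d \<zeta> = g (\<gamma> \<zeta>) - g \<zeta>" for \<zeta>
  have d: "d \<in> Hp 2" unfolding d_def[abs_def] by (rule Hp_2_diff[OF Hp_2_compose[OF \<gamma> g] g])
  have re: "AE \<zeta> in circle_measure. Re (g \<zeta>) = u \<zeta>" unfolding g_def by (rule Re_analytic_completion[OF u(1)])
  have "AE \<zeta> in circle_measure. Re (d \<zeta>) = 0"
    using re AE_automorphism[OF automorphism[OF \<gamma>] re] invariantD[OF u(2) \<gamma>]
    by eventually_elim (simp add: d_def)
  note c = Hp_2_imaginary_constant[OF d this]
  have gm: "g \<in> borel_measurable circle_measure" using Hp_2_square_integrable[OF g] by measurable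
  have "disc_extension d 0 = disc_extension g (\<gamma> 0) - disc_extension g 0"
    unfolding d_def[abs_def] using disc_extension_diff[OF Hp_2_compose[OF \<gamma> g] g, of 0]
      disc_extension_automorphism[OF automorphism[OF \<gamma>] gm, of 0] by simp
  moreover have "Im (disc_extension g 0) = 0"
    unfolding g_def by (subst Im_disc_extension_analytic_completion[OF u(1)]) (simp_all add: szego_kernel_def)
  moreover have "Im (disc_extension g (\<gamma> 0)) = - period u \<gamma>"
    unfolding g_def period_def by (rule Im_disc_extension_analytic_completion[OF u(1) norm_at_0[OF \<gamma>]])
  ultimately have "disc_extension d 0 = - \<i> * of_real (period u \<gamma>)"
    using c(2) by (simp add: complex_eq_iff)
  then have "AE \<zeta> in circle_measure. d \<zeta> = - \<i> * of_real (period u \<gamma>)" using c(1) by simp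
  then show ?thesis by eventually_elim (simp add: d_def g_def algebra_simps)
qed

lemma exp_completion_automorphic:
  assumes u: "square_integrable circle_measure u" "invariant u" and \<gamma>: "\<gamma> \<in> \<Gamma>"
  shows "AE \<zeta> in circle_measure. exp (c * analytic_completion u (\<gamma> \<zeta>))
    = exp (- \<i> * c * of_real (period u \<gamma>)) * exp (c * analytic_completion u \<zeta>)"
  using completion_automorphic[OF assms]
proof eventually_elim
  case (elim \<zeta>)
  have "c * analytic_completion u (\<gamma> \<zeta>) = - \<i> * c * of_real (period u \<gamma>) + c * analytic_completion u \<zeta>"
    unfolding elim by (simp add: algebra_simps)
  then show ?case by (simp only: exp_add)
qed

text \<open>The constants add up along a composition, by applying the previous relation twice.\<close>

lemma period_mult:
  assumes u: "square_integrable circle_measure u" "invariant u" and \<gamma>: "\<gamma> \<in> \<Gamma>" and \<delta>: "\<delta> \<in> \<Gamma>"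
  shows "period u (\<gamma> \<otimes>\<^bsub>BijGroup (cball 0 1)\<^esub> \<delta>) = period u \<gamma> + period u \<delta>"
proof -
  let ?\<eta> = "\<gamma> \<otimes>\<^bsub>BijGroup (cball 0 1)\<^esub> \<delta>"
  have cmp: "AE \<zeta> in circle_measure. ?\<eta> \<zeta> = \<gamma> (\<delta> \<zeta>)" by (rule AE_circleI) (rule group_mult(2)[OF \<gamma> \<delta>], simp)
  have "AE \<zeta> in circle_measure. \<i> * complex_of_real (period u ?\<eta>) = \<i> * complex_of_real (period u \<gamma> + period u \<delta>)"
    using cmp completion_automorphic[OF u group_mult(1)[OF \<gamma> \<delta>]] completion_automorphic[OF u \<delta>]
      AE_automorphism[OF automorphism[OF \<delta>] completion_automorphic[OF u \<gamma>]]
    by eventually_elim (simp add: algebra_simps)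
  then have "complex_of_real (period u ?\<eta>) = complex_of_real (period u \<gamma> + period u \<delta>)"
    by (simp add: circle.AE_const)
  then show ?thesis by (simp only: of_real_eq_iff)
qed

lemma period_character:
  assumes u: "square_integrable circle_measure u" "invariant u"
  shows "(\<lambda>\<gamma>. exp (- \<i> * of_real (period u \<gamma>))) \<in> characters \<Gamma>"
proof -
  have "exp (- \<i> * of_real (period u (\<gamma> \<otimes>\<^bsub>BijGroup (cball 0 1)\<^esub> \<delta>)))
      = exp (- \<i> * of_real (period u \<gamma>)) * exp (- \<i> * of_real (period u \<delta>))"
    if "\<gamma> \<in> \<Gamma>" "\<delta> \<in> \<Gamma>" for \<gamma> \<delta>
    by (simp add: period_mult[OF u that] distrib_left exp_add[symmetric] algebra_simps)
  then show ?thesis by (simp add: characters_def hom_def circle_group_def)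
qed

subsection \<open>The algebra of invariant sets\<close>

lemma invariant_set_iff:
  assumes E: "E \<in> sets circle_measure" and \<gamma>: "\<gamma> \<in> \<Gamma>"
  shows "emeasure circle_measure (sym_diff E (\<gamma> -` E \<inter> space circle_measure)) = 0
    \<longleftrightarrow> (AE \<zeta> in circle_measure. \<gamma> \<zeta> \<in> E \<longleftrightarrow> \<zeta> \<in> E)"
proof -
  have m: "\<gamma> -` E \<inter> space circle_measure \<in> sets circle_measure"
    by (rule measurable_sets[OF automorphism_measurable[OF automorphism[OF \<gamma>]] E])
  have eq: "sym_diff E (\<gamma> -` E \<inter> space circle_measure) = {\<zeta> \<in> space circle_measure. \<not> (\<gamma> \<zeta> \<in> E \<longleftrightarrow> \<zeta> \<in> E)}"
    using sets.sets_into_space[OF E] by auto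
  have "sym_diff E (\<gamma> -` E \<inter> space circle_measure) \<in> sets circle_measure" using E m by blast
  from AE_iff_measurable[OF this eq[symmetric]] show ?thesis by (rule sym)
qed

lemma sets_invariant_algebra:
  assumes "E \<in> sets (invariant_algebra \<Gamma>)"
  shows "E \<in> sets circle_measure \<and> (\<forall>\<gamma>\<in>\<Gamma>. AE \<zeta> in circle_measure. \<gamma> \<zeta> \<in> E \<longleftrightarrow> \<zeta> \<in> E)"
proof -
  let ?G = "{E \<in> sets circle_measure. \<forall>\<gamma>\<in>\<Gamma>.
        emeasure circle_measure (sym_diff E (\<gamma> -` E \<inter> space circle_measure)) = 0}"
  have sp: "?G \<subseteq> Pow (space circle_measure)" using sets.sets_into_space by blast
  have "E \<in> sigma_sets (space circle_measure) ?G"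
    using assms sets_measure_of[OF sp] by (simp add: invariant_algebra_def)
  then show ?thesis
  proof induction
    case (Basic E) then show ?case using invariant_set_iff by auto
  next
    case Empty show ?case by simp
  next
    case (Compl E)
    have "AE \<zeta> in circle_measure. \<gamma> \<zeta> \<in> space circle_measure - E \<longleftrightarrow> \<zeta> \<in> space circle_measure - E" if \<gamma>: "\<gamma> \<in> \<Gamma>" for \<gamma>
    proof -
      have sp: "AE \<zeta> in circle_measure. \<gamma> \<zeta> \<in> space circle_measure \<and> \<zeta> \<in> space circle_measure"
        by (rule AE_circleI) (simp add: automorphism_norm(2)[OF automorphism[OF \<gamma>]])
      have "AE \<zeta> in circle_measure. \<gamma> \<zeta> \<in> E \<longleftrightarrow> \<zeta> \<in> E" using Compl \<gamma> by blast
      with sp show ?thesis by eventually_elim simp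
    qed
    then show ?case using Compl by blast
  next
    case (Union A)
    have "AE \<zeta> in circle_measure. \<gamma> \<zeta> \<in> (\<Union>i. A i) \<longleftrightarrow> \<zeta> \<in> (\<Union>i. A i)" if \<gamma>: "\<gamma> \<in> \<Gamma>" for \<gamma>
    proof -
      have "AE \<zeta> in circle_measure. \<forall>i::nat. \<gamma> \<zeta> \<in> A i \<longleftrightarrow> \<zeta> \<in> A i"
        using Union.IH \<gamma> by (subst AE_all_countable) blast
      then show ?thesis by eventually_elim auto
    qed
    then show ?case using Union.IH by blast
  qed
qed

lemma subalgebra_invariant: "subalgebra circle_measure (invariant_algebra \<Gamma>)"
  unfolding subalgebra_def
proof
  show "space (invariant_algebra \<Gamma>) = space circle_measure"
    unfolding invariant_algebra_def by (rule space_measure_of) (use sets.sets_into_space in blast)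
  show "sets (invariant_algebra \<Gamma>) \<subseteq> sets circle_measure" using sets_invariant_algebra by blast
qed

sublocale inv: finite_measure_subalgebra circle_measure "invariant_algebra \<Gamma>"
  by (rule finite_measure_subalgebra.intro)
     (auto intro!: subalgebra_invariant finite_measure_subalgebra_axioms.intro circle.finite_measure_axioms)

text \<open>Invariance of the sublevel sets at all rational levels, outside of a common null set, is invariance of the
  function.\<close>

lemma measurable_invariant_algebra_imp_invariant:
  fixes v :: "complex \<Rightarrow> real"
  assumes v: "v \<in> borel_measurable (invariant_algebra \<Gamma>)"
  shows "invariant v"
  unfolding invariant_def
proof
  fix \<gamma> assume \<gamma>: "\<gamma> \<in> \<Gamma>"
  have sp: "space (invariant_algebra \<Gamma>) = sphere 0 1" using subalgebra_invariant by (simp add: subalgebra_def)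
  have one: "AE \<zeta> in circle_measure. v (\<gamma> \<zeta>) < q \<longleftrightarrow> v \<zeta> < q" for q
  proof -
    have "{\<zeta> \<in> space (invariant_algebra \<Gamma>). v \<zeta> < q} \<in> sets (invariant_algebra \<Gamma>)" using v by measurable
    from sets_invariant_algebra[OF this] \<gamma>
    have "AE \<zeta> in circle_measure. \<gamma> \<zeta> \<in> {\<zeta> \<in> space (invariant_algebra \<Gamma>). v \<zeta> < q} \<longleftrightarrow> \<zeta> \<in> {\<zeta> \<in> space (invariant_algebra \<Gamma>). v \<zeta> < q}"
      by blast
    moreover have "AE \<zeta> in circle_measure. norm (\<gamma> \<zeta>) = 1 \<and> norm \<zeta> = 1"
      by (rule AE_circleI) (simp add: automorphism_norm(2)[OF automorphism[OF \<gamma>]])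
    ultimately show ?thesis by eventually_elim (simp add: sp)
  qed
  have "AE \<zeta> in circle_measure. \<forall>q\<in>\<rat>. v (\<gamma> \<zeta>) < q \<longleftrightarrow> v \<zeta> < q"
    by (rule AE_ball_countable'[OF one countable_rat])
  then show "AE \<zeta> in circle_measure. v (\<gamma> \<zeta>) = v \<zeta>"
  proof eventually_elim
    case (elim \<zeta>)
    show ?case
    proof (rule ccontr)
      assume "v (\<gamma> \<zeta>) \<noteq> v \<zeta>"
      then consider "v (\<gamma> \<zeta>) < v \<zeta>" | "v \<zeta> < v (\<gamma> \<zeta>)" by linarith
      then show False
      proof cases
        case 1
        then obtain q where "q \<in> \<rat>" "v (\<gamma> \<zeta>) < q" "q < v \<zeta>" using Rats_dense_in_real by blast
        then show False using elim by force
      next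
        case 2
        then obtain q where "q \<in> \<rat>" "v \<zeta> < q" "q < v (\<gamma> \<zeta>)" using Rats_dense_in_real by blast
        then show False using elim by force
      qed
    qed
  qed
qed

lemma invariant_imp_measurable_invariant_algebra:
  fixes u :: "complex \<Rightarrow> real"
  assumes u: "u \<in> borel_measurable circle_measure" "invariant u"
  shows "u \<in> borel_measurable (invariant_algebra \<Gamma>)"
  unfolding borel_measurable_iff_less
proof
  fix a
  have sp: "space (invariant_algebra \<Gamma>) = space circle_measure" using subalgebra_invariant by (simp add: subalgebra_def)
  let ?E = "{w \<in> space circle_measure. u w < a}"
  have E: "?E \<in> sets circle_measure" using u(1) by measurable
  have "emeasure circle_measure (sym_diff ?E (\<gamma> -` ?E \<inter> space circle_measure)) = 0" if \<gamma>: "\<gamma> \<in> \<Gamma>" for \<gamma>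
    unfolding invariant_set_iff[OF E \<gamma>]
  proof -
    have "AE \<zeta> in circle_measure. norm (\<gamma> \<zeta>) = 1 \<and> norm \<zeta> = 1"
      by (rule AE_circleI) (simp add: automorphism_norm(2)[OF automorphism[OF \<gamma>]])
    then show "AE \<zeta> in circle_measure. \<gamma> \<zeta> \<in> ?E \<longleftrightarrow> \<zeta> \<in> ?E"
      using invariantD[OF u(2) \<gamma>] by eventually_elim simp
  qed
  then show "{w \<in> space (invariant_algebra \<Gamma>). u w < a} \<in> sets (invariant_algebra \<Gamma>)"
    unfolding sp unfolding invariant_algebra_def using E sets.sets_into_space
    by (subst sets_measure_of) (blast, auto intro!: sigma_sets.Basic)
qed

lemma Re_defect_function:
  "Re (defect_function \<Gamma> \<gamma> \<zeta>)
    = real_cond_exp circle_measure (invariant_algebra \<Gamma>) (\<lambda>\<xi>. 2 * Im (szego_kernel (\<gamma> 0) \<xi>)) \<zeta>"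
  by (simp add: defect_function_def invariant_cond_exp_def)

text \<open>Against an invariant function the kernel may be replaced by its conditional expectation, the
  real part of the defect function.\<close>

lemma period_eq_defect:
  assumes u: "square_integrable circle_measure u" "invariant u" and \<gamma>: "\<gamma> \<in> \<Gamma>"
  shows "period u \<gamma> = (\<integral>\<zeta>. u \<zeta> * Re (defect_function \<Gamma> \<gamma> \<zeta>) \<partial>circle_measure)"
proof -
  have [measurable]: "u \<in> borel_measurable circle_measure" using u(1) by measurable
  have s: "square_integrable circle_measure (\<lambda>\<zeta>. 2 * Im (szego_kernel (\<gamma> 0) \<zeta>))"
  proof (rule circle.bounded_square_integrable(1))
    show "AE \<zeta> in circle_measure. norm (2 * Im (szego_kernel (\<gamma> 0) \<zeta>)) \<le> 2 * (1 / (1 - norm (\<gamma> 0)))"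
    proof (rule AE_circleI)
      fix \<zeta> :: complex assume "norm \<zeta> = 1"
      from order_trans[OF abs_Im_le_cmod szego_kernel_bounded[OF this norm_at_0[OF \<gamma>]]]
      show "norm (2 * Im (szego_kernel (\<gamma> 0) \<zeta>)) \<le> 2 * (1 / (1 - norm (\<gamma> 0)))"
        unfolding real_norm_def abs_mult abs_numeral by (rule mult_left_mono) simp
    qed
  qed measurable
  have i: "integrable circle_measure (\<lambda>\<zeta>. u \<zeta> * (2 * Im (szego_kernel (\<gamma> 0) \<zeta>)))"
    using square_integrable_inner[OF u(1) s] by simp
  have um: "u \<in> borel_measurable (invariant_algebra \<Gamma>)"
    by (rule invariant_imp_measurable_invariant_algebra[OF _ u(2)]) measurable
  have km: "(\<lambda>\<zeta>. 2 * Im (szego_kernel (\<gamma> 0) \<zeta>)) \<in> borel_measurable circle_measure" using s by measurable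
  show ?thesis unfolding period_def Re_defect_function
    by (rule inv.real_cond_exp_intg(2)[OF i um km, symmetric])
qed

subsection \<open>Correcting periods by bounded functions\<close>

definition bounded_invariant :: "(complex \<Rightarrow> 'b::real_normed_vector) \<Rightarrow> bool" where
  "bounded_invariant f \<longleftrightarrow> f \<in> borel_measurable circle_measure \<and> invariant f \<and>
     (\<exists>B. AE \<zeta> in circle_measure. norm (f \<zeta>) \<le> B)"

lemma bounded_invariant_real_cond_exp:
  assumes f: "f \<in> borel_measurable circle_measure" "AE \<zeta> in circle_measure. \<bar>f \<zeta>\<bar> \<le> B"
  shows "bounded_invariant (real_cond_exp circle_measure (invariant_algebra \<Gamma>) f)"
proof -
  let ?v = "real_cond_exp circle_measure (invariant_algebra \<Gamma>) f"
  have i: "integrable circle_measure f"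
    by (rule circle.integrable_const_bound[where B=B]) (use f in auto)
  have "AE \<zeta> in circle_measure. ?v \<zeta> \<le> B"
    by (rule inv.real_cond_exp_le_c[OF i]) (use f(2) in \<open>auto elim: eventually_mono\<close>)
  moreover have "AE \<zeta> in circle_measure. ?v \<zeta> \<ge> - B"
    by (rule inv.real_cond_exp_ge_c[OF i]) (use f(2) in \<open>auto elim: eventually_mono\<close>)
  ultimately have "AE \<zeta> in circle_measure. norm (?v \<zeta>) \<le> B" by eventually_elim simp
  then show ?thesis
    unfolding bounded_invariant_def
    using measurable_invariant_algebra_imp_invariant[OF borel_measurable_cond_exp] by auto
qed

lemma bounded_invariant_defect_function:
  assumes \<gamma>: "\<gamma> \<in> \<Gamma>" shows "bounded_invariant (defect_function \<Gamma> \<gamma>)"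
proof -
  let ?d = "\<lambda>\<xi>. szego_kernel (\<gamma> 0) \<xi> - cnj (szego_kernel (\<gamma> 0) \<xi>)"
  let ?E = "real_cond_exp circle_measure (invariant_algebra \<Gamma>)"
  define B where "B = 2 * (1 / (1 - norm (\<gamma> 0)))"
  have k: "norm (?d \<zeta>) \<le> B" if "norm \<zeta> = 1" for \<zeta>
    using norm_triangle_ineq4[of "szego_kernel (\<gamma> 0) \<zeta>" "cnj (szego_kernel (\<gamma> 0) \<zeta>)"]
      szego_kernel_bounded[OF that norm_at_0[OF \<gamma>]] by (simp add: B_def)
  have "B \<ge> 0" using order_trans[OF norm_ge_zero k[of 1]] by simp
  then have re: "bounded_invariant (?E (\<lambda>\<xi>. Re (?d \<xi>)))"
    by (intro bounded_invariant_real_cond_exp[where B=B]) simp_all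
  have im: "bounded_invariant (?E (\<lambda>\<xi>. Im (?d \<xi>)))"
    by (rule bounded_invariant_real_cond_exp[where B=B])
       (measurable, use order_trans[OF abs_Im_le_cmod k] in \<open>auto intro!: AE_circleI\<close>)
  define h where "h a b = - \<i> * Complex a b" for a b
  have eq: "defect_function \<Gamma> \<gamma> = (\<lambda>\<zeta>. h (?E (\<lambda>\<xi>. Re (?d \<xi>)) \<zeta>) (?E (\<lambda>\<xi>. Im (?d \<xi>)) \<zeta>))"
    by (simp add: defect_function_def invariant_cond_exp_def h_def)
  have hb: "norm (h a b) \<le> \<bar>a\<bar> + \<bar>b\<bar>" for a b
    using cmod_le[of "Complex a b"] by (simp add: h_def norm_mult)
  have hc: "h a b = of_real b - \<i> * of_real a" for a b by (simp add: h_def complex_eq_iff)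
  obtain B1 B2 where "AE \<zeta> in circle_measure. norm (?E (\<lambda>\<xi>. Re (?d \<xi>)) \<zeta>) \<le> B1"
    "AE \<zeta> in circle_measure. norm (?E (\<lambda>\<xi>. Im (?d \<xi>)) \<zeta>) \<le> B2"
    using re im unfolding bounded_invariant_def by blast
  then have "AE \<zeta> in circle_measure. norm (h (?E (\<lambda>\<xi>. Re (?d \<xi>)) \<zeta>) (?E (\<lambda>\<xi>. Im (?d \<xi>)) \<zeta>)) \<le> B1 + B2"
  proof eventually_elim
    case (elim \<zeta>)
    then show ?case using hb[of "?E (\<lambda>\<xi>. Re (?d \<xi>)) \<zeta>" "?E (\<lambda>\<xi>. Im (?d \<xi>)) \<zeta>"] unfolding real_norm_def by linarith
  qed
  moreover have "invariant (\<lambda>\<zeta>. h (?E (\<lambda>\<xi>. Re (?d \<xi>)) \<zeta>) (?E (\<lambda>\<xi>. Im (?d \<xi>)) \<zeta>))"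
  proof -
    have "invariant (?E (\<lambda>\<xi>. Re (?d \<xi>)))" "invariant (?E (\<lambda>\<xi>. Im (?d \<xi>)))"
      using re im unfolding bounded_invariant_def by blast+
    from invariant_compose2[OF this, of h] show ?thesis .
  qed
  moreover have "(\<lambda>\<zeta>. h (?E (\<lambda>\<xi>. Re (?d \<xi>)) \<zeta>) (?E (\<lambda>\<xi>. Im (?d \<xi>)) \<zeta>)) \<in> borel_measurable circle_measure"
    unfolding hc by measurable
  ultimately show ?thesis unfolding eq bounded_invariant_def by blast
qed

end

lemma complex_function_module: "module (\<lambda>c (f :: complex \<Rightarrow> complex) \<zeta>. c * f \<zeta>)"
  by unfold_locales (auto simp: fun_eq_iff algebra_simps)

lemma complex_span_subset:
  assumes "S \<subseteq> V" "0 \<in> V" "\<And>f g. f \<in> V \<Longrightarrow> g \<in> V \<Longrightarrow> (\<lambda>\<zeta>. f \<zeta> + g \<zeta>) \<in> V" "\<And>c f. f \<in> V \<Longrightarrow> (\<lambda>\<zeta>. c * f \<zeta>) \<in> V"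
  shows "complex_span S \<subseteq> V"
proof -
  interpret C: module "\<lambda>c (f :: complex \<Rightarrow> complex) \<zeta>. c * f \<zeta>" by (rule complex_function_module)
  have "f + g \<in> V" if "f \<in> V" "g \<in> V" for f g
    using assms(3)[OF that] by (simp add: plus_fun_def)
  then have "C.subspace V" unfolding C.subspace_def using assms(2,4) by blast
  then show ?thesis unfolding complex_span_def using assms(1) by (intro C.span_minimal)
qed

context automorphism_group
begin

lemma bounded_invariant_add:
  fixes f g :: "complex \<Rightarrow> 'b::euclidean_space"
  assumes "bounded_invariant f" "bounded_invariant g"
  shows "bounded_invariant (\<lambda>\<zeta>. f \<zeta> + g \<zeta>)"
proof -
  obtain B1 B2 where "AE \<zeta> in circle_measure. norm (f \<zeta>) \<le> B1" "AE \<zeta> in circle_measure. norm (g \<zeta>) \<le> B2"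
    using assms unfolding bounded_invariant_def by blast
  then have "AE \<zeta> in circle_measure. norm (f \<zeta> + g \<zeta>) \<le> B1 + B2"
    by eventually_elim (rule norm_triangle_mono)
  moreover have "invariant (\<lambda>\<zeta>. f \<zeta> + g \<zeta>)"
  proof -
    have "invariant f" "invariant g" using assms unfolding bounded_invariant_def by blast+
    from invariant_compose2[OF this, of "(+)"] show ?thesis .
  qed
  moreover have "(\<lambda>\<zeta>. f \<zeta> + g \<zeta>) \<in> borel_measurable circle_measure"
    using assms unfolding bounded_invariant_def by (intro borel_measurable_add) blast+
  ultimately show ?thesis unfolding bounded_invariant_def by blast
qed

lemma bounded_invariant_compose:
  fixes f :: "complex \<Rightarrow> 'b::euclidean_space" and h :: "'b \<Rightarrow> 'c::euclidean_space"
  assumes "bounded_invariant f" and h: "h \<in> borel_measurable borel" "\<And>x. norm (h x) \<le> K * norm x" "K \<ge> 0"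
  shows "bounded_invariant (\<lambda>\<zeta>. h (f \<zeta>))"
proof -
  obtain B where "AE \<zeta> in circle_measure. norm (f \<zeta>) \<le> B"
    using assms unfolding bounded_invariant_def by blast
  then have "AE \<zeta> in circle_measure. norm (h (f \<zeta>)) \<le> K * B"
    by eventually_elim (rule order_trans[OF h(2) mult_left_mono[OF _ h(3)]])
  moreover have "invariant (\<lambda>\<zeta>. h (f \<zeta>))"
    by (rule invariant_compose) (use assms(1) in \<open>simp add: bounded_invariant_def\<close>)
  moreover have "(\<lambda>\<zeta>. h (f \<zeta>)) \<in> borel_measurable circle_measure"
    using assms(1) h(1) unfolding bounded_invariant_def by (auto intro: measurable_compose)
  ultimately show ?thesis unfolding bounded_invariant_def by blast
qed

lemma bounded_invariant_square_integrable:
  fixes f :: "complex \<Rightarrow> 'b::euclidean_space"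
  assumes "bounded_invariant f" shows "square_integrable circle_measure f"
  using assms circle.bounded_square_integrable(1) unfolding bounded_invariant_def by blast

lemma bounded_invariant_defect_space:
  assumes "f \<in> defect_space \<Gamma>" shows "bounded_invariant f"
proof -
  have "complex_span (defect_function \<Gamma> ` \<Gamma>) \<subseteq> Collect bounded_invariant"
  proof (rule complex_span_subset)
    show "defect_function \<Gamma> ` \<Gamma> \<subseteq> Collect bounded_invariant" using bounded_invariant_defect_function by blast
    show "0 \<in> Collect bounded_invariant"
      by (auto simp: bounded_invariant_def invariant_def zero_fun_def intro: exI[of _ 0])
    show "(\<lambda>\<zeta>. f \<zeta> + g \<zeta>) \<in> Collect bounded_invariant"
      if "f \<in> Collect bounded_invariant" "g \<in> Collect bounded_invariant" for f g :: "complex \<Rightarrow> complex"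
      using that bounded_invariant_add by simp
    show "(\<lambda>\<zeta>. c * f \<zeta>) \<in> Collect bounded_invariant"
      if "f \<in> Collect bounded_invariant" for c and f :: "complex \<Rightarrow> complex"
      using that bounded_invariant_compose[of f "\<lambda>x. c * x" "norm c"] by (simp add: norm_mult)
  qed
  then show ?thesis using assms by (auto simp: defect_space_def)
qed

end

lemma l2inner_cong_AE:
  assumes "square_integrable M f" "square_integrable M g" "square_integrable M h" "AE x in M. f x = g x"
  shows "l2inner M f h = l2inner M g h"
  unfolding l2inner_def
proof (rule integral_cong_AE)
  show "AE x in M. f x \<bullet> h x = g x \<bullet> h x" using assms(4) by eventually_elim simp
qed (intro borel_measurable_inner square_integrable_measurable assms)+

text \<open>Gram--Schmidt orthogonalization, modulo equality almost everywhere. The class \<open>C\<close> is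
  carried along so that the basis inherits properties such as boundedness and invariance.\<close>

lemma l2_orthonormal_basis:
  fixes C :: "('a \<Rightarrow> real) \<Rightarrow> bool"
  assumes "finite R" "\<And>r. r \<in> R \<Longrightarrow> C r"
    and sq: "\<And>f. C f \<Longrightarrow> square_integrable M f"
    and add: "\<And>f g. C f \<Longrightarrow> C g \<Longrightarrow> C (\<lambda>x. f x + g x)" and scale: "\<And>c f. C f \<Longrightarrow> C (\<lambda>x. c * f x)"
    and zero: "C (\<lambda>x. 0)"
  shows "\<exists>b m. (\<forall>i<m::nat. C (b i)) \<and> (\<forall>i<m. \<forall>j<m. l2inner M (b i) (b j) = (if i = j then 1 else 0)) \<and>
    (\<forall>r\<in>R. AE x in M. r x = (\<Sum>i<m. l2inner M r (b i) * b i x))"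
  using assms(1,2)
proof (induction R rule: finite_induct)
  case empty
  show ?case by (rule exI, rule exI[of _ 0]) simp
next
  case (insert r R)
  have CR: "C r" if "r \<in> R" for r using insert.prems that by blast
  have "\<exists>b m. (\<forall>i<m::nat. C (b i)) \<and> (\<forall>i<m. \<forall>j<m. l2inner M (b i) (b j) = (if i = j then 1 else 0)) \<and>
    (\<forall>r\<in>R. AE x in M. r x = (\<Sum>i<m. l2inner M r (b i) * b i x))"
    by (rule insert.IH) (rule CR)
  then obtain b and m :: nat where bm: "\<forall>i<m. C (b i)"
    "\<forall>i<m. \<forall>j<m. l2inner M (b i) (b j) = (if i = j then 1 else 0)"
    "\<forall>r\<in>R. AE x in M. r x = (\<Sum>i<m. l2inner M r (b i) * b i x)" by (elim exE conjE)
  note b = bm(1)[rule_format] bm(2)[rule_format] bm(3)[rule_format]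
  have sumC: "C (\<lambda>x. \<Sum>i<k. c i * b i x)" if "k \<le> m" for k c
    using that
  proof (induction k)
    case (Suc k)
    then have "C (\<lambda>x. (\<Sum>i<k. c i * b i x) + c k * b k x)" by (intro add scale b) auto
    then show ?case by simp
  qed (simp add: zero)
  define p where "p x = (\<Sum>i<m. l2inner M r (b i) * b i x)" for x
  have p: "C p" unfolding p_def[abs_def] by (rule sumC) simp
  have r: "C r" using insert.prems by blast
  define q where "q x = r x + (-1) * p x" for x
  have q: "C q" unfolding q_def[abs_def] by (intro add r scale p)
  note sqs = sq[OF p] sq[OF r] sq[OF q] sq[OF b(1)]
  have pb: "l2inner M p (b j) = l2inner M r (b j)" if j: "j < m" for j
  proof -
    have i: "integrable M (\<lambda>x. l2inner M r (b i) * (b i x * b j x))" if "i < m" for i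
      using square_integrable_inner[OF sqs(4)[OF that] sqs(4)[OF j]] by simp
    have "l2inner M p (b j) = (\<integral>x. (\<Sum>i<m. l2inner M r (b i) * (b i x * b j x)) \<partial>M)"
      by (simp add: l2inner_def p_def sum_distrib_right mult.assoc)
    also have "\<dots> = (\<Sum>i<m. \<integral>x. l2inner M r (b i) * (b i x * b j x) \<partial>M)"
      by (rule Bochner_Integration.integral_sum) (use i in auto)
    also have "\<dots> = (\<Sum>i<m. l2inner M r (b i) * l2inner M (b i) (b j))" by (simp add: l2inner_def)
    also have "\<dots> = l2inner M r (b j)" using b(2)[OF _ j] j by (simp add: if_distrib[of "(*) _"] cong: if_cong)
    finally show ?thesis .
  qed
  have qb: "l2inner M q (b j) = 0" if j: "j < m" for j
  proof -
    have "l2inner M q (b j) = l2inner M r (b j) + l2inner M (\<lambda>x. (-1) * p x) (b j)"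
      unfolding q_def[abs_def] by (rule l2inner_add_left[OF sqs(2) sq[OF scale[OF p]] sqs(4)[OF j]])
    also have "l2inner M (\<lambda>x. (-1) * p x) (b j) = - l2inner M p (b j)" by (simp add: l2inner_def)
    finally show ?thesis by (simp add: pb[OF j])
  qed
  show ?case
  proof (cases "l2norm M q = 0")
    case True
    from l2norm_eq_0_AE[OF sqs(3) True]
    have "AE x in M. r x = (\<Sum>i<m. l2inner M r (b i) * b i x)"
      by eventually_elim (simp add: q_def p_def)
    then show ?thesis using bm by (intro exI[of _ b] exI[of _ m]) simp
  next
    case False
    define e where "e x = (1 / l2norm M q) * q x" for x
    define b' where "b' = b(m := e)"
    have e: "C e" unfolding e_def[abs_def] by (rule scale[OF q])
    have ee: "l2inner M e e = 1"
    proof -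
      have "l2norm M e = 1" unfolding e_def[abs_def] using l2norm_scaleR[of M "1 / l2norm M q" q] False by simp
      then show ?thesis by (simp add: l2inner_self)
    qed
    have eb: "l2inner M e (b j) = 0" if "j < m" for j
      using qb[OF that] l2inner_scaleR_left[of M "1 / l2norm M q" q "b j"] by (simp add: e_def[abs_def])
    have be: "l2inner M (b j) e = 0" if "j < m" for j using eb[OF that] by (simp add: l2inner_commute)
    have re: "l2inner M r e = l2norm M q"
    proof -
      have "l2inner M p e = 0"
      proof -
        have i: "integrable M (\<lambda>x. l2inner M r (b i) * (b i x * e x))" if "i < m" for i
          using square_integrable_inner[OF sqs(4)[OF that] sq[OF e]] by simp
        have "l2inner M p e = (\<integral>x. (\<Sum>i<m. l2inner M r (b i) * (b i x * e x)) \<partial>M)"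
          by (simp add: l2inner_def p_def sum_distrib_right mult.assoc)
        also have "\<dots> = (\<Sum>i<m. \<integral>x. l2inner M r (b i) * (b i x * e x) \<partial>M)"
          by (rule Bochner_Integration.integral_sum) (use i in auto)
        also have "\<dots> = (\<Sum>i<m. l2inner M r (b i) * l2inner M (b i) e)" by (simp add: l2inner_def)
        finally show ?thesis by (simp add: be)
      qed
      moreover have "l2inner M q e = l2norm M q"
        using l2inner_scaleR_left[of M "1 / l2norm M q" q q] False
        by (simp add: e_def[abs_def] l2inner_commute[of M q] l2inner_self power2_eq_square)
      moreover have "l2inner M (\<lambda>x. q x + p x) e = l2inner M q e + l2inner M p e"
        by (rule l2inner_add_left[OF sqs(3) sqs(1) sq[OF e]])
      moreover have "(\<lambda>x. q x + p x) = r" by (simp add: q_def fun_eq_iff)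
      ultimately show ?thesis by simp
    qed
    have "AE x in M. s x = (\<Sum>i<Suc m. l2inner M s (b' i) * b' i x)" if s: "s \<in> insert r R" for s
    proof (cases "s = r")
      case True
      have "r x = (\<Sum>i<Suc m. l2inner M r (b' i) * b' i x)" for x
        using False by (simp add: b'_def re q_def p_def e_def)
      then show ?thesis using True by simp
    next
      case False
      then have ae: "AE x in M. s x = (\<Sum>i<m. l2inner M s (b i) * b i x)" using s b(3) by blast
      have "l2inner M s e = 0"
      proof -
        have "l2inner M s e = l2inner M (\<lambda>x. \<Sum>i<m. l2inner M s (b i) * b i x) e"
          by (rule l2inner_cong_AE[OF sq[OF insert.prems[OF s]] sq[OF sumC[OF order_refl]] sq[OF e] ae])
        also have "\<dots> = (\<integral>x. (\<Sum>i<m. l2inner M s (b i) * (b i x * e x)) \<partial>M)"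
          by (simp add: l2inner_def sum_distrib_right mult.assoc)
        also have "\<dots> = (\<Sum>i<m. \<integral>x. l2inner M s (b i) * (b i x * e x) \<partial>M)"
          by (rule Bochner_Integration.integral_sum) (use square_integrable_inner[OF sqs(4) sq[OF e]] in auto)
        also have "\<dots> = (\<Sum>i<m. l2inner M s (b i) * l2inner M (b i) e)" by (simp add: l2inner_def)
        finally show ?thesis by (simp add: be)
      qed
      with ae show ?thesis by (auto simp: b'_def elim: eventually_mono)
    qed
    moreover have "\<forall>i<Suc m. C (b' i)" using b(1) e by (simp add: b'_def less_Suc_eq)
    moreover have "\<forall>i<Suc m. \<forall>j<Suc m. l2inner M (b' i) (b' j) = (if i = j then 1 else 0)"
      using b(2) ee eb be by (auto simp: b'_def less_Suc_eq)
    ultimately show ?thesis by blast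
  qed
qed

context automorphism_group
begin

text \<open>Periods are inner products with the real parts of defect functions, so \<open>u\<close> has the same periods as its orthogonal
  projection onto the span of the real and imaginary parts of a finite spanning family of the defect space. Being a combination of finitely many
  bounded functions, with coefficients controlled by the norm of \<open>u\<close>, the projection is uniformly small when that norm is.\<close>

lemma period_correction:
  assumes fd: "finite_dim_ae (defect_space \<Gamma>)"
  obtains C where "C \<ge> 0" "\<And>u :: complex \<Rightarrow> real. square_integrable circle_measure u \<Longrightarrow> invariant u \<Longrightarrow>
    \<exists>v. v \<in> borel_measurable circle_measure \<and> invariant v \<and>
      (AE \<zeta> in circle_measure. \<bar>v \<zeta>\<bar> \<le> C * l2norm circle_measure u) \<and> (\<forall>\<gamma>\<in>\<Gamma>. period v \<gamma> = period u \<gamma>)"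
proof -
  obtain B where B: "B \<subseteq> defect_space \<Gamma>" "finite B"
    "\<And>f. f \<in> defect_space \<Gamma> \<Longrightarrow> \<exists>g\<in>complex_span B. AE \<zeta> in circle_measure. f \<zeta> = g \<zeta>"
    using fd unfolding finite_dim_ae_def by blast
  define R where "R = (\<lambda>f \<zeta>. Re (f \<zeta>)) ` B \<union> (\<lambda>f \<zeta>. Im (f \<zeta>)) ` B"
  have RC: "bounded_invariant r" if rR: "r \<in> R" for r
  proof -
    obtain f where f: "f \<in> B" "r = (\<lambda>\<zeta>. Re (f \<zeta>)) \<or> r = (\<lambda>\<zeta>. Im (f \<zeta>))" using rR by (auto simp: R_def)
    then have "bounded_invariant f" using B(1) bounded_invariant_defect_space by blast
    then show ?thesis using f(2) bounded_invariant_compose[of f Re 1] bounded_invariant_compose[of f Im 1]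
        abs_Re_le_cmod abs_Im_le_cmod by auto
  qed
  have zero: "bounded_invariant (\<lambda>\<zeta>. 0::real)"
    by (auto simp: bounded_invariant_def invariant_def intro: exI[of _ 0])
  have scale: "bounded_invariant (\<lambda>\<zeta>. c * f \<zeta>)" if "bounded_invariant f" for c :: real and f
    using bounded_invariant_compose[OF that, of "\<lambda>x. c * x" "\<bar>c\<bar>"] by (simp add: abs_mult)
  have finR: "finite R" using B(2) by (simp add: R_def)
  have "\<exists>b m. (\<forall>i<m::nat. bounded_invariant (b i)) \<and>
    (\<forall>i<m. \<forall>j<m. l2inner circle_measure (b i) (b j) = (if i = j then 1 else 0)) \<and>
    (\<forall>r\<in>R. AE x in circle_measure. r x = (\<Sum>i<m. l2inner circle_measure r (b i) * b i x))"
    by (rule l2_orthonormal_basis[where C=bounded_invariant, OF finR])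
       (fact RC bounded_invariant_square_integrable bounded_invariant_add scale zero)+
  then obtain b and m :: nat where bm: "\<forall>i<m. bounded_invariant (b i)"
    "\<forall>i<m. \<forall>j<m. l2inner circle_measure (b i) (b j) = (if i = j then 1 else 0)"
    "\<forall>r\<in>R. AE x in circle_measure. r x = (\<Sum>i<m. l2inner circle_measure r (b i) * b i x)"
    by (elim exE conjE)
  note b = bm(1)[rule_format] bm(2)[rule_format] bm(3)[rule_format]
  note bs = bounded_invariant_square_integrable[OF b(1)]
  define S where "S = {f :: complex \<Rightarrow> real. square_integrable circle_measure f \<and>
    (AE x in circle_measure. f x = (\<Sum>i<m. l2inner circle_measure f (b i) * b i x))}"
  have S_add: "(\<lambda>x. f x + g x) \<in> S" if "f \<in> S" "g \<in> S" for f g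
  proof -
    have fg: "square_integrable circle_measure f" "square_integrable circle_measure g" using that by (auto simp: S_def)
    have "AE x in circle_measure. f x = (\<Sum>i<m. l2inner circle_measure f (b i) * b i x)"
      "AE x in circle_measure. g x = (\<Sum>i<m. l2inner circle_measure g (b i) * b i x)" using that by (auto simp: S_def)
    then have "AE x in circle_measure. f x + g x = (\<Sum>i<m. l2inner circle_measure (\<lambda>x. f x + g x) (b i) * b i x)"
      by eventually_elim (simp add: l2inner_add_left[OF fg bs] distrib_right sum.distrib)
    then show ?thesis using fg by (auto simp: S_def)
  qed
  have S_scale: "(\<lambda>x. c * f x) \<in> S" if "f \<in> S" for c f
  proof -
    have f: "square_integrable circle_measure f" using that by (auto simp: S_def)
    have "AE x in circle_measure. f x = (\<Sum>i<m. l2inner circle_measure f (b i) * b i x)" using that by (auto simp: S_def)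
    then have "AE x in circle_measure. c * f x = (\<Sum>i<m. l2inner circle_measure (\<lambda>x. c * f x) (b i) * b i x)"
    proof eventually_elim
      case (elim x)
      have "l2inner circle_measure (\<lambda>x. c * f x) (b i) = c * l2inner circle_measure f (b i)" for i
        using l2inner_scaleR_left[of circle_measure c f "b i"] by simp
      then show ?case using elim by (simp add: sum_distrib_left mult.assoc)
    qed
    then show ?thesis using square_integrable_scaleR[OF f, of c] by (auto simp: S_def)
  qed
  have RS: "R \<subseteq> S" using RC bounded_invariant_square_integrable b(3) by (auto simp: S_def)
  have spanS: "complex_span B \<subseteq> {f. (\<lambda>\<zeta>. Re (f \<zeta>)) \<in> S \<and> (\<lambda>\<zeta>. Im (f \<zeta>)) \<in> S}"
  proof (rule complex_span_subset)
    show "B \<subseteq> {f. (\<lambda>\<zeta>. Re (f \<zeta>)) \<in> S \<and> (\<lambda>\<zeta>. Im (f \<zeta>)) \<in> S}" using RS by (auto simp: R_def)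
    show "0 \<in> {f. (\<lambda>\<zeta>. Re (f \<zeta>)) \<in> S \<and> (\<lambda>\<zeta>. Im (f \<zeta>)) \<in> S}" by (simp add: S_def l2inner_def)
    show "(\<lambda>\<zeta>. f \<zeta> + g \<zeta>) \<in> {f. (\<lambda>\<zeta>. Re (f \<zeta>)) \<in> S \<and> (\<lambda>\<zeta>. Im (f \<zeta>)) \<in> S}"
      if "f \<in> {f. (\<lambda>\<zeta>. Re (f \<zeta>)) \<in> S \<and> (\<lambda>\<zeta>. Im (f \<zeta>)) \<in> S}"
        "g \<in> {f. (\<lambda>\<zeta>. Re (f \<zeta>)) \<in> S \<and> (\<lambda>\<zeta>. Im (f \<zeta>)) \<in> S}" for f g
      using that S_add by simp
    show "(\<lambda>\<zeta>. c * f \<zeta>) \<in> {f. (\<lambda>\<zeta>. Re (f \<zeta>)) \<in> S \<and> (\<lambda>\<zeta>. Im (f \<zeta>)) \<in> S}"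
      if "f \<in> {f. (\<lambda>\<zeta>. Re (f \<zeta>)) \<in> S \<and> (\<lambda>\<zeta>. Im (f \<zeta>)) \<in> S}" for c f
      using that S_add[OF S_scale[of "\<lambda>\<zeta>. Re (f \<zeta>)" "Re c"] S_scale[of "\<lambda>\<zeta>. Im (f \<zeta>)" "- Im c"]]
        S_add[OF S_scale[of "\<lambda>\<zeta>. Im (f \<zeta>)" "Re c"] S_scale[of "\<lambda>\<zeta>. Re (f \<zeta>)" "Im c"]] by simp
  qed
  define V where "V \<gamma> \<zeta> = Re (defect_function \<Gamma> \<gamma> \<zeta>)" for \<gamma> \<zeta>
  have Vs: "square_integrable circle_measure (V \<gamma>)" if "\<gamma> \<in> \<Gamma>" for \<gamma>
  proof -
    have "bounded_invariant (\<lambda>\<zeta>. Re (defect_function \<Gamma> \<gamma> \<zeta>))"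
      by (rule bounded_invariant_compose[OF bounded_invariant_defect_function[OF that], of Re 1]) (auto simp: abs_Re_le_cmod)
    then show ?thesis unfolding V_def[abs_def] by (rule bounded_invariant_square_integrable)
  qed
  have V: "AE x in circle_measure. V \<gamma> x = (\<Sum>i<m. l2inner circle_measure (V \<gamma>) (b i) * b i x)" if \<gamma>: "\<gamma> \<in> \<Gamma>" for \<gamma>
  proof -
    interpret C: module "\<lambda>c (f :: complex \<Rightarrow> complex) \<zeta>. c * f \<zeta>" by (rule complex_function_module)
    have "defect_function \<Gamma> \<gamma> \<in> defect_space \<Gamma>"
      unfolding defect_space_def complex_span_def using \<gamma> by (intro C.span_base imageI)
    from B(3)[OF this] obtain g where g: "g \<in> complex_span B" "AE \<zeta> in circle_measure. defect_function \<Gamma> \<gamma> \<zeta> = g \<zeta>" by blast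
    have gS: "(\<lambda>\<zeta>. Re (g \<zeta>)) \<in> S" using spanS g(1) by blast
    have gs: "square_integrable circle_measure (\<lambda>\<zeta>. Re (g \<zeta>))" using gS by (simp add: S_def)
    have eq: "AE \<zeta> in circle_measure. V \<gamma> \<zeta> = Re (g \<zeta>)" using g(2) by eventually_elim (simp add: V_def)
    have "l2inner circle_measure (V \<gamma>) (b i) = l2inner circle_measure (\<lambda>\<zeta>. Re (g \<zeta>)) (b i)" if "i < m" for i
      by (rule l2inner_cong_AE[OF Vs[OF \<gamma>] gs bs[OF that] eq])
    moreover have "AE \<zeta> in circle_measure. Re (g \<zeta>) = (\<Sum>i<m. l2inner circle_measure (\<lambda>\<zeta>. Re (g \<zeta>)) (b i) * b i \<zeta>)"
      using gS by (simp add: S_def)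
    ultimately show ?thesis using eq by (auto elim: eventually_elim2)
  qed
  have "\<exists>K. AE \<zeta> in circle_measure. \<bar>b i \<zeta>\<bar> \<le> K" if "i < m" for i
    using b(1)[OF that] unfolding bounded_invariant_def by auto
  then obtain K where K: "\<And>i. i < m \<Longrightarrow> AE \<zeta> in circle_measure. \<bar>b i \<zeta>\<bar> \<le> K i" by metis
  define C where "C = (\<Sum>i<m. \<bar>K i\<bar>)"
  have nb: "l2norm circle_measure (b i) = 1" if "i < m" for i
    using b(2)[OF that that] l2inner_self[of circle_measure "b i"] l2norm_nonneg[of circle_measure "b i"]
    by (simp add: power2_eq_1_iff)
  show ?thesis
  proof (rule that)
    show "C \<ge> 0" by (simp add: C_def sum_nonneg)
    fix u :: "complex \<Rightarrow> real" assume u: "square_integrable circle_measure u" "invariant u"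
    define v where "v \<zeta> = (\<Sum>i<m. l2inner circle_measure u (b i) * b i \<zeta>)" for \<zeta>
    have v: "bounded_invariant (\<lambda>\<zeta>. \<Sum>i<k. l2inner circle_measure u (b i) * b i \<zeta>)" if "k \<le> m" for k
      using that
    proof (induction k)
      case (Suc k)
      then have "bounded_invariant (\<lambda>\<zeta>. (\<Sum>i<k. l2inner circle_measure u (b i) * b i \<zeta>) + l2inner circle_measure u (b k) * b k \<zeta>)"
        by (intro bounded_invariant_add scale b) auto
      then show ?case by simp
    qed (simp add: zero)
    have vb: "bounded_invariant v" unfolding v_def[abs_def] by (rule v) simp
    have "AE \<zeta> in circle_measure. \<forall>i\<in>{..<m}. \<bar>b i \<zeta>\<bar> \<le> K i"
      by (rule AE_finite_allI) (use K in auto)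
    then have bound: "AE \<zeta> in circle_measure. \<bar>v \<zeta>\<bar> \<le> C * l2norm circle_measure u"
    proof eventually_elim
      case (elim \<zeta>)
      have "\<bar>v \<zeta>\<bar> \<le> (\<Sum>i<m. \<bar>l2inner circle_measure u (b i) * b i \<zeta>\<bar>)" unfolding v_def by (rule sum_abs)
      also have "\<dots> \<le> (\<Sum>i<m. l2norm circle_measure u * \<bar>K i\<bar>)"
      proof (rule sum_mono)
        fix i assume i: "i \<in> {..<m}"
        have "\<bar>l2inner circle_measure u (b i)\<bar> \<le> l2norm circle_measure u"
          using l2inner_Cauchy_Schwarz[OF u(1) bs[of i]] nb[of i] i by simp
        moreover have "\<bar>b i \<zeta>\<bar> \<le> \<bar>K i\<bar>" using elim i by force
        ultimately show "\<bar>l2inner circle_measure u (b i) * b i \<zeta>\<bar> \<le> l2norm circle_measure u * \<bar>K i\<bar>"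
          unfolding abs_mult by (intro mult_mono) auto
      qed
      also have "\<dots> = C * l2norm circle_measure u" by (simp add: C_def sum_distrib_left mult.commute)
      finally show ?case .
    qed
    have per: "period v \<gamma> = period u \<gamma>" if \<gamma>: "\<gamma> \<in> \<Gamma>" for \<gamma>
    proof -
      have vs: "square_integrable circle_measure v" "invariant v"
        using vb bounded_invariant_square_integrable unfolding bounded_invariant_def by blast+
      have sum: "l2inner circle_measure (\<lambda>\<zeta>. \<Sum>i<m. c i * b i \<zeta>) f = (\<Sum>i<m. c i * l2inner circle_measure (b i) f)"
        if f: "square_integrable circle_measure f" for f c
      proof -
        have "l2inner circle_measure (\<lambda>\<zeta>. \<Sum>i<m. c i * b i \<zeta>) f = (\<integral>x. (\<Sum>i<m. c i * (b i x * f x)) \<partial>circle_measure)"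
          by (simp add: l2inner_def sum_distrib_right mult.assoc)
        also have "\<dots> = (\<Sum>i<m. \<integral>x. c i * (b i x * f x) \<partial>circle_measure)"
          by (rule Bochner_Integration.integral_sum) (use square_integrable_inner[OF bs f] in auto)
        finally show ?thesis by (simp add: l2inner_def)
      qed
      have "period v \<gamma> = l2inner circle_measure v (V \<gamma>)"
        unfolding period_eq_defect[OF vs \<gamma>] by (simp add: l2inner_def V_def)
      also have "\<dots> = (\<Sum>i<m. l2inner circle_measure u (b i) * l2inner circle_measure (b i) (V \<gamma>))"
        unfolding v_def[abs_def] by (rule sum[OF Vs[OF \<gamma>]])
      also have "\<dots> = (\<Sum>i<m. l2inner circle_measure (V \<gamma>) (b i) * l2inner circle_measure (b i) u)"
        by (simp add: l2inner_commute mult.commute)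
      also have "\<dots> = l2inner circle_measure (\<lambda>\<zeta>. \<Sum>i<m. l2inner circle_measure (V \<gamma>) (b i) * b i \<zeta>) u"
        by (rule sum[OF u(1), symmetric])
      also have "\<dots> = l2inner circle_measure (V \<gamma>) u"
      proof -
        have ss: "square_integrable circle_measure (\<lambda>\<zeta>. \<Sum>i<m. l2inner circle_measure (V \<gamma>) (b i) * b i \<zeta>)"
          using square_integrable_scaleR[OF bs] by (intro square_integrable_sum) auto
        show ?thesis by (rule l2inner_cong_AE[OF Vs[OF \<gamma>] ss u(1) V[OF \<gamma>], symmetric])
      qed
      also have "\<dots> = period u \<gamma>"
        unfolding period_eq_defect[OF u \<gamma>] by (simp add: l2inner_def V_def mult.commute)
      finally show ?thesis .
    qed
    show "\<exists>v. v \<in> borel_measurable circle_measure \<and> invariant v \<and>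
      (AE \<zeta> in circle_measure. \<bar>v \<zeta>\<bar> \<le> C * l2norm circle_measure u) \<and> (\<forall>\<gamma>\<in>\<Gamma>. period v \<gamma> = period u \<gamma>)"
      using vb bound per unfolding bounded_invariant_def by blast
  qed
qed

end

section \<open>Weighted interpolation\<close>

lemma ln_max_one_bounds:
  fixes x :: real assumes "x \<ge> 0"
  shows "0 \<le> ln (max 1 x)" "ln (max 1 x) \<le> x"
proof -
  show "0 \<le> ln (max 1 x)" by simp
  have "ln (max 1 x) \<le> max 1 x - 1" by (rule ln_le_minus_one) simp
  then show "ln (max 1 x) \<le> x" using assms by (simp add: max_def split: if_splits)
qed

context automorphism_group
begin

lemma Hp_inv_infinityI:
  assumes "f \<in> Hp 2" "invariant f" "AE \<zeta> in circle_measure. norm (f \<zeta>) \<le> B"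
  shows "f \<in> Hp_inv \<infinity> \<Gamma>"
  using assms unfolding Hp_inv_iff Hp_infinity_iff Hp_2_iff square_integrable_def invariant_def by blast

text \<open>The multiplier \<open>G n\<close> is the outer function of modulus \<open>min 1 ((n + 1)/|q|)\<close>, up to a correction that removes
  the periods of the conjugate function of \<open>log |G n|\<close>, so that \<open>G n\<close> is invariant and not merely
  character-automorphic. Since \<open>log |G n|\<close> tends to \<open>0\<close> in the mean, the correction tends to \<open>0\<close> uniformly.\<close>

lemma bounding_multipliers:
  assumes fd: "finite_dim_ae (defect_space \<Gamma>)" and q: "q \<in> Hp 2" "invariant q"
  obtains G :: "nat \<Rightarrow> complex \<Rightarrow> complex" and \<delta> :: "nat \<Rightarrow> real"
  where "\<And>n. G n \<in> Hp_inv \<infinity> \<Gamma>" "\<And>n. (\<lambda>\<zeta>. G n \<zeta> * q \<zeta>) \<in> Hp_inv \<infinity> \<Gamma>"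
    "\<delta> \<longlonglongrightarrow> 0" "\<And>n. AE \<zeta> in circle_measure. norm (G n \<zeta>) \<le> exp (\<delta> n)"
    "\<And>z. norm z < 1 \<Longrightarrow> (\<lambda>n. disc_extension (G n) z) \<longlonglongrightarrow> 1"
proof -
  obtain C where C: "C \<ge> 0" and corr: "\<And>u :: complex \<Rightarrow> real. square_integrable circle_measure u \<Longrightarrow> invariant u \<Longrightarrow>
    \<exists>v. v \<in> borel_measurable circle_measure \<and> invariant v \<and>
      (AE \<zeta> in circle_measure. \<bar>v \<zeta>\<bar> \<le> C * l2norm circle_measure u) \<and> (\<forall>\<gamma>\<in>\<Gamma>. period v \<gamma> = period u \<gamma>)"
    using period_correction[OF fd] by blast
  note qs = Hp_2_square_integrable[OF q(1)]
  have qm[measurable]: "q \<in> borel_measurable circle_measure" using qs by measurable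
  define u where "u n \<zeta> = - ln (max 1 (norm (q \<zeta>) / Suc n))" for n \<zeta>
  have um[measurable]: "u n \<in> borel_measurable circle_measure" for n unfolding u_def[abs_def] by measurable
  have ub: "u n \<zeta> \<le> 0" "\<bar>u n \<zeta>\<bar> \<le> norm (q \<zeta>) / Suc n" for n \<zeta>
    using ln_max_one_bounds[of "norm (q \<zeta>) / Suc n"] by (auto simp: u_def)
  have qn: "square_integrable circle_measure (\<lambda>\<zeta>. (1 / Suc n) *\<^sub>R q \<zeta>)" for n using qs by (rule square_integrable_scaleR)
  have un: "square_integrable circle_measure (u n)" "l2norm circle_measure (u n) \<le> l2norm circle_measure q / Suc n" for n
  proof -
    have "AE \<zeta> in circle_measure. norm (u n \<zeta>) \<le> norm ((1 / Suc n) *\<^sub>R q \<zeta>)" using ub by simp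
    from l2norm_mono[OF um qn this]
    show "square_integrable circle_measure (u n)" "l2norm circle_measure (u n) \<le> l2norm circle_measure q / Suc n"
      by (simp_all add: l2norm_scaleR)
  qed
  have ui: "invariant (u n)" for n
    unfolding u_def[abs_def] by (rule invariant_compose[OF q(2), of "\<lambda>w. - ln (max 1 (norm w / Suc n))"])
  have "\<exists>v. v \<in> borel_measurable circle_measure \<and> invariant v \<and>
      (AE \<zeta> in circle_measure. \<bar>v \<zeta>\<bar> \<le> C * l2norm circle_measure (u n)) \<and> (\<forall>\<gamma>\<in>\<Gamma>. period v \<gamma> = period (u n) \<gamma>)" for n
    by (rule corr[OF un(1) ui])
  then have "\<exists>v. \<forall>n. v n \<in> borel_measurable circle_measure \<and> invariant (v n) \<and>
      (AE \<zeta> in circle_measure. \<bar>v n \<zeta>\<bar> \<le> C * l2norm circle_measure (u n)) \<and> (\<forall>\<gamma>\<in>\<Gamma>. period (v n) \<gamma> = period (u n) \<gamma>)"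
    by (intro choice allI)
  then obtain v where v: "\<And>n. v n \<in> borel_measurable circle_measure" "\<And>n. invariant (v n)"
    "\<And>n. AE \<zeta> in circle_measure. \<bar>v n \<zeta>\<bar> \<le> C * l2norm circle_measure (u n)"
    "\<And>n \<gamma>. \<gamma> \<in> \<Gamma> \<Longrightarrow> period (v n) \<gamma> = period (u n) \<gamma>" by blast
  define \<delta> where "\<delta> n = C * (l2norm circle_measure q / Suc n)" for n
  have over: "(\<lambda>n. l2norm circle_measure q / Suc n) \<longlonglongrightarrow> 0"
    by (rule LIMSEQ_Suc[OF lim_const_over_n])
  have \<delta>lim: "\<delta> \<longlonglongrightarrow> 0" unfolding \<delta>_def[abs_def] using tendsto_mult_right_zero[OF over] by simp
  have \<delta>0: "\<delta> n \<ge> 0" for n using C by (simp add: \<delta>_def)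
  have vb: "AE \<zeta> in circle_measure. norm (v n \<zeta>) \<le> \<delta> n" for n
    using v(3)[of n] mult_left_mono[OF un(2)[of n] C] unfolding \<delta>_def by (auto elim!: eventually_mono)
  note vs = circle.bounded_square_integrable[OF v(1) vb]
  define p where "p n \<zeta> = u n \<zeta> - v n \<zeta>" for n \<zeta>
  have ps: "square_integrable circle_measure (p n)" for n
    unfolding p_def[abs_def] by (rule square_integrable_diff[OF un(1) vs(1)])
  have pn: "l2norm circle_measure (p n) \<le> l2norm circle_measure q / Suc n + \<delta> n" for n
  proof -
    have "l2norm circle_measure (p n) \<le> l2norm circle_measure (u n) + l2norm circle_measure (\<lambda>\<zeta>. - v n \<zeta>)"
      using l2norm_triangle[OF un(1) square_integrable_minus[OF vs(1)], of n n] by (simp add: p_def[abs_def])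
    then show ?thesis using un(2)[of n] vs(2)[OF \<delta>0, of n] by (simp add: l2norm_minus)
  qed
  have pinv: "invariant (p n)" for n
    using invariant_compose2[OF ui v(2), of "(-)" n n] by (simp add: p_def[abs_def])
  have pper: "period (p n) \<gamma> = 0" if \<gamma>: "\<gamma> \<in> \<Gamma>" for n \<gamma>
  proof -
    have km: "square_integrable circle_measure (szego_kernel (\<gamma> 0))"
      by (rule szego_kernel_square_integrable[OF norm_at_0[OF \<gamma>]])
    have ks: "square_integrable circle_measure (\<lambda>\<zeta>. 2 * Im (szego_kernel (\<gamma> 0) \<zeta>))"
      by (rule l2norm_mono(1)[OF _ square_integrable_scaleR[OF km, of 2]])
         (use abs_Im_le_cmod in \<open>auto simp: abs_mult\<close>)
    have "period (p n) \<gamma> = period (u n) \<gamma> - period (v n) \<gamma>"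
      unfolding period_def p_def
      using square_integrable_inner[OF un(1)[of n] ks] square_integrable_inner[OF vs(1)[of n] ks]
      by (simp add: left_diff_distrib)
    then show ?thesis using v(4)[OF \<gamma>] by simp
  qed
  define g where "g n = analytic_completion (p n)" for n
  have g: "g n \<in> Hp 2" for n unfolding g_def by (rule analytic_completion(1)[OF ps])
  have Reg: "AE \<zeta> in circle_measure. Re (g n \<zeta>) = u n \<zeta> - v n \<zeta>" for n
    unfolding g_def using Re_analytic_completion[OF ps] by (simp add: p_def)
  have Re_le: "AE \<zeta> in circle_measure. Re (g n \<zeta>) \<le> \<delta> n" for n
    using Reg[of n] vb[of n]
  proof eventually_elim
    case (elim \<zeta>) then show ?case using ub(1)[of n \<zeta>] by simp
  qed
  note E = exp_Hp_infinity[OF g Re_le]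
  have Ginv: "invariant (\<lambda>\<zeta>. exp (g n \<zeta>))" for n
    unfolding invariant_def
  proof
    fix \<gamma> assume \<gamma>: "\<gamma> \<in> \<Gamma>"
    show "AE \<zeta> in circle_measure. exp (g n (\<gamma> \<zeta>)) = exp (g n \<zeta>)"
      using exp_completion_automorphic[OF ps[of n] pinv[of n] \<gamma>, of 1] by (simp add: pper[OF \<gamma>] g_def)
  qed
  have Gb: "AE \<zeta> in circle_measure. norm (exp (g n \<zeta>)) \<le> exp (\<delta> n)" for n
    using Re_le[of n] by eventually_elim simp
  show ?thesis
  proof (rule that[of "\<lambda>n \<zeta>. exp (g n \<zeta>)" \<delta>])
    show "(\<lambda>\<zeta>. exp (g n \<zeta>)) \<in> Hp_inv \<infinity> \<Gamma>" for n
      by (rule Hp_inv_infinityI[OF Hp_infinity_imp_2[OF E(1)] Ginv Gb])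
    show "(\<lambda>\<zeta>. exp (g n \<zeta>) * q \<zeta>) \<in> Hp_inv \<infinity> \<Gamma>" for n
    proof (rule Hp_inv_infinityI)
      show "(\<lambda>\<zeta>. exp (g n \<zeta>) * q \<zeta>) \<in> Hp 2" by (rule Hp_2_mult_infinity[OF E(1) q(1)])
      show "invariant (\<lambda>\<zeta>. exp (g n \<zeta>) * q \<zeta>)" by (rule invariant_compose2[OF Ginv q(2)])
      show "AE \<zeta> in circle_measure. norm (exp (g n \<zeta>) * q \<zeta>) \<le> exp (\<delta> n) * Suc n"
        using Reg[of n] vb[of n]
      proof eventually_elim
        case (elim \<zeta>)
        define m where "m = max 1 (norm (q \<zeta>) / Suc n)"
        have m: "m > 0" "norm (q \<zeta>) \<le> m * Suc n"
        proof -
          show "m > 0" by (simp add: m_def)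
          have "norm (q \<zeta>) / Suc n \<le> m" by (simp add: m_def)
          then show "norm (q \<zeta>) \<le> m * Suc n" by (simp only: pos_divide_le_eq of_nat_0_less_iff zero_less_Suc)
        qed
        have "Re (g n \<zeta>) = - ln m - v n \<zeta>" using elim(1) unfolding u_def m_def .
        then have "norm (exp (g n \<zeta>)) = exp (- ln m - v n \<zeta>)" by (simp only: norm_exp_eq_Re)
        also have "\<dots> = exp (- v n \<zeta>) / m" using m(1) by (simp add: exp_diff exp_minus field_simps)
        also have "\<dots> \<le> exp (\<delta> n) / m" using elim(2) m(1) by (intro divide_right_mono) auto
        finally have "norm (exp (g n \<zeta>)) * norm (q \<zeta>) \<le> (exp (\<delta> n) / m) * (m * Suc n)"
          using m by (intro mult_mono) auto
        also have "\<dots> = exp (\<delta> n) * Suc n" using m(1) by simp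
        finally show ?case by (simp add: norm_mult)
      qed
    qed
    show "\<delta> \<longlonglongrightarrow> 0" by (rule \<delta>lim)
    show "AE \<zeta> in circle_measure. norm (exp (g n \<zeta>)) \<le> exp (\<delta> n)" for n by (rule Gb)
    fix z :: complex assume z: "norm z < 1"
    have "(\<lambda>n. disc_extension (g n) z) \<longlonglongrightarrow> 0"
    proof (rule Lim_null_comparison)
      show "\<forall>\<^sub>F n in sequentially. norm (disc_extension (g n) z)
          \<le> (2 * (l2norm circle_measure q / Suc n + \<delta> n)) * (1 / (1 - norm z))"
      proof (rule always_eventually, rule allI)
        fix n
        have "l2norm circle_measure (g n) \<le> 2 * (l2norm circle_measure q / Suc n + \<delta> n)"
          unfolding g_def by (rule order_trans[OF l2norm_analytic_completion[OF ps] mult_left_mono[OF pn]]) simp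
        then have "l2norm circle_measure (g n) * (1 / (1 - norm z))
            \<le> (2 * (l2norm circle_measure q / Suc n + \<delta> n)) * (1 / (1 - norm z))"
          by (rule mult_right_mono) (use z in simp)
        with norm_disc_extension_le[OF g z, of n]
        show "norm (disc_extension (g n) z) \<le> (2 * (l2norm circle_measure q / Suc n + \<delta> n)) * (1 / (1 - norm z))"
          by linarith
      qed
      have "(\<lambda>n. (2 * (l2norm circle_measure q / Suc n + \<delta> n)) * (1 / (1 - norm z))) \<longlonglongrightarrow> (2 * (0 + 0)) * (1 / (1 - norm z))"
        by (intro tendsto_mult_right tendsto_mult_left tendsto_add over \<delta>lim)
      then show "(\<lambda>n. (2 * (l2norm circle_measure q / Suc n + \<delta> n)) * (1 / (1 - norm z))) \<longlonglongrightarrow> 0" by simp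
    qed
    from tendsto_exp[OF this] show "(\<lambda>n. disc_extension (\<lambda>\<zeta>. exp (g n \<zeta>)) z) \<longlonglongrightarrow> 1"
      by (simp add: E(2)[OF z])
  qed
qed

text \<open>The adjoint of the contraction \<open>k\<^sub>j \<mapsto> cnj (w\<^sub>j) k\<^sub>j\<close> maps \<open>h\<close> to an element of the span of the kernels
  whose value at \<open>z\<^sub>j\<close> is \<open>w\<^sub>j h(z\<^sub>j)\<close>. It is the combination of kernels for which the quadratic functional \<open>Q\<close> below is
  least; an approximate minimum suffices, and exists even if the kernels are linearly dependent.\<close>

lemma approximate_adjoint_image:
  fixes z w :: "complex ^ 'n"
  assumes z: "\<And>j. norm (z $ j) < 1" and h: "h \<in> Hp_char 2 \<Gamma> \<sigma>"
    and contr: "\<And>x. l2norm circle_measure (\<lambda>\<zeta>. \<Sum>j\<in>UNIV. (x j * cnj (w $ j)) * kernel_function \<Gamma> \<sigma> (z $ j) \<zeta>)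
       \<le> l2norm circle_measure (\<lambda>\<zeta>. \<Sum>j\<in>UNIV. x j * kernel_function \<Gamma> \<sigma> (z $ j) \<zeta>)"
    and \<eta>: "\<eta> > 0"
  shows "\<exists>y\<in>Hp_char 2 \<Gamma> \<sigma>. l2norm circle_measure y \<le> l2norm circle_measure h + \<eta> \<and>
    (\<forall>j. norm (disc_extension y (z $ j) - w $ j * disc_extension h (z $ j)) \<le> \<eta>)"
proof -
  define k where "k j = kernel_function \<Gamma> \<sigma> (z $ j)" for j
  define K where "K x \<zeta> = (\<Sum>j\<in>UNIV. x j * k j \<zeta>)" for x \<zeta>
  define T where "T x = K (\<lambda>j. x j * cnj (w $ j))" for x
  have KH: "K x \<in> Hp_char 2 \<Gamma> \<sigma>" for x unfolding K_def[abs_def] k_def by (rule kernel_combination_Hp_char[OF z])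
  note Ks = Hp_char_square_integrable[OF KH] and hs = Hp_char_square_integrable[OF h]
  have TK: "l2norm circle_measure (T x) \<le> l2norm circle_measure (K x)" for x
    using contr[of x] by (simp add: T_def K_def[abs_def] k_def)
  have Kadd: "K (\<lambda>j. x j + of_real t * v j) = (\<lambda>\<zeta>. K x \<zeta> + t *\<^sub>R K v \<zeta>)" for x v t
    by (simp add: K_def fun_eq_iff distrib_right sum.distrib sum_distrib_left scaleR_conv_of_real mult.assoc)
  have Tadd: "T (\<lambda>j. x j + of_real t * v j) = (\<lambda>\<zeta>. T x \<zeta> + t *\<^sub>R T v \<zeta>)" for x v t
    unfolding T_def Kadd[symmetric] by (simp add: distrib_right mult.assoc)
  have Ts: "square_integrable circle_measure (T x)" for x unfolding T_def by (rule Ks)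
  define Q where "Q x = (l2norm circle_measure (K x))\<^sup>2 - 2 * l2inner circle_measure (T x) h" for x
  have Q_ge: "- (l2norm circle_measure h)\<^sup>2 \<le> Q x" for x
  proof -
    have "l2inner circle_measure (T x) h \<le> l2norm circle_measure (T x) * l2norm circle_measure h"
      using l2inner_Cauchy_Schwarz[OF Ts hs, of x] by linarith
    also have "\<dots> \<le> l2norm circle_measure (K x) * l2norm circle_measure h"
      by (rule mult_right_mono[OF TK l2norm_nonneg])
    finally have "l2inner circle_measure (T x) h \<le> l2norm circle_measure (K x) * l2norm circle_measure h" .
    moreover have "2 * (l2norm circle_measure (K x) * l2norm circle_measure h)
        \<le> (l2norm circle_measure (K x))\<^sup>2 + (l2norm circle_measure h)\<^sup>2"
      using sum_squares_bound[of "l2norm circle_measure (K x)" "l2norm circle_measure h"] by (simp only: mult.assoc)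
    ultimately show ?thesis unfolding Q_def by linarith
  qed
  have bdd: "bdd_below (range Q)" by (rule bdd_belowI2[where m="- (l2norm circle_measure h)\<^sup>2"]) (rule Q_ge)
  define \<kappa> where "\<kappa> = 1 + (\<Sum>j\<in>UNIV. l2norm circle_measure (k j))"
  have \<kappa>: "\<kappa> \<ge> 1" "l2norm circle_measure (k j) \<le> \<kappa>" for j
  proof -
    show "\<kappa> \<ge> 1" by (simp add: \<kappa>_def sum_nonneg)
    have "l2norm circle_measure (k j) \<le> (\<Sum>j\<in>UNIV. l2norm circle_measure (k j))" by (rule member_le_sum) auto
    then show "l2norm circle_measure (k j) \<le> \<kappa>" by (simp add: \<kappa>_def)
  qed
  define \<epsilon> where "\<epsilon> = \<eta> / \<kappa>"
  have \<epsilon>: "\<epsilon> > 0" "\<epsilon> \<le> \<eta>" "\<epsilon> * \<kappa> = \<eta>"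
  proof -
    show "\<epsilon> > 0" using \<eta> \<kappa>(1) by (simp add: \<epsilon>_def)
    show e: "\<epsilon> * \<kappa> = \<eta>" using \<kappa>(1) by (simp add: \<epsilon>_def)
    show "\<epsilon> \<le> \<eta>" using mult_left_mono[OF \<kappa>(1), of \<epsilon>] \<open>\<epsilon> > 0\<close> e by simp
  qed
  have "(INF x. Q x) < (INF x. Q x) + \<epsilon>\<^sup>2" using \<epsilon>(1) by simp
  then have "\<exists>x\<in>UNIV. Q x < (INF x. Q x) + \<epsilon>\<^sup>2" by (rule cINF_less_iff[OF UNIV_not_empty bdd, THEN iffD1])
  then obtain x where x: "Q x < (INF x. Q x) + \<epsilon>\<^sup>2" by blast
  have Qx: "Q x \<le> Q y + \<epsilon>\<^sup>2" for y using x cINF_lower[OF bdd, of y] by simp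
  \<comment> \<open>At an approximate minimum the derivative of \<open>Q\<close> in every direction \<open>v\<close> is small.\<close>
  have var: "\<bar>l2inner circle_measure (K x) (K v) - l2inner circle_measure (T v) h\<bar> \<le> \<epsilon> * l2norm circle_measure (K v)" for v
  proof -
    let ?D = "l2inner circle_measure (K x) (K v) - l2inner circle_measure (T v) h"
    have "0 \<le> \<epsilon>\<^sup>2 + 2 * t * ?D + t\<^sup>2 * (l2norm circle_measure (K v))\<^sup>2" for t
    proof -
      have 1: "(l2norm circle_measure (K (\<lambda>j. x j + of_real t * v j)))\<^sup>2
          = (l2norm circle_measure (K x))\<^sup>2 + 2 * t * l2inner circle_measure (K x) (K v) + t\<^sup>2 * (l2norm circle_measure (K v))\<^sup>2"
        unfolding Kadd using l2norm_add_square[OF Ks square_integrable_scaleR[OF Ks], of x t v]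
        by (simp add: l2norm_scaleR l2inner_def power_mult_distrib)
      have 2: "l2inner circle_measure (T (\<lambda>j. x j + of_real t * v j)) h
          = l2inner circle_measure (T x) h + t * l2inner circle_measure (T v) h"
        unfolding Tadd l2inner_add_left[OF Ts square_integrable_scaleR[OF Ts] hs] l2inner_scaleR_left ..
      have "Q (\<lambda>j. x j + of_real t * v j) = Q x + 2 * t * ?D + t\<^sup>2 * (l2norm circle_measure (K v))\<^sup>2"
        unfolding Q_def 1 2 by (simp add: algebra_simps)
      then show ?thesis using Qx[of "\<lambda>j. x j + of_real t * v j"] by linarith
    qed
    then have "?D\<^sup>2 \<le> \<epsilon>\<^sup>2 * (l2norm circle_measure (K v))\<^sup>2"
      by (rule quadratic_nonneg_imp_discriminant) auto
    then have "\<bar>?D\<bar>\<^sup>2 \<le> (\<epsilon> * l2norm circle_measure (K v))\<^sup>2" by (simp only: power_mult_distrib power2_abs)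
    then show ?thesis by (rule power2_le_imp_le) (use \<epsilon>(1) in simp)
  qed
  have ev: "l2inner circle_measure (K v) y = Re (\<Sum>j\<in>UNIV. cnj (v j) * disc_extension y (z $ j))"
    if y: "y \<in> Hp_char 2 \<Gamma> \<sigma>" for v y
    using l2inner_eq_Re[OF Ks Hp_char_square_integrable[OF y], of v] kernel_combination_inner[OF z y, of v]
    by (simp add: K_def k_def)
  define y where "y = K x"
  have yH: "y \<in> Hp_char 2 \<Gamma> \<sigma>" unfolding y_def by (rule KH)
  have norm_y: "l2norm circle_measure y \<le> l2norm circle_measure h + \<epsilon>"
  proof (cases "l2norm circle_measure y = 0")
    case True
    then show ?thesis using \<epsilon>(1) by (simp add: add_nonneg_nonneg less_imp_le)
  next
    case False
    then have pos: "l2norm circle_measure y > 0" using l2norm_nonneg[of circle_measure y] by linarith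
    have "l2inner circle_measure (T x) h \<le> l2norm circle_measure (T x) * l2norm circle_measure h"
      using l2inner_Cauchy_Schwarz[OF Ts hs, of x] by linarith
    also have "\<dots> \<le> l2norm circle_measure y * l2norm circle_measure h"
      unfolding y_def by (rule mult_right_mono[OF TK l2norm_nonneg])
    finally have "(l2norm circle_measure y)\<^sup>2 \<le> l2norm circle_measure y * l2norm circle_measure h + \<epsilon> * l2norm circle_measure y"
      using var[of x] unfolding y_def l2inner_self by linarith
    then have "l2norm circle_measure y * l2norm circle_measure y \<le> l2norm circle_measure y * (l2norm circle_measure h + \<epsilon>)"
      by (simp add: power2_eq_square algebra_simps)
    then show ?thesis using pos by simp
  qed
  have "norm (disc_extension y (z $ j) - w $ j * disc_extension h (z $ j)) \<le> \<eta>" for j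
  proof -
    define D where "D = disc_extension y (z $ j) - w $ j * disc_extension h (z $ j)"
    \<comment> \<open>In this direction the derivative of \<open>Q\<close> is twice \<open>|D|\<^sup>2\<close>.\<close>
    define v where "v i = (if i = j then D else 0)" for i
    have Kv: "K v = (\<lambda>\<zeta>. D * k j \<zeta>)"
      by (simp add: K_def v_def fun_eq_iff if_distrib[of "\<lambda>a. a * _"] cong: if_cong)
    have "l2inner circle_measure (K x) (K v) = Re (cnj D * disc_extension y (z $ j))"
      using ev[OF yH, of v]
      by (simp add: y_def l2inner_commute[of _ "K x"] v_def if_distrib[of cnj] if_distrib[of "\<lambda>a. a * _"] cong: if_cong)
    moreover have "l2inner circle_measure (T v) h = Re (cnj D * (w $ j * disc_extension h (z $ j)))"
      unfolding T_def ev[OF h]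
      by (simp add: v_def if_distrib[of cnj] if_distrib[of "\<lambda>a. a * _"] mult.assoc cong: if_cong)
    ultimately have "l2inner circle_measure (K x) (K v) - l2inner circle_measure (T v) h = Re (cnj D * D)"
      by (simp add: D_def right_diff_distrib)
    also have "\<dots> = (norm D)\<^sup>2"
      by (subst mult.commute, subst complex_norm_square[symmetric], rule Re_complex_of_real)
    finally have "(norm D)\<^sup>2 \<le> \<epsilon> * l2norm circle_measure (K v)" using var[of v] by simp
    also have "l2norm circle_measure (K v) = norm D * l2norm circle_measure (k j)"
      unfolding Kv by (simp add: l2norm_def norm_mult power_mult_distrib real_sqrt_mult)
    also have "\<epsilon> * (norm D * l2norm circle_measure (k j)) \<le> norm D * \<eta>"
    proof -
      have "\<epsilon> * l2norm circle_measure (k j) \<le> \<eta>"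
        using mult_left_mono[OF \<kappa>(2)[of j], of \<epsilon>] \<epsilon> by simp
      from mult_left_mono[OF this norm_ge_zero[of D]] show ?thesis by (simp add: mult_ac)
    qed
    finally have "norm D * norm D \<le> norm D * \<eta>" by (simp add: power2_eq_square)
    then have "norm D \<le> \<eta>" using \<eta> by (cases "D = 0") auto
    then show ?thesis by (simp add: D_def)
  qed
  moreover have "l2norm circle_measure y \<le> l2norm circle_measure h + \<eta>" using norm_y \<epsilon>(2) by linarith
  ultimately show ?thesis using yH by blast
qed

text \<open>An invariant weight \<open>r\<close> is \<open>|h|\<^sup>2\<close> for a function \<open>h\<close> without zeros, automorphic with some character
  \<open>\<sigma>\<close>; multiplication by \<open>e = 1/h\<close> carries \<open>H\<^sup>2\<^sub>\<sigma>\<close> to invariant functions, with the norm weighted by \<open>r\<close>. So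
  positivity of the Pick matrix of \<open>\<sigma>\<close> solves the interpolation problem in the mean with respect to
  \<open>r\<close>, and the multipliers above make the solution bounded. The lower bound \<open>\<epsilon>\<close> of the weight makes \<open>e\<close> bounded.\<close>

lemma weighted_interpolation:
  fixes z w :: "complex ^ 'n"
  assumes fd: "finite_dim_ae (defect_space \<Gamma>)" and z: "\<And>j. norm (z $ j) < 1"
    and psd: "\<And>\<sigma>. \<sigma> \<in> characters \<Gamma> \<Longrightarrow>
       pos_semidef (\<chi> i j. (1 - w $ i * cnj (w $ j)) * reproducing_kernel \<Gamma> \<sigma> (z $ i) (z $ j))"
    and r: "square_integrable circle_measure r" "invariant r" "AE \<zeta> in circle_measure. \<epsilon> \<le> r \<zeta>" and \<epsilon>: "\<epsilon> > 0"
    and \<eta>: "\<eta> > 0"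
  shows "\<exists>f\<in>Hp_inv \<infinity> \<Gamma>. (\<forall>j. norm (disc_extension f (z $ j) - w $ j) \<le> \<eta>) \<and>
    (\<integral>\<zeta>. (norm (f \<zeta>))\<^sup>2 * r \<zeta> \<partial>circle_measure) \<le> (\<integral>\<zeta>. r \<zeta> \<partial>circle_measure) + \<eta>"
proof -
  have rm[measurable]: "r \<in> borel_measurable circle_measure" using r(1) by measurable
  have ri: "integrable circle_measure r" by (rule circle.l2_imp_integrable[OF r(1)])
  define u where "u \<zeta> = ln (r \<zeta>) / 2" for \<zeta>
  have um[measurable]: "u \<in> borel_measurable circle_measure" unfolding u_def[abs_def] by measurable
  have us: "square_integrable circle_measure u"
  proof (rule l2norm_mono(1)[OF um])
    show "square_integrable circle_measure (\<lambda>\<zeta>. \<bar>ln \<epsilon>\<bar> + r \<zeta>)"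
      by (rule square_integrable_add[OF circle.bounded_square_integrable(1)[where B="\<bar>ln \<epsilon>\<bar>"] r(1)]) auto
    show "AE \<zeta> in circle_measure. norm (u \<zeta>) \<le> norm (\<bar>ln \<epsilon>\<bar> + r \<zeta>)"
      using r(3)
    proof eventually_elim
      case (elim \<zeta>)
      have "ln \<epsilon> \<le> ln (r \<zeta>)" "ln (r \<zeta>) \<le> r \<zeta> - 1" using elim \<epsilon> by (auto intro: ln_le_minus_one)
      then have "\<bar>ln (r \<zeta>)\<bar> \<le> \<bar>ln \<epsilon>\<bar> + r \<zeta>" using elim \<epsilon> by linarith
      moreover have "norm (u \<zeta>) = \<bar>ln (r \<zeta>)\<bar> / 2" by (simp add: u_def)
      moreover have "norm (\<bar>ln \<epsilon>\<bar> + r \<zeta>) = \<bar>ln \<epsilon>\<bar> + r \<zeta>" using elim \<epsilon> by simp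
      ultimately show ?case by linarith
    qed
  qed
  have ui: "invariant u" unfolding u_def[abs_def] by (rule invariant_compose[OF r(2), of "\<lambda>t. ln t / 2"])
  have eu: "AE \<zeta> in circle_measure. (exp (u \<zeta>))\<^sup>2 = r \<zeta>"
    using r(3)
  proof eventually_elim
    case (elim \<zeta>)
    have "(exp (u \<zeta>))\<^sup>2 = exp (2 * u \<zeta>)" by (simp add: exp_double)
    then show ?case using elim \<epsilon> by (simp add: u_def)
  qed
  have eus: "square_integrable circle_measure (\<lambda>\<zeta>. exp (u \<zeta>))"
  proof (rule square_integrableI[OF _ ri])
    show "AE \<zeta> in circle_measure. (norm (exp (u \<zeta>)))\<^sup>2 \<le> r \<zeta>" using eu by eventually_elim simp
  qed measurable
  define g where "g = analytic_completion u"
  have g: "g \<in> Hp 2" unfolding g_def by (rule analytic_completion(1)[OF us])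
  have Reg: "AE \<zeta> in circle_measure. Re (g \<zeta>) = u \<zeta>" unfolding g_def by (rule Re_analytic_completion[OF us])
  define \<sigma> where "\<sigma> \<gamma> = exp (- \<i> * of_real (period u \<gamma>))" for \<gamma>
  have \<sigma>: "\<sigma> \<in> characters \<Gamma>" unfolding \<sigma>_def[abs_def] by (rule period_character[OF us ui])
  define h where "h \<zeta> = exp (g \<zeta>)" for \<zeta>
  have h2: "h \<in> Hp 2" unfolding h_def[abs_def] g_def by (rule exp_analytic_completion_Hp_2[OF us eus])
  have hH: "h \<in> Hp_char 2 \<Gamma> \<sigma>"
    unfolding Hp_char_iff
  proof (intro conjI ballI h2)
    fix \<gamma> assume "\<gamma> \<in> \<Gamma>"
    from exp_completion_automorphic[OF us ui this, of 1]
    show "AE \<zeta> in circle_measure. h (\<gamma> \<zeta>) = \<sigma> \<gamma> * h \<zeta>" by (simp add: h_def g_def \<sigma>_def)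
  qed
  have hr: "AE \<zeta> in circle_measure. (norm (h \<zeta>))\<^sup>2 = r \<zeta>"
    using Reg eu by eventually_elim (simp add: h_def)
  have hn: "(l2norm circle_measure h)\<^sup>2 = (\<integral>\<zeta>. r \<zeta> \<partial>circle_measure)"
    unfolding l2norm_square by (rule integral_cong_AE) (use hr Hp_2_square_integrable[OF h2] in \<open>auto simp: square_integrable_def\<close>)
  define e where "e \<zeta> = exp ((-1) * g \<zeta>)" for \<zeta>
  have mg: "(\<lambda>\<zeta>. (-1) * g \<zeta>) \<in> Hp 2" by (rule Hp_2_cmult[OF g])
  have "AE \<zeta> in circle_measure. Re ((-1) * g \<zeta>) \<le> - ln \<epsilon> / 2"
    using Reg r(3)
  proof eventually_elim
    case (elim \<zeta>)
    have "ln \<epsilon> \<le> ln (r \<zeta>)" using elim \<epsilon> by simp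
    then show ?case using elim by (simp add: u_def)
  qed
  from exp_Hp_infinity(1)[OF mg this] have eI: "e \<in> Hp \<infinity>" by (simp only: e_def[abs_def])
  have he: "h \<zeta> * e \<zeta> = 1" for \<zeta> by (simp add: h_def e_def exp_minus)
  have ext1: "disc_extension h a * disc_extension e a = 1" if a: "norm a < 1" for a
  proof -
    have "disc_extension h a * disc_extension e a = disc_extension (\<lambda>\<zeta>. h \<zeta> * e \<zeta>) a"
      by (rule Hp_2_mult(2)[OF h2 Hp_infinity_imp_2[OF eI] a, symmetric])
    also have "\<dots> = disc_extension (\<lambda>\<zeta>. 1) a" by (simp add: he)
    also have "\<dots> = 1" using holomorphic_Hp_infinity(2)[of "\<lambda>\<zeta>. 1" 2 a] a by simp
    finally show ?thesis .
  qed
  have ae: "AE \<zeta> in circle_measure. e (\<gamma> \<zeta>) * \<sigma> \<gamma> = e \<zeta>" if \<gamma>: "\<gamma> \<in> \<Gamma>" for \<gamma>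
    using exp_completion_automorphic[OF us ui \<gamma>, of "-1"]
    by eventually_elim (simp add: e_def g_def \<sigma>_def exp_minus)
  define \<kappa> where "\<kappa> = 2 + 2 * l2norm circle_measure h + (\<Sum>j\<in>UNIV. norm (disc_extension e (z $ j)))"
  have sn: "0 \<le> (\<Sum>j\<in>UNIV. norm (disc_extension e (z $ j)))" by (rule sum_nonneg) simp
  have \<kappa>: "\<kappa> > 0" "2 * l2norm circle_measure h + 1 \<le> \<kappa>" "norm (disc_extension e (z $ j)) \<le> \<kappa>" for j
  proof -
    have "norm (disc_extension e (z $ j)) \<le> (\<Sum>j\<in>UNIV. norm (disc_extension e (z $ j)))" by (rule member_le_sum) auto
    then show "\<kappa> > 0" "2 * l2norm circle_measure h + 1 \<le> \<kappa>" "norm (disc_extension e (z $ j)) \<le> \<kappa>"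
      using sn l2norm_nonneg[of circle_measure h] unfolding \<kappa>_def by linarith+
  qed
  \<comment> \<open>\<open>\<kappa>\<close> absorbs both the increase of the squared norm of \<open>h\<close> by the error \<open>\<theta>\<close> and the factors \<open>e(z\<^sub>j)\<close>.\<close>
  define \<theta> where "\<theta> = min 1 (\<eta> / (2 * \<kappa>))"
  have \<theta>: "\<theta> > 0" "\<theta> \<le> 1" "\<theta> * \<kappa> \<le> \<eta> / 2"
  proof -
    show "\<theta> > 0" "\<theta> \<le> 1" using \<eta> \<kappa>(1) by (auto simp: \<theta>_def)
    have "\<theta> \<le> \<eta> / (2 * \<kappa>)" by (simp add: \<theta>_def)
    from mult_right_mono[OF this, of \<kappa>] show "\<theta> * \<kappa> \<le> \<eta> / 2" using \<kappa>(1) by simp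
  qed
  have contr: "l2norm circle_measure (\<lambda>\<zeta>. \<Sum>j\<in>UNIV. (x j * cnj (w $ j)) * kernel_function \<Gamma> \<sigma> (z $ j) \<zeta>)
       \<le> l2norm circle_measure (\<lambda>\<zeta>. \<Sum>j\<in>UNIV. x j * kernel_function \<Gamma> \<sigma> (z $ j) \<zeta>)" for x
    using psd[OF \<sigma>] unfolding pos_semidef_pick_iff[OF z] by blast
  obtain y where y: "y \<in> Hp_char 2 \<Gamma> \<sigma>" "l2norm circle_measure y \<le> l2norm circle_measure h + \<theta>"
    "\<And>j. norm (disc_extension y (z $ j) - w $ j * disc_extension h (z $ j)) \<le> \<theta>"
    using approximate_adjoint_image[OF z hH contr \<theta>(1)] by blast
  note ys = Hp_char_square_integrable[OF y(1)]
  have yn: "(l2norm circle_measure y)\<^sup>2 \<le> (\<integral>\<zeta>. r \<zeta> \<partial>circle_measure) + \<eta> / 2"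
  proof -
    have "(l2norm circle_measure y)\<^sup>2 \<le> (l2norm circle_measure h + \<theta>)\<^sup>2" by (rule power_mono[OF y(2)]) simp
    also have "\<dots> = (l2norm circle_measure h)\<^sup>2 + \<theta> * (2 * l2norm circle_measure h + \<theta>)"
      by (simp add: power2_eq_square algebra_simps)
    also have "\<theta> * (2 * l2norm circle_measure h + \<theta>) \<le> \<theta> * \<kappa>"
      using \<theta> \<kappa>(2) by (intro mult_left_mono) auto
    finally show ?thesis using \<theta>(3) hn by linarith
  qed
  define q where "q \<zeta> = e \<zeta> * y \<zeta>" for \<zeta>
  have q2: "q \<in> Hp 2" unfolding q_def[abs_def] by (rule Hp_2_mult_infinity[OF eI Hp_char_2[OF y(1)]])
  have qinv: "invariant q"
    unfolding invariant_def
  proof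
    fix \<gamma> assume \<gamma>: "\<gamma> \<in> \<Gamma>"
    have "AE \<zeta> in circle_measure. y (\<gamma> \<zeta>) = \<sigma> \<gamma> * y \<zeta>" using y(1) \<gamma> by (simp add: Hp_char_iff)
    with ae[OF \<gamma>] show "AE \<zeta> in circle_measure. q (\<gamma> \<zeta>) = q \<zeta>"
      by eventually_elim (simp add: q_def flip: mult.assoc)
  qed
  have qext: "norm (disc_extension q (z $ j) - w $ j) \<le> \<eta> / 2" for j
  proof -
    have "disc_extension q (z $ j) = disc_extension e (z $ j) * disc_extension y (z $ j)"
      unfolding q_def[abs_def] by (rule Hp_2_mult(2)[OF Hp_infinity_imp_2[OF eI] Hp_char_2[OF y(1)] z])
    moreover have "w $ j = w $ j * (disc_extension h (z $ j) * disc_extension e (z $ j))" using ext1[OF z] by simp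
    ultimately have "disc_extension q (z $ j) - w $ j
        = disc_extension e (z $ j) * (disc_extension y (z $ j) - w $ j * disc_extension h (z $ j))"
      by (simp only: right_diff_distrib mult_ac)
    then have "norm (disc_extension q (z $ j) - w $ j)
        = norm (disc_extension e (z $ j)) * norm (disc_extension y (z $ j) - w $ j * disc_extension h (z $ j))"
      by (simp only: norm_mult)
    also have "\<dots> \<le> \<kappa> * \<theta>" using \<kappa>(1) by (intro mult_mono \<kappa>(3) y(3)) auto
    finally show ?thesis using \<theta>(3) by (simp add: mult.commute)
  qed
  obtain G and \<delta> :: "nat \<Rightarrow> real" where G: "\<And>n. G n \<in> Hp_inv \<infinity> \<Gamma>" "\<And>n. (\<lambda>\<zeta>. G n \<zeta> * q \<zeta>) \<in> Hp_inv \<infinity> \<Gamma>"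
    "\<delta> \<longlonglongrightarrow> 0" "\<And>n. AE \<zeta> in circle_measure. norm (G n \<zeta>) \<le> exp (\<delta> n)"
    "\<And>a. norm a < 1 \<Longrightarrow> (\<lambda>n. disc_extension (G n) a) \<longlonglongrightarrow> 1"
    using bounding_multipliers[OF fd q2 qinv] by blast
  have GI: "G n \<in> Hp \<infinity>" for n using G(1) unfolding Hp_inv_iff by blast
  have ext: "disc_extension (\<lambda>\<zeta>. G n \<zeta> * q \<zeta>) (z $ j) = disc_extension (G n) (z $ j) * disc_extension q (z $ j)" for n j
    by (rule Hp_2_mult(2)[OF Hp_infinity_imp_2[OF GI] q2 z])
  have int: "(\<integral>\<zeta>. (norm (G n \<zeta> * q \<zeta>))\<^sup>2 * r \<zeta> \<partial>circle_measure) \<le> (exp (\<delta> n))\<^sup>2 * (l2norm circle_measure y)\<^sup>2" for n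
  proof -
    have "(\<integral>\<zeta>. (norm (G n \<zeta> * q \<zeta>))\<^sup>2 * r \<zeta> \<partial>circle_measure) \<le> (\<integral>\<zeta>. (exp (\<delta> n))\<^sup>2 * (norm (y \<zeta>))\<^sup>2 \<partial>circle_measure)"
    proof (rule integral_mono_AE')
      show "integrable circle_measure (\<lambda>\<zeta>. (exp (\<delta> n))\<^sup>2 * (norm (y \<zeta>))\<^sup>2)"
        using square_integrable_integrable[OF ys] by simp
      show "AE \<zeta> in circle_measure. (norm (G n \<zeta> * q \<zeta>))\<^sup>2 * r \<zeta> \<le> (exp (\<delta> n))\<^sup>2 * (norm (y \<zeta>))\<^sup>2"
        using hr G(4)[of n]
      proof eventually_elim
        case (elim \<zeta>)
        have "(norm (G n \<zeta> * q \<zeta>))\<^sup>2 * r \<zeta> = (norm (G n \<zeta>))\<^sup>2 * (norm (h \<zeta> * e \<zeta>))\<^sup>2 * (norm (y \<zeta>))\<^sup>2"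
          by (simp add: elim(1)[symmetric] q_def norm_mult power_mult_distrib mult_ac)
        also have "\<dots> \<le> (exp (\<delta> n))\<^sup>2 * (norm (y \<zeta>))\<^sup>2"
          unfolding he using power_mono[OF elim(2), of 2] by (simp add: mult_right_mono)
        finally show ?case .
      qed
    qed simp
    then show ?thesis by (simp add: l2norm_square)
  qed
  have lim1: "(\<lambda>n. (exp (\<delta> n))\<^sup>2 * (l2norm circle_measure y)\<^sup>2) \<longlonglongrightarrow> (exp 0)\<^sup>2 * (l2norm circle_measure y)\<^sup>2"
    by (intro tendsto_mult_right tendsto_power tendsto_exp G(3))
  have "\<forall>\<^sub>F n in sequentially. (exp (\<delta> n))\<^sup>2 * (l2norm circle_measure y)\<^sup>2 < (l2norm circle_measure y)\<^sup>2 + \<eta> / 2"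
    using order_tendstoD(2)[OF lim1, of "(l2norm circle_measure y)\<^sup>2 + \<eta> / 2"] \<eta> by simp
  moreover have "\<forall>\<^sub>F n in sequentially. \<forall>j. dist (disc_extension (G n) (z $ j) * disc_extension q (z $ j)) (disc_extension q (z $ j)) < \<eta> / 2"
  proof (rule eventually_all_finite)
    fix j
    have "(\<lambda>n. disc_extension (G n) (z $ j) * disc_extension q (z $ j)) \<longlonglongrightarrow> 1 * disc_extension q (z $ j)"
      by (intro tendsto_mult_right G(5) z)
    from tendstoD[OF this, of "\<eta> / 2"] \<eta>
    show "\<forall>\<^sub>F n in sequentially. dist (disc_extension (G n) (z $ j) * disc_extension q (z $ j)) (disc_extension q (z $ j)) < \<eta> / 2"
      by simp
  qed
  ultimately have "\<forall>\<^sub>F n in sequentially. (exp (\<delta> n))\<^sup>2 * (l2norm circle_measure y)\<^sup>2 < (l2norm circle_measure y)\<^sup>2 + \<eta> / 2 \<and>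
      (\<forall>j. dist (disc_extension (G n) (z $ j) * disc_extension q (z $ j)) (disc_extension q (z $ j)) < \<eta> / 2)"
    by (rule eventually_conj)
  then obtain n where n: "(exp (\<delta> n))\<^sup>2 * (l2norm circle_measure y)\<^sup>2 < (l2norm circle_measure y)\<^sup>2 + \<eta> / 2"
    "\<And>j. dist (disc_extension (G n) (z $ j) * disc_extension q (z $ j)) (disc_extension q (z $ j)) < \<eta> / 2"
    using eventually_happens'[OF sequentially_bot] by blast
  show ?thesis
  proof (intro bexI[of _ "\<lambda>\<zeta>. G n \<zeta> * q \<zeta>"] conjI allI G(2))
    fix j
    have "norm (disc_extension (\<lambda>\<zeta>. G n \<zeta> * q \<zeta>) (z $ j) - w $ j)
        \<le> norm (disc_extension (\<lambda>\<zeta>. G n \<zeta> * q \<zeta>) (z $ j) - disc_extension q (z $ j)) + norm (disc_extension q (z $ j) - w $ j)"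
      using norm_triangle_ineq[of "disc_extension (\<lambda>\<zeta>. G n \<zeta> * q \<zeta>) (z $ j) - disc_extension q (z $ j)"
          "disc_extension q (z $ j) - w $ j"] by simp
    also have "\<dots> \<le> \<eta>" using n(2)[of j] qext[of j] by (simp add: ext dist_norm)
    finally show "norm (disc_extension (\<lambda>\<zeta>. G n \<zeta> * q \<zeta>) (z $ j) - w $ j) \<le> \<eta>" .
  next
    show "(\<integral>\<zeta>. (norm (G n \<zeta> * q \<zeta>))\<^sup>2 * r \<zeta> \<partial>circle_measure) \<le> (\<integral>\<zeta>. r \<zeta> \<partial>circle_measure) + \<eta>"
      using int[of n] n(1) yn by linarith
  qed
qed

end

section \<open>Convex duality\<close>

lemma norm_convex_combination_square:
  fixes a b :: "'a::real_inner"
  assumes "0 \<le> t" "t \<le> 1"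
  shows "(norm ((1 - t) *\<^sub>R a + t *\<^sub>R b))\<^sup>2 \<le> (1 - t) * (norm a)\<^sup>2 + t * (norm b)\<^sup>2"
proof -
  have "(1 - t) * (norm a)\<^sup>2 + t * (norm b)\<^sup>2 - (norm ((1 - t) *\<^sub>R a + t *\<^sub>R b))\<^sup>2 = t * (1 - t) * (norm (a - b))\<^sup>2"
    by (simp add: power2_norm_eq_inner inner_add_left inner_add_right inner_diff_left inner_diff_right inner_commute[of b a])
       (simp add: algebra_simps)
  moreover have "0 \<le> t * (1 - t) * (norm (a - b))\<^sup>2" using assms by simp
  ultimately show ?thesis by linarith
qed

context automorphism_group
begin

lemma Hp_inv_infinityD:
  assumes "f \<in> Hp_inv \<infinity> \<Gamma>"
  shows "f \<in> Hp 2" "invariant f" "\<exists>B. AE \<zeta> in circle_measure. norm (f \<zeta>) \<le> B"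
  using assms Hp_infinity_imp_2 unfolding Hp_inv_iff Hp_infinity_iff invariant_def by blast+

lemma Hp_inv_infinity_combination:
  assumes f: "f \<in> Hp_inv \<infinity> \<Gamma>" and g: "g \<in> Hp_inv \<infinity> \<Gamma>"
  shows "(\<lambda>\<zeta>. a * f \<zeta> + b * g \<zeta>) \<in> Hp_inv \<infinity> \<Gamma>"
proof -
  obtain B1 B2 where "AE \<zeta> in circle_measure. norm (f \<zeta>) \<le> B1" "AE \<zeta> in circle_measure. norm (g \<zeta>) \<le> B2"
    using Hp_inv_infinityD(3)[OF f] Hp_inv_infinityD(3)[OF g] by blast
  then have b: "AE \<zeta> in circle_measure. norm (a * f \<zeta> + b * g \<zeta>) \<le> norm a * B1 + norm b * B2"
  proof eventually_elim
    case (elim \<zeta>)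
    have "norm (a * f \<zeta>) \<le> norm a * B1" "norm (b * g \<zeta>) \<le> norm b * B2"
      unfolding norm_mult using elim by (auto intro: mult_left_mono)
    then show ?case by (rule norm_triangle_mono)
  qed
  have i: "invariant (\<lambda>\<zeta>. a * f \<zeta> + b * g \<zeta>)"
    using invariant_compose2[OF Hp_inv_infinityD(2)[OF f] Hp_inv_infinityD(2)[OF g], of "\<lambda>x y. a * x + b * y"] .
  have h: "(\<lambda>\<zeta>. a * f \<zeta> + b * g \<zeta>) \<in> Hp 2"
    by (rule Hp_2_add[OF Hp_2_cmult[OF Hp_inv_infinityD(1)[OF f]] Hp_2_cmult[OF Hp_inv_infinityD(1)[OF g]]])
  from h i b show ?thesis by (rule Hp_inv_infinityI)
qed

lemma disc_extension_combination:
  assumes f: "f \<in> Hp_inv \<infinity> \<Gamma>" and g: "g \<in> Hp_inv \<infinity> \<Gamma>" and z: "norm z < 1"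
  shows "disc_extension (\<lambda>\<zeta>. a * f \<zeta> + b * g \<zeta>) z = a * disc_extension f z + b * disc_extension g z"
proof -
  note f2 = Hp_inv_infinityD(1)[OF f] and g2 = Hp_inv_infinityD(1)[OF g]
  have "disc_extension (\<lambda>\<zeta>. a * f \<zeta> - (- b) * g \<zeta>) z = disc_extension (\<lambda>\<zeta>. a * f \<zeta>) z - disc_extension (\<lambda>\<zeta>. (- b) * g \<zeta>) z"
    by (rule disc_extension_diff[OF Hp_2_cmult[OF f2] Hp_2_cmult[OF g2] z])
  then show ?thesis unfolding disc_extension_cmult by simp
qed

lemma convex_disc_estimate:
  assumes f: "f \<in> Hp_inv \<infinity> \<Gamma>" and g: "g \<in> Hp_inv \<infinity> \<Gamma>" and z: "norm z < 1"
    and t: "0 \<le> t" "t \<le> 1" and "norm (disc_extension f z - w) \<le> \<eta>" "norm (disc_extension g z - w) \<le> \<eta>"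
  shows "norm (disc_extension (\<lambda>\<zeta>. of_real (1 - t) * f \<zeta> + of_real t * g \<zeta>) z - w) \<le> \<eta>"
proof -
  have "disc_extension (\<lambda>\<zeta>. of_real (1 - t) * f \<zeta> + of_real t * g \<zeta>) z - w
      = of_real (1 - t) * (disc_extension f z - w) + of_real t * (disc_extension g z - w)"
    unfolding disc_extension_combination[OF f g z] by (simp add: algebra_simps)
  also have "norm \<dots> \<le> norm (of_real (1 - t) * (disc_extension f z - w)) + norm (of_real t * (disc_extension g z - w))"
    by (rule norm_triangle_ineq)
  also have "\<dots> \<le> (1 - t) * \<eta> + t * \<eta>"
    unfolding norm_mult norm_of_real using t assms(6,7) by (intro add_mono mult_mono) auto
  finally show ?thesis by (simp add: algebra_simps)
qed

text \<open>Let \<open>\<rho>\<close> be the element of least norm in the closure of the convex set \<open>S\<close> of all invariant \<open>\<psi>\<close> such that \<open>1 + \<psi>\<close>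
  majorizes \<open>|f|\<^sup>2\<close> for some approximate solution \<open>f\<close>. It is nonnegative because \<open>S\<close> may be enlarged by
  nonnegative functions, and the inner product of \<open>\<rho>\<close> with every element of \<open>S\<close> is at least its squared norm. For \<open>\<psi> = |f|\<^sup>2 - 1\<close> with \<open>f\<close> a
  solution in the mean with respect to the weight \<open>\<rho> + \<epsilon>\<close>, with small \<open>\<epsilon>\<close>, this is possible only if \<open>\<rho> = 0\<close>.\<close>

lemma approximate_interpolation:
  fixes z w :: "complex ^ 'n"
  assumes fd: "finite_dim_ae (defect_space \<Gamma>)" and z: "\<And>j. norm (z $ j) < 1"
    and psd: "\<And>\<sigma>. \<sigma> \<in> characters \<Gamma> \<Longrightarrow>
       pos_semidef (\<chi> i j. (1 - w $ i * cnj (w $ j)) * reproducing_kernel \<Gamma> \<sigma> (z $ i) (z $ j))"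
    and \<eta>: "\<eta> > 0"
  shows "\<exists>f\<in>Hp_inv \<infinity> \<Gamma>. (\<forall>j. norm (disc_extension f (z $ j) - w $ j) \<le> \<eta>) \<and>
    l2norm circle_measure (\<lambda>\<zeta>. max 0 ((norm (f \<zeta>))\<^sup>2 - 1)) \<le> \<eta>"
proof -
  define E where "E = {f \<in> Hp_inv \<infinity> \<Gamma>. \<forall>j. norm (disc_extension f (z $ j) - w $ j) \<le> \<eta>}"
  define S where "S = {\<psi> :: complex \<Rightarrow> real. square_integrable circle_measure \<psi> \<and> invariant \<psi> \<and>
    (\<exists>f\<in>E. AE \<zeta> in circle_measure. (norm (f \<zeta>))\<^sup>2 \<le> 1 + \<psi> \<zeta>)}"
  have nsq: "square_integrable circle_measure (\<lambda>\<zeta>. (norm (f \<zeta>))\<^sup>2)" if f: "f \<in> E" for f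
  proof -
    have fI: "f \<in> Hp_inv \<infinity> \<Gamma>" using f by (simp add: E_def)
    obtain B where "AE \<zeta> in circle_measure. norm (f \<zeta>) \<le> B" using Hp_inv_infinityD(3)[OF fI] by blast
    then have B: "AE \<zeta> in circle_measure. norm ((norm (f \<zeta>))\<^sup>2) \<le> B\<^sup>2" by eventually_elim (simp add: power_mono)
    show ?thesis
      by (rule circle.bounded_square_integrable(1)[OF _ B])
         (use Hp_2_square_integrable[OF Hp_inv_infinityD(1)[OF fI]] in \<open>auto simp: square_integrable_def\<close>)
  qed
  have one: "square_integrable circle_measure (\<lambda>\<zeta>. 1::real)"
    by (rule circle.bounded_square_integrable(1)[where B=1]) auto
  have psiS: "(\<lambda>\<zeta>. (norm (f \<zeta>))\<^sup>2 - 1) \<in> S" if f: "f \<in> E" for f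
  proof -
    have "invariant (\<lambda>\<zeta>. (norm (f \<zeta>))\<^sup>2 - 1)"
      by (rule invariant_compose[OF Hp_inv_infinityD(2), of f "\<lambda>x. (norm x)\<^sup>2 - 1"]) (use f in \<open>simp add: E_def\<close>)
    moreover have "square_integrable circle_measure (\<lambda>\<zeta>. (norm (f \<zeta>))\<^sup>2 - 1)"
      by (rule square_integrable_diff[OF nsq[OF f] one])
    ultimately show ?thesis using f unfolding S_def by (auto intro!: bexI[of _ f])
  qed
  have S_sq: "square_integrable circle_measure \<psi>" if "\<psi> \<in> S" for \<psi> using that by (simp add: S_def)
  have wE: "\<exists>f\<in>E. (\<integral>\<zeta>. (norm (f \<zeta>))\<^sup>2 * r \<zeta> \<partial>circle_measure) \<le> (\<integral>\<zeta>. r \<zeta> \<partial>circle_measure) + \<theta>"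
    if r: "square_integrable circle_measure r" "invariant r" "AE \<zeta> in circle_measure. \<epsilon> \<le> r \<zeta>" "\<epsilon> > 0" and \<theta>: "\<theta> > 0" for r \<epsilon> \<theta>
  proof -
    have m: "min \<eta> \<theta> > 0" using \<eta> \<theta> by simp
    from weighted_interpolation[OF fd z psd r m]
    obtain f where f: "f \<in> Hp_inv \<infinity> \<Gamma>" "\<And>j. norm (disc_extension f (z $ j) - w $ j) \<le> min \<eta> \<theta>"
      "(\<integral>\<zeta>. (norm (f \<zeta>))\<^sup>2 * r \<zeta> \<partial>circle_measure) \<le> (\<integral>\<zeta>. r \<zeta> \<partial>circle_measure) + min \<eta> \<theta>" by blast
    then show ?thesis by (intro bexI[of _ f]) (auto simp: E_def)
  qed
  have "invariant (\<lambda>\<zeta>. 1::real)" by (simp add: invariant_def)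
  from wE[OF one this _ zero_less_one zero_less_one] obtain f0 where f0: "f0 \<in> E" by auto
  have conv: "(\<lambda>\<zeta>. (1 - t) *\<^sub>R \<psi>1 \<zeta> + t *\<^sub>R \<psi>2 \<zeta>) \<in> S" if \<psi>: "\<psi>1 \<in> S" "\<psi>2 \<in> S" and t: "0 \<le> t" "t \<le> 1" for \<psi>1 \<psi>2 t
  proof -
    obtain f1 f2 where f: "f1 \<in> E" "AE \<zeta> in circle_measure. (norm (f1 \<zeta>))\<^sup>2 \<le> 1 + \<psi>1 \<zeta>"
      "f2 \<in> E" "AE \<zeta> in circle_measure. (norm (f2 \<zeta>))\<^sup>2 \<le> 1 + \<psi>2 \<zeta>" using \<psi> by (auto simp: S_def)
    define f where "f \<zeta> = of_real (1 - t) * f1 \<zeta> + of_real t * f2 \<zeta>" for \<zeta>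
    have fE: "f \<in> E"
      unfolding E_def f_def[abs_def] using f(1,3) Hp_inv_infinity_combination convex_disc_estimate[OF _ _ z t]
      by (auto simp: E_def simp del: of_real_diff)
    have ae: "AE \<zeta> in circle_measure. (norm (f \<zeta>))\<^sup>2 \<le> 1 + ((1 - t) *\<^sub>R \<psi>1 \<zeta> + t *\<^sub>R \<psi>2 \<zeta>)"
      using f(2,4)
    proof eventually_elim
      case (elim \<zeta>)
      have "(norm (f \<zeta>))\<^sup>2 \<le> (1 - t) * (norm (f1 \<zeta>))\<^sup>2 + t * (norm (f2 \<zeta>))\<^sup>2"
        using norm_convex_combination_square[OF t, of "f1 \<zeta>" "f2 \<zeta>"] by (simp add: f_def scaleR_conv_of_real)
      also have "\<dots> \<le> (1 - t) * (1 + \<psi>1 \<zeta>) + t * (1 + \<psi>2 \<zeta>)"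
        using elim t by (intro add_mono mult_left_mono) auto
      finally show ?case by (simp add: algebra_simps)
    qed
    have "invariant (\<lambda>\<zeta>. (1 - t) *\<^sub>R \<psi>1 \<zeta> + t *\<^sub>R \<psi>2 \<zeta>)"
      using invariant_compose2[of \<psi>1 \<psi>2 "\<lambda>x y. (1 - t) *\<^sub>R x + t *\<^sub>R y"] \<psi> by (simp add: S_def)
    moreover have "square_integrable circle_measure (\<lambda>\<zeta>. (1 - t) *\<^sub>R \<psi>1 \<zeta> + t *\<^sub>R \<psi>2 \<zeta>)"
      by (rule square_integrable_add[OF square_integrable_scaleR[OF S_sq[OF \<psi>(1)]] square_integrable_scaleR[OF S_sq[OF \<psi>(2)]]])
    ultimately show ?thesis unfolding S_def using fE ae by blast
  qed
  have mid: "(\<lambda>\<zeta>. (1/2) *\<^sub>R (\<psi>1 \<zeta> + \<psi>2 \<zeta>)) \<in> S" if "\<psi>1 \<in> S" "\<psi>2 \<in> S" for \<psi>1 \<psi>2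
    using conv[OF that, of "1/2"] by (simp add: field_simps)
  have Sne: "S \<noteq> {}" using psiS[OF f0] by blast
  obtain \<rho> g where g: "\<And>n. g n \<in> S" and \<rho>s: "square_integrable circle_measure \<rho>"
    and lim: "(\<lambda>n::nat. l2norm circle_measure (\<lambda>\<zeta>. g n \<zeta> - \<rho> \<zeta>)) \<longlonglongrightarrow> 0"
    and min: "\<And>h. h \<in> S \<Longrightarrow> l2norm circle_measure \<rho> \<le> l2norm circle_measure h"
  proof (rule circle.l2_nested_convex[of "\<lambda>_. S" "l2norm circle_measure (\<lambda>\<zeta>. (norm (f0 \<zeta>))\<^sup>2 - 1)"])
    show "\<exists>g\<in>S. l2norm circle_measure g \<le> l2norm circle_measure (\<lambda>\<zeta>. (norm (f0 \<zeta>))\<^sup>2 - 1)" for n :: nat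
      using psiS[OF f0] by blast
  qed (use S_sq Sne mid in auto)
  note gs = S_sq[OF g]
  have sep: "(l2norm circle_measure \<rho>)\<^sup>2 \<le> l2inner circle_measure \<rho> \<psi>" if \<psi>: "\<psi> \<in> S" for \<psi>
  proof -
    note \<psi>s = S_sq[OF \<psi>]
    define d where "d \<zeta> = \<psi> \<zeta> - \<rho> \<zeta>" for \<zeta>
    have ds: "square_integrable circle_measure d" unfolding d_def[abs_def] by (rule square_integrable_diff[OF \<psi>s \<rho>s])
    have *: "0 \<le> 2 * l2inner circle_measure \<rho> d + t * (l2norm circle_measure d)\<^sup>2" if t: "0 < t" "t \<le> 1" for t
    proof -
      define a where "a n \<zeta> = (1 - t) *\<^sub>R g n \<zeta> + t *\<^sub>R \<psi> \<zeta>" for n \<zeta>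
      have aS: "a n \<in> S" for n unfolding a_def[abs_def] by (rule conv[OF g \<psi>]) (use t in auto)
      have rd: "square_integrable circle_measure (\<lambda>\<zeta>. \<rho> \<zeta> + t *\<^sub>R d \<zeta>)"
        by (rule square_integrable_add[OF \<rho>s square_integrable_scaleR[OF ds]])
      have "l2norm circle_measure (\<lambda>\<zeta>. a n \<zeta> - (\<rho> \<zeta> + t *\<^sub>R d \<zeta>)) = \<bar>1 - t\<bar> * l2norm circle_measure (\<lambda>\<zeta>. g n \<zeta> - \<rho> \<zeta>)" for n
        using l2norm_scaleR[of circle_measure "1 - t" "\<lambda>\<zeta>. g n \<zeta> - \<rho> \<zeta>"] by (simp add: a_def d_def algebra_simps)
      then have "(\<lambda>n. l2norm circle_measure (\<lambda>\<zeta>. a n \<zeta> - (\<rho> \<zeta> + t *\<^sub>R d \<zeta>))) \<longlonglongrightarrow> 0"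
        using tendsto_mult_right_zero[OF lim, of "\<bar>1 - t\<bar>"] by simp
      from l2norm_tendsto[OF S_sq[OF aS] rd this]
      have "l2norm circle_measure \<rho> \<le> l2norm circle_measure (\<lambda>\<zeta>. \<rho> \<zeta> + t *\<^sub>R d \<zeta>)"
        by (rule LIMSEQ_le_const) (use min[OF aS] in auto)
      then have "(l2norm circle_measure \<rho>)\<^sup>2 \<le> (l2norm circle_measure (\<lambda>\<zeta>. \<rho> \<zeta> + t *\<^sub>R d \<zeta>))\<^sup>2"
        by (rule power_mono) simp
      also have "\<dots> = (l2norm circle_measure \<rho>)\<^sup>2 + 2 * t * l2inner circle_measure \<rho> d + t\<^sup>2 * (l2norm circle_measure d)\<^sup>2"
        using l2norm_add_square[OF \<rho>s square_integrable_scaleR[OF ds], of t] l2norm_scaleR[of circle_measure t d]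
        by (simp add: l2inner_def power_mult_distrib mult_ac)
      finally have "0 \<le> t * (2 * l2inner circle_measure \<rho> d + t * (l2norm circle_measure d)\<^sup>2)"
        by (simp add: power2_eq_square algebra_simps)
      then show ?thesis using t(1) by (simp add: zero_le_mult_iff)
    qed
    have "0 \<le> 2 * l2inner circle_measure \<rho> d"
    proof (rule tendsto_lowerbound)
      have "((\<lambda>t. 2 * l2inner circle_measure \<rho> d + t * (l2norm circle_measure d)\<^sup>2) \<longlongrightarrow>
          2 * l2inner circle_measure \<rho> d + 0 * (l2norm circle_measure d)\<^sup>2) (at_right 0)"
        by (intro tendsto_intros)
      then show "((\<lambda>t. 2 * l2inner circle_measure \<rho> d + t * (l2norm circle_measure d)\<^sup>2) \<longlongrightarrow>
          2 * l2inner circle_measure \<rho> d) (at_right 0)" by simp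
      show "\<forall>\<^sub>F t in at_right 0. 0 \<le> 2 * l2inner circle_measure \<rho> d + t * (l2norm circle_measure d)\<^sup>2"
        by (rule eventually_mono[OF eventually_at_right_real[OF zero_less_one]]) (intro *, auto)
    qed simp
    moreover have "l2inner circle_measure \<rho> d = l2inner circle_measure \<rho> \<psi> - (l2norm circle_measure \<rho>)\<^sup>2"
      using l2inner_add_left[OF ds \<rho>s \<rho>s] unfolding l2inner_self d_def
      by (simp add: l2inner_commute[of _ \<rho>])
    ultimately show ?thesis by simp
  qed
  have \<rho>inv: "invariant \<rho>"
    unfolding invariant_def
  proof
    fix \<gamma> assume \<gamma>: "\<gamma> \<in> \<Gamma>"
    have "AE \<zeta> in circle_measure. complex_of_real (\<rho> (\<gamma> \<zeta>)) = 1 * complex_of_real (\<rho> \<zeta>)"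
    proof (rule equivariance_l2_limit[OF automorphism[OF \<gamma>], of "\<lambda>n \<zeta>. complex_of_real (g n \<zeta>)"])
      show "(\<lambda>n. l2norm circle_measure (\<lambda>\<zeta>. complex_of_real (g n \<zeta>) - complex_of_real (\<rho> \<zeta>))) \<longlonglongrightarrow> 0"
        unfolding of_real_diff[symmetric] l2norm_of_real by (rule lim)
      show "AE \<zeta> in circle_measure. complex_of_real (g n (\<gamma> \<zeta>)) = 1 * complex_of_real (g n \<zeta>)" for n
      proof -
        have "invariant (g n)" using g[of n] by (simp add: S_def)
        from invariantD[OF this \<gamma>] show ?thesis by eventually_elim simp
      qed
    qed (simp_all add: gs \<rho>s)
    then show "AE \<zeta> in circle_measure. \<rho> (\<gamma> \<zeta>) = \<rho> \<zeta>" by eventually_elim simp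
  qed
  have \<rho>m: "\<rho> \<in> borel_measurable circle_measure" using \<rho>s by measurable
  \<comment> \<open>The negative part of \<open>\<rho>\<close> may be added to elements of \<open>S\<close>, so its inner product with \<open>\<rho>\<close> is nonnegative.\<close>
  define \<nu> where "\<nu> \<zeta> = max 0 (- \<rho> \<zeta>)" for \<zeta>
  have \<nu>s: "square_integrable circle_measure \<nu>"
    by (rule l2norm_mono(1)[OF _ \<rho>s]) (use \<rho>m in \<open>auto simp: \<nu>_def[abs_def]\<close>)
  have "0 \<le> l2inner circle_measure \<nu> \<rho>"
  proof -
    have "(\<lambda>\<zeta>. g n \<zeta> + \<nu> \<zeta>) \<in> S" for n
    proof -
      obtain f where f: "f \<in> E" "AE \<zeta> in circle_measure. (norm (f \<zeta>))\<^sup>2 \<le> 1 + g n \<zeta>" using g[of n] by (auto simp: S_def)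
      have "invariant (g n)" using g[of n] by (simp add: S_def)
      from invariant_compose2[OF this \<rho>inv, of "\<lambda>x y. x + max 0 (- y)"]
      have "invariant (\<lambda>\<zeta>. g n \<zeta> + \<nu> \<zeta>)" by (simp add: \<nu>_def)
      moreover have "AE \<zeta> in circle_measure. (norm (f \<zeta>))\<^sup>2 \<le> 1 + (g n \<zeta> + \<nu> \<zeta>)"
        using f(2) by eventually_elim (simp add: \<nu>_def)
      moreover have "square_integrable circle_measure (\<lambda>\<zeta>. g n \<zeta> + \<nu> \<zeta>)" by (rule square_integrable_add[OF gs \<nu>s])
      ultimately show ?thesis using f(1) unfolding S_def by blast
    qed
    from sep[OF this]
    have "(l2norm circle_measure \<rho>)\<^sup>2 \<le> l2inner circle_measure (g n) \<rho> + l2inner circle_measure \<nu> \<rho>" for n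
      using l2inner_add_left[OF gs \<nu>s \<rho>s] by (simp add: l2inner_commute[of _ \<rho>])
    moreover have "(\<lambda>n. l2inner circle_measure (g n) \<rho> + l2inner circle_measure \<nu> \<rho>)
        \<longlonglongrightarrow> l2inner circle_measure \<rho> \<rho> + l2inner circle_measure \<nu> \<rho>"
      by (intro tendsto_add tendsto_const l2inner_tendsto[OF gs \<rho>s \<rho>s lim])
    ultimately have "(l2norm circle_measure \<rho>)\<^sup>2 \<le> l2inner circle_measure \<rho> \<rho> + l2inner circle_measure \<nu> \<rho>"
      by (intro LIMSEQ_le_const) auto
    then show ?thesis by (simp add: l2inner_self)
  qed
  also have "l2inner circle_measure \<nu> \<rho> = - (l2norm circle_measure \<nu>)\<^sup>2"
  proof -
    have "\<nu> \<zeta> \<bullet> \<rho> \<zeta> = - ((norm (\<nu> \<zeta>))\<^sup>2)" for \<zeta> by (simp add: \<nu>_def max_def power2_eq_square)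
    then show ?thesis by (simp add: l2inner_def l2norm_square)
  qed
  finally have "l2norm circle_measure \<nu> = 0" by simp
  from l2norm_eq_0_AE[OF \<nu>s this] have \<rho>0: "AE \<zeta> in circle_measure. 0 \<le> \<rho> \<zeta>"
    by eventually_elim (simp add: \<nu>_def max_def split: if_splits)
  have "l2norm circle_measure \<rho> = 0"
  proof (rule ccontr)
    assume ne: "l2norm circle_measure \<rho> \<noteq> 0"
    define \<delta> where "\<delta> = (l2norm circle_measure \<rho>)\<^sup>2"
    have \<delta>: "\<delta> > 0" using ne by (simp add: \<delta>_def)
    define r where "r \<zeta> = \<rho> \<zeta> + \<delta> / 4" for \<zeta>
    have r: "square_integrable circle_measure r"
      unfolding r_def[abs_def]
      by (rule square_integrable_add[OF \<rho>s circle.bounded_square_integrable(1)[where B="\<bar>\<delta> / 4\<bar>"]]) auto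
    have ri: "invariant r" unfolding r_def[abs_def] by (rule invariant_compose[OF \<rho>inv])
    have r\<epsilon>: "AE \<zeta> in circle_measure. \<delta> / 4 \<le> r \<zeta>" using \<rho>0 by eventually_elim (simp add: r_def)
    obtain f where f: "f \<in> E"
      "(\<integral>\<zeta>. (norm (f \<zeta>))\<^sup>2 * r \<zeta> \<partial>circle_measure) \<le> (\<integral>\<zeta>. r \<zeta> \<partial>circle_measure) + \<delta> / 4"
      using wE[OF r ri r\<epsilon>, of "\<delta> / 4"] \<delta> by auto
    note fs = nsq[OF f(1)]
    have i\<rho>: "integrable circle_measure \<rho>" by (rule circle.l2_imp_integrable[OF \<rho>s])
    have ifr: "integrable circle_measure (\<lambda>\<zeta>. (norm (f \<zeta>))\<^sup>2 * r \<zeta>)"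
      and if\<rho>: "integrable circle_measure (\<lambda>\<zeta>. (norm (f \<zeta>))\<^sup>2 * \<rho> \<zeta>)"
      using square_integrable_inner[OF fs r] square_integrable_inner[OF fs \<rho>s] by simp_all
    have "\<delta> \<le> l2inner circle_measure \<rho> (\<lambda>\<zeta>. (norm (f \<zeta>))\<^sup>2 - 1)"
      unfolding \<delta>_def by (rule sep[OF psiS[OF f(1)]])
    also have "\<dots> = (\<integral>\<zeta>. (norm (f \<zeta>))\<^sup>2 * \<rho> \<zeta> \<partial>circle_measure) - (\<integral>\<zeta>. \<rho> \<zeta> \<partial>circle_measure)"
      using if\<rho> i\<rho> by (simp add: l2inner_def right_diff_distrib mult.commute)
    also have "(\<integral>\<zeta>. (norm (f \<zeta>))\<^sup>2 * \<rho> \<zeta> \<partial>circle_measure) \<le> (\<integral>\<zeta>. (norm (f \<zeta>))\<^sup>2 * r \<zeta> \<partial>circle_measure)"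
      by (rule integral_mono[OF if\<rho> ifr]) (use \<delta> in \<open>simp add: r_def distrib_left\<close>)
    also have "\<dots> \<le> (\<integral>\<zeta>. r \<zeta> \<partial>circle_measure) + \<delta> / 4" by (rule f(2))
    also have "(\<integral>\<zeta>. r \<zeta> \<partial>circle_measure) = (\<integral>\<zeta>. \<rho> \<zeta> \<partial>circle_measure) + \<delta> / 4"
      using i\<rho> circle.prob_space by (simp add: r_def)
    finally show False using \<delta> by simp
  qed
  with l2norm_tendsto[OF gs \<rho>s lim] have "(\<lambda>n. l2norm circle_measure (g n)) \<longlonglongrightarrow> 0" by simp
  from order_tendstoD(2)[OF this \<eta>] obtain n where n: "l2norm circle_measure (g n) < \<eta>"
    by (auto simp: eventually_sequentially)
  obtain f where f: "f \<in> E" "AE \<zeta> in circle_measure. (norm (f \<zeta>))\<^sup>2 \<le> 1 + g n \<zeta>" using g[of n] by (auto simp: S_def)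
  have fm: "f \<in> borel_measurable circle_measure"
    using f(1) Hp_inv_infinityD(1) Hp_2_square_integrable square_integrable_measurable unfolding E_def by blast
  have "l2norm circle_measure (\<lambda>\<zeta>. max 0 ((norm (f \<zeta>))\<^sup>2 - 1)) \<le> l2norm circle_measure (g n)"
  proof (rule l2norm_mono(2)[OF _ gs])
    show "AE \<zeta> in circle_measure. norm (max 0 ((norm (f \<zeta>))\<^sup>2 - 1)) \<le> norm (g n \<zeta>)"
      using f(2) by eventually_elim (auto simp: max_def)
    show "(\<lambda>\<zeta>. max 0 ((norm (f \<zeta>))\<^sup>2 - 1)) \<in> borel_measurable circle_measure" using fm by measurable
  qed
  with n have "l2norm circle_measure (\<lambda>\<zeta>. max 0 ((norm (f \<zeta>))\<^sup>2 - 1)) \<le> \<eta>" by linarith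
  then show ?thesis using f(1) unfolding E_def by blast
qed

text \<open>The sets of approximate solutions shrink as the error tends to \<open>0\<close>, and they are convex since \<open>max 0 (|f|\<^sup>2 - 1)\<close>
  is a convex function of \<open>f\<close>. So they contain a sequence convergent in the mean, and its limit is an exact solution.\<close>

lemma pick_matrix_sufficient:
  fixes z w :: "complex ^ 'n"
  assumes fd: "finite_dim_ae (defect_space \<Gamma>)" and z: "\<And>j. norm (z $ j) < 1"
    and psd: "\<And>\<sigma>. \<sigma> \<in> characters \<Gamma> \<Longrightarrow>
       pos_semidef (\<chi> i j. (1 - w $ i * cnj (w $ j)) * reproducing_kernel \<Gamma> \<sigma> (z $ i) (z $ j))"
  shows "\<exists>f\<in>Hp_inv \<infinity> \<Gamma>. Linf_norm f \<le> 1 \<and> (\<forall>j. disc_extension f (z $ j) = w $ j)"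
proof -
  define ex where "ex f \<zeta> = max 0 ((norm (f \<zeta>))\<^sup>2 - 1)" for f :: "complex \<Rightarrow> complex" and \<zeta>
  define S where "S n = {f \<in> Hp_inv \<infinity> \<Gamma>. (\<forall>j. norm (disc_extension f (z $ j) - w $ j) \<le> 1 / Suc n) \<and>
    l2norm circle_measure (ex f) \<le> 1 / Suc n}" for n
  have exs: "square_integrable circle_measure (ex f)" if f: "f \<in> Hp_inv \<infinity> \<Gamma>" for f
  proof -
    obtain B where B: "AE \<zeta> in circle_measure. norm (f \<zeta>) \<le> B" using Hp_inv_infinityD(3)[OF f] by blast
    have fm: "f \<in> borel_measurable circle_measure"
      using Hp_2_square_integrable[OF Hp_inv_infinityD(1)[OF f]] by measurable
    have "AE \<zeta> in circle_measure. norm (ex f \<zeta>) \<le> B\<^sup>2"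
      using B
    proof eventually_elim
      case (elim \<zeta>)
      have "(norm (f \<zeta>))\<^sup>2 \<le> B\<^sup>2" using elim by (simp add: power_mono)
      then show ?case by (auto simp: ex_def max_def)
    qed
    moreover have "ex f \<in> borel_measurable circle_measure" unfolding ex_def[abs_def] using fm by measurable
    ultimately show ?thesis by (intro circle.bounded_square_integrable(1))
  qed
  have S_sq: "square_integrable circle_measure f" if "f \<in> S n" for f n
    using that Hp_2_square_integrable[OF Hp_inv_infinityD(1)] by (simp add: S_def)
  have ne: "S n \<noteq> {}" for n
    using approximate_interpolation[OF fd z psd, of "1 / Suc n"] by (auto simp: S_def ex_def[abs_def])
  have dec: "S (Suc n) \<subseteq> S n" for n
  proof -
    have "1 / real (Suc (Suc n)) \<le> 1 / real (Suc n)" by (rule frac_le) auto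
    then show ?thesis unfolding S_def using order_trans by blast
  qed
  have mid: "(\<lambda>\<zeta>. (1/2) *\<^sub>R (f \<zeta> + g \<zeta>)) \<in> S n" if fg: "f \<in> S n" "g \<in> S n" for f g n
  proof -
    define h where "h \<zeta> = of_real (1 - 1/2) * f \<zeta> + of_real (1/2) * g \<zeta>" for \<zeta>
    have H: "f \<in> Hp_inv \<infinity> \<Gamma>" "g \<in> Hp_inv \<infinity> \<Gamma>" using fg by (simp_all add: S_def)
    have hH: "h \<in> Hp_inv \<infinity> \<Gamma>" unfolding h_def[abs_def] by (rule Hp_inv_infinity_combination[OF H])
    have he: "norm (disc_extension h (z $ j) - w $ j) \<le> 1 / Suc n" for j
      unfolding h_def[abs_def] by (rule convex_disc_estimate[OF H z]) (use fg in \<open>auto simp: S_def\<close>)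
    have "l2norm circle_measure (ex h) \<le> l2norm circle_measure (\<lambda>\<zeta>. (1/2) *\<^sub>R ex f \<zeta> + (1/2) *\<^sub>R ex g \<zeta>)"
    proof (rule l2norm_mono(2))
      show "ex h \<in> borel_measurable circle_measure" using exs[OF hH] by measurable
      show "square_integrable circle_measure (\<lambda>\<zeta>. (1/2) *\<^sub>R ex f \<zeta> + (1/2) *\<^sub>R ex g \<zeta>)"
        by (rule square_integrable_add[OF square_integrable_scaleR[OF exs[OF H(1)]] square_integrable_scaleR[OF exs[OF H(2)]]])
      show "AE \<zeta> in circle_measure. norm (ex h \<zeta>) \<le> norm ((1/2) *\<^sub>R ex f \<zeta> + (1/2) *\<^sub>R ex g \<zeta>)"
      proof (rule AE_I2)
        fix \<zeta>
        have "(norm (h \<zeta>))\<^sup>2 \<le> (1/2) * (norm (f \<zeta>))\<^sup>2 + (1/2) * (norm (g \<zeta>))\<^sup>2"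
          using norm_convex_combination_square[of "1/2" "f \<zeta>" "g \<zeta>"] by (simp add: h_def scaleR_conv_of_real)
        moreover have "ex f \<zeta> \<ge> 0" "ex g \<zeta> \<ge> 0" "ex h \<zeta> \<ge> 0" "ex f \<zeta> \<ge> (norm (f \<zeta>))\<^sup>2 - 1" "ex g \<zeta> \<ge> (norm (g \<zeta>))\<^sup>2 - 1"
          by (auto simp: ex_def)
        moreover have "ex h \<zeta> = 0 \<or> ex h \<zeta> = (norm (h \<zeta>))\<^sup>2 - 1" by (auto simp: ex_def max_def)
        ultimately show "norm (ex h \<zeta>) \<le> norm ((1/2) *\<^sub>R ex f \<zeta> + (1/2) *\<^sub>R ex g \<zeta>)" by auto
      qed
    qed
    also have "\<dots> \<le> (1/2) * l2norm circle_measure (ex f) + (1/2) * l2norm circle_measure (ex g)"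
      using l2norm_triangle[OF square_integrable_scaleR[OF exs[OF H(1)], of "1/2"] square_integrable_scaleR[OF exs[OF H(2)], of "1/2"]]
      by (simp only: l2norm_scaleR)
    also have "\<dots> \<le> 1 / Suc n" using fg by (simp add: S_def)
    finally have "h \<in> S n" using hH he by (simp add: S_def)
    moreover have "h = (\<lambda>\<zeta>. (1/2) *\<^sub>R (f \<zeta> + g \<zeta>))"
      by (simp add: h_def fun_eq_iff scaleR_conv_of_real distrib_left)
    ultimately show ?thesis by simp
  qed
  have bound: "\<exists>f\<in>S n. l2norm circle_measure f \<le> 2" for n
  proof -
    obtain f where f: "f \<in> S n" using ne by blast
    note fs = S_sq[OF f]
    have fH: "f \<in> Hp_inv \<infinity> \<Gamma>" using f by (simp add: S_def)
    note ei = circle.l2_imp_integrable[OF exs[OF fH]]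
    have "(l2norm circle_measure f)\<^sup>2 \<le> (\<integral>\<zeta>. 1 + ex f \<zeta> \<partial>circle_measure)"
      unfolding l2norm_square
    proof (rule integral_mono[OF square_integrable_integrable[OF fs]])
      show "integrable circle_measure (\<lambda>\<zeta>. 1 + ex f \<zeta>)" using ei by simp
    qed (simp add: ex_def)
    also have "\<dots> = 1 + (\<integral>\<zeta>. norm (ex f \<zeta>) \<partial>circle_measure)"
    proof -
      have "norm (ex f \<zeta>) = ex f \<zeta>" for \<zeta> by (simp add: ex_def)
      then show ?thesis using ei circle.prob_space by simp
    qed
    also have "\<dots> \<le> 1 + 1 / Suc n"
      using circle.integral_norm_le_l2norm[OF exs[OF fH]] f by (simp add: S_def)
    also have "\<dots> \<le> 2\<^sup>2" by (simp add: field_simps)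
    finally have "l2norm circle_measure f \<le> 2" by (rule power2_le_imp_le) simp
    with f show ?thesis by blast
  qed
  obtain f g where g: "\<And>n. g n \<in> S n" and fs: "square_integrable circle_measure f"
    and lim: "(\<lambda>n. l2norm circle_measure (\<lambda>\<zeta>. g n \<zeta> - f \<zeta>)) \<longlonglongrightarrow> 0"
  proof (rule circle.l2_nested_convex[where S=S and B=2])
    show "square_integrable circle_measure f" if "f \<in> S n" for n f by (rule S_sq[OF that])
  qed (use ne dec mid bound in auto)
  note gs = S_sq[OF g]
  have gH: "g n \<in> Hp_inv \<infinity> \<Gamma>" for n using g[of n] by (simp add: S_def)
  have gc: "g n \<in> Hp_char 2 \<Gamma> (\<lambda>_. 1)" for n
    using Hp_inv_infinityD(1,2)[OF gH[of n]] by (simp add: Hp_char_iff invariant_def)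
  have fc: "f \<in> Hp_char 2 \<Gamma> (\<lambda>_. 1)" by (rule Hp_char_l2_limit[OF gc fs lim])
  have f2: "f \<in> Hp 2" by (rule Hp_char_2[OF fc])
  have finv: "invariant f" using fc by (simp add: Hp_char_iff invariant_def)
  have inv0: "(\<lambda>n. 1 / real (Suc n)) \<longlonglongrightarrow> 0" by (rule LIMSEQ_Suc[OF lim_const_over_n])
  have ext: "disc_extension f (z $ j) = w $ j" for j
  proof -
    have "(\<lambda>n. disc_extension (g n) (z $ j)) \<longlonglongrightarrow> disc_extension f (z $ j)"
      by (rule disc_extension_tendsto[OF Hp_char_2[OF gc] f2 z lim])
    moreover have "(\<lambda>n. disc_extension (g n) (z $ j)) \<longlonglongrightarrow> w $ j"
      by (rule LIM_zero_cancel, rule Lim_null_comparison[OF _ inv0]) (use g in \<open>simp add: S_def\<close>)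
    ultimately show ?thesis by (rule LIMSEQ_unique)
  qed
  have f1: "AE \<zeta> in circle_measure. norm (f \<zeta>) \<le> 1"
  proof -
    obtain r where r: "strict_mono r" "AE \<zeta> in circle_measure. (\<lambda>n. g (r n) \<zeta>) \<longlonglongrightarrow> f \<zeta>"
      using l2_tendsto_AE_subseq[OF gs fs lim] by blast
    have "(\<lambda>n. l2norm circle_measure (ex (g n))) \<longlonglongrightarrow> 0"
      by (rule Lim_null_comparison[OF _ inv0]) (use g in \<open>simp add: S_def\<close>)
    from LIMSEQ_subseq_LIMSEQ[OF this r(1)]
    have "(\<lambda>n. l2norm circle_measure (\<lambda>\<zeta>. ex (g (r n)) \<zeta> - 0)) \<longlonglongrightarrow> 0" by (simp add: o_def)
    from l2_tendsto_AE_subseq[OF exs[OF gH] square_integrable_zero this]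
    obtain s where s: "strict_mono s" "AE \<zeta> in circle_measure. (\<lambda>n. ex (g (r (s n))) \<zeta>) \<longlonglongrightarrow> 0" by blast
    show ?thesis
      using r(2) s(2)
    proof eventually_elim
      case (elim \<zeta>)
      have "(\<lambda>n. g (r (s n)) \<zeta>) \<longlonglongrightarrow> f \<zeta>" using LIMSEQ_subseq_LIMSEQ[OF elim(1) s(1)] by (simp add: o_def)
      then have "(\<lambda>n. ex (g (r (s n))) \<zeta>) \<longlonglongrightarrow> ex f \<zeta>" unfolding ex_def by (intro tendsto_intros)
      then have "ex f \<zeta> = 0" using elim(2) by (rule LIMSEQ_unique)
      then have "(norm (f \<zeta>))\<^sup>2 \<le> 1\<^sup>2" by (simp add: ex_def max_def split: if_splits)
      then show ?case by (rule power2_le_imp_le) simp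
    qed
  qed
  have "f \<in> Hp_inv \<infinity> \<Gamma>" by (rule Hp_inv_infinityI[OF f2 finv f1])
  moreover have "Linf_norm f \<le> 1"
    using Linf_norm_le_iff[of f 1] f1 fs by (simp add: one_ereal_def square_integrable_def)
  ultimately show ?thesis using ext by blast
qed

end

theorem theorem1p3:
  fixes \<Gamma> :: "(complex \<Rightarrow> complex) set" and z w :: "complex ^ 'n"
  assumes "admissible \<Gamma>"
    and "\<And>j. z $ j \<in> ball 0 1"
  shows "(\<exists>f \<in> Hp_inv \<infinity> \<Gamma>. Linf_norm f \<le> 1 \<and> (\<forall>j. disc_extension f (z $ j) = w $ j)) \<longleftrightarrow>
    (\<forall>\<sigma> \<in> characters \<Gamma>.
       pos_semidef (\<chi> i j. (1 - w $ i * cnj (w $ j)) * reproducing_kernel \<Gamma> \<sigma> (z $ i) (z $ j)))"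
proof -
  interpret automorphism_group \<Gamma>
    by (rule automorphism_group.intro) (use assms(1) in \<open>auto simp: admissible_def fuchsian_def\<close>)
  have fd: "finite_dim_ae (defect_space \<Gamma>)" using assms(1) by (simp add: admissible_def)
  have z: "norm (z $ j) < 1" for j using assms(2)[of j] by simp
  show ?thesis
    using pick_matrix_necessary[OF z] pick_matrix_sufficient[OF fd z] by blast
qed

end
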